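(* Let $N\ge 1$, let $\Omega\subset\mathbb{R}^N$ be a bounded domain with smooth boundary, let $p>1$ and $1<\alpha<2$, and let $f\in L^\infty(\Omega)$ with $f\ge 0$, $f\not\equiv 0$. Then the problem $$-\mathrm{div}(|\nabla u|^{p-2}\nabla u)+|u|^{p-2}u=\frac{f(x)}{u^\alpha}\ \text{ in }\Omega,\qquad u=0\ \text{ on }\partial\Omega,$$ has a unique positive solution in $W^{1,p}_0(\Omega)$.
   Context: A positive solution in $W^{1,p}_0(\Omega)$ is a function $u\in W^{1,p}_0(\Omega)$, $u>0$ a.e. in $\Omega$, such that $$\int_\Omega |\nabla u|^{p-2}\nabla u\cdot\nabla\varphi\,dx+\int_\Omega |u|^{p-2}u\,\varphi\,dx=\int_\Omega\frac{f\varphi}{u^\alpha}\,dx\qquad\text{for all }\varphi\in C_0^\infty(\Omega),$$ all integrals being well defined and finite. *)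

theory Defs
  imports "HOL-Analysis.Analysis"
begin

primrec Ck_smooth :: "nat \<Rightarrow> ('a::euclidean_space \<Rightarrow> real) \<Rightarrow> bool" where
  "Ck_smooth 0 f \<longleftrightarrow> continuous_on UNIV f"
| "Ck_smooth (Suc k) f \<longleftrightarrow> (\<forall>x. f differentiable (at x)) \<and>
     (\<forall>b\<in>Basis. Ck_smooth k (\<lambda>x. frechet_derivative f (at x) b))"

definition smooth_fun :: "('a::euclidean_space \<Rightarrow> real) \<Rightarrow> bool" where
  "smooth_fun f \<longleftrightarrow> (\<forall>k. Ck_smooth k f)"

definition classical_grad :: "('a::euclidean_space \<Rightarrow> real) \<Rightarrow> 'a \<Rightarrow> 'a" where
  "classical_grad f x = (\<Sum>b\<in>Basis. frechet_derivative f (at x) b *\<^sub>R b)"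

text \<open>\<open>C\<^sub>0\<^sup>\<infinity>(\<Omega>)\<close>: elements are extended by zero to the whole space.\<close>

definition test_functions :: "'a::euclidean_space set \<Rightarrow> ('a \<Rightarrow> real) set" where
  "test_functions \<Omega> =
     {\<phi>. smooth_fun \<phi> \<and> compact (closure {x. \<phi> x \<noteq> 0}) \<and> closure {x. \<phi> x \<noteq> 0} \<subseteq> \<Omega>}"

text \<open>Near each boundary point \<open>\<Omega>\<close> is the region strictly above a smooth graph, in orthonormal
  coordinates whose last axis is \<open>e\<close>. The argument \<open>y - (y \<bullet> e) *\<^sub>R e\<close> of \<open>\<gamma>\<close> is the orthogonal
  projection of \<open>y\<close> to the hyperplane orthogonal to \<open>e\<close>, so only the restriction of \<open>\<gamma>\<close> to that
  hyperplane matters.\<close>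

definition smooth_boundary :: "'a::euclidean_space set \<Rightarrow> bool" where
  "smooth_boundary \<Omega> \<longleftrightarrow>
     (\<forall>x\<in>frontier \<Omega>. \<exists>r>0. \<exists>e \<gamma>. norm e = 1 \<and> smooth_fun \<gamma> \<and>
        \<Omega> \<inter> ball x r = {y \<in> ball x r. y \<bullet> e > \<gamma> (y - (y \<bullet> e) *\<^sub>R e)})"

text \<open>Members of the function spaces below are functions on the whole type; only their values
  almost everywhere in \<open>\<Omega>\<close> are relevant.\<close>

definition Lp_on :: "'a::euclidean_space set \<Rightarrow> real \<Rightarrow> ('a \<Rightarrow> 'b::euclidean_space) set" where
  "Lp_on \<Omega> p = {u. u \<in> borel_measurable (lebesgue_on \<Omega>) \<and>
                    integrable (lebesgue_on \<Omega>) (\<lambda>x. norm (u x) powr p)}"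

definition Linfty_on :: "'a::euclidean_space set \<Rightarrow> ('a \<Rightarrow> real) set" where
  "Linfty_on \<Omega> = {u. u \<in> borel_measurable (lebesgue_on \<Omega>) \<and>
                      (\<exists>M. AE x in lebesgue_on \<Omega>. \<bar>u x\<bar> \<le> M)}"

definition has_weak_gradient ::
    "'a::euclidean_space set \<Rightarrow> ('a \<Rightarrow> real) \<Rightarrow> ('a \<Rightarrow> 'a) \<Rightarrow> bool" where
  "has_weak_gradient \<Omega> u G \<longleftrightarrow>
     (\<forall>K. compact K \<and> K \<subseteq> \<Omega> \<longrightarrow> integrable (lebesgue_on K) u \<and> integrable (lebesgue_on K) G) \<and>
     (\<forall>\<phi>\<in>test_functions \<Omega>. \<forall>b\<in>Basis.
        (LINT x|lebesgue_on \<Omega>. u x * (classical_grad \<phi> x \<bullet> b)) =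
        - (LINT x|lebesgue_on \<Omega>. (G x \<bullet> b) * \<phi> x))"

text \<open>\<open>W\<^sub>0\<^sup>1\<^sup>,\<^sup>p(\<Omega>)\<close>: the members of \<open>W\<^sup>1\<^sup>,\<^sup>p(\<Omega>)\<close> that lie in the closure of \<open>C\<^sub>0\<^sup>\<infinity>(\<Omega>)\<close> for the norm
  whose \<open>p\<close>-th power is \<open>\<integral>|u|\<^sup>p + \<integral>|\<nabla>u|\<^sup>p\<close>.\<close>

definition W1p_0 :: "'a::euclidean_space set \<Rightarrow> real \<Rightarrow> ('a \<Rightarrow> real) set" where
  "W1p_0 \<Omega> p = {u. \<exists>G. u \<in> Lp_on \<Omega> p \<and> G \<in> Lp_on \<Omega> p \<and> has_weak_gradient \<Omega> u G \<and>
     (\<forall>\<epsilon>>0. \<exists>\<phi>\<in>test_functions \<Omega>.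
        (LINT x|lebesgue_on \<Omega>. \<bar>u x - \<phi> x\<bar> powr p) +
        (LINT x|lebesgue_on \<Omega>. norm (G x - classical_grad \<phi> x) powr p) < \<epsilon>)}"

text \<open>The weak gradient \<open>G\<close> is determined almost everywhere in \<open>\<Omega>\<close>. Since \<open>0 powr a = 0\<close>, the flux
  \<open>|\<nabla>u|\<^sup>p\<^sup>-\<^sup>2\<nabla>u\<close> is read as \<open>0\<close> where \<open>\<nabla>u = 0\<close>, also for \<open>p < 2\<close>.\<close>

definition positive_solution ::
    "'a::euclidean_space set \<Rightarrow> real \<Rightarrow> real \<Rightarrow> ('a \<Rightarrow> real) \<Rightarrow> ('a \<Rightarrow> real) \<Rightarrow> bool" where
  "positive_solution \<Omega> p \<alpha> f u \<longleftrightarrow>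
     u \<in> W1p_0 \<Omega> p \<and> (AE x in lebesgue_on \<Omega>. u x > 0) \<and>
     (\<exists>G. has_weak_gradient \<Omega> u G \<and>
       (\<forall>\<phi>\<in>test_functions \<Omega>.
          integrable (lebesgue_on \<Omega>)
            (\<lambda>x. (norm (G x) powr (p - 2) *\<^sub>R G x) \<bullet> classical_grad \<phi> x) \<and>
          integrable (lebesgue_on \<Omega>) (\<lambda>x. \<bar>u x\<bar> powr (p - 2) * u x * \<phi> x) \<and>
          integrable (lebesgue_on \<Omega>) (\<lambda>x. f x * \<phi> x / u x powr \<alpha>) \<and>
          (LINT x|lebesgue_on \<Omega>. (norm (G x) powr (p - 2) *\<^sub>R G x) \<bullet> classical_grad \<phi> x) +
          (LINT x|lebesgue_on \<Omega>. \<bar>u x\<bar> powr (p - 2) * u x * \<phi> x) =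
          (LINT x|lebesgue_on \<Omega>. f x * \<phi> x / u x powr \<alpha>)))"

end

theory Submission
  imports Defs
begin

text \<open>The solution is the minimiser of the strictly convex functional
  \<open>J(u) = 1/p \<integral>|\<nabla>u|\<^sup>p + 1/p \<integral>|u|\<^sup>p + 1/(\<alpha>-1) \<integral>f u\<^sup>1\<^sup>-\<^sup>\<alpha>\<close> over the nonnegative functions of
  \<open>W\<^sub>0\<^sup>1\<^sup>,\<^sup>p(\<Omega>)\<close>. It is finite somewhere because \<open>\<alpha> < 2\<close>: a smooth defining function of \<open>\<Omega>\<close> has an integrable power
  of exponent \<open>1 - \<alpha>\<close>. Uniform convexity makes minimising sequences Cauchy, and Fatou's lemma passes to the
  limit in the singular term. Perturbing the minimiser \<open>u\<close> upwards shows that it is a supersolution, so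
  \<open>log (1 + u/\<delta>)\<close> has a locally bounded gradient in \<open>L\<^sup>p\<close> uniformly in \<open>\<delta>\<close>; with a Poincare inequality, letting
  \<open>\<delta>\<close> tend to \<open>0\<close>, this forces \<open>u > 0\<close> almost everywhere. Testing with \<open>(u + t\<phi>)\<^sup>+\<close> and using the identity
  obtained by scaling \<open>u\<close> then yields the equation. For uniqueness, every solution may be tested
  with \<open>W\<^sub>0\<^sup>1\<^sup>,\<^sup>p\<close> functions, and the \<open>p\<close>-Laplacian is strictly monotone while \<open>u\<^sup>-\<^sup>\<alpha>\<close> is decreasing.\<close>

text \<open>The difficulty is that the singular term carries the weight \<open>f\<close>, which may
  vanish on large sets, while \<open>u powr (- \<alpha>)\<close> may blow up at the boundary. A
  priori only upward perturbations are known to keep the energy finite, and they yield just an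
  inequality; the use of Fatou there also supplies the integrability of
  \<open>f u powr (- \<alpha>) \<psi>\<close> that the weak formulation demands. The missing half is
  recovered because the direction \<open>u\<close> itself is two-sided: \<open>s u\<close> is
  admissible for every \<open>s > 0\<close>.

  Finite energy forces \<open>u > 0\<close> only where \<open>f > 0\<close>. Elsewhere positivity
  must come from the operator alone, so it is proved for nonnegative supersolutions of the problem
  with right-hand side 0. That class is invariant under scaling, which makes the logarithmic bound
  uniform, and connectedness spreads positivity from ball to ball.

  The condition \<open>\<alpha> < 2\<close> and the smooth boundary enter through the existence of a
  competitor: the height over a local boundary graph has an integrable power of exponent
  \<open>1 - \<alpha> > -1\<close>. Weak derivatives are met only when translating to and from the
  given definitions.\<close>

section \<open>Closure properties of smooth functions\<close>

lemma frechet_derivative_eqI: "(f has_derivative f') (at x) \<Longrightarrow> frechet_derivative f (at x) = f'"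
  by (metis frechet_derivative_at)

lemma Ck_smooth_imp_continuous: "Ck_smooth k f \<Longrightarrow> continuous_on UNIV f"
proof (cases k)
  case (Suc n)
  assume "Ck_smooth k f"
  then show ?thesis using Suc
    by (auto intro!: continuous_at_imp_continuous_on differentiable_imp_continuous_within)
qed auto

lemma Ck_smooth_Suc_D: "Ck_smooth (Suc k) f \<Longrightarrow> Ck_smooth k f"
proof (induction k arbitrary: f)
  case 0 then show ?case using Ck_smooth_imp_continuous by (metis Ck_smooth.simps(1))
next
  case (Suc k) then show ?case by (metis Ck_smooth.simps(2))
qed

text \<open>The recursion speaks of \<open>frechet_derivative\<close>; by uniqueness of derivatives
  any explicit family of derivatives may be exhibited instead. The induction steps of the closure
  properties below go through this rule.\<close>

lemma Ck_smooth_SucI: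
  assumes "\<And>x. (f has_derivative f' x) (at x)" "\<And>b. b \<in> Basis \<Longrightarrow> Ck_smooth k (\<lambda>x. f' x b)"
  shows "Ck_smooth (Suc k) f"
proof -
  have "frechet_derivative f (at x) = f' x" for x using assms(1) frechet_derivative_eqI by blast
  then show ?thesis using assms by (auto simp: differentiable_def)
qed

lemma Ck_smooth_Suc_has_derivative:
  "Ck_smooth (Suc k) f \<Longrightarrow> (f has_derivative frechet_derivative f (at x)) (at x)"
  using frechet_derivative_works by auto

lemma Ck_smooth_const [simp]: "Ck_smooth k (\<lambda>x. c)"
proof (induction k arbitrary: c)
  case (Suc k)
  show ?case by (rule Ck_smooth_SucI[where f'="\<lambda>x b. 0"]) (auto intro: Suc)
qed auto

lemma Ck_smooth_bounded_linear:
  assumes "bounded_linear f" shows "Ck_smooth k f"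
proof (cases k)
  case 0 then show ?thesis using assms by (simp add: linear_continuous_on)
next
  case (Suc n) show ?thesis unfolding Suc
    by (rule Ck_smooth_SucI[where f'="\<lambda>x. f"])
       (auto intro: assms bounded_linear_imp_has_derivative)
qed

lemma Ck_smooth_add:
  "Ck_smooth k f \<Longrightarrow> Ck_smooth k g \<Longrightarrow> Ck_smooth k (\<lambda>x. f x + g x)"
proof (induction k arbitrary: f g)
  case 0 then show ?case by (simp add: continuous_on_add)
next
  case (Suc k)
  note d = Suc.prems[THEN Ck_smooth_Suc_has_derivative]
  show ?case
    by (rule Ck_smooth_SucI[OF has_derivative_add[OF d]]) (use Suc in auto)
qed

lemma Ck_smooth_mult:
  "Ck_smooth k f \<Longrightarrow> Ck_smooth k g \<Longrightarrow> Ck_smooth k (\<lambda>x. f x * g x)"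
proof (induction k arbitrary: f g)
  case 0 then show ?case by (simp add: continuous_on_mult)
next
  case (Suc k)
  note d = Suc.prems[THEN Ck_smooth_Suc_has_derivative]
  have s: "Ck_smooth k f" "Ck_smooth k g" using Suc.prems Ck_smooth_Suc_D by blast+
  show ?case
    by (rule Ck_smooth_SucI[OF has_derivative_mult[OF d]])
       (use Suc s in \<open>auto intro!: Ck_smooth_add Suc.IH\<close>)
qed

lemma Ck_smooth_sum:
  "(\<And>i. i \<in> I \<Longrightarrow> Ck_smooth k (f i)) \<Longrightarrow> Ck_smooth k (\<lambda>x. \<Sum>i\<in>I. f i x)"
  by (induction I rule: infinite_finite_induct) (auto intro: Ck_smooth_add)

lemma Ck_smooth_compose_linear:
  fixes f :: "'b::euclidean_space \<Rightarrow> real" and L :: "'a::euclidean_space \<Rightarrow> 'b"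
  assumes L: "bounded_linear L"
  shows "Ck_smooth k f \<Longrightarrow> Ck_smooth k (\<lambda>x. f (L x))"
proof (induction k arbitrary: f)
  case 0 then show ?case
    using continuous_on_compose2[OF _ linear_continuous_on[OF L], of UNIV f UNIV] by simp
next
  case (Suc k)
  have d: "((\<lambda>x. f (L x)) has_derivative (\<lambda>b. frechet_derivative f (at (L x)) (L b))) (at x)" for x
    using has_derivative_compose[OF bounded_linear_imp_has_derivative[OF L]
        Ck_smooth_Suc_has_derivative[OF Suc.prems]] by blast
  \<comment> \<open>\<open>Ck_smooth\<close> controls derivatives in basis directions only, and
    \<open>L b\<close> need not be a basis vector, so the derivative is expanded in the
    basis.\<close>
  have lin: "frechet_derivative f (at y) v = (\<Sum>c\<in>Basis. (v \<bullet> c) * frechet_derivative f (at y) c)" for y v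
  proof -
    have l: "linear (frechet_derivative f (at y))"
      using Suc.prems linear_frechet_derivative by auto
    show ?thesis
      by (subst (1) euclidean_representation[of v, symmetric])
         (simp add: linear_sum[OF l] linear_scale[OF l])
  qed
  show ?case
    apply (rule Ck_smooth_SucI[OF d])
    apply (subst lin)
    apply (intro Ck_smooth_sum Ck_smooth_mult Ck_smooth_const Suc.IH)
    using Suc.prems by auto
qed

lemma Ck_smooth_compose_real:
  fixes g :: "real \<Rightarrow> real" and f :: "'a::euclidean_space \<Rightarrow> real"
  shows "Ck_smooth k g \<Longrightarrow> Ck_smooth k f \<Longrightarrow> Ck_smooth k (\<lambda>x. g (f x))"
proof (induction k arbitrary: g)
  case 0 then show ?case
    using continuous_on_compose2[of UNIV g UNIV f] by simp
next
  case (Suc k)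
  have d: "((\<lambda>x. g (f x)) has_derivative
      (\<lambda>b. frechet_derivative g (at (f x)) (frechet_derivative f (at x) b))) (at x)" for x
    using has_derivative_compose[OF Ck_smooth_Suc_has_derivative[OF Suc.prems(2)]
        Ck_smooth_Suc_has_derivative[OF Suc.prems(1)]] by blast
  have lin: "frechet_derivative g (at y) v = v * frechet_derivative g (at y) 1" for y v
  proof -
    have l: "linear (frechet_derivative g (at y))"
      using Suc.prems linear_frechet_derivative by auto
    show ?thesis using linear_scale[OF l, of v 1] by simp
  qed
  show ?case
    apply (rule Ck_smooth_SucI[OF d])
    apply (subst lin)
    apply (rule Ck_smooth_mult)
    using Suc.prems(2) apply simp
    apply (rule Suc.IH)
    using Suc.prems Ck_smooth_Suc_D by auto
qed

text \<open>Real powers are not smooth on the whole line, so \<open>Ck_smooth_compose_real\<close>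
  does not apply. The derivative is again a power of \<open>f\<close> times smooth factors, with
  exponent \<open>a - 1\<close>; hence the induction runs over all exponents at once.\<close>

lemma Ck_smooth_powr:
  fixes f :: "'a::euclidean_space \<Rightarrow> real"
  assumes pos: "\<And>x. f x > 0"
  shows "Ck_smooth k f \<Longrightarrow> Ck_smooth k (\<lambda>x. f x powr a)"
proof (induction k arbitrary: a)
  case 0 then show ?case using pos by (auto intro!: continuous_on_powr continuous_on_const simp: less_imp_neq[symmetric])
next
  case (Suc k)
  note df = Ck_smooth_Suc_has_derivative[OF Suc.prems]
  have g: "((\<lambda>y. y powr a) has_derivative (\<lambda>h. a * f x powr (a - 1) * h)) (at (f x))" for x
    using has_real_derivative_powr[OF pos, of a x] by (simp add: has_field_derivative_def)
  show ?case
    apply (rule Ck_smooth_SucI[OF has_derivative_compose[OF df g]])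
    apply (intro Ck_smooth_mult Ck_smooth_const Suc.IH)
    using Suc.prems Ck_smooth_Suc_D by auto
qed

lemma Ck_smooth_ln:
  fixes f :: "'a::euclidean_space \<Rightarrow> real"
  assumes pos: "\<And>x. f x > 0" and f: "Ck_smooth k f"
  shows "Ck_smooth k (\<lambda>x. ln (f x))"
proof (cases k)
  case 0 then show ?thesis using pos f by (auto intro!: continuous_on_ln simp: less_imp_neq[symmetric])
next
  case (Suc n)
  note df = Ck_smooth_Suc_has_derivative[OF f[unfolded Suc]]
  have g: "(ln has_derivative (\<lambda>h. f x powr (-1) * h)) (at (f x))" for x
    using DERIV_ln[OF pos, of x] pos[of x]
    by (simp add: has_field_derivative_def powr_minus)
  show ?thesis unfolding Suc
    apply (rule Ck_smooth_SucI[OF has_derivative_compose[OF df g]])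
    apply (intro Ck_smooth_mult Ck_smooth_powr pos)
    using f[unfolded Suc] Ck_smooth_Suc_D by auto
qed

lemma smooth_fun_const [simp]: "smooth_fun (\<lambda>x. c)"
  and smooth_fun_bounded_linear: "bounded_linear L \<Longrightarrow> smooth_fun L"
  and smooth_fun_add: "smooth_fun f \<Longrightarrow> smooth_fun g \<Longrightarrow> smooth_fun (\<lambda>x. f x + g x)"
  and smooth_fun_mult: "smooth_fun f \<Longrightarrow> smooth_fun g \<Longrightarrow> smooth_fun (\<lambda>x. f x * g x)"
  and smooth_fun_sum: "(\<And>i. i \<in> I \<Longrightarrow> smooth_fun (F i)) \<Longrightarrow> smooth_fun (\<lambda>x. \<Sum>i\<in>I. F i x)"
  and smooth_fun_powr: "(\<And>x. f x > 0) \<Longrightarrow> smooth_fun f \<Longrightarrow> smooth_fun (\<lambda>x. f x powr a)"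
  and smooth_fun_ln: "(\<And>x. f x > 0) \<Longrightarrow> smooth_fun f \<Longrightarrow> smooth_fun (\<lambda>x. ln (f x))"
  by (auto simp: smooth_fun_def intro: Ck_smooth_bounded_linear Ck_smooth_add Ck_smooth_mult
      Ck_smooth_sum Ck_smooth_powr Ck_smooth_ln)

lemma smooth_fun_compose_linear: "bounded_linear L \<Longrightarrow> smooth_fun f \<Longrightarrow> smooth_fun (\<lambda>x. f (L x))"
  by (auto simp: smooth_fun_def intro: Ck_smooth_compose_linear)

lemma smooth_fun_compose_real:
  fixes g :: "real \<Rightarrow> real"
  shows "smooth_fun g \<Longrightarrow> smooth_fun f \<Longrightarrow> smooth_fun (\<lambda>x. g (f x))"
  by (auto simp: smooth_fun_def intro: Ck_smooth_compose_real)

lemma smooth_fun_ident_real [simp]: "smooth_fun (\<lambda>x::real. x)"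
  by (intro smooth_fun_bounded_linear) (rule bounded_linear_ident)

lemma smooth_fun_minus: "smooth_fun f \<Longrightarrow> smooth_fun (\<lambda>x. - f x)"
  using smooth_fun_mult[OF smooth_fun_const[of "-1"], of f] by simp

lemma smooth_fun_diff: "smooth_fun f \<Longrightarrow> smooth_fun g \<Longrightarrow> smooth_fun (\<lambda>x. f x - g x)"
  using smooth_fun_add[OF _ smooth_fun_minus, of f g] by simp

lemma smooth_fun_power: "smooth_fun f \<Longrightarrow> smooth_fun (\<lambda>x. f x ^ n)"
  by (induction n) (auto intro: smooth_fun_mult)

lemma smooth_fun_continuous: "smooth_fun f \<Longrightarrow> continuous_on UNIV f"
  using Ck_smooth_imp_continuous smooth_fun_def by blast

lemma smooth_fun_has_derivative:
  "smooth_fun f \<Longrightarrow> (f has_derivative frechet_derivative f (at x)) (at x)"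
  using Ck_smooth_Suc_has_derivative smooth_fun_def by blast

lemma smooth_fun_deriv: "smooth_fun f \<Longrightarrow> b \<in> Basis \<Longrightarrow> smooth_fun (\<lambda>x. frechet_derivative f (at x) b)"
  unfolding smooth_fun_def by (metis Ck_smooth.simps(2))

lemma smooth_fun_inner_dist: "smooth_fun (\<lambda>x::'a::euclidean_space. (x - c) \<bullet> (x - c))"
proof -
  have "smooth_fun (\<lambda>x::'a. \<Sum>b\<in>Basis. (x \<bullet> b - c \<bullet> b) * (x \<bullet> b - c \<bullet> b))"
    by (intro smooth_fun_sum smooth_fun_mult smooth_fun_diff smooth_fun_const smooth_fun_bounded_linear
        bounded_linear_inner_left)
  then show ?thesis by (subst euclidean_inner) (simp add: inner_diff_left)
qed

subsection \<open>Smooth steps and cut-off functions\<close>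

text \<open>The factor \<open>inverse x ^ m\<close> makes the family closed under differentiation:
  the derivative of member \<open>m\<close> combines members \<open>m + 1\<close> and
  \<open>m + 2\<close>, so smoothness follows by one induction over all \<open>m\<close>.\<close>

definition flat_fun :: "nat \<Rightarrow> real \<Rightarrow> real" where
  "flat_fun m x = (if x > 0 then (inverse x) ^ m * exp (- inverse x) else 0)"

lemma flat_fun_tendsto_0: "((\<lambda>x. flat_fun m x) \<longlongrightarrow> 0) (at 0)"
proof -
  have r: "((\<lambda>x. flat_fun m x) \<longlongrightarrow> 0) (at_right 0)"
  proof -
    have "((\<lambda>y::real. y ^ m / exp y) \<longlongrightarrow> 0) at_top" by (rule tendsto_power_div_exp_0)
    then have "((\<lambda>x::real. inverse x ^ m / exp (inverse x)) \<longlongrightarrow> 0) (at_right 0)"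
      using filterlim_compose[OF _ filterlim_inverse_at_top_right] by blast
    moreover have "eventually (\<lambda>x. flat_fun m x = inverse x ^ m / exp (inverse x)) (at_right (0::real))"
      by (auto simp: eventually_at_filter flat_fun_def exp_minus field_simps)
    ultimately show ?thesis using tendsto_cong by force
  qed
  have l: "((\<lambda>x. flat_fun m x) \<longlongrightarrow> 0) (at_left 0)"
    by (rule tendsto_eventually) (auto simp: eventually_at_filter flat_fun_def)
  show ?thesis using l r by (simp add: filterlim_split_at)
qed

lemma flat_fun_has_derivative:
  "(flat_fun m has_real_derivative (flat_fun (m+2) x - real m * flat_fun (m+1) x)) (at x)"
proof -
  consider "x > 0" | "x < 0" | "x = 0" by linarith
  then show ?thesis
  proof cases
    case 1
    have "((\<lambda>x. (inverse x) ^ m * exp (- inverse x)) has_real_derivative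
       (flat_fun (m+2) x - real m * flat_fun (m+1) x)) (at x)"
      using 1 apply (auto intro!: derivative_eq_intros simp: flat_fun_def)
      apply (cases m) apply (auto simp: field_simps power2_eq_square) done
    then show ?thesis
      by (rule DERIV_cong_ev[THEN iffD1, rotated -1])
         (use 1 in \<open>auto simp: flat_fun_def eventually_nhds intro!: exI[of _ "{0<..}"]\<close>)
  next
    case 2
    have "((\<lambda>x. 0) has_real_derivative 0) (at x)" by simp
    then have "(flat_fun m has_real_derivative 0) (at x)"
      by (rule DERIV_cong_ev[THEN iffD1, rotated -1])
         (use 2 in \<open>auto simp: flat_fun_def eventually_nhds intro!: exI[of _ "{..<0}"]\<close>)
    then show ?thesis using 2 by (simp add: flat_fun_def)
  next
    case 3
    have "((\<lambda>h. flat_fun (Suc m) h) \<longlongrightarrow> 0) (at 0)" by (rule flat_fun_tendsto_0)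
    moreover have "(flat_fun m (0 + h) - flat_fun m 0) / h = flat_fun (Suc m) h" for h
      by (auto simp: flat_fun_def field_simps)
    ultimately show ?thesis using 3 by (simp add: DERIV_def flat_fun_def)
  qed
qed

lemma smooth_fun_flat: "smooth_fun (flat_fun m)"
proof -
  have "Ck_smooth k (flat_fun m)" for k m
  proof (induction k arbitrary: m)
    case 0
    have "isCont (flat_fun m) x" for x using flat_fun_has_derivative DERIV_isCont by blast
    then show ?case by (auto intro!: continuous_at_imp_continuous_on)
  next
    case (Suc k)
    have "((flat_fun m) has_derivative (\<lambda>h. (flat_fun (m+2) x + (- real m) * flat_fun (m+1) x) * h)) (at x)" for x
      using flat_fun_has_derivative[of m x] by (simp add: has_field_derivative_def)
    then show ?case
      by (rule Ck_smooth_SucI) (intro Ck_smooth_add Ck_smooth_mult Ck_smooth_const Suc)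
  qed
  then show ?thesis by (simp add: smooth_fun_def)
qed

text \<open>The usual quotient of flat functions. The two summands of the denominator never vanish
  together, and the reciprocal is written as a power so that the smoothness of \<open>powr\<close>
  applies.\<close>

definition smooth_step :: "real \<Rightarrow> real" where
  "smooth_step t = flat_fun 0 (t - 1) * (flat_fun 0 (t - 1) + flat_fun 0 (2 - t)) powr (-1)"

lemma smooth_fun_step: "smooth_fun smooth_step"
  and smooth_step_0: "t \<le> 1 \<Longrightarrow> smooth_step t = 0"
  and smooth_step_1: "t \<ge> 2 \<Longrightarrow> smooth_step t = 1"
  and smooth_step_ge0: "smooth_step t \<ge> 0"
  and smooth_step_le1: "smooth_step t \<le> 1"
proof -
  have nn: "flat_fun 0 x \<ge> 0" for x by (simp add: flat_fun_def)
  have pos: "flat_fun 0 (t - 1) + flat_fun 0 (2 - t) > 0" for t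
    by (cases "t > 1") (auto simp: flat_fun_def add_pos_nonneg)
  show "smooth_fun smooth_step" unfolding smooth_step_def
    by (intro smooth_fun_mult smooth_fun_powr pos smooth_fun_add
        smooth_fun_compose_real[OF smooth_fun_flat] smooth_fun_diff smooth_fun_ident_real smooth_fun_const)
  show "t \<le> 1 \<Longrightarrow> smooth_step t = 0" by (simp add: smooth_step_def flat_fun_def)
  show "t \<ge> 2 \<Longrightarrow> smooth_step t = 1" by (simp add: smooth_step_def flat_fun_def powr_minus)
  show "smooth_step t \<ge> 0" by (simp add: smooth_step_def nn)
  show "smooth_step t \<le> 1" using pos[of t] nn by (simp add: smooth_step_def powr_minus field_simps)
qed

text \<open>Finitely many balls around points of \<open>K\<close> cover \<open>K\<close>; sum the corresponding smooth bumps and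
  apply the smooth step.\<close>

lemma smooth_cutoff:
  fixes K U :: "'a::euclidean_space set"
  assumes K: "compact K" and U: "open U" "K \<subseteq> U"
  obtains \<zeta> where "\<zeta> \<in> test_functions U" "\<And>x. 0 \<le> \<zeta> x" "\<And>x. \<zeta> x \<le> 1" "\<And>x. x \<in> K \<Longrightarrow> \<zeta> x = 1"
proof -
  have "\<exists>r>0. cball x r \<subseteq> U" if "x \<in> K" for x using that U open_contains_cball by blast
  then obtain r where r: "\<And>x. x \<in> K \<Longrightarrow> r x > 0 \<and> cball x (r x) \<subseteq> U" by metis
  obtain C where C: "C \<subseteq> K" "finite C" "K \<subseteq> (\<Union>c\<in>C. ball c (r c))"
  proof (rule compactE_image[OF K, of K "\<lambda>c. ball c (r c)"])
    show "K \<subseteq> (\<Union>c\<in>K. ball c (r c))" using r by force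
  qed auto
  define \<rho> where "\<rho> = (\<lambda>x. \<Sum>c\<in>C. flat_fun 0 ((r c)\<^sup>2 - (x - c) \<bullet> (x - c)))"
  have fpos: "flat_fun 0 ((r c)\<^sup>2 - (x - c) \<bullet> (x - c)) > 0 \<longleftrightarrow> x \<in> ball c (r c)" if "c \<in> C" for c x
  proof -
    have "r c > 0" using r C that by blast
    then have "(norm (x - c))\<^sup>2 < (r c)\<^sup>2 \<longleftrightarrow> norm (x - c) < r c"
      by (smt (verit) norm_ge_zero power_less_imp_less_base power_strict_mono zero_less_numeral)
    then show ?thesis
      by (simp add: flat_fun_def dist_norm norm_minus_commute[of c x] flip: power2_norm_eq_inner)
  qed
  have fnn: "flat_fun 0 t \<ge> 0" for t by (simp add: flat_fun_def)
  have \<rho>s: "smooth_fun \<rho>" unfolding \<rho>_def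
    by (rule smooth_fun_sum, rule smooth_fun_compose_real[OF smooth_fun_flat], rule smooth_fun_diff,
        rule smooth_fun_const, rule smooth_fun_inner_dist)
  have \<rho>pos: "\<rho> x > 0" if xK: "x \<in> K" for x
  proof -
    obtain c where c: "c \<in> C" "x \<in> ball c (r c)" using C(3) xK by auto
    show ?thesis unfolding \<rho>_def by (rule sum_pos2[OF C(2) c(1)]) (use fpos[OF c(1)] c(2) fnn in auto)
  qed
  obtain m where m: "m > 0" "\<And>x. x \<in> K \<Longrightarrow> \<rho> x \<ge> m"
  proof (cases "K = {}")
    case True then show ?thesis using that[of 1] by simp
  next
    case False
    have "continuous_on K \<rho>" using smooth_fun_continuous[OF \<rho>s] continuous_on_subset by blast
    from continuous_attains_inf[OF K False this] show ?thesis using that \<rho>pos by blast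
  qed
  \<comment> \<open>On \<open>K\<close> the argument is at least 2, where \<open>smooth_step\<close>
    is 1; where \<open>\<rho>\<close> vanishes the argument is 0 and so is the step.\<close>
  define \<zeta> where "\<zeta> = (\<lambda>x. smooth_step ((2 / m) * \<rho> x))"
  have sub: "{x. \<zeta> x \<noteq> 0} \<subseteq> (\<Union>c\<in>C. cball c (r c))"
  proof safe
    fix x assume x: "\<zeta> x \<noteq> 0"
    have "\<rho> x \<noteq> 0" using x smooth_step_0[of 0] by (auto simp: \<zeta>_def)
    then obtain c where "c \<in> C" "flat_fun 0 ((r c)\<^sup>2 - (x - c) \<bullet> (x - c)) \<noteq> 0"
      unfolding \<rho>_def by (meson sum.neutral)
    then have "x \<in> ball c (r c)" using fpos fnn by (metis order_le_imp_less_or_eq)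
    then show "x \<in> (\<Union>c\<in>C. cball c (r c))" using \<open>c \<in> C\<close> ball_subset_cball by blast
  qed
  have cl: "closed (\<Union>c\<in>C. cball c (r c))" using C by (intro closed_UN) auto
  have bd: "bounded (\<Union>c\<in>C. cball c (r c))" using C by (intro bounded_UN) auto
  have sub2: "closure {x. \<zeta> x \<noteq> 0} \<subseteq> (\<Union>c\<in>C. cball c (r c))" using closure_minimal[OF sub cl] .
  show ?thesis
  proof
    show "\<zeta> \<in> test_functions U" unfolding test_functions_def
    proof safe
      show "smooth_fun \<zeta>" unfolding \<zeta>_def
        by (intro smooth_fun_compose_real[OF smooth_fun_step] smooth_fun_mult smooth_fun_const \<rho>s)
      show "compact (closure {x. \<zeta> x \<noteq> 0})"
        using bounded_subset[OF bd sub2] by (simp add: compact_eq_bounded_closed)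
      show "x \<in> U" if x: "x \<in> closure {x. \<zeta> x \<noteq> 0}" for x
      proof -
        obtain c where "c \<in> C" "x \<in> cball c (r c)" using sub2 x by auto
        then show ?thesis using r[of c] C(1) by (meson subsetD)
      qed
    qed
    show "\<zeta> x = 1" if "x \<in> K" for x
      unfolding \<zeta>_def by (rule smooth_step_1) (use m that in \<open>simp add: field_simps\<close>)
  qed (auto simp: \<zeta>_def smooth_step_ge0 smooth_step_le1)
qed

subsection \<open>The spaces \<open>L\<^sup>p\<close>\<close>

text \<open>Fatou's lemma in \<open>ennreal\<close>, carried back to real integrals. Integrability
  of the limit \<open>h\<close> is a conclusion, because the bounds \<open>C n\<close> converge to a
  finite number; many applications below need exactly this.\<close>

lemma Fatou_real:
  fixes g :: "nat \<Rightarrow> 'a \<Rightarrow> real"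
  assumes int: "\<And>n. integrable M (g n)" and nn: "\<And>n. AE x in M. 0 \<le> g n x"
    and lim: "AE x in M. (\<lambda>n. g n x) \<longlonglongrightarrow> h x" and h: "h \<in> borel_measurable M"
    and le: "\<And>n. (LINT x|M. g n x) \<le> C n" and C: "C \<longlonglongrightarrow> c"
  shows "integrable M h" "(LINT x|M. h x) \<le> c" "0 \<le> c"
proof -
  have hnn: "AE x in M. 0 \<le> h x"
  proof -
    have "AE x in M. \<forall>n. 0 \<le> g n x" using nn by (simp add: AE_all_countable)
    then show ?thesis using lim by eventually_elim (metis LIMSEQ_le_const)
  qed
  have Cnn: "0 \<le> C n" for n using integral_nonneg_AE[OF nn[of n]] le[of n] by linarith
  show c0: "0 \<le> c" using C Cnn by (metis LIMSEQ_le_const)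
  have "(\<integral>\<^sup>+x. ennreal (h x) \<partial>M) = (\<integral>\<^sup>+x. liminf (\<lambda>n. ennreal (g n x)) \<partial>M)"
  proof (rule nn_integral_cong_AE, use lim in eventually_elim)
    fix x assume "(\<lambda>n. g n x) \<longlonglongrightarrow> h x"
    then have "(\<lambda>n. ennreal (g n x)) \<longlonglongrightarrow> ennreal (h x)" by (rule tendsto_ennrealI)
    then show "ennreal (h x) = liminf (\<lambda>n. ennreal (g n x))"
      by (simp add: lim_imp_Liminf)
  qed
  also have "\<dots> \<le> liminf (\<lambda>n. \<integral>\<^sup>+x. ennreal (g n x) \<partial>M)"
    by (rule nn_integral_liminf) (use int in measurable)
  also have "\<dots> \<le> liminf (\<lambda>n. ennreal (C n))"
  proof (rule Liminf_mono, rule always_eventually, rule allI)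
    fix n show "(\<integral>\<^sup>+x. ennreal (g n x) \<partial>M) \<le> ennreal (C n)"
      by (subst nn_integral_eq_integral[OF int nn]) (simp add: le ennreal_leI)
  qed
  also have "\<dots> = ennreal c" using tendsto_ennrealI[OF C] by (simp add: lim_imp_Liminf)
  finally have fin: "(\<integral>\<^sup>+x. ennreal (h x) \<partial>M) \<le> ennreal c" .
  show ih: "integrable M h"
  proof (rule integrableI_nonneg[OF h hnn])
    show "(\<integral>\<^sup>+x. ennreal (h x) \<partial>M) < \<infinity>" using fin by (simp add: le_less_trans)
  qed
  show "(LINT x|M. h x) \<le> c"
    using fin nn_integral_eq_integral[OF ih hnn] c0 by (simp add: ennreal_le_iff)
qed

text \<open>Integrals bounded by \<open>C\<close> make the liminf of the functions finite almost
  everywhere. This detects divergence to infinity, which a real-valued limit function cannot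
  represent.\<close>

lemma Fatou_AE_not_at_top:
  fixes g :: "nat \<Rightarrow> 'a \<Rightarrow> real"
  assumes int: "\<And>n. integrable M (g n)" and nn: "\<And>n. AE x in M. 0 \<le> g n x"
    and le: "\<And>n. (LINT x|M. g n x) \<le> C"
  shows "AE x in M. \<not> filterlim (\<lambda>n. g n x) at_top sequentially"
proof -
  have "(\<integral>\<^sup>+x. liminf (\<lambda>n. ennreal (g n x)) \<partial>M) \<le> liminf (\<lambda>n. \<integral>\<^sup>+x. ennreal (g n x) \<partial>M)"
    by (rule nn_integral_liminf) (use int in measurable)
  also have "\<dots> \<le> liminf (\<lambda>n::nat. ennreal C)"
  proof (rule Liminf_mono, rule always_eventually, rule allI)
    fix n show "(\<integral>\<^sup>+x. ennreal (g n x) \<partial>M) \<le> ennreal C"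
      by (subst nn_integral_eq_integral[OF int nn]) (simp add: le ennreal_leI)
  qed
  also have "\<dots> < \<infinity>" by (simp add: Liminf_const)
  finally have fin: "(\<integral>\<^sup>+x. liminf (\<lambda>n. ennreal (g n x)) \<partial>M) \<noteq> \<infinity>" by simp
  have "AE x in M. liminf (\<lambda>n. ennreal (g n x)) \<noteq> \<infinity>"
    by (rule nn_integral_PInf_AE[OF _ fin]) (use int in measurable)
  then show ?thesis
  proof eventually_elim
    fix x assume *: "liminf (\<lambda>n. ennreal (g n x)) \<noteq> \<infinity>"
    show "\<not> filterlim (\<lambda>n. g n x) at_top sequentially"
    proof
      assume "filterlim (\<lambda>n. g n x) at_top sequentially"
      then have "(\<lambda>n. ennreal (g n x)) \<longlonglongrightarrow> \<infinity>"
        by (simp add: tendsto_PInfty_eq_at_top ennreal_tendsto_top_eq_at_top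
            filterlim_compose[OF ennreal_tendsto_top_eq_at_top[THEN iffD1]])
      then show False using * by (simp add: lim_imp_Liminf)
    qed
  qed
qed

section \<open>Elementary inequalities for real powers\<close>

lemma powr_add_le:
  fixes a b p :: real assumes "0 \<le> a" "0 \<le> b" "0 \<le> p"
  shows "(a + b) powr p \<le> 2 powr p * (a powr p + b powr p)"
proof -
  have "(a + b) powr p \<le> (2 * max a b) powr p" by (rule powr_mono2) (use assms in auto)
  also have "\<dots> = 2 powr p * (max a b) powr p" using assms by (simp add: powr_mult)
  also have "(max a b) powr p \<le> a powr p + b powr p" by (simp add: max_def)
  finally show ?thesis by simp
qed

lemma norm_add_powr_le:
  fixes a b :: "'b::real_normed_vector" assumes "0 \<le> p"
  shows "norm (a + b) powr p \<le> 2 powr p * (norm a powr p + norm b powr p)"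
  using powr_add_le[of "norm a" "norm b" p] powr_mono2[of p "norm (a+b)" "norm a + norm b"] assms
    norm_triangle_ineq[of a b] by simp

text \<open>Splitting at \<open>b = \<eta> * a\<close>, one of the two summands alone already
  dominates. The constants are not the sharp ones of Young's inequality; what matters is that
  \<open>\<eta>\<close> can be chosen small.\<close>

lemma young_eps:
  fixes a b p \<eta> :: real assumes "0 \<le> a" "0 \<le> b" "1 \<le> p" "0 < \<eta>"
  shows "a powr (p - 1) * b \<le> \<eta> * a powr p + \<eta> powr (1 - p) * b powr p"
proof (cases "b \<le> \<eta> * a")
  case True
  have "a powr (p - 1) * b \<le> a powr (p - 1) * (\<eta> * a)" using True by (simp add: mult_left_mono)
  also have "\<dots> = \<eta> * a powr p" using assms by (cases "a = 0") (auto simp: powr_diff field_simps)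
  finally show ?thesis by (simp add: add_increasing2)
next
  case False
  then have b: "b > 0" using assms by (smt (verit) mult_nonneg_nonneg)
  have "a \<le> b / \<eta>" using False assms by (simp add: field_simps)
  then have "a powr (p - 1) * b \<le> (b / \<eta>) powr (p - 1) * b"
    using assms by (intro mult_right_mono powr_mono2) auto
  also have "\<dots> = \<eta> powr (1 - p) * b powr p" using assms b
    by (simp add: powr_divide powr_diff field_simps)
  finally show ?thesis using assms by (simp add: add_increasing)
qed

text \<open>This takes the role of Hoelder's inequality for integrability: products of a
  \<open>p - 1\<close>-st power with a first power are dominated by the \<open>p\<close>-th power of
  a sum, which again comes from \<open>L^p\<close>.\<close>

lemma powr_mult_le_add_powr:
  fixes a b p :: real assumes "0 \<le> a" "0 \<le> b" "1 \<le> p"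
  shows "a powr (p - 1) * b \<le> (a + b) powr p"
proof (cases "a + b = 0")
  case True
  then have "b = 0" using assms by linarith
  then show ?thesis by simp
next
  case False
  have "a powr (p - 1) * b \<le> (a + b) powr (p - 1) * (a + b)"
    using assms by (intro mult_mono powr_mono2) auto
  also have "\<dots> = (a + b) powr p" using False assms by (simp add: powr_diff)
  finally show ?thesis .
qed

section \<open>\<open>L^p\<close> over a general measure: vector space operations, limits,
  completeness\<close>

definition Lp_space :: "'a measure \<Rightarrow> real \<Rightarrow> ('a \<Rightarrow> 'b::euclidean_space) set" where
  "Lp_space M p = {u. u \<in> borel_measurable M \<and> integrable M (\<lambda>x. norm (u x) powr p)}"

lemma Lp_on_eq: "Lp_on \<Omega> p = Lp_space (lebesgue_on \<Omega>) p"
  by (simp add: Lp_on_def Lp_space_def)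

lemma Lp_measurable [measurable_dest]: "u \<in> Lp_space M p \<Longrightarrow> u \<in> borel_measurable M"
  and Lp_integrable: "u \<in> Lp_space M p \<Longrightarrow> integrable M (\<lambda>x. norm (u x) powr p)"
  by (auto simp: Lp_space_def)

lemma Lp_bound:
  assumes g: "g \<in> borel_measurable M" and h: "integrable M h"
    and le: "AE x in M. norm (g x) powr p \<le> h x"
  shows "g \<in> Lp_space M p"
proof -
  have "integrable M (\<lambda>x. norm (g x) powr p)"
    by (rule Bochner_Integration.integrable_bound[OF h]) (use g le in auto)
  then show ?thesis using g by (simp add: Lp_space_def)
qed

lemma Lp_bound_norm:
  assumes g: "g \<in> borel_measurable M" and h: "h \<in> Lp_space M p" and p: "0 \<le> p"
    and le: "AE x in M. norm (g x) \<le> norm (h x)"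
  shows "g \<in> Lp_space M p"
  by (rule Lp_bound[OF g Lp_integrable[OF h]]) (use le p in \<open>auto elim!: eventually_mono intro!: powr_mono2\<close>)

lemma Lp_add:
  assumes "u \<in> Lp_space M p" "v \<in> Lp_space M p" "0 \<le> p"
  shows "(\<lambda>x. u x + v x) \<in> Lp_space M p"
  by (rule Lp_bound[where h="\<lambda>x. 2 powr p * (norm (u x) powr p + norm (v x) powr p)"])
     (use assms norm_add_powr_le in \<open>auto simp: Lp_space_def\<close>)

lemma Lp_scaleR: 
  assumes "u \<in> Lp_space M p"
  shows "(\<lambda>x. c *\<^sub>R u x) \<in> Lp_space M p"
  using assms by (auto simp: Lp_space_def powr_mult)

lemma Lp_minus: "u \<in> Lp_space M p \<Longrightarrow> (\<lambda>x. - u x) \<in> Lp_space M p"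
  using Lp_scaleR[of u M p "-1"] by simp

lemma Lp_diff:
  assumes "u \<in> Lp_space M p" "v \<in> Lp_space M p" "0 \<le> p"
  shows "(\<lambda>x. u x - v x) \<in> Lp_space M p"
  using Lp_add[OF assms(1) Lp_minus[OF assms(2)] assms(3)] by simp

lemma Lp_norm: "u \<in> Lp_space M p \<Longrightarrow> (\<lambda>x. norm (u x)) \<in> Lp_space M p"
  by (auto simp: Lp_space_def intro: measurable_compose[OF _ borel_measurable_norm])

text \<open>This is the \<open>p\<close>-th power of the norm of the difference. It satisfies the
  triangle inequality up to the factor \<open>2 powr p\<close>, which is enough for arguments with
  limits.\<close>

definition Lp_dist :: "'a measure \<Rightarrow> real \<Rightarrow> ('a \<Rightarrow> 'b::euclidean_space) \<Rightarrow> ('a \<Rightarrow> 'b) \<Rightarrow> real" where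
  "Lp_dist M p u v = (LINT x|M. norm (u x - v x) powr p)"

lemma Lp_dist_nonneg: "0 \<le> Lp_dist M p u v" by (simp add: Lp_dist_def)

lemma Lp_dist_commute: "Lp_dist M p u v = Lp_dist M p v u"
  by (simp add: Lp_dist_def norm_minus_commute)

lemma Lp_dist_le:
  assumes "0 \<le> p" "u \<in> Lp_space M p" "v \<in> Lp_space M p" "w \<in> Lp_space M p"
  shows "Lp_dist M p u w \<le> 2 powr p * (Lp_dist M p u v + Lp_dist M p v w)"
proof -
  have i: "integrable M (\<lambda>x. norm (u x - v x) powr p)" "integrable M (\<lambda>x. norm (v x - w x) powr p)"
    "integrable M (\<lambda>x. norm (u x - w x) powr p)"
    using Lp_integrable[OF Lp_diff[OF _ _ assms(1)]] assms by blast+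
  have "Lp_dist M p u w \<le> (LINT x|M. 2 powr p * (norm (u x - v x) powr p + norm (v x - w x) powr p))"
    unfolding Lp_dist_def
  proof (rule integral_mono)
    show "norm (u x - w x) powr p \<le> 2 powr p * (norm (u x - v x) powr p + norm (v x - w x) powr p)" for x
      using norm_add_powr_le[OF assms(1), of "u x - v x" "v x - w x"] by simp
  qed (use i assms in auto)
  also have "\<dots> = 2 powr p * (Lp_dist M p u v + Lp_dist M p v w)"
    unfolding Lp_dist_def using i assms by simp
  finally show ?thesis .
qed

lemma Lp_subseq_AE:
  assumes p: "0 < p" and u: "\<And>n. u n \<in> Lp_space M p" and v: "v \<in> Lp_space M p"
    and lim: "(\<lambda>n. Lp_dist M p (u n) v) \<longlonglongrightarrow> 0"
  obtains r :: "nat \<Rightarrow> nat" where "strict_mono r" "AE x in M. (\<lambda>n. u (r n) x) \<longlonglongrightarrow> v x"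
proof -
  have i: "integrable M (\<lambda>x. norm (u n x - v x) powr p)" for n
    using Lp_integrable[OF Lp_diff[OF u v]] p by simp
  have "(\<lambda>n. LINT x|M. norm (norm (u n x - v x) powr p)) \<longlonglongrightarrow> 0"
    using lim by (simp add: Lp_dist_def)
  from tendsto_L1_AE_subseq[OF i this] obtain r :: "nat \<Rightarrow> nat" where r: "strict_mono r"
    and ae: "AE x in M. (\<lambda>n. norm (u (r n) x - v x) powr p) \<longlonglongrightarrow> 0" by blast
  have "AE x in M. (\<lambda>n. u (r n) x) \<longlonglongrightarrow> v x"
    using ae
  proof eventually_elim
    fix x assume "(\<lambda>n. norm (u (r n) x - v x) powr p) \<longlonglongrightarrow> 0"
    then have "(\<lambda>n. (norm (u (r n) x - v x) powr p) powr (1 / p)) \<longlonglongrightarrow> 0 powr (1 / p)"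
      by (rule tendsto_powr2) (use p in auto)
    then have "(\<lambda>n. norm (u (r n) x - v x)) \<longlonglongrightarrow> 0" using p by (simp add: powr_powr)
    then show "(\<lambda>n. u (r n) x) \<longlonglongrightarrow> v x" using LIM_zero_cancel tendsto_norm_zero_iff by blast
  qed
  then show ?thesis using that r by blast
qed

lemma Lp_dominated:
  assumes p: "0 < p" and u: "\<And>n. u n \<in> borel_measurable M" and v: "v \<in> borel_measurable M"
    and g: "g \<in> Lp_space M p" and le: "\<And>n. AE x in M. norm (u n x) \<le> g x"
    and lim: "AE x in M. (\<lambda>n. u n x) \<longlonglongrightarrow> v x"
  shows "\<And>n. u n \<in> Lp_space M p" "v \<in> Lp_space M p" "(\<lambda>n. Lp_dist M p (u n) v) \<longlonglongrightarrow> 0"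
proof -
  have le': "AE x in M. norm (u n x) \<le> norm (g x)" for n using le[of n] by eventually_elim simp
  show "u n \<in> Lp_space M p" for n
    by (rule Lp_bound_norm[OF u g _ le']) (use p in auto)
  have lev: "AE x in M. norm (v x) \<le> norm (g x)"
  proof -
    have "AE x in M. \<forall>n. norm (u n x) \<le> norm (g x)" using le' by (simp add: AE_all_countable)
    then show ?thesis using lim
      by eventually_elim (metis LIMSEQ_le_const2 tendsto_norm)
  qed
  show "v \<in> Lp_space M p" by (rule Lp_bound_norm[OF v g _ lev]) (use p in auto)
  have "(\<lambda>n. LINT x|M. norm (u n x - v x) powr p) \<longlonglongrightarrow> (LINT x|M. 0)"
  proof (rule integral_dominated_convergence[where w="\<lambda>x. 2 powr p * (norm (g x) powr p + norm (g x) powr p)"])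
    show "integrable M (\<lambda>x. 2 powr p * (norm (g x) powr p + norm (g x) powr p))"
      using Lp_integrable[OF g] by simp
    show "AE x in M. (\<lambda>n. norm (u n x - v x) powr p) \<longlonglongrightarrow> 0"
      using lim
    proof eventually_elim
      fix x assume "(\<lambda>n. u n x) \<longlonglongrightarrow> v x"
      then have "(\<lambda>n. norm (u n x - v x)) \<longlonglongrightarrow> 0" using LIM_zero tendsto_norm_zero by blast
      then have "(\<lambda>n. norm (u n x - v x) powr p) \<longlonglongrightarrow> 0 powr p"
        by (rule tendsto_powr2) (use p in auto)
      then show "(\<lambda>n. norm (u n x - v x) powr p) \<longlonglongrightarrow> 0" using p by simp
    qed
    show "AE x in M. norm (norm (u n x - v x) powr p) \<le> 2 powr p * (norm (g x) powr p + norm (g x) powr p)" for n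
      using le'[of n] lev
    proof eventually_elim
      fix x assume "norm (u n x) \<le> norm (g x)" "norm (v x) \<le> norm (g x)"
      then have "norm (u n x) powr p \<le> norm (g x) powr p" "norm (v x) powr p \<le> norm (g x) powr p"
        using p by (auto intro: powr_mono2)
      then show "norm (norm (u n x - v x) powr p) \<le> 2 powr p * (norm (g x) powr p + norm (g x) powr p)"
        using norm_add_powr_le[of p "u n x" "- v x"] p
        by (smt (verit) add_uminus_conv_diff mult_left_mono norm_minus_cancel powr_ge_zero real_norm_def)
    qed
  qed (use u v in auto)
  then show "(\<lambda>n. Lp_dist M p (u n) v) \<longlonglongrightarrow> 0" by (simp add: Lp_dist_def)
qed

text \<open>The estimate \<open>|d| \<le> 2\<^sup>-\<^sup>k + 2\<^sup>k\<^sup>(\<^sup>p\<^sup>-\<^sup>1\<^sup>) |d|\<^sup>p\<close> turns fast convergence in \<open>L\<^sup>p\<close> into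
  absolute convergence almost everywhere without Hoelder or Minkowski.\<close>

lemma Lp_complete:
  fixes u :: "nat \<Rightarrow> 'a \<Rightarrow> 'b::euclidean_space"
  assumes p: "1 \<le> p" and u: "\<And>n. u n \<in> Lp_space M p"
    and cauchy: "\<And>e. e > 0 \<Longrightarrow> \<exists>N. \<forall>m\<ge>N. \<forall>n\<ge>N. Lp_dist M p (u m) (u n) < e"
  obtains v where "v \<in> Lp_space M p" "(\<lambda>n. Lp_dist M p (u n) v) \<longlonglongrightarrow> 0"
proof -
  have "\<exists>N. \<forall>k. \<forall>m\<ge>N k. \<forall>n\<ge>N k. Lp_dist M p (u m) (u n) < 2 powr (- real k * p)"
    using cauchy by (intro choice) auto
  then obtain N where N: "\<And>k m n. m \<ge> N k \<Longrightarrow> n \<ge> N k \<Longrightarrow> Lp_dist M p (u m) (u n) < 2 powr (- real k * p)"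
    by blast
  \<comment> \<open>Partial sums make the indices monotone while each \<open>r k\<close> still
    exceeds \<open>N k\<close>.\<close>
  define r where "r = (\<lambda>k. \<Sum>j\<le>k. N j + 1)"
  have rN: "r k \<ge> N k" for k
  proof -
    have "N k + 1 \<le> r k" unfolding r_def by (rule member_le_sum) auto
    then show ?thesis by simp
  qed
  have rmono: "r k \<le> r (Suc k)" for k by (simp add: r_def)
  define d where "d = (\<lambda>k x. u (r (Suc k)) x - u (r k) x)"
  \<comment> \<open>The weight is the factor of \<open>|d|^p\<close> in the estimate announced
    above. Since the \<open>k\<close>-th distance is below \<open>2 powr (- k p)\<close>, the
    integral of \<open>c k\<close> is at most \<open>2^(-k)\<close>, and the series of the
    \<open>c k\<close> converges almost everywhere.\<close>
  define c where "c = (\<lambda>k x. 2 powr (real k * (p - 1)) * norm (d k x) powr p)"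
  have dLp: "d k \<in> Lp_space M p" for k unfolding d_def using Lp_diff u p by fastforce
  have ci: "integrable M (c k)" for k unfolding c_def using Lp_integrable[OF dLp] by simp
  have c0: "0 \<le> c k x" for k x by (simp add: c_def)
  have cle: "(LINT x|M. c k x) \<le> (1/2) ^ k" for k
  proof -
    have "Lp_dist M p (u (r (Suc k))) (u (r k)) < 2 powr (- real k * p)"
      using N rN rmono by (meson order_trans)
    then have "(LINT x|M. c k x) \<le> 2 powr (real k * (p - 1)) * 2 powr (- real k * p)"
      unfolding c_def d_def Lp_dist_def integral_mult_right_zero by (intro mult_left_mono) auto
    also have "\<dots> = 2 powr (- real k)" by (simp add: powr_add[symmetric] algebra_simps)
    also have "\<dots> = (1/2) ^ k" by (simp add: powr_minus powr_realpow power_divide divide_simps)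
    finally show ?thesis .
  qed
  have "(\<integral>\<^sup>+x. (\<Sum>k. ennreal (c k x)) \<partial>M) = (\<Sum>k. \<integral>\<^sup>+x. ennreal (c k x) \<partial>M)"
    by (rule nn_integral_suminf) (use ci in measurable)
  also have "\<dots> \<le> (\<Sum>k. ennreal ((1/2) ^ k))"
  proof (rule suminf_le)
    fix k show "(\<integral>\<^sup>+x. ennreal (c k x) \<partial>M) \<le> ennreal ((1/2) ^ k)"
      by (subst nn_integral_eq_integral[OF ci]) (simp_all add: c0 ennreal_leI cle)
  qed auto
  also have "\<dots> = ennreal (\<Sum>k. (1/2) ^ k)"
    by (rule suminf_ennreal2) (auto intro: summable_geometric)
  also have "\<dots> < \<infinity>" by simp
  finally have "(\<integral>\<^sup>+x. (\<Sum>k. ennreal (c k x)) \<partial>M) \<noteq> \<infinity>" by simp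
  then have "AE x in M. (\<Sum>k. ennreal (c k x)) \<noteq> \<infinity>"
    by (rule nn_integral_PInf_AE[rotated]) (use ci in measurable)
  then have conv: "AE x in M. convergent (\<lambda>k. u (r k) x)"
  proof eventually_elim
    fix x assume "(\<Sum>k. ennreal (c k x)) \<noteq> \<infinity>"
    then have sc: "summable (\<lambda>k. c k x)"
      by (intro summable_suminf_not_top) (auto simp: c_def)
    have "summable (\<lambda>k. (1/2) ^ k + c k x)"
      by (intro summable_add sc summable_geometric) auto
    moreover have "norm (d k x) \<le> (1/2) ^ k + c k x" for k
    proof -
      define a where "a = (2::real) powr (real k)"
      have a: "a > 0" "(1/2) ^ k = 1 / a" by (simp_all add: a_def powr_realpow power_divide)
      have a3: "2 powr (real k * (p - 1)) = a powr (p - 1)" by (simp only: a_def powr_powr)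
      have "1 powr (p - 1) * norm (d k x) \<le> (1/a) * 1 powr p + (1/a) powr (1 - p) * norm (d k x) powr p"
        by (rule young_eps) (use a p in auto)
      moreover have "(1/a) powr (1 - p) = a powr (p - 1)"
        using a(1) by (simp add: powr_divide powr_diff)
      ultimately show ?thesis unfolding c_def a a3 by simp
    qed
    ultimately have "summable (\<lambda>k. d k x)" by (rule summable_comparison_test'[where N=0])
    then have "convergent (\<lambda>k. \<Sum>j<k. d j x)" by (simp add: summable_iff_convergent)
    then have "convergent (\<lambda>k. (\<Sum>j<k. d j x) + u (r 0) x)"
      by (rule convergent_add[OF _ convergent_const])
    moreover have "(\<Sum>j<k. d j x) = u (r k) x - u (r 0) x" for k
      unfolding d_def by (rule sum_lessThan_telescope)
    ultimately show "convergent (\<lambda>k. u (r k) x)" by simp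
  qed
  define v where "v = (\<lambda>x. lim (\<lambda>k. u (r k) x))"
  have um: "u n \<in> borel_measurable M" for n using u Lp_measurable by blast
  have vm: "v \<in> borel_measurable M" unfolding v_def by (rule borel_measurable_lim_metric[OF um])
  have lim: "AE x in M. (\<lambda>k. u (r k) x) \<longlonglongrightarrow> v x"
    using conv by eventually_elim (simp add: v_def convergent_LIMSEQ_iff)
  \<comment> \<open>Fatou along the tail of the subsequence carries the Cauchy bound over to the
    distance from the limit, for the whole sequence and not just for the subsequence.\<close>
  have main: "integrable M (\<lambda>x. norm (v x - u n x) powr p) \<and> Lp_dist M p (u n) v \<le> 2 powr (- real k * p)"
    if n: "n \<ge> N k" for n k
  proof -
    have i: "integrable M (\<lambda>x. norm (u (r (j + k)) x - u n x) powr p)" for j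
      using Lp_integrable[OF Lp_diff[OF u u]] p by simp
    have lm: "AE x in M. (\<lambda>j. norm (u (r (j + k)) x - u n x) powr p) \<longlonglongrightarrow> norm (v x - u n x) powr p"
      using lim
    proof eventually_elim
      fix x assume "(\<lambda>k. u (r k) x) \<longlonglongrightarrow> v x"
      then have "(\<lambda>j. u (r (j + k)) x) \<longlonglongrightarrow> v x" by (rule LIMSEQ_ignore_initial_segment)
      then show "(\<lambda>j. norm (u (r (j + k)) x - u n x) powr p) \<longlonglongrightarrow> norm (v x - u n x) powr p"
        using p by (intro tendsto_powr2 tendsto_norm tendsto_diff tendsto_const) auto
    qed
    have le: "(LINT x|M. norm (u (r (j + k)) x - u n x) powr p) \<le> 2 powr (- real k * p)" for j
    proof -
      have "mono r" using rmono by (simp add: mono_iff_le_Suc)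
      then have "r (j + k) \<ge> N k" using rN[of k] by (meson le_add2 monoD order_trans)
      then show ?thesis using N[OF _ n] by (simp add: Lp_dist_def less_imp_le)
    qed
    have m: "(\<lambda>x. norm (v x - u n x) powr p) \<in> borel_measurable M" using vm um by measurable
    show ?thesis using Fatou_real[OF i _ lm m le tendsto_const] 
      unfolding Lp_dist_commute[of M p "u n"] by (simp add: Lp_dist_def)
  qed
  have "v \<in> Lp_space M p"
  proof -
    have "(\<lambda>x. v x - u (N 0) x) \<in> Lp_space M p" using main[of 0 "N 0"] vm um by (simp add: Lp_space_def)
    from Lp_add[OF this u[of "N 0"]] show ?thesis using p by simp
  qed
  moreover have "(\<lambda>n. Lp_dist M p (u n) v) \<longlonglongrightarrow> 0"
  proof (rule LIMSEQ_I)
    fix e :: real assume e: "e > 0"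
    have "(\<lambda>k. (1/2::real) ^ k) \<longlonglongrightarrow> 0" by (rule LIMSEQ_power_zero) simp
    then obtain k where k: "(1/2::real) ^ k < e" using e
      by (metis order_tendstoD(2) eventually_sequentially order_refl)
    have "2 powr (- real k * p) \<le> 2 powr (- real k)" using p mult_left_mono[of 1 p "real k"] by (intro powr_mono) auto
    also have "\<dots> = (1/2) ^ k" by (simp add: powr_minus powr_realpow power_divide divide_simps)
    finally have "Lp_dist M p (u n) v < e" if "n \<ge> N k" for n using main[OF that] k by linarith
    then show "\<exists>no. \<forall>n\<ge>no. norm (Lp_dist M p (u n) v - 0) < e" by (auto simp: Lp_dist_nonneg)
  qed
  ultimately show ?thesis using that by blast
qed

text \<open>Young's inequality with a small parameter stands in for Hoelder's inequality.\<close>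

lemma integral_mult_tendsto_0:
  fixes w :: "nat \<Rightarrow> 'a \<Rightarrow> 'b::euclidean_space" and k :: "nat \<Rightarrow> 'a \<Rightarrow> real"
  assumes p: "1 \<le> p" and w: "\<And>n. w n \<in> Lp_space M p" and lim: "(\<lambda>n. LINT x|M. norm (w n x) powr p) \<longlonglongrightarrow> 0"
    and g: "g \<in> Lp_space M p" and k: "\<And>n. k n \<in> borel_measurable M"
    and le: "\<And>n. AE x in M. \<bar>k n x\<bar> \<le> C * (norm (g x) powr (p - 1) * norm (w n x))" and C: "0 \<le> C"
  shows "\<And>n. integrable M (k n)" "(\<lambda>n. LINT x|M. \<bar>k n x\<bar>) \<longlonglongrightarrow> 0" "(\<lambda>n. LINT x|M. k n x) \<longlonglongrightarrow> 0"
proof -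
  define G where "G = (LINT x|M. norm (g x) powr p)"
  have gi: "integrable M (\<lambda>x. norm (g x) powr p)" using g Lp_integrable by blast
  have wi: "integrable M (\<lambda>x. norm (w n x) powr p)" for n using w Lp_integrable by blast
  have bd: "AE x in M. \<bar>k n x\<bar> \<le> C * (\<eta> * norm (g x) powr p + \<eta> powr (1 - p) * norm (w n x) powr p)"
    if "\<eta> > 0" for n \<eta>
    using le[of n]
  proof eventually_elim
    fix x assume "\<bar>k n x\<bar> \<le> C * (norm (g x) powr (p - 1) * norm (w n x))"
    also have "\<dots> \<le> C * (\<eta> * norm (g x) powr p + \<eta> powr (1 - p) * norm (w n x) powr p)"
      using C p that by (intro mult_left_mono young_eps) auto
    finally show "\<bar>k n x\<bar> \<le> C * (\<eta> * norm (g x) powr p + \<eta> powr (1 - p) * norm (w n x) powr p)" .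
  qed
  show ki: "integrable M (k n)" for n
    by (rule Bochner_Integration.integrable_bound[where f="\<lambda>x. C * (1 * norm (g x) powr p + 1 powr (1 - p) * norm (w n x) powr p)"])
      (use gi wi k bd[of 1 n] in auto)
  have Ile: "(LINT x|M. \<bar>k n x\<bar>) \<le> C * (\<eta> * G + \<eta> powr (1 - p) * (LINT x|M. norm (w n x) powr p))"
    if "\<eta> > 0" for n \<eta>
  proof -
    have "(LINT x|M. \<bar>k n x\<bar>) \<le> (LINT x|M. C * (\<eta> * norm (g x) powr p + \<eta> powr (1 - p) * norm (w n x) powr p))"
      by (rule integral_mono_AE) (use ki gi wi bd[OF that] in auto)
    also have "\<dots> = C * (\<eta> * G + \<eta> powr (1 - p) * (LINT x|M. norm (w n x) powr p))"
      unfolding G_def using gi wi by simp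
    finally show ?thesis .
  qed
  have G0: "0 \<le> G" by (simp add: G_def)
  show l1: "(\<lambda>n. LINT x|M. \<bar>k n x\<bar>) \<longlonglongrightarrow> 0"
  proof (rule LIMSEQ_I)
    fix e :: real assume e: "e > 0"
    \<comment> \<open>With this choice the contribution of the fixed function \<open>g\<close> is at
      most \<open>e / 2\<close>; the added 1 guards against \<open>C * G = 0\<close>.\<close>
    define \<eta> where "\<eta> = e / (2 * (C * G + 1))"
    have CG: "C * G + 1 > 0" using C G0 by (simp add: add_nonneg_pos)
    have \<eta>: "\<eta> > 0" "C * (\<eta> * G) < e / 2 + e / 4" 
    proof -
      show "\<eta> > 0" using e CG by (simp add: \<eta>_def)
      have "C * (\<eta> * G) = e / 2 * (C * G / (C * G + 1))" by (simp add: \<eta>_def)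
      also have "\<dots> \<le> e / 2 * 1" using e CG by (intro mult_left_mono) (auto simp: divide_le_eq)
      finally show "C * (\<eta> * G) < e / 2 + e / 4" using e by simp
    qed
    have "(\<lambda>n. C * (\<eta> * G + \<eta> powr (1 - p) * (LINT x|M. norm (w n x) powr p))) \<longlonglongrightarrow> C * (\<eta> * G + \<eta> powr (1 - p) * 0)"
      by (intro tendsto_intros lim)
    moreover have "C * (\<eta> * G + \<eta> powr (1 - p) * 0) < e" using \<eta> e by simp
    ultimately have "eventually (\<lambda>n. C * (\<eta> * G + \<eta> powr (1 - p) * (LINT x|M. norm (w n x) powr p)) < e) sequentially"
      by (rule order_tendstoD(2))
    then have "eventually (\<lambda>n. (LINT x|M. \<bar>k n x\<bar>) < e) sequentially"
      by eventually_elim (use Ile[OF \<eta>(1)] in \<open>meson le_less_trans\<close>)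
    then show "\<exists>no. \<forall>n\<ge>no. norm ((LINT x|M. \<bar>k n x\<bar>) - 0) < e"
      by (auto simp: eventually_sequentially)
  qed
  show "(\<lambda>n. LINT x|M. k n x) \<longlonglongrightarrow> 0"
    by (rule Lim_null_comparison[OF _ l1]) (auto intro!: always_eventually integral_abs_bound)
qed

subsection \<open>Convexity of the \<open>p\<close>-energy\<close>

lemma bernoulli_powr_strict:
  fixes r p :: real assumes p: "p > 1" and r: "0 \<le> r" "r \<noteq> 1"
  shows "r powr p > 1 + p * (r - 1)"
proof (cases "r = 0")
  case True then show ?thesis using p by simp
next
  case False
  then have r0: "r > 0" using r by simp
  have D: "((\<lambda>x. x powr p) has_real_derivative p * x powr (p - 1)) (at x)" if "x > 0" for x
    using has_real_derivative_powr that by blast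
  show ?thesis
  proof (cases "r > 1")
    case True
    obtain c where c: "1 < c" "c < r" "r powr p - 1 powr p = (r - 1) * (p * c powr (p - 1))"
      using MVT2[of 1 r "\<lambda>x. x powr p" "\<lambda>x. p * x powr (p - 1)"] D True by auto
    have "c powr (p - 1) > 1" using c p by (simp add: gr_one_powr)
    then have "(r - 1) * (p * c powr (p - 1)) > (r - 1) * (p * 1)"
      using True p by (intro mult_strict_left_mono) auto
    then show ?thesis using c by (simp add: algebra_simps)
  next
    case False
    then have r1: "r < 1" using r by simp
    obtain c where c: "r < c" "c < 1" "1 powr p - r powr p = (1 - r) * (p * c powr (p - 1))"
      using MVT2[of r 1 "\<lambda>x. x powr p" "\<lambda>x. p * x powr (p - 1)"] D r1 r0 by auto
    have "c powr (p - 1) < 1 powr (p - 1)" by (rule powr_less_mono2) (use c p r0 in auto)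
    then have "(1 - r) * (p * c powr (p - 1)) < (1 - r) * (p * 1)"
      using r1 p by (intro mult_strict_left_mono) auto
    then show ?thesis using c by (simp add: algebra_simps)
  qed
qed

text \<open>The gradient of \<open>norm a powr p / p\<close>. The value at 0 is 0 for every exponent
  because of the vector factor, also when \<open>p < 2\<close>.\<close>

definition pflux :: "real \<Rightarrow> 'b::real_normed_vector \<Rightarrow> 'b" where
  "pflux p a = norm a powr (p - 2) *\<^sub>R a"

lemma norm_pflux: "norm (pflux p a) = norm a powr (p - 1)"
proof (cases "a = 0")
  case False
  then have "norm a powr (p - 2) * norm a = norm a powr (p - 2) * norm a powr 1" by simp
  also have "\<dots> = norm a powr (p - 1)" by (simp only: powr_add[symmetric]) simp
  finally show ?thesis by (simp add: pflux_def)
qed (simp add: pflux_def)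

lemma pflux_inner_self: 
  fixes a :: "'b::real_inner" shows "pflux p a \<bullet> a = norm a powr p"
proof (cases "a = 0")
  case False
  then have "norm a powr (p - 2) * (norm a)\<^sup>2 = norm a powr (p - 2) * norm a powr 2" by simp
  also have "\<dots> = norm a powr p" by (simp only: powr_add[symmetric]) simp
  finally show ?thesis by (simp add: pflux_def power2_norm_eq_inner)
qed (simp add: pflux_def)

text \<open>Strict convexity of \<open>norm a powr p\<close> has two sources. If the norms differ,
  Bernoulli's inequality for their ratio is strict; if they agree, strictness comes from
  \<open>a \<bullet> b < norm a * norm b\<close>, valid for distinct vectors of equal
  length.\<close>

lemma norm_powr_gradient_strict:
  fixes a b :: "'b::real_inner" assumes p: "p > 1" and ne: "a \<noteq> b"
  shows "norm b powr p > norm a powr p + p * (pflux p a \<bullet> (b - a))"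
proof (cases "a = 0")
  case True then show ?thesis using ne by (simp add: pflux_def)
next
  case False
  define s t where "s = norm a" and "t = norm b"
  have st: "s > 0" "t \<ge> 0" using False by (auto simp: s_def t_def)
  have ab: "pflux p a \<bullet> (b - a) = pflux p a \<bullet> b - s powr p"
    by (simp add: inner_diff_right pflux_inner_self s_def)
  have cs: "pflux p a \<bullet> b \<le> s powr (p - 1) * t"
    using norm_cauchy_schwarz[of "pflux p a" b] by (simp add: norm_pflux s_def t_def)
  show ?thesis
  proof (cases "s = t")
    case True
    have "(norm (a - b))\<^sup>2 > 0" using ne by simp
    moreover have "(norm (a - b))\<^sup>2 = s\<^sup>2 + t\<^sup>2 - 2 * (a \<bullet> b)"
      by (simp add: power2_norm_eq_inner inner_diff_left inner_diff_right inner_commute s_def t_def)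
    ultimately have "a \<bullet> b < s * s" using True by (simp add: power2_eq_square)
    then have "pflux p a \<bullet> b < s powr (p - 2) * (s * s)" using st
      by (simp add: pflux_def s_def)
    also have "\<dots> = s powr p" using pflux_inner_self[of p a] 
      by (simp add: pflux_def s_def power2_norm_eq_inner[symmetric] power2_eq_square)
    finally have "p * (pflux p a \<bullet> (b - a)) < 0" using ab p by (simp add: mult_pos_neg)
    then show ?thesis using True by (simp add: s_def t_def)
  next
    case False
    have "(t / s) powr p > 1 + p * (t / s - 1)"
      by (rule bernoulli_powr_strict) (use st False p in auto)
    then have "s powr p * (t / s) powr p > s powr p * (1 + p * (t / s - 1))" using st by simp
    moreover have "s powr p * (t / s) powr p = t powr p" using st by (simp add: powr_divide)
    moreover have "s powr p * (1 + p * (t / s - 1)) = s powr p + p * (s powr (p - 1) * t - s powr p)"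
      using st by (simp add: powr_diff field_simps)
    ultimately have "t powr p > s powr p + p * (s powr (p - 1) * t - s powr p)" by simp
    moreover have "p * (s powr (p - 1) * t - s powr p) \<ge> p * (pflux p a \<bullet> b - s powr p)"
      using cs p by simp
    ultimately show ?thesis using ab by (simp add: s_def t_def)
  qed
qed

text \<open>Value and gradient are treated as one vector, so that the zero-order term and the
  \<open>p\<close>-Laplacian become a single convex function with a single flux. It is not
  \<open>norm z powr p\<close>, only equivalent to it up to constants.\<close>

definition penergy :: "real \<Rightarrow> real \<times> 'b::real_normed_vector \<Rightarrow> real" where
  "penergy p z = \<bar>fst z\<bar> powr p + norm (snd z) powr p"

definition pflux2 :: "real \<Rightarrow> real \<times> 'b::real_normed_vector \<Rightarrow> real \<times> 'b" where
  "pflux2 p z = (pflux p (fst z), pflux p (snd z))"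

lemma penergy_nonneg [simp]: "0 \<le> penergy p z" by (simp add: penergy_def)

lemma penergy_gradient_strict:
  fixes z w :: "real \<times> 'b::real_inner" assumes p: "p > 1" and ne: "z \<noteq> w"
  shows "penergy p w > penergy p z + p * (pflux2 p z \<bullet> (w - z))"
proof -
  have n1: "norm b powr p \<ge> norm a powr p + p * (pflux p a \<bullet> (b - a))" for a b :: real
    using norm_powr_gradient_strict[OF p, of a b] by (cases "a = b") auto
  have n2: "norm b powr p \<ge> norm a powr p + p * (pflux p a \<bullet> (b - a))" for a b :: 'b
    using norm_powr_gradient_strict[OF p, of a b] by (cases "a = b") auto
  from ne have "fst z \<noteq> fst w \<or> snd z \<noteq> snd w" by (auto simp: prod_eq_iff)
  then show ?thesis
    using norm_powr_gradient_strict[OF p, of "fst z" "fst w"] norm_powr_gradient_strict[OF p, of "snd z" "snd w"]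
      n1[of "fst z" "fst w"] n2[of "snd z" "snd w"]
    by (auto simp: penergy_def pflux2_def inner_prod_def algebra_simps)
qed

lemma penergy_gradient:
  fixes z w :: "real \<times> 'b::real_inner" assumes p: "p > 1"
  shows "penergy p w \<ge> penergy p z + p * (pflux2 p z \<bullet> (w - z))"
  using penergy_gradient_strict[OF p, of z w] by (cases "z = w") auto

text \<open>Adding the strict gradient inequalities at \<open>z\<close> and at \<open>w\<close>
  cancels the energies and leaves the monotonicity of the flux.\<close>

lemma pflux2_monotone_strict:
  fixes z w :: "real \<times> 'b::real_inner" assumes p: "p > 1" and ne: "z \<noteq> w"
  shows "(pflux2 p z - pflux2 p w) \<bullet> (z - w) > 0"
proof -
  have "p * ((pflux2 p z - pflux2 p w) \<bullet> (z - w)) > 0"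
    using penergy_gradient_strict[OF p ne] penergy_gradient_strict[OF p ne[symmetric]]
    by (simp add: inner_diff_left inner_diff_right algebra_simps)
  then show ?thesis using p by (simp add: zero_less_mult_iff)
qed

lemma pflux2_inner_self: 
  fixes z :: "real \<times> 'b::real_inner" shows "pflux2 p z \<bullet> z = penergy p z"
  using pflux_inner_self[of p "fst z"] by (simp add: pflux2_def inner_prod_def pflux_inner_self penergy_def)

lemma norm_pflux2_le: 
  assumes "1 \<le> p" shows "norm (pflux2 p z) \<le> 2 * norm z powr (p - 1)"
proof -
  have "norm (pflux2 p z) \<le> norm (pflux p (fst z)) + norm (pflux p (snd z))"
    unfolding pflux2_def by (rule norm_Pair_le)
  also have "\<dots> \<le> norm z powr (p - 1) + norm z powr (p - 1)" unfolding norm_pflux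
    using assms norm_fst_le[of "fst z" "snd z"] norm_snd_le[of "snd z" "fst z"] by (intro add_mono powr_mono2) auto
  finally show ?thesis by simp
qed

lemma pflux2_inner_le:
  fixes z w :: "real \<times> 'b::real_inner" assumes "1 \<le> p" 
  shows "\<bar>pflux2 p z \<bullet> w\<bar> \<le> 2 * (norm z powr (p - 1) * norm w)"
proof -
  have "\<bar>pflux2 p z \<bullet> w\<bar> \<le> norm (pflux2 p z) * norm w" by (rule Cauchy_Schwarz_ineq2)
  also have "\<dots> \<le> 2 * norm z powr (p - 1) * norm w" using norm_pflux2_le[OF assms, of z] by (intro mult_right_mono) simp_all
  finally show ?thesis by (simp add: mult.assoc)
qed

lemma penergy_le: assumes "0 \<le> p" shows "penergy p z \<le> 2 * norm z powr p"
proof -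
  have "\<bar>fst z\<bar> powr p \<le> norm z powr p" using assms norm_fst_le[of "fst z" "snd z"] by (intro powr_mono2) auto
  moreover have "norm (snd z) powr p \<le> norm z powr p" using assms norm_snd_le[of "snd z" "fst z"] by (intro powr_mono2) auto
  ultimately show ?thesis by (simp add: penergy_def)
qed

lemma norm_powr_le_penergy: assumes "0 \<le> p" shows "norm z powr p \<le> 2 powr p * penergy p z"
proof -
  have "norm z \<le> \<bar>fst z\<bar> + norm (snd z)" using norm_Pair_le[of "fst z" "snd z"] by simp
  then have "norm z powr p \<le> (\<bar>fst z\<bar> + norm (snd z)) powr p" using assms by (intro powr_mono2) auto
  also have "\<dots> \<le> 2 powr p * penergy p z" unfolding penergy_def using assms by (intro powr_add_le) auto
  finally show ?thesis .
qed

lemma penergy_scaleR: assumes "0 \<le> s" shows "penergy p (s *\<^sub>R z) = s powr p * penergy p z"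
  using assms by (simp add: penergy_def abs_mult powr_mult algebra_simps)

lemma pflux2_scaleR: assumes "0 < s" shows "pflux2 p (s *\<^sub>R z) = s powr (p - 1) *\<^sub>R pflux2 p z"
proof -
  have "(s powr (p - 2) * s) = s powr (p - 1)" using assms powr_add[of s "p - 2" 1] by simp
  then show ?thesis using assms
    by (simp add: pflux2_def pflux_def powr_mult abs_mult mult.commute mult.left_commute)
qed

lemma continuous_pflux: 
  fixes z :: "'b::euclidean_space"
  assumes p: "p > 1" shows "isCont (pflux p) z"
proof (cases "z = 0")
  case False
  then show ?thesis unfolding pflux_def by (intro continuous_intros) auto
next
  case True
  have "((\<lambda>w. norm (w::'b) powr (p - 1)) \<longlongrightarrow> 0 powr (p - 1)) (at 0)"
    using p by (intro tendsto_powr2 tendsto_norm_zero tendsto_ident_at) auto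
  then have "((\<lambda>w. norm (pflux p (w::'b))) \<longlongrightarrow> 0) (at 0)" using p by (simp add: norm_pflux)
  then have "(pflux p \<longlongrightarrow> (0::'b)) (at 0)" using tendsto_norm_zero_iff by blast
  then show ?thesis using True by (simp add: isCont_def pflux_def)
qed

lemma continuous_on_pflux2: 
  assumes p: "p > 1" shows "continuous_on UNIV (pflux2 p :: real \<times> 'b::euclidean_space \<Rightarrow> _)"
proof -
  have c: "continuous_on UNIV (pflux p :: 'c::euclidean_space \<Rightarrow> 'c)"
    using continuous_pflux[OF p] continuous_at_imp_continuous_on by blast
  show ?thesis unfolding pflux2_def
    by (intro continuous_intros continuous_on_compose2[OF c]) auto
qed

lemma continuous_on_penergy: 
  assumes p: "p > 1" shows "continuous_on S (penergy p :: real \<times> 'b::euclidean_space \<Rightarrow> _)"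
  unfolding penergy_def using p by (intro continuous_intros continuous_on_powr') auto

text \<open>A uniform convexity estimate for all \<open>p > 1\<close> at once, by compactness of the unit sphere
  and homogeneity.\<close>

lemma penergy_uniformly_convex:
  assumes p: "p > 1" and e: "\<epsilon> > 0"
  obtains C where "C \<ge> 0" "\<And>z w :: real \<times> 'b::euclidean_space. norm (z - w) powr p \<le>
     \<epsilon> * (penergy p z + penergy p w) + C * ((penergy p z + penergy p w) / 2 - penergy p ((1/2) *\<^sub>R (z + w)))"
proof -
  define D where "D = (\<lambda>q :: (real \<times> 'b) \<times> (real \<times> 'b).
     (penergy p (fst q) + penergy p (snd q)) / 2 - penergy p ((1/2) *\<^sub>R (fst q + snd q)))"
  \<comment> \<open>Pairs normalised to total energy 1 and separated by at least
    \<open>\<epsilon>\<close>. This set is compact and contains no diagonal point, so the convexity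
    defect \<open>D\<close> has a positive minimum on it.\<close>
  define S where "S = {q :: (real \<times> 'b) \<times> (real \<times> 'b). penergy p (fst q) + penergy p (snd q) = 1
     \<and> \<epsilon> \<le> norm (fst q - snd q) powr p}"
  have pc: "continuous_on UNIV (\<lambda>q. penergy p (h q))" if "continuous_on UNIV h" for h :: "(real \<times> 'b) \<times> (real \<times> 'b) \<Rightarrow> real \<times> 'b"
    using continuous_on_compose2[OF continuous_on_penergy[OF p, of UNIV] that] by auto
  have cont: "continuous_on UNIV D" unfolding D_def
    by (intro continuous_intros pc) simp
  have mid: "D (z, w) \<ge> 0 \<and> (z \<noteq> w \<longrightarrow> D (z, w) > 0)" for z w
  proof (cases "z = w")
    case True
    have "(1/2) *\<^sub>R (w + w) = w" by (simp flip: scaleR_2)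
    then show ?thesis using True by (simp add: D_def)
  next
    case False
    define m where "m = (1/2) *\<^sub>R (z + w)"
    have zm: "z - m = (1/2) *\<^sub>R (z - w)" and wm: "w - m = - ((1/2) *\<^sub>R (z - w))"
      unfolding m_def by (auto simp: algebra_simps prod_eq_iff simp flip: scaleR_left_distrib)
    have "m \<noteq> z" using zm False by auto
    then show ?thesis
      using penergy_gradient_strict[OF p, of m z] penergy_gradient[OF p, of m w]
      unfolding D_def zm wm by (simp add: m_def)
  qed
  have cS: "closed S"
  proof -
    have 1: "closed {q :: (real \<times> 'b) \<times> (real \<times> 'b). penergy p (fst q) + penergy p (snd q) = 1}"
      by (rule closed_Collect_eq) (intro continuous_intros pc)+
    have 2: "closed {q :: (real \<times> 'b) \<times> (real \<times> 'b). \<epsilon> \<le> norm (fst q - snd q) powr p}"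
      by (rule closed_Collect_le) (rule continuous_on_const, rule continuous_on_powr', intro continuous_intros,
          rule continuous_on_const, use p in simp)
    have "S = {q. penergy p (fst q) + penergy p (snd q) = 1} \<inter> {q. \<epsilon> \<le> norm (fst q - snd q) powr p}"
      by (auto simp: S_def)
    then show ?thesis using 1 2 by (simp add: closed_Int)
  qed
  have bS: "bounded S"
  proof -
    have "norm q \<le> 4" if "q \<in> S" for q
    proof -
      have "norm z \<le> 2" if "penergy p z \<le> 1" for z :: "real \<times> 'b"
      proof (rule ccontr)
        assume "\<not> norm z \<le> 2"
        then have "2 powr p < norm z powr p" using p by (intro powr_less_mono2) auto
        also have "\<dots> \<le> 2 powr p * penergy p z" by (rule norm_powr_le_penergy) (use p in simp)
        also have "\<dots> \<le> 2 powr p * 1" using that by (intro mult_left_mono) auto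
        finally show False by simp
      qed
      moreover have "penergy p (fst q) \<le> 1" "penergy p (snd q) \<le> 1"
        using that penergy_nonneg[of p "fst q"] penergy_nonneg[of p "snd q"] unfolding S_def by (simp_all, linarith+)
      ultimately have "norm (fst q) \<le> 2" "norm (snd q) \<le> 2" by auto
      then show ?thesis using norm_Pair_le[of "fst q" "snd q"] by simp
    qed
    then show ?thesis using bounded_iff by blast
  qed
  obtain m where m: "m > 0" "\<And>q. q \<in> S \<Longrightarrow> m \<le> D q"
  proof (cases "S = {}")
    case True then show ?thesis using that[of 1] by simp
  next
    case False
    have "compact S" using cS bS by (simp add: compact_eq_bounded_closed)
    then obtain q where q: "q \<in> S" "\<And>q'. q' \<in> S \<Longrightarrow> D q \<le> D q'"
      using continuous_attains_inf[OF _ False] cont continuous_on_subset by (metis top_greatest)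
    have "fst q \<noteq> snd q" using q(1) e p by (auto simp: S_def)
    then have "D q > 0" using mid[of "fst q" "snd q"] by simp
    then show ?thesis using that q by blast
  qed
  \<comment> \<open>The numerator bounds \<open>norm (z - w) powr p\<close> relative to the total
    energy, and \<open>m\<close> is the least defect on \<open>S\<close>; hence \<open>C\<close>
    times the defect absorbs the whole left-hand side for every pair that rescales into
    \<open>S\<close>.\<close>
  define C where "C = 2 powr p * 2 powr p / m"
  show ?thesis
  proof
    show "C \<ge> 0" using m by (simp add: C_def)
    fix z w :: "real \<times> 'b"
    define \<Lambda> where "\<Lambda> = penergy p z + penergy p w"
    have L0: "\<Lambda> \<ge> 0" by (simp add: \<Lambda>_def)
    have Dd: "(penergy p z + penergy p w) / 2 - penergy p ((1/2) *\<^sub>R (z + w)) = D (z, w)" by (simp add: D_def)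
    have bound: "norm (z - w) powr p \<le> 2 powr p * 2 powr p * \<Lambda>"
    proof -
      have "norm (z - w) powr p \<le> 2 powr p * (norm z powr p + norm w powr p)"
        using norm_add_powr_le[of p z "- w"] p by simp
      also have "norm z powr p + norm w powr p \<le> 2 powr p * \<Lambda>"
        using norm_powr_le_penergy[of p z] norm_powr_le_penergy[of p w] p by (simp add: \<Lambda>_def algebra_simps)
      finally show ?thesis by (simp add: mult.assoc)
    qed
    show "norm (z - w) powr p \<le> \<epsilon> * (penergy p z + penergy p w)
        + C * ((penergy p z + penergy p w) / 2 - penergy p ((1/2) *\<^sub>R (z + w)))"
    proof (cases "\<Lambda> = 0 \<or> norm (z - w) powr p \<le> \<epsilon> * \<Lambda>")
      case True
      have "norm (z - w) powr p \<le> \<epsilon> * \<Lambda>" using True bound by auto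
      then show ?thesis unfolding Dd unfolding \<Lambda>_def[symmetric] using \<open>C \<ge> 0\<close> mid[of z w]
        by (simp add: add_increasing2)
    next
      case False
      then have L: "\<Lambda> > 0" using L0 by auto
      \<comment> \<open>By homogeneity of degree \<open>p\<close>, scaling with \<open>s\<close>
        brings the total energy \<open>\<Lambda>\<close> to 1.\<close>
      define s where "s = \<Lambda> powr (- 1 / p)"
      have s: "s > 0" "s powr p = 1 / \<Lambda>"
      proof -
        show "s > 0" using L by (simp add: s_def)
        have "s powr p = \<Lambda> powr (- 1 / p * p)" by (simp only: s_def powr_powr)
        also have "- 1 / p * p = - 1" using p by simp
        finally show "s powr p = 1 / \<Lambda>" using L by (simp add: powr_minus divide_simps)
      qed
      have "(s *\<^sub>R z, s *\<^sub>R w) \<in> S"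
      proof -
        have "penergy p (s *\<^sub>R z) + penergy p (s *\<^sub>R w) = s powr p * \<Lambda>"
          using s(1) by (simp add: penergy_scaleR \<Lambda>_def distrib_left)
        moreover have "norm (s *\<^sub>R z - s *\<^sub>R w) powr p = s powr p * norm (z - w) powr p"
          using s by (simp add: powr_mult flip: scaleR_diff_right)
        moreover have "\<epsilon> \<le> norm (z - w) powr p / \<Lambda>" using False L by (simp add: pos_le_divide_eq)
        ultimately show ?thesis using s L by (simp add: S_def)
      qed
      then have "m \<le> D (s *\<^sub>R z, s *\<^sub>R w)" by (rule m)
      also have "\<dots> = s powr p * D (z, w)"
      proof -
        have h: "(1/2) *\<^sub>R (s *\<^sub>R z + s *\<^sub>R w) = s *\<^sub>R ((1/2) *\<^sub>R (z + w))" by (simp add: algebra_simps)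
        have "D (s *\<^sub>R z, s *\<^sub>R w) = (s powr p * penergy p z + s powr p * penergy p w) / 2
            - s powr p * penergy p ((1/2) *\<^sub>R (z + w))"
          unfolding D_def fst_conv snd_conv h using s(1) by (simp only: penergy_scaleR less_imp_le)
        also have "\<dots> = s powr p * D (z, w)"
          by (simp only: D_def fst_conv snd_conv right_diff_distrib distrib_left add_divide_distrib times_divide_eq_right)
        finally show ?thesis .
      qed
      finally have "m * \<Lambda> \<le> D (z, w)" using s L by (simp add: field_simps)
      then have "C * (m * \<Lambda>) \<le> C * D (z, w)" using \<open>C \<ge> 0\<close> by (intro mult_left_mono)
      then have "2 powr p * 2 powr p * \<Lambda> \<le> C * D (z, w)" using m by (simp add: C_def)
      then show ?thesis unfolding Dd unfolding \<Lambda>_def[symmetric] using bound e L0 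
        by (smt (verit) mult_nonneg_nonneg)
    qed
  qed
qed

lemma squeeze_0:
  fixes a b :: "nat \<Rightarrow> real"
  assumes "\<And>n. 0 \<le> a n" "\<And>n. a n \<le> b n" "b \<longlonglongrightarrow> 0"
  shows "a \<longlonglongrightarrow> 0"
  by (rule real_tendsto_sandwich[OF _ _ tendsto_const assms(3)]) (use assms in auto)

subsection \<open>Test functions\<close>

lemma has_derivative_classical_grad:
  fixes f :: "'a::euclidean_space \<Rightarrow> real"
  assumes "f differentiable (at x)"
  shows "(f has_derivative (\<lambda>h. classical_grad f x \<bullet> h)) (at x)"
proof -
  let ?D = "frechet_derivative f (at x)"
  have d: "(f has_derivative ?D) (at x)" using assms frechet_derivative_works by blast
  have l: "linear ?D" using assms linear_frechet_derivative by blast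
  have "?D h = classical_grad f x \<bullet> h" for h
  proof -
    have "?D h = (\<Sum>b\<in>Basis. (h \<bullet> b) * ?D b)"
      by (subst (1) euclidean_representation[of h, symmetric]) (simp add: linear_sum[OF l] linear_scale[OF l])
    also have "\<dots> = classical_grad f x \<bullet> h"
      by (simp add: classical_grad_def inner_sum_right mult.commute inner_commute[of _ h])
    finally show ?thesis .
  qed
  then have "?D = (\<lambda>h. classical_grad f x \<bullet> h)" by blast
  then show ?thesis using d by simp
qed

lemma classical_grad_eqI:
  fixes f :: "'a::euclidean_space \<Rightarrow> real"
  assumes "(f has_derivative (\<lambda>h. g \<bullet> h)) (at x)" shows "classical_grad f x = g"
proof -
  have "frechet_derivative f (at x) = (\<lambda>h. g \<bullet> h)" using assms frechet_derivative_eqI by blast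
  then show ?thesis by (simp add: classical_grad_def euclidean_representation)
qed

lemma smooth_grad: "smooth_fun f \<Longrightarrow> (f has_derivative (\<lambda>h. classical_grad f x \<bullet> h)) (at x)"
  by (rule has_derivative_classical_grad) (use smooth_fun_has_derivative differentiable_def in blast)

lemma smooth_continuous_grad: "smooth_fun f \<Longrightarrow> continuous_on UNIV (classical_grad f)"
proof -
  assume "smooth_fun f"
  then have "continuous_on UNIV (\<lambda>x. \<Sum>b\<in>Basis. frechet_derivative f (at x) b *\<^sub>R b)"
    by (intro continuous_on_sum continuous_on_scaleR continuous_on_const smooth_fun_continuous smooth_fun_deriv)
  then show ?thesis by (simp add: classical_grad_def[abs_def])
qed

lemma smooth_real_deriv:
  fixes S :: "real \<Rightarrow> real" assumes "smooth_fun S"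
  shows "(S has_real_derivative deriv S t) (at t)" "smooth_fun (deriv S)" "continuous_on UNIV (deriv S)"
proof -
  have d: "(S has_derivative frechet_derivative S (at t)) (at t)" for t
    using smooth_fun_has_derivative[OF assms] .
  have e: "(S has_real_derivative frechet_derivative S (at t) 1) (at t)" for t
  proof -
    have "frechet_derivative S (at t) h = frechet_derivative S (at t) 1 * h" for h
      using linear_scale[OF has_derivative_linear[OF d[of t]], of h 1] by (simp add: mult.commute[of h])
    then have "frechet_derivative S (at t) = (*) (frechet_derivative S (at t) 1)" by blast
    then show ?thesis using d[of t] unfolding has_field_derivative_def by metis
  qed
  then have eq: "deriv S = (\<lambda>t. frechet_derivative S (at t) 1)" using DERIV_imp_deriv by blast
  show "(S has_real_derivative deriv S t) (at t)" using e eq by simp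
  show "smooth_fun (deriv S)" unfolding eq by (rule smooth_fun_deriv[OF assms]) simp
  then show "continuous_on UNIV (deriv S)" by (rule smooth_fun_continuous)
qed

lemma grad_compose_real:
  fixes S :: "real \<Rightarrow> real" assumes "smooth_fun S" "smooth_fun f"
  shows "classical_grad (\<lambda>x. S (f x)) x = deriv S (f x) *\<^sub>R classical_grad f x"
proof (rule classical_grad_eqI)
  have "(S has_derivative (\<lambda>h. deriv S (f x) * h)) (at (f x))"
    using smooth_real_deriv(1)[OF assms(1), of "f x"] by (simp add: has_field_derivative_def)
  from has_derivative_compose[OF smooth_grad[OF assms(2)] this]
  show "((\<lambda>x. S (f x)) has_derivative (\<lambda>h. (deriv S (f x) *\<^sub>R classical_grad f x) \<bullet> h)) (at x)"
    unfolding inner_scaleR_left .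
qed

lemma grad_mult:
  assumes "smooth_fun f" "smooth_fun g"
  shows "classical_grad (\<lambda>x. f x * g x) x = f x *\<^sub>R classical_grad g x + g x *\<^sub>R classical_grad f x"
  by (rule classical_grad_eqI)
     (use has_derivative_mult[OF smooth_grad[OF assms(1), of x] smooth_grad[OF assms(2), of x]]
       in \<open>simp add: inner_add_left mult.commute\<close>)

lemma grad_add:
  assumes "smooth_fun f" "smooth_fun g"
  shows "classical_grad (\<lambda>x. f x + g x) x = classical_grad f x + classical_grad g x"
  by (rule classical_grad_eqI)
     (use has_derivative_add[OF smooth_grad[OF assms(1), of x] smooth_grad[OF assms(2), of x]]
       in \<open>simp add: inner_add_left\<close>)

lemma grad_cmult:
  assumes "smooth_fun f"
  shows "classical_grad (\<lambda>x. c * f x) x = c *\<^sub>R classical_grad f x"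
  by (rule classical_grad_eqI)
     (use has_derivative_mult_right[OF smooth_grad[OF assms(1), of x], of c] in simp)

lemma test_smooth: "\<phi> \<in> test_functions \<Omega> \<Longrightarrow> smooth_fun \<phi>"
  by (simp add: test_functions_def)

lemma test_zero: "\<phi> \<in> test_functions \<Omega> \<Longrightarrow> x \<notin> closure {x. \<phi> x \<noteq> 0} \<Longrightarrow> \<phi> x = 0"
  using subsetD[OF closure_subset[of "{x. \<phi> x \<noteq> 0}"], of x] by auto

lemma test_grad_zero:
  assumes "\<phi> \<in> test_functions \<Omega>" "x \<notin> closure {x. \<phi> x \<noteq> 0}"
  shows "classical_grad \<phi> x = 0"
proof (rule classical_grad_eqI)
  have "(\<bullet>) (0::'a) = (\<lambda>h. 0)" by auto
  then have "((\<lambda>x. 0) has_derivative (\<bullet>) 0) (at x)" by simp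
  then show "(\<phi> has_derivative (\<bullet>) 0) (at x)"
  proof (rule has_derivative_transform_within_open)
    show "open (- closure {x. \<phi> x \<noteq> 0})" by (rule open_Compl[OF closed_closure])
    show "x \<in> - closure {x. \<phi> x \<noteq> 0}" using assms(2) unfolding Compl_iff .
    show "0 = \<phi> y" if "y \<in> - closure {x. \<phi> x \<noteq> 0}" for y
      by (rule test_zero[OF assms(1) that[unfolded Compl_iff], symmetric])
  qed
qed

lemma test_vanish: 
  assumes "\<phi> \<in> test_functions \<Omega>" "x \<notin> \<Omega>" shows "\<phi> x = 0" "classical_grad \<phi> x = 0"
proof -
  have "x \<notin> closure {x. \<phi> x \<noteq> 0}" using assms unfolding test_functions_def by blast
  then show "\<phi> x = 0" "classical_grad \<phi> x = 0"
    by (rule test_zero[OF assms(1)], rule test_grad_zero[OF assms(1)])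
qed

lemma test_functionsI:
  assumes "smooth_fun f" "compact K" "K \<subseteq> \<Omega>" "\<And>x. x \<notin> K \<Longrightarrow> f x = 0"
  shows "f \<in> test_functions \<Omega>"
proof -
  have "closure {x. f x \<noteq> 0} \<subseteq> K" using assms compact_imp_closed by (intro closure_minimal) auto
  moreover from this have "compact (closure {x. f x \<noteq> 0})"
    using bounded_subset[OF compact_imp_bounded[OF assms(2)]] by (simp add: compact_eq_bounded_closed)
  ultimately show ?thesis using assms by (auto simp: test_functions_def)
qed

lemma test_functions_op:
  assumes f: "\<phi> \<in> test_functions \<Omega>" and g: "smooth_fun g" and z: "\<And>x. \<phi> x = 0 \<Longrightarrow> g x = 0"
  shows "g \<in> test_functions \<Omega>"
proof (rule test_functionsI[OF g])
  show "compact (closure {x. \<phi> x \<noteq> 0})" "closure {x. \<phi> x \<noteq> 0} \<subseteq> \<Omega>"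
    using f by (simp_all add: test_functions_def)
  show "g x = 0" if "x \<notin> closure {x. \<phi> x \<noteq> 0}" for x by (rule z, rule test_zero[OF f that])
qed

lemma test_add:
  assumes "\<phi> \<in> test_functions \<Omega>" "\<psi> \<in> test_functions \<Omega>"
  shows "(\<lambda>x. \<phi> x + \<psi> x) \<in> test_functions \<Omega>"
proof (rule test_functionsI)
  show "smooth_fun (\<lambda>x. \<phi> x + \<psi> x)" using assms test_smooth smooth_fun_add by blast
  show "compact (closure {x. \<phi> x \<noteq> 0} \<union> closure {x. \<psi> x \<noteq> 0})"
    "closure {x. \<phi> x \<noteq> 0} \<union> closure {x. \<psi> x \<noteq> 0} \<subseteq> \<Omega>"
    using assms by (simp_all add: test_functions_def compact_Un)
  show "\<phi> x + \<psi> x = 0" if "x \<notin> closure {x. \<phi> x \<noteq> 0} \<union> closure {x. \<psi> x \<noteq> 0}" for x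
    using test_zero[OF assms(1), of x] test_zero[OF assms(2), of x] that by simp
qed

lemma test_cmult: "\<phi> \<in> test_functions \<Omega> \<Longrightarrow> (\<lambda>x. c * \<phi> x) \<in> test_functions \<Omega>"
  by (rule test_functions_op) (auto intro: smooth_fun_mult test_smooth)

definition jet :: "('a::euclidean_space \<Rightarrow> real) \<Rightarrow> 'a \<Rightarrow> real \<times> 'a" where
  "jet \<phi> x = (\<phi> x, classical_grad \<phi> x)"

lemma continuous_jet: "smooth_fun \<phi> \<Longrightarrow> continuous_on UNIV (jet \<phi>)"
  unfolding jet_def[abs_def] by (intro continuous_on_Pair smooth_fun_continuous smooth_continuous_grad)

lemma test_jet_bounded:
  assumes "\<phi> \<in> test_functions \<Omega>"
  obtains B where "B \<ge> 0" "\<And>x. norm (jet \<phi> x) \<le> B"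
proof -
  let ?K = "closure {x. \<phi> x \<noteq> 0}"
  have "compact (jet \<phi> ` ?K)"
  proof (rule compact_continuous_image)
    show "continuous_on ?K (jet \<phi>)"
      using continuous_on_subset[OF continuous_jet[OF test_smooth[OF assms]]] by blast
    show "compact ?K" using assms unfolding test_functions_def by blast
  qed
  then obtain B where B: "\<And>y. y \<in> jet \<phi> ` ?K \<Longrightarrow> norm y \<le> B"
    using compact_imp_bounded bounded_iff by metis
  have "norm (jet \<phi> x) \<le> max B 0" for x
  proof (cases "x \<in> ?K")
    case True
    then show ?thesis using B[of "jet \<phi> x"] by auto
  next
    case False
    have "jet \<phi> x = 0" unfolding jet_def using test_zero[OF assms False] test_grad_zero[OF assms False] by (simp add: zero_prod_def)
    then show ?thesis by simp
  qed
  then show ?thesis using that[of "max B 0"] by auto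
qed

lemma jet_add: "smooth_fun f \<Longrightarrow> smooth_fun g \<Longrightarrow> jet (\<lambda>x. f x + g x) x = jet f x + jet g x"
  and jet_cmult: "smooth_fun f \<Longrightarrow> jet (\<lambda>x. c * f x) x = c *\<^sub>R jet f x"
  by (simp_all add: jet_def grad_add grad_cmult)

subsection \<open>The space \<open>W\<^sub>0\<^sup>1\<^sup>,\<^sup>p\<close> as a closed space of jets\<close>

locale sobolev =
  fixes \<Omega> :: "'a::euclidean_space set" and p :: real
  assumes open_\<Omega>: "open \<Omega>" and bounded_\<Omega>: "bounded \<Omega>" and p: "p > 1"
begin

abbreviation "M \<equiv> lebesgue_on \<Omega>"

lemma \<Omega>_sets [measurable]: "\<Omega> \<in> sets lebesgue" using open_\<Omega> by (simp add: borel_open)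

lemma lmeasurable_\<Omega>: "\<Omega> \<in> lmeasurable"
  using bounded_set_imp_lmeasurable bounded_\<Omega> \<Omega>_sets by blast

sublocale fin: finite_measure M
  using finite_measure_lebesgue_on lmeasurable_\<Omega> by blast

lemma cont_measurable: "continuous_on UNIV f \<Longrightarrow> f \<in> borel_measurable M"
  using continuous_imp_measurable_on_sets_lebesgue[OF continuous_on_subset \<Omega>_sets] by blast

lemma Lp_bounded:
  assumes "g \<in> borel_measurable M" "AE x in M. norm (g x) \<le> B"
  shows "g \<in> Lp_space M p"
proof (rule Lp_bound[OF assms(1), where h="\<lambda>x. B powr p"])
  show "AE x in M. norm (g x) powr p \<le> B powr p"
    using assms(2) by eventually_elim (use p in \<open>auto intro: powr_mono2\<close>)
qed simp

lemma Lp_integrable_norm: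
  assumes "g \<in> Lp_space M p" shows "integrable M g"
proof (rule Bochner_Integration.integrable_bound[where f="\<lambda>x. 1 + norm (g x) powr p"])
  show "integrable M (\<lambda>x. 1 + norm (g x) powr p)" using Lp_integrable[OF assms] by simp
  have "norm (g x) \<le> 1 + norm (g x) powr p" for x
    using young_eps[of 1 "norm (g x)" p 1] p by simp
  then show "AE x in M. norm (g x) \<le> norm (1 + norm (g x) powr p)" by simp
qed (use assms Lp_measurable in blast)

text \<open>A Sobolev function is carried along with its gradient as the pair \<open>(u, \<nabla>u)\<close>, so that lattice
  operations and limits never refer to weak derivatives.\<close>

definition W0 :: "('a \<Rightarrow> real \<times> 'a) set" where
  "W0 = {U. U \<in> Lp_space M p \<and> (\<forall>\<epsilon>>0. \<exists>\<phi>\<in>test_functions \<Omega>. Lp_dist M p (jet \<phi>) U < \<epsilon>)}"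

lemma W0_Lp: "U \<in> W0 \<Longrightarrow> U \<in> Lp_space M p" by (simp add: W0_def)

lemma W0_measurable [measurable_dest]: "U \<in> W0 \<Longrightarrow> U \<in> borel_measurable M"
  using W0_Lp Lp_measurable by blast

lemma jet_Lp: "\<phi> \<in> test_functions \<Omega> \<Longrightarrow> jet \<phi> \<in> Lp_space M p"
  by (metis (mono_tags, lifting) AE_I2 Lp_bounded cont_measurable continuous_jet test_jet_bounded test_smooth)

lemma jet_W0: "\<phi> \<in> test_functions \<Omega> \<Longrightarrow> jet \<phi> \<in> W0"
  unfolding W0_def using jet_Lp by (auto simp: Lp_dist_def intro!: bexI[of _ \<phi>])

text \<open>Passing to a subsequence adds convergence almost everywhere to convergence in
  \<open>L^p\<close>; nonlinear expressions in \<open>U\<close> need the former, integrals the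
  latter.\<close>

lemma W0_seq:
  assumes "U \<in> W0"
  obtains \<phi> where "\<And>n::nat. \<phi> n \<in> test_functions \<Omega>" "(\<lambda>n. Lp_dist M p (jet (\<phi> n)) U) \<longlonglongrightarrow> 0"
    "AE x in M. (\<lambda>n. jet (\<phi> n) x) \<longlonglongrightarrow> U x"
proof -
  have "\<forall>n. \<exists>\<phi>\<in>test_functions \<Omega>. Lp_dist M p (jet \<phi>) U < inverse (real (Suc n))"
    using assms by (auto simp: W0_def)
  then obtain \<phi> where \<phi>: "\<And>n. \<phi> n \<in> test_functions \<Omega>" "\<And>n. Lp_dist M p (jet (\<phi> n)) U < inverse (real (Suc n))"
    by metis
  have lim: "(\<lambda>n. Lp_dist M p (jet (\<phi> n)) U) \<longlonglongrightarrow> 0"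
    by (rule real_tendsto_sandwich[OF _ _ tendsto_const LIMSEQ_inverse_real_of_nat])
       (use \<phi>(2) in \<open>auto simp: Lp_dist_nonneg less_imp_le simp del: of_nat_Suc intro!: always_eventually\<close>)
  have p0: "0 < p" using p by simp
  obtain r :: "nat \<Rightarrow> nat" where r: "strict_mono r" "AE x in M. (\<lambda>n. jet (\<phi> (r n)) x) \<longlonglongrightarrow> U x"
    using Lp_subseq_AE[OF p0 jet_Lp[OF \<phi>(1)] W0_Lp[OF assms] lim] by blast
  show ?thesis
    by (rule that[of "\<lambda>n. \<phi> (r n)"])
       (use \<phi> r LIMSEQ_subseq_LIMSEQ[OF lim r(1)] in \<open>auto simp: comp_def\<close>)
qed

lemma W0_limI:
  assumes U: "U \<in> Lp_space M p" and V: "\<And>n::nat. V n \<in> W0" and lim: "(\<lambda>n. Lp_dist M p (V n) U) \<longlonglongrightarrow> 0"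
  shows "U \<in> W0"
proof -
  have "\<exists>\<phi>\<in>test_functions \<Omega>. Lp_dist M p (jet \<phi>) U < \<epsilon>" if e: "\<epsilon> > 0" for \<epsilon>
  proof -
    define d where "d = \<epsilon> / (2 powr p * 2)"
    have d: "d > 0" using e by (simp add: d_def)
    obtain n where n: "Lp_dist M p (V n) U < d"
      using order_tendstoD(2)[OF lim d] eventually_sequentially by auto
    obtain \<phi> where \<phi>: "\<phi> \<in> test_functions \<Omega>" "Lp_dist M p (jet \<phi>) (V n) < d"
      using V[of n] d by (auto simp: W0_def)
    have "Lp_dist M p (jet \<phi>) U \<le> 2 powr p * (Lp_dist M p (jet \<phi>) (V n) + Lp_dist M p (V n) U)"
      by (rule Lp_dist_le) (use p jet_Lp \<phi> V W0_Lp U in auto)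
    also have "\<dots> < 2 powr p * (d + d)" using n \<phi> by (intro mult_strict_left_mono add_strict_mono) auto
    also have "\<dots> = \<epsilon>" by (simp add: d_def)
    finally show ?thesis using \<phi> by blast
  qed
  then show ?thesis using U by (simp add: W0_def)
qed

text \<open>Dominated convergence turns pointwise limits into \<open>L^p\<close> limits. Operations
  that are not smooth, such as the positive part, enter \<open>W0\<close> by this route.\<close>

lemma W0_dominated:
  assumes V: "\<And>n::nat. V n \<in> W0" and g: "g \<in> Lp_space M p" and le: "\<And>n. AE x in M. norm (V n x) \<le> g x"
    and U: "U \<in> borel_measurable M" and lim: "AE x in M. (\<lambda>n. V n x) \<longlonglongrightarrow> U x"
  shows "U \<in> W0"
proof -
  have p0: "0 < p" using p by simp
  show ?thesis
    by (rule W0_limI[where V=V, OF _ V]) (rule Lp_dominated(2,3)[OF p0 W0_measurable[OF V] U g le lim])+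
qed

lemma W0_add:
  assumes "U \<in> W0" "V \<in> W0" shows "(\<lambda>x. U x + V x) \<in> W0"
proof -
  obtain \<phi> where \<phi>: "\<And>n::nat. \<phi> n \<in> test_functions \<Omega>" "(\<lambda>n. Lp_dist M p (jet (\<phi> n)) U) \<longlonglongrightarrow> 0"
    using W0_seq[OF assms(1)] by blast
  obtain \<psi> where \<psi>: "\<And>n::nat. \<psi> n \<in> test_functions \<Omega>" "(\<lambda>n. Lp_dist M p (jet (\<psi> n)) V) \<longlonglongrightarrow> 0"
    using W0_seq[OF assms(2)] by blast
  have p0: "0 \<le> p" using p by simp
  have S: "(\<lambda>x. U x + V x) \<in> Lp_space M p" using Lp_add W0_Lp assms p0 by blast
  show ?thesis
  proof (rule W0_limI[where V="\<lambda>n. jet (\<lambda>x. \<phi> n x + \<psi> n x)"])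
    show "(\<lambda>x. U x + V x) \<in> Lp_space M p" by (rule S)
    show "jet (\<lambda>x. \<phi> n x + \<psi> n x) \<in> W0" for n by (rule jet_W0[OF test_add[OF \<phi>(1) \<psi>(1)]])
    let ?a = "\<lambda>n. Lp_dist M p (jet (\<lambda>x. \<phi> n x + \<psi> n x)) (\<lambda>x. U x + V x)"
    have le: "?a n \<le> 2 powr p * (Lp_dist M p (jet (\<phi> n)) U + Lp_dist M p (jet (\<psi> n)) V)" for n
    proof -
      have i: "integrable M (\<lambda>x. norm (jet (\<phi> n) x - U x) powr p)" "integrable M (\<lambda>x. norm (jet (\<psi> n) x - V x) powr p)"
        "integrable M (\<lambda>x. norm (jet (\<lambda>x. \<phi> n x + \<psi> n x) x - (U x + V x)) powr p)"
        by (rule Lp_integrable[OF Lp_diff[OF jet_Lp[OF \<phi>(1)] W0_Lp[OF assms(1)] p0]],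
            rule Lp_integrable[OF Lp_diff[OF jet_Lp[OF \<psi>(1)] W0_Lp[OF assms(2)] p0]],
            rule Lp_integrable[OF Lp_diff[OF jet_Lp[OF test_add[OF \<phi>(1) \<psi>(1)]] S p0]])
      have "?a n \<le> (LINT x|M. 2 powr p * (norm (jet (\<phi> n) x - U x) powr p + norm (jet (\<psi> n) x - V x) powr p))"
        unfolding Lp_dist_def
      proof (rule integral_mono)
        fix x
        have "jet (\<lambda>x. \<phi> n x + \<psi> n x) x - (U x + V x) = (jet (\<phi> n) x - U x) + (jet (\<psi> n) x - V x)"
          using jet_add[OF test_smooth[OF \<phi>(1)] test_smooth[OF \<psi>(1)]] by simp
        then show "norm (jet (\<lambda>x. \<phi> n x + \<psi> n x) x - (U x + V x)) powr p
          \<le> 2 powr p * (norm (jet (\<phi> n) x - U x) powr p + norm (jet (\<psi> n) x - V x) powr p)"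
          using norm_add_powr_le[OF p0] by metis
      qed (use i in auto)
      then show ?thesis using i by (simp add: Lp_dist_def)
    qed
    have "(\<lambda>n. 2 powr p * (Lp_dist M p (jet (\<phi> n)) U + Lp_dist M p (jet (\<psi> n)) V)) \<longlonglongrightarrow> 2 powr p * (0 + 0)"
      by (intro tendsto_intros \<phi> \<psi>)
    then have "(\<lambda>n. 2 powr p * (Lp_dist M p (jet (\<phi> n)) U + Lp_dist M p (jet (\<psi> n)) V)) \<longlonglongrightarrow> 0" by simp
    then show "?a \<longlonglongrightarrow> 0" by (rule squeeze_0[OF Lp_dist_nonneg le])
  qed
qed

lemma W0_scaleR:
  assumes "U \<in> W0" shows "(\<lambda>x. c *\<^sub>R U x) \<in> W0"
proof -
  obtain \<phi> where \<phi>: "\<And>n::nat. \<phi> n \<in> test_functions \<Omega>" "(\<lambda>n. Lp_dist M p (jet (\<phi> n)) U) \<longlonglongrightarrow> 0"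
    using W0_seq[OF assms(1)] by blast
  show ?thesis
  proof (rule W0_limI[where V="\<lambda>n. jet (\<lambda>x. c * \<phi> n x)"])
    show "(\<lambda>x. c *\<^sub>R U x) \<in> Lp_space M p" by (rule Lp_scaleR[OF W0_Lp[OF assms]])
    show "jet (\<lambda>x. c * \<phi> n x) \<in> W0" for n by (rule jet_W0[OF test_cmult[OF \<phi>(1)]])
    have "Lp_dist M p (jet (\<lambda>x. c * \<phi> n x)) (\<lambda>x. c *\<^sub>R U x) = \<bar>c\<bar> powr p * Lp_dist M p (jet (\<phi> n)) U" for n
      unfolding Lp_dist_def jet_cmult[OF test_smooth[OF \<phi>(1)]] scaleR_diff_right[symmetric]
      by (simp add: powr_mult)
    moreover have "(\<lambda>n. \<bar>c\<bar> powr p * Lp_dist M p (jet (\<phi> n)) U) \<longlonglongrightarrow> \<bar>c\<bar> powr p * 0"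
      by (intro tendsto_intros \<phi>)
    ultimately show "(\<lambda>n. Lp_dist M p (jet (\<lambda>x. c * \<phi> n x)) (\<lambda>x. c *\<^sub>R U x)) \<longlonglongrightarrow> 0" by simp
  qed
qed

lemma W0_diff:
  assumes "U \<in> W0" "V \<in> W0" shows "(\<lambda>x. U x - V x) \<in> W0"
  using W0_add[OF assms(1) W0_scaleR[OF assms(2), of "-1"]] by simp

text \<open>A superposition \<open>x \<mapsto> Q (x, u x)\<close> with spatial derivative
  \<open>a\<close> and derivative \<open>b\<close> in the second slot acts on jets by the chain
  rule. Along approximating test functions the error is split at a mixed expression: coefficients at
  the approximant, but value and gradient of \<open>U\<close>. The Lipschitz bounds control the
  first part in \<open>L^p\<close>, dominated convergence the second. Composition and multiplication
  by a cut-off are both instances.\<close>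

lemma W0_op:
  fixes Q :: "'a \<times> real \<Rightarrow> real" and a :: "'a \<times> real \<Rightarrow> 'a" and b :: "'a \<times> real \<Rightarrow> real"
  assumes U: "U \<in> W0"
    and test: "\<And>\<phi>. \<phi> \<in> test_functions \<Omega> \<Longrightarrow> (\<lambda>x. Q (x, \<phi> x)) \<in> test_functions \<Omega>"
    and grad: "\<And>\<phi> x. \<phi> \<in> test_functions \<Omega> \<Longrightarrow>
        classical_grad (\<lambda>x. Q (x, \<phi> x)) x = a (x, \<phi> x) + b (x, \<phi> x) *\<^sub>R classical_grad \<phi> x"
    and cont: "continuous_on UNIV Q" "continuous_on UNIV a" "continuous_on UNIV b"
    and bds: "\<And>x t. \<bar>Q (x, t)\<bar> \<le> A + L * \<bar>t\<bar>" "\<And>x s t. \<bar>Q (x, t) - Q (x, s)\<bar> \<le> L * \<bar>t - s\<bar>" 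
       "\<And>z. norm (a z) \<le> A" "\<And>z. \<bar>b z\<bar> \<le> L"
    and AL: "0 \<le> A" "0 \<le> L"
  shows "(\<lambda>x. (Q (x, fst (U x)), a (x, fst (U x)) + b (x, fst (U x)) *\<^sub>R snd (U x))) \<in> W0"
proof -
  have p0: "0 < p" "0 \<le> p" using p by auto
  obtain \<phi> where \<phi>: "\<And>n::nat. \<phi> n \<in> test_functions \<Omega>" "(\<lambda>n. Lp_dist M p (jet (\<phi> n)) U) \<longlonglongrightarrow> 0"
    "AE x in M. (\<lambda>n. jet (\<phi> n) x) \<longlonglongrightarrow> U x"
    using W0_seq[OF U] by blast
  \<comment> \<open>\<open>V\<close> feeds the coefficients \<open>a\<close> and \<open>b\<close>,
    while \<open>W\<close> supplies the value and the gradient; keeping them apart is what allows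
    the two-stage estimate.\<close>
  define T where "T = (\<lambda>(V::'a \<Rightarrow> real) (W::'a \<Rightarrow> real \<times> 'a) x. (Q (x, fst (W x)), a (x, V x) + b (x, V x) *\<^sub>R snd (W x)))"
  have xm: "(\<lambda>x. x) \<in> borel_measurable M" by (rule cont_measurable) (rule continuous_on_id)
  have cm: "(\<lambda>x. h (x, f x)) \<in> borel_measurable M" if "continuous_on UNIV h" "f \<in> borel_measurable M"
    for h :: "'a \<times> real \<Rightarrow> 'c::euclidean_space" and f :: "'a \<Rightarrow> real"
    using measurable_compose[OF measurable_Pair[OF xm that(2)], of h borel]
      borel_measurable_continuous_onI[OF that(1)] by (simp add: borel_prod)
  have Tm: "T V W \<in> borel_measurable M" if V: "V \<in> borel_measurable M" and W: "W \<in> borel_measurable M" for V W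
  proof -
    have "(\<lambda>x. fst (W x)) \<in> borel_measurable M" "(\<lambda>x. snd (W x)) \<in> borel_measurable M"
      using W by (simp_all add: borel_measurable_continuous_on[OF continuous_on_fst[OF continuous_on_id]]
         borel_measurable_continuous_on[OF continuous_on_snd[OF continuous_on_id]])
    then show ?thesis unfolding T_def
      by (intro borel_measurable_Pair borel_measurable_add borel_measurable_scaleR cm cont V)
  qed
  have Um: "U \<in> borel_measurable M" "(\<lambda>x. fst (U x)) \<in> borel_measurable M" using W0_measurable[OF U]
    by (simp_all add: borel_measurable_continuous_on[OF continuous_on_fst[OF continuous_on_id]])
  have \<phi>m: "\<phi> n \<in> borel_measurable M" for n
    using cont_measurable[OF smooth_fun_continuous[OF test_smooth[OF \<phi>(1)]]] .
  define g where "g = (\<lambda>x. 2 * A + 2 * L * norm (U x))"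
  have gLp: "g \<in> Lp_space M p" unfolding g_def
  proof (rule Lp_add)
    show "(\<lambda>x. 2 * A) \<in> Lp_space M p" by (rule Lp_bounded) auto
    have "(\<lambda>x. (2 * L) *\<^sub>R norm (U x)) \<in> Lp_space M p"
      by (rule Lp_scaleR) (rule Lp_norm[OF W0_Lp[OF U]])
    then show "(\<lambda>x. 2 * L * norm (U x)) \<in> Lp_space M p" by simp
  qed (use p in auto)
  have Tg: "norm (T V U x) \<le> g x" for V x
  proof -
    have "norm (T V U x) \<le> \<bar>Q (x, fst (U x))\<bar> + norm (a (x, V x) + b (x, V x) *\<^sub>R snd (U x))"
      unfolding T_def using norm_Pair_le by (metis real_norm_def)
    also have "\<dots> \<le> (A + L * \<bar>fst (U x)\<bar>) + (A + L * norm (snd (U x)))"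
    proof (intro add_mono bds(1))
      have "norm (b (x, V x) *\<^sub>R snd (U x)) \<le> L * norm (snd (U x))" using bds(4) by (simp add: mult_right_mono)
      then show "norm (a (x, V x) + b (x, V x) *\<^sub>R snd (U x)) \<le> A + L * norm (snd (U x))"
        using norm_triangle_le[of "a (x, V x)"] bds(3)[of "(x, V x)"] by (meson add_mono order_trans norm_triangle_ineq)
    qed
    also have "\<dots> \<le> (A + L * norm (U x)) + (A + L * norm (U x))"
      using norm_fst_le[of "fst (U x)" "snd (U x)"] norm_snd_le[of "snd (U x)" "fst (U x)"] AL
      by (intro add_mono mult_left_mono) auto
    finally show ?thesis by (simp add: g_def)
  qed
  have TU: "T (\<lambda>x. fst (U x)) U \<in> Lp_space M p" and TnU: "T (\<phi> n) U \<in> Lp_space M p"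
    and lim2: "(\<lambda>n. Lp_dist M p (T (\<phi> n) U) (T (\<lambda>x. fst (U x)) U)) \<longlonglongrightarrow> 0" for n
  proof -
    have l: "AE x in M. (\<lambda>n. T (\<phi> n) U x) \<longlonglongrightarrow> T (\<lambda>x. fst (U x)) U x"
      using \<phi>(3)
    proof eventually_elim
      fix x assume "(\<lambda>n. jet (\<phi> n) x) \<longlonglongrightarrow> U x"
      then have "(\<lambda>n. fst (jet (\<phi> n) x)) \<longlonglongrightarrow> fst (U x)" by (rule tendsto_fst)
      then have "(\<lambda>n. (x, \<phi> n x)) \<longlonglongrightarrow> (x, fst (U x))" by (intro tendsto_Pair tendsto_const) (simp add: jet_def)
      then have "(\<lambda>n. a (x, \<phi> n x)) \<longlonglongrightarrow> a (x, fst (U x))" "(\<lambda>n. b (x, \<phi> n x)) \<longlonglongrightarrow> b (x, fst (U x))"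
        using continuous_on_tendsto_compose[OF cont(2)] continuous_on_tendsto_compose[OF cont(3)] by auto
      then show "(\<lambda>n. T (\<phi> n) U x) \<longlonglongrightarrow> T (\<lambda>x. fst (U x)) U x"
        unfolding T_def by (intro tendsto_intros)
    qed
    note d = Lp_dominated[OF p0(1) Tm[OF \<phi>m Um(1)] Tm[OF Um(2,1)] gLp AE_I2[OF Tg] l]
    show "T (\<lambda>x. fst (U x)) U \<in> Lp_space M p" "T (\<phi> n) U \<in> Lp_space M p"
      "(\<lambda>n. Lp_dist M p (T (\<phi> n) U) (T (\<lambda>x. fst (U x)) U)) \<longlonglongrightarrow> 0" using d by auto
  qed
  have jT: "jet (\<lambda>x. Q (x, \<phi> n x)) = T (\<phi> n) (jet (\<phi> n))" for n
    using grad[OF \<phi>(1)[of n]] by (auto simp: jet_def T_def)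
  have le1: "Lp_dist M p (jet (\<lambda>x. Q (x, \<phi> n x))) (T (\<phi> n) U) \<le> (2 * L) powr p * Lp_dist M p (jet (\<phi> n)) U" for n
  proof -
    have "Lp_dist M p (jet (\<lambda>x. Q (x, \<phi> n x))) (T (\<phi> n) U) \<le> (LINT x|M. (2 * L) powr p * norm (jet (\<phi> n) x - U x) powr p)"
      unfolding Lp_dist_def
    proof (rule integral_mono)
      show "integrable M (\<lambda>x. norm (jet (\<lambda>x. Q (x, \<phi> n x)) x - T (\<phi> n) U x) powr p)"
        by (rule Lp_integrable[OF Lp_diff[OF jet_Lp[OF test[OF \<phi>(1)]] TnU p0(2)]])
      show "integrable M (\<lambda>x. (2 * L) powr p * norm (jet (\<phi> n) x - U x) powr p)"
        using Lp_integrable[OF Lp_diff[OF jet_Lp[OF \<phi>(1)] W0_Lp[OF U] p0(2)]] by auto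
      fix x
      define w where "w = jet (\<phi> n) x - U x"
      have "jet (\<lambda>x. Q (x, \<phi> n x)) x - T (\<phi> n) U x =
         (Q (x, \<phi> n x) - Q (x, fst (U x)), b (x, \<phi> n x) *\<^sub>R (classical_grad (\<phi> n) x - snd (U x)))"
        unfolding jT by (simp add: T_def jet_def scaleR_diff_right)
      then have "norm (jet (\<lambda>x. Q (x, \<phi> n x)) x - T (\<phi> n) U x) \<le>
         \<bar>Q (x, \<phi> n x) - Q (x, fst (U x))\<bar> + \<bar>b (x, \<phi> n x)\<bar> * norm (classical_grad (\<phi> n) x - snd (U x))"
        using norm_Pair_le[of "Q (x, \<phi> n x) - Q (x, fst (U x))" "b (x, \<phi> n x) *\<^sub>R (classical_grad (\<phi> n) x - snd (U x))"]
        by simp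
      also have "\<dots> \<le> L * norm (fst w) + L * norm (snd w)"
      proof -
        have "\<bar>b (x, \<phi> n x)\<bar> * norm (classical_grad (\<phi> n) x - snd (U x)) \<le> L * norm (classical_grad (\<phi> n) x - snd (U x))"
          by (rule mult_right_mono[OF bds(4)]) simp
        then show ?thesis using bds(2)[of x "\<phi> n x" "fst (U x)"] by (simp add: w_def jet_def)
      qed
      also have "\<dots> \<le> L * norm w + L * norm w"
        using norm_fst_le[of "fst w" "snd w"] norm_snd_le[of "snd w" "fst w"] AL
        by (intro add_mono mult_left_mono) auto
      finally have "norm (jet (\<lambda>x. Q (x, \<phi> n x)) x - T (\<phi> n) U x) powr p \<le> (2 * L * norm w) powr p"
        using p by (intro powr_mono2) auto
      then show "norm (jet (\<lambda>x. Q (x, \<phi> n x)) x - T (\<phi> n) U x) powr p \<le> (2 * L) powr p * norm (jet (\<phi> n) x - U x) powr p"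
        using AL by (simp add: powr_mult w_def)
    qed
    then show ?thesis by (simp add: Lp_dist_def)
  qed
  have "T (\<lambda>x. fst (U x)) U \<in> W0"
  proof (rule W0_limI[where V="\<lambda>n. jet (\<lambda>x. Q (x, \<phi> n x))"])
    show "T (\<lambda>x. fst (U x)) U \<in> Lp_space M p" by (rule TU)
    show "jet (\<lambda>x. Q (x, \<phi> n x)) \<in> W0" for n by (rule jet_W0[OF test[OF \<phi>(1)]])
    let ?a = "\<lambda>n. Lp_dist M p (jet (\<lambda>x. Q (x, \<phi> n x))) (T (\<lambda>x. fst (U x)) U)"
    let ?b = "\<lambda>n. 2 powr p * ((2 * L) powr p * Lp_dist M p (jet (\<phi> n)) U + Lp_dist M p (T (\<phi> n) U) (T (\<lambda>x. fst (U x)) U))"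
    have le: "?a n \<le> ?b n" for n
    proof -
      have "?a n \<le> 2 powr p * (Lp_dist M p (jet (\<lambda>x. Q (x, \<phi> n x))) (T (\<phi> n) U) + Lp_dist M p (T (\<phi> n) U) (T (\<lambda>x. fst (U x)) U))"
        by (rule Lp_dist_le[OF p0(2) jet_Lp[OF test[OF \<phi>(1)]] TnU TU])
      also have "\<dots> \<le> ?b n" using le1[of n] by simp
      finally show ?thesis .
    qed
    have "?b \<longlonglongrightarrow> 2 powr p * ((2 * L) powr p * 0 + 0)" by (intro tendsto_intros \<phi>(2) lim2)
    then have "?b \<longlonglongrightarrow> 0" by simp
    then show "?a \<longlonglongrightarrow> 0" by (rule squeeze_0[OF Lp_dist_nonneg le])
  qed
  then show ?thesis by (simp add: T_def)
qed

end

subsection \<open>Chain rule and truncation\<close>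

lemma compact_sets_lebesgue: "compact K \<Longrightarrow> K \<in> sets lebesgue"
  by (simp add: borel_closed compact_imp_closed)

lemma norm_fst_le_norm: "norm (fst z) \<le> norm z" and norm_snd_le_norm: "norm (snd z) \<le> norm z"
  using norm_fst_le[of "fst z" "snd z"] norm_snd_le[of "snd z" "fst z"] by simp_all

lemma real_lipschitz_deriv:
  fixes S :: "real \<Rightarrow> real"
  assumes "smooth_fun S" "\<And>t. \<bar>deriv S t\<bar> \<le> L"
  shows "\<bar>S t - S s\<bar> \<le> L * \<bar>t - s\<bar>"
  using field_differentiable_bound[of UNIV S "deriv S" L t s] smooth_real_deriv(1)[OF assms(1)] assms(2)
  by simp

text \<open>A smooth positive part that vanishes for \<open>k t \<le> 1\<close> and equals
  \<open>t\<close> for \<open>k t \<ge> 2\<close>. Vanishing on a whole interval to the right of 0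
  gives compact supports after composition.\<close>

definition soft_pos :: "real \<Rightarrow> real \<Rightarrow> real" where
  "soft_pos k t = t * smooth_step (k * t)"

lemma smooth_soft_pos: "smooth_fun (soft_pos k)"
  unfolding soft_pos_def[abs_def]
  by (rule smooth_fun_mult[OF smooth_fun_ident_real])
     (rule smooth_fun_compose_real[OF smooth_fun_step smooth_fun_mult[OF smooth_fun_const smooth_fun_ident_real]])

lemma deriv_step_0: assumes "s < 1 \<or> s > 2" shows "deriv smooth_step s = 0"
proof -
  have "(smooth_step has_real_derivative 0) (at s)"
  proof (cases "s < 1")
    case True
    have "((\<lambda>x::real. 0::real) has_real_derivative 0) (at s)" by simp
    then show ?thesis
      by (rule has_field_derivative_transform_within_open[where S="{..<1}"]) (use True smooth_step_0 in auto)
  next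
    case False
    have "((\<lambda>x::real. 1::real) has_real_derivative 0) (at s)" by simp
    then show ?thesis
      by (rule has_field_derivative_transform_within_open[where S="{2<..}"]) (use False assms smooth_step_1 in auto)
  qed
  then show ?thesis by (rule DERIV_imp_deriv)
qed

lemma deriv_soft_pos: "deriv (soft_pos k) t = smooth_step (k * t) + (k * t) * deriv smooth_step (k * t)"
proof -
  have "((\<lambda>t. smooth_step (k * t)) has_real_derivative deriv smooth_step (k * t) * k) (at t)"
    by (rule DERIV_chain'[where f="\<lambda>t. k * t"])
       (auto intro!: derivative_eq_intros smooth_real_deriv(1)[OF smooth_fun_step])
  then have "(soft_pos k has_real_derivative 1 * smooth_step (k * t) + deriv smooth_step (k * t) * k * t) (at t)"
    unfolding soft_pos_def[abs_def] by (rule DERIV_mult[OF DERIV_ident])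
  then show ?thesis by (simp add: DERIV_imp_deriv mult.commute mult.left_commute)
qed

lemma soft_pos_0: "k > 0 \<Longrightarrow> t \<le> 0 \<Longrightarrow> soft_pos k t = 0"
  and soft_pos_nonneg: "k > 0 \<Longrightarrow> 0 \<le> soft_pos k t"
  and soft_pos_le: "k > 0 \<Longrightarrow> soft_pos k t \<le> max 0 t"
proof -
  show 1: "soft_pos k t = 0" if "k > 0" "t \<le> 0" for t
    using that smooth_step_0[of "k * t"] by (simp add: soft_pos_def mult_le_0_iff order_trans[of _ 0 1])
  show "0 \<le> soft_pos k t" if "k > 0"
    using 1[OF that, of t] smooth_step_ge0[of "k * t"] by (cases "t \<le> 0") (auto simp: soft_pos_def)
  show "soft_pos k t \<le> max 0 t" if "k > 0"
    using 1[OF that, of t] smooth_step_le1[of "k * t"]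
    by (cases "t \<le> 0") (auto simp: soft_pos_def mult_left_le)
qed

lemma deriv_soft_pos_0: "k > 0 \<Longrightarrow> t \<le> 0 \<Longrightarrow> deriv (soft_pos k) t = 0"
  using smooth_step_0[of "k * t"] deriv_step_0[of "k * t"]
  by (simp add: deriv_soft_pos mult_le_0_iff order_trans[of _ 0 1] le_less_trans[of _ 0 1])

lemma soft_pos_id: "k * t > 2 \<Longrightarrow> soft_pos k t = t" "k * t > 2 \<Longrightarrow> deriv (soft_pos k) t = 1"
  by (simp_all add: soft_pos_def smooth_step_1 deriv_soft_pos deriv_step_0)

text \<open>The derivative depends on \<open>k * t\<close> alone, and \<open>s\<close> times the
  derivative of the step vanishes outside the interval from 1 to 2; hence one bound serves all
  \<open>k\<close>.\<close>

lemma deriv_soft_pos_bounded: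
  obtains C where "C \<ge> 0" "\<And>k t. \<bar>deriv (soft_pos k) t\<bar> \<le> C"
proof -
  have "continuous_on {1..2} (\<lambda>s. s * deriv smooth_step s)"
    by (intro continuous_intros continuous_on_subset[OF smooth_real_deriv(3)[OF smooth_fun_step]]) auto
  then have "compact ((\<lambda>s. s * deriv smooth_step s) ` {1..2::real})"
    by (rule compact_continuous_image) auto
  then obtain B where B: "\<And>y. y \<in> (\<lambda>s. s * deriv smooth_step s) ` {1..2::real} \<Longrightarrow> norm y \<le> B"
    using compact_imp_bounded bounded_iff by metis
  have "\<bar>s * deriv smooth_step s\<bar> \<le> max B 0" for s
  proof (cases "s \<in> {1..2}")
    case True then show ?thesis using B[of "s * deriv smooth_step s"] by auto
  next
    case False then show ?thesis using deriv_step_0[of s] by auto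
  qed
  then have "\<bar>deriv (soft_pos k) t\<bar> \<le> 1 + max B 0" for k t
    unfolding deriv_soft_pos using smooth_step_ge0[of "k * t"] smooth_step_le1[of "k * t"]
    by (smt (verit, ccfv_threshold))
  then show ?thesis using that[of "1 + max B 0"] by auto
qed

lemma soft_pos_tendsto:
  "(\<lambda>n. soft_pos (real (Suc n)) t) \<longlonglongrightarrow> max 0 t"
  "(\<lambda>n. deriv (soft_pos (real (Suc n))) t) \<longlonglongrightarrow> (if t > 0 then 1 else 0)"
proof -
  have ev: "eventually (\<lambda>n. real (Suc n) * t > 2) sequentially" if "t > 0"
  proof -
    obtain N :: nat where N: "2 / t < real N" using reals_Archimedean2 by blast
    show ?thesis
    proof (rule eventually_sequentiallyI)
      fix n assume "N \<le> n"
      then have "2 / t < real (Suc n)" using N by linarith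
      then show "2 < real (Suc n) * t" using that by (simp add: pos_divide_less_eq)
    qed
  qed
  show "(\<lambda>n. soft_pos (real (Suc n)) t) \<longlonglongrightarrow> max 0 t"
  proof (cases "t > 0")
    case True
    show ?thesis by (rule tendsto_eventually, use ev[OF True] in eventually_elim) (use True in \<open>simp add: soft_pos_id\<close>)
  next
    case False then show ?thesis by (simp add: soft_pos_0 max_def)
  qed
  show "(\<lambda>n. deriv (soft_pos (real (Suc n))) t) \<longlonglongrightarrow> (if t > 0 then 1 else 0)"
  proof (cases "t > 0")
    case True
    show ?thesis by (rule tendsto_eventually, use ev[OF True] in eventually_elim) (use True in \<open>simp add: soft_pos_id\<close>)
  next
    case False then show ?thesis by (simp add: deriv_soft_pos_0)
  qed
qed

context sobolev
begin

lemma W0_compose: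
  assumes U: "U \<in> W0" and S: "smooth_fun S" "S 0 = 0" "\<And>t. \<bar>deriv S t\<bar> \<le> L"
  shows "(\<lambda>x. (S (fst (U x)), deriv S (fst (U x)) *\<^sub>R snd (U x))) \<in> W0"
proof -
  have L: "0 \<le> L" using S(3)[of 0] by linarith
  have c2: "continuous_on UNIV (\<lambda>z::'a \<times> real. h (snd z))" if "continuous_on UNIV h" for h :: "real \<Rightarrow> real"
    using continuous_on_compose2[OF that continuous_on_snd[OF continuous_on_id]] by simp
  have "(\<lambda>x. ((\<lambda>z. S (snd z)) (x, fst (U x)), (\<lambda>z. 0::'a) (x, fst (U x)) + (\<lambda>z. deriv S (snd z)) (x, fst (U x)) *\<^sub>R snd (U x))) \<in> W0"
  proof (rule W0_op[OF U, where A=0 and L=L])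
    fix \<phi> assume \<phi>: "\<phi> \<in> test_functions \<Omega>"
    show "(\<lambda>x. S (snd (x, \<phi> x))) \<in> test_functions \<Omega>"
      by (rule test_functions_op[OF \<phi>]) (use S smooth_fun_compose_real[OF S(1) test_smooth[OF \<phi>]] in auto)
    show "classical_grad (\<lambda>x. S (snd (x, \<phi> x))) x = 0 + deriv S (snd (x, \<phi> x)) *\<^sub>R classical_grad \<phi> x" for x
      using grad_compose_real[OF S(1) test_smooth[OF \<phi>]] by simp
  next
    show "\<bar>S (snd (x, t))\<bar> \<le> 0 + L * \<bar>t\<bar>" for x :: 'a and t
      using real_lipschitz_deriv[OF S(1,3), of t 0] S(2) by simp
    show "\<bar>S (snd (x, t)) - S (snd (x, s))\<bar> \<le> L * \<bar>t - s\<bar>" for x :: 'a and t s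
      using real_lipschitz_deriv[OF S(1,3), of t s] by simp
  qed (use c2 S smooth_fun_continuous smooth_real_deriv(3) L in auto)
  then show ?thesis by simp
qed

text \<open>Here \<open>T\<close> need not vanish at 0, in contrast to the function \<open>S\<close>
  of \<open>W0_compose\<close>: compact support comes from the factor \<open>Z\<close>. Negative
  powers of \<open>1 + u\<close> become test functions in this way.\<close>

lemma W0_mult_test:
  assumes U: "U \<in> W0" and Z: "Z \<in> test_functions \<Omega>"
    and T: "smooth_fun T" "\<And>t. \<bar>T t\<bar> \<le> A" "\<And>t. \<bar>deriv T t\<bar> \<le> L"
  shows "(\<lambda>x. (Z x * T (fst (U x)), T (fst (U x)) *\<^sub>R classical_grad Z x + (Z x * deriv T (fst (U x))) *\<^sub>R snd (U x))) \<in> W0"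
proof -
  obtain B where B: "B \<ge> 0" "\<And>x. norm (jet Z x) \<le> B" using test_jet_bounded[OF Z] by blast
  have AL: "0 \<le> A" "0 \<le> L" using T(2,3)[of 0] by linarith+
  have ZB: "\<bar>Z x\<bar> \<le> B" "norm (classical_grad Z x) \<le> B" for x
    using B(2)[of x] norm_fst_le[of "Z x" "classical_grad Z x"] norm_snd_le[of "classical_grad Z x" "Z x"]
    by (auto simp: jet_def)
  have c2: "continuous_on UNIV (\<lambda>z::'a \<times> real. h (snd z))" if "continuous_on UNIV h" for h :: "real \<Rightarrow> real"
    using continuous_on_compose2[OF that continuous_on_snd[OF continuous_on_id]] by simp
  have c1: "continuous_on UNIV (\<lambda>z::'a \<times> real. h (fst z))" if "continuous_on UNIV h" for h :: "'a \<Rightarrow> 'c::euclidean_space"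
    using continuous_on_compose2[OF that continuous_on_fst[OF continuous_on_id]] by simp
  have "(\<lambda>x. ((\<lambda>z. Z (fst z) * T (snd z)) (x, fst (U x)), (\<lambda>z. T (snd z) *\<^sub>R classical_grad Z (fst z)) (x, fst (U x)) + (\<lambda>z. Z (fst z) * deriv T (snd z)) (x, fst (U x)) *\<^sub>R snd (U x))) \<in> W0"
  proof (rule W0_op[OF U, where A="A * B" and L="B * L"])
    fix \<phi> assume \<phi>: "\<phi> \<in> test_functions \<Omega>"
    note s = smooth_fun_compose_real[OF T(1) test_smooth[OF \<phi>]]
    show "(\<lambda>x. Z (fst (x, \<phi> x)) * T (snd (x, \<phi> x))) \<in> test_functions \<Omega>"
      by (rule test_functions_op[OF Z]) (use smooth_fun_mult[OF test_smooth[OF Z] s] in auto)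
    show "classical_grad (\<lambda>x. Z (fst (x, \<phi> x)) * T (snd (x, \<phi> x))) x =
        T (snd (x, \<phi> x)) *\<^sub>R classical_grad Z (fst (x, \<phi> x))
        + (Z (fst (x, \<phi> x)) * deriv T (snd (x, \<phi> x))) *\<^sub>R classical_grad \<phi> x" for x
      using grad_mult[OF test_smooth[OF Z] s, of x] grad_compose_real[OF T(1) test_smooth[OF \<phi>], of x]
      by (simp add: add.commute)
  next
    show "continuous_on UNIV (\<lambda>z. Z (fst z) * T (snd z))"
      "continuous_on UNIV (\<lambda>z. T (snd z) *\<^sub>R classical_grad Z (fst z))"
      "continuous_on UNIV (\<lambda>z. Z (fst z) * deriv T (snd z))"
      using c1[OF smooth_fun_continuous[OF test_smooth[OF Z]]] c1[OF smooth_continuous_grad[OF test_smooth[OF Z]]]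
        c2[OF smooth_fun_continuous[OF T(1)]] c2[OF smooth_real_deriv(3)[OF T(1)]]
      by (simp_all add: continuous_on_mult continuous_on_scaleR)
  next
    fix x :: 'a and s t :: real
    have "\<bar>Z x * T t\<bar> \<le> B * A" unfolding abs_mult by (intro mult_mono ZB T) (use B in auto)
    moreover have "0 \<le> B * L * \<bar>t\<bar>" using B AL by simp
    ultimately show "\<bar>Z (fst (x, t)) * T (snd (x, t))\<bar> \<le> A * B + B * L * \<bar>t\<bar>" by (simp add: mult.commute)
    have "\<bar>Z x * (T t - T s)\<bar> \<le> B * (L * \<bar>t - s\<bar>)"
      unfolding abs_mult by (intro mult_mono ZB real_lipschitz_deriv T) (use B in auto)
    then show "\<bar>Z (fst (x, t)) * T (snd (x, t)) - Z (fst (x, s)) * T (snd (x, s))\<bar> \<le> B * L * \<bar>t - s\<bar>"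
      by (simp add: right_diff_distrib mult.assoc)
  next
    fix z :: "'a \<times> real"
    show "norm (T (snd z) *\<^sub>R classical_grad Z (fst z)) \<le> A * B"
      unfolding norm_scaleR by (intro mult_mono ZB T) (use AL in auto)
    show "\<bar>Z (fst z) * deriv T (snd z)\<bar> \<le> B * L" unfolding abs_mult by (intro mult_mono ZB T) (use B in auto)
  qed (use B AL in auto)
  then show ?thesis by simp
qed

lemma W0_fst_measurable: "U \<in> W0 \<Longrightarrow> (\<lambda>x. fst (U x)) \<in> borel_measurable M"
  and W0_snd_measurable: "U \<in> W0 \<Longrightarrow> (\<lambda>x. snd (U x)) \<in> borel_measurable M"
  using borel_measurable_continuous_on[OF continuous_on_fst[OF continuous_on_id]]
     borel_measurable_continuous_on[OF continuous_on_snd[OF continuous_on_id]] W0_measurable by blast+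

text \<open>The derivatives of \<open>soft_pos\<close> converge to the indicator of
  \<open>t > 0\<close>, with value 0 at \<open>t = 0\<close> because they vanish for
  \<open>t \<le> 0\<close>. This fixes the gradient of the positive part as 0 on the zero
  set.\<close>

lemma W0_pos_part:
  assumes U: "U \<in> W0"
  shows "(\<lambda>x. (max 0 (fst (U x)), (if fst (U x) > 0 then 1 else 0) *\<^sub>R snd (U x))) \<in> W0"
proof -
  obtain C where C: "C \<ge> 0" "\<And>k t. \<bar>deriv (soft_pos k) t\<bar> \<le> C" using deriv_soft_pos_bounded by blast
  let ?V = "\<lambda>n x. (soft_pos (real (Suc n)) (fst (U x)), deriv (soft_pos (real (Suc n))) (fst (U x)) *\<^sub>R snd (U x))"
  show ?thesis
  proof (rule W0_dominated[where V="?V" and g="\<lambda>x. (1 + C) * norm (U x)"])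
    show "?V n \<in> W0" for n
      by (rule W0_compose[OF U smooth_soft_pos _ C(2)]) (simp add: soft_pos_def)
    show "(\<lambda>x. (1 + C) * norm (U x)) \<in> Lp_space M p"
      using Lp_scaleR[OF Lp_norm[OF W0_Lp[OF U]], of "1 + C"] by simp
    have "norm (?V n x) \<le> (1 + C) * norm (U x)" for n x
    proof -
      have "norm (?V n x) \<le> \<bar>soft_pos (real (Suc n)) (fst (U x))\<bar> + \<bar>deriv (soft_pos (real (Suc n))) (fst (U x))\<bar> * norm (snd (U x))"
        using norm_Pair_le[of "soft_pos (real (Suc n)) (fst (U x))" "deriv (soft_pos (real (Suc n))) (fst (U x)) *\<^sub>R snd (U x)"] by simp
      also have "\<dots> \<le> \<bar>fst (U x)\<bar> + C * norm (snd (U x))"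
        using soft_pos_nonneg[of "real (Suc n)" "fst (U x)"] soft_pos_le[of "real (Suc n)" "fst (U x)"] C
        by (intro add_mono mult_right_mono) auto
      also have "\<dots> \<le> norm (U x) + C * norm (U x)"
        using norm_fst_le[of "fst (U x)" "snd (U x)"] norm_snd_le[of "snd (U x)" "fst (U x)"] C
        by (intro add_mono mult_left_mono) auto
      finally show ?thesis by (simp add: algebra_simps)
    qed
    then show "AE x in M. norm (?V n x) \<le> (1 + C) * norm (U x)" for n by simp
    have "(\<lambda>x. max 0 (fst (U x))) \<in> borel_measurable M"
      using W0_fst_measurable[OF U] by measurable
    moreover have "(\<lambda>x. if fst (U x) > 0 then 1 else 0::real) \<in> borel_measurable M"
      using W0_fst_measurable[OF U] by measurable
    ultimately show "(\<lambda>x. (max 0 (fst (U x)), (if fst (U x) > 0 then 1 else 0) *\<^sub>R snd (U x))) \<in> borel_measurable M"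
      using W0_snd_measurable[OF U] by (intro borel_measurable_Pair borel_measurable_scaleR)
    show "AE x in M. (\<lambda>n. ?V n x) \<longlonglongrightarrow> (max 0 (fst (U x)), (if fst (U x) > 0 then 1 else 0) *\<^sub>R snd (U x))"
      by (intro AE_I2 tendsto_Pair tendsto_scaleR soft_pos_tendsto tendsto_const)
  qed
qed

end

subsection \<open>Weak gradients\<close>

lemma integral_lborel_translate:
  fixes f :: "'a::euclidean_space \<Rightarrow> real"
  assumes "f \<in> borel_measurable borel"
  shows "(LINT x|lborel. f (x + c)) = (LINT x|lborel. f x)"
proof -
  have "(LINT x|distr lborel borel ((+) c). f x) = (LINT x|lborel. f (c + x))"
    by (rule integral_distr) (use assms in auto)
  then show ?thesis by (simp add: lborel_distr_plus add.commute)
qed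

lemma integrable_lborel_bounded_support:
  fixes f :: "'a::euclidean_space \<Rightarrow> real"
  assumes "f \<in> borel_measurable borel" "\<And>x. \<bar>f x\<bar> \<le> B * indicator (cball 0 R) x"
  shows "integrable lborel f"
proof (rule Bochner_Integration.integrable_bound)
  have "emeasure lborel (cball 0 R :: 'a set) < \<infinity>" by (rule emeasure_bounded_finite) simp
  then show "integrable lborel (\<lambda>x::'a. B * indicator (cball 0 R) x :: real)"
    by (intro integrable_mult_right) (simp add: integrable_indicator_iff)
qed (use assms in \<open>auto intro: order_trans[OF assms(2) abs_ge_self]\<close>)

text \<open>Difference quotients integrate to 0 by translation invariance of Lebesgue measure, and
  dominated convergence passes to the derivative. Applied to a product of test functions this is
  integration by parts.\<close>

lemma integral_directional_derivative_0:
  fixes g :: "'a::euclidean_space \<Rightarrow> real" and b :: 'a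
  assumes g: "g \<in> test_functions UNIV"
  shows "(LINT x|lborel. classical_grad g x \<bullet> b) = 0"
proof -
  have gs: "smooth_fun g" using g test_smooth by blast
  obtain B where B: "B \<ge> 0" "\<And>x. norm (jet g x) \<le> B" using test_jet_bounded[OF g] by blast
  have GB: "norm (classical_grad g x) \<le> B" and gB: "\<bar>g x\<bar> \<le> B" for x
    using B(2)[of x] norm_snd_le[of "classical_grad g x" "g x"] norm_fst_le[of "g x" "classical_grad g x"] by (auto simp: jet_def)
  have "bounded (closure {x. g x \<noteq> 0})" using g by (simp add: test_functions_def compact_imp_bounded)
  from bounded_subset_ballD[OF this, of 0] obtain R where "closure {x. g x \<noteq> 0} \<subseteq> ball 0 R" by auto
  then have R: "closure {x. g x \<noteq> 0} \<subseteq> cball 0 R" using ball_subset_cball by (rule subset_trans)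
  have g0: "g x = 0" if "norm x > R" for x
  proof (rule test_zero[OF g])
    show "x \<notin> closure {x. g x \<noteq> 0}"
    proof
      assume "x \<in> closure {x. g x \<noteq> 0}"
      then have "x \<in> cball 0 R" by (rule subsetD[OF R])
      then show False using that by simp
    qed
  qed
  define h where "h = (\<lambda>n. inverse (real (Suc n)))"
  have h: "h n > 0" "h n \<le> 1" for n by (auto simp: h_def inverse_le_1_iff)
  have hlim: "h \<longlonglongrightarrow> 0" unfolding h_def by (rule LIMSEQ_inverse_real_of_nat)
  define q where "q = (\<lambda>n x. (g (x + h n *\<^sub>R b) - g x) / h n)"
  have gm: "g \<in> borel_measurable borel" using smooth_fun_continuous[OF gs] by (rule borel_measurable_continuous_onI)
  have gi: "integrable lborel g"
    by (rule integrable_lborel_bounded_support[OF gm, of B R])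
       (use gB g0 in \<open>auto simp: indicator_def not_le\<close>)
  have gmt: "(\<lambda>x. g (x + c)) \<in> borel_measurable borel" for c
    using gm by measurable
  have git: "integrable lborel (\<lambda>x. g (x + c))" for c
  proof -
    have "integrable (distr lborel borel ((+) c)) g" using gi by (simp add: lborel_distr_plus)
    then show ?thesis by (subst (asm) integrable_distr_eq) (use gm in \<open>auto simp: add.commute\<close>)
  qed
  have q0: "(LINT x|lborel. q n x) = 0" for n
    unfolding q_def using gi git integral_lborel_translate[OF gm, of "h n *\<^sub>R b"] by simp
  have qlim: "(\<lambda>n. q n x) \<longlonglongrightarrow> classical_grad g x \<bullet> b" for x
  proof -
    have "((\<lambda>t. g (x + t *\<^sub>R b)) has_derivative (\<lambda>t. classical_grad g x \<bullet> (t *\<^sub>R b))) (at 0)"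
    proof -
      have d1: "((\<lambda>t::real. x + t *\<^sub>R b) has_derivative (\<lambda>t. t *\<^sub>R b)) (at 0)"
        by (auto intro!: derivative_eq_intros)
      have d2: "(g has_derivative (\<bullet>) (classical_grad g x)) (at (x + 0 *\<^sub>R b))" using smooth_grad[OF gs] by simp
      from has_derivative_compose[OF d1 d2] show ?thesis .
    qed
    then have "((\<lambda>t. g (x + t *\<^sub>R b)) has_real_derivative classical_grad g x \<bullet> b) (at 0)"
      by (simp add: has_field_derivative_def mult.commute[of "classical_grad g x \<bullet> b"] mult_commute_abs)
    then have "((\<lambda>t. (g (x + t *\<^sub>R b) - g x) / t) \<longlongrightarrow> classical_grad g x \<bullet> b) (at 0)"
      by (simp add: DERIV_def)
    moreover have "filterlim h (at 0) sequentially"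
      using hlim h(1) by (auto simp: filterlim_at less_imp_neq[symmetric] intro!: always_eventually)
    ultimately show ?thesis unfolding q_def by (rule filterlim_compose)
  qed
  \<comment> \<open>Since \<open>h n \<le> 1\<close>, all quotients live in one ball, enlarged by
    \<open>norm b\<close>, and the gradient bound \<open>B\<close> serves as Lipschitz
    constant.\<close>
  have qB: "\<bar>q n x\<bar> \<le> B * norm b * indicator (cball 0 (R + norm b)) x" for n x
  proof (cases "norm x \<le> R + norm b")
    case True
    have "norm (g (x + h n *\<^sub>R b) - g x) \<le> B * norm (x + h n *\<^sub>R b - x)"
    proof (rule differentiable_bound[where S=UNIV and f'="\<lambda>x. (\<bullet>) (classical_grad g x)"])
      show "onorm ((\<bullet>) (classical_grad g y)) \<le> B" for y
      proof (rule onorm_le)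
        fix v
        have "\<bar>classical_grad g y \<bullet> v\<bar> \<le> norm (classical_grad g y) * norm v" by (rule Cauchy_Schwarz_ineq2)
        also have "\<dots> \<le> B * norm v" by (rule mult_right_mono[OF GB]) simp
        finally show "norm (classical_grad g y \<bullet> v) \<le> B * norm v" by simp
      qed
    qed (use smooth_grad[OF gs] in auto)
    then have "\<bar>g (x + h n *\<^sub>R b) - g x\<bar> \<le> B * norm b * h n" using h(1)[of n] by (simp add: mult.commute mult.left_commute)
    then have "\<bar>q n x\<bar> \<le> B * norm b" unfolding q_def using h(1)[of n] by (simp add: divide_le_eq)
    then show ?thesis using True by simp
  next
    case False
    have "norm (h n *\<^sub>R b) \<le> norm b" using h[of n] by (simp add: mult_left_le_one_le)
    then have "norm (x + h n *\<^sub>R b) > R" "norm x > R" using False norm_triangle_ineq4[of "x + h n *\<^sub>R b" "h n *\<^sub>R b"] 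
      by (auto intro: order_trans) (smt (verit) norm_ge_zero)
    then show ?thesis using False by (simp add: q_def g0)
  qed
  have gradm: "(\<lambda>x. classical_grad g x \<bullet> b) \<in> borel_measurable lborel"
    using borel_measurable_continuous_onI[OF continuous_on_inner[OF smooth_continuous_grad[OF gs] continuous_on_const]] by simp
  have qm: "q n \<in> borel_measurable lborel" for n
    unfolding q_def using gm gmt by measurable
  have "(\<lambda>n. LINT x|lborel. q n x) \<longlonglongrightarrow> (LINT x|lborel. classical_grad g x \<bullet> b)"
  proof (rule integral_dominated_convergence[where w="\<lambda>x. B * norm b * indicator (cball 0 (R + norm b)) x"])
    show "integrable lborel (\<lambda>x. B * norm b * indicator (cball 0 (R + norm b)) x :: real)"
      by (rule integrable_lborel_bounded_support[where B="B * norm b" and R="R + norm b"])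
         (use B in \<open>auto simp: indicator_def\<close>)
  qed (use gradm qm qlim qB in auto)
  then show ?thesis using q0 by (simp add: LIMSEQ_const_iff)
qed

context sobolev
begin

lemma test_UNIV: "\<phi> \<in> test_functions \<Omega> \<Longrightarrow> \<phi> \<in> test_functions UNIV"
  by (simp add: test_functions_def)

lemma LINT_M_eq_lborel:
  fixes f :: "'a \<Rightarrow> real"
  assumes "f \<in> borel_measurable borel" "\<And>x. x \<notin> \<Omega> \<Longrightarrow> f x = 0"
  shows "(LINT x|M. f x) = (LINT x|lborel. f x)"
proof -
  have "(LINT x|M. f x) = (LINT x|lebesgue. indicator \<Omega> x *\<^sub>R f x)"
    by (rule integral_restrict_space) simp
  also have "(\<lambda>x. indicator \<Omega> x *\<^sub>R f x) = f"
  proof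
    show "indicator \<Omega> x *\<^sub>R f x = f x" for x by (cases "x \<in> \<Omega>") (use assms(2) in auto)
  qed
  also have "(LINT x|lebesgue. f x) = (LINT x|lborel. f x)" by (rule integral_completion) (use assms in simp)
  finally show ?thesis .
qed

text \<open>On a set of finite measure the constant 1 belongs to \<open>L^p\<close>, so convergence
  in \<open>L^p\<close> implies convergence of the pairings with any bounded field.\<close>

lemma W0_integral_inner_tendsto:
  assumes \<phi>: "\<And>n::nat. \<phi> n \<in> test_functions \<Omega>" "(\<lambda>n. Lp_dist M p (jet (\<phi> n)) U) \<longlonglongrightarrow> 0" and U: "U \<in> W0"
    and c: "c \<in> borel_measurable M" "\<And>x. norm (c x) \<le> B"
  shows "(\<lambda>n. LINT x|M. jet (\<phi> n) x \<bullet> c x) \<longlonglongrightarrow> (LINT x|M. U x \<bullet> c x)"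
    and "integrable M (\<lambda>x. U x \<bullet> c x)"
proof -
  have B: "0 \<le> B" using c(2)[of undefined] norm_ge_zero order_trans by blast
  have p1: "1 \<le> p" and p0: "0 \<le> p" using p by auto
  define w where "w = (\<lambda>n x. jet (\<phi> n) x - U x)"
  have w: "w n \<in> Lp_space M p" for n unfolding w_def by (rule Lp_diff[OF jet_Lp[OF \<phi>(1)] W0_Lp[OF U] p0])
  have wl: "(\<lambda>n. LINT x|M. norm (w n x) powr p) \<longlonglongrightarrow> 0" using \<phi>(2) by (simp add: Lp_dist_def w_def)
  have g: "(\<lambda>x. 1::real) \<in> Lp_space M p" by (rule Lp_bounded[where B=1]) auto
  have km: "(\<lambda>x. w n x \<bullet> c x) \<in> borel_measurable M" for n
    using borel_measurable_inner[OF Lp_measurable[OF w] c(1)] .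
  have le: "\<bar>w n x \<bullet> c x\<bar> \<le> B * (norm (1::real) powr (p - 1) * norm (w n x))" for n x
  proof -
    have "\<bar>w n x \<bullet> c x\<bar> \<le> norm (w n x) * norm (c x)" by (rule Cauchy_Schwarz_ineq2)
    also have "\<dots> \<le> norm (w n x) * B" using c(2) by (rule mult_left_mono) simp
    finally show ?thesis by (simp add: mult.commute)
  qed
  note t = integral_mult_tendsto_0[OF p1 w wl g km AE_I2[OF le] B]
  have Ji: "integrable M (\<lambda>x. norm (jet (\<phi> n) x))" for n
    using Lp_integrable_norm[OF Lp_norm[OF jet_Lp[OF \<phi>(1)]]] .
  have Jc: "integrable M (\<lambda>x. jet (\<phi> n) x \<bullet> c x)" for n
  proof (rule Bochner_Integration.integrable_bound)
    show "integrable M (\<lambda>x. B * norm (jet (\<phi> n) x))" using Ji by simp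
    show "(\<lambda>x. jet (\<phi> n) x \<bullet> c x) \<in> borel_measurable M"
      using borel_measurable_inner[OF Lp_measurable[OF jet_Lp[OF \<phi>(1)]] c(1)] .
    show "AE x in M. norm (jet (\<phi> n) x \<bullet> c x) \<le> norm (B * norm (jet (\<phi> n) x))"
    proof (rule AE_I2)
      fix x
      have "\<bar>jet (\<phi> n) x \<bullet> c x\<bar> \<le> norm (jet (\<phi> n) x) * norm (c x)" by (rule Cauchy_Schwarz_ineq2)
      also have "\<dots> \<le> norm (jet (\<phi> n) x) * B" using c(2) by (rule mult_left_mono) simp
      finally show "norm (jet (\<phi> n) x \<bullet> c x) \<le> norm (B * norm (jet (\<phi> n) x))"
        using B by (simp add: mult.commute)
    qed
  qed
  have eq: "(\<lambda>x. U x \<bullet> c x) = (\<lambda>x. jet (\<phi> n) x \<bullet> c x - w n x \<bullet> c x)" for n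
    by (auto simp: w_def inner_diff_left)
  show iU: "integrable M (\<lambda>x. U x \<bullet> c x)" unfolding eq[of 0] using Jc t(1) by (rule Bochner_Integration.integrable_diff)
  have "(LINT x|M. jet (\<phi> n) x \<bullet> c x) = (LINT x|M. U x \<bullet> c x) + (LINT x|M. w n x \<bullet> c x)" for n
    unfolding eq[of n] using Jc t(1) by simp
  moreover have "(\<lambda>n. (LINT x|M. U x \<bullet> c x) + (LINT x|M. w n x \<bullet> c x)) \<longlonglongrightarrow> (LINT x|M. U x \<bullet> c x) + 0"
    by (intro tendsto_add tendsto_const t(3))
  ultimately show "(\<lambda>n. LINT x|M. jet (\<phi> n) x \<bullet> c x) \<longlonglongrightarrow> (LINT x|M. U x \<bullet> c x)" by simp
qed

lemma integrable_compact_subset: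
  fixes f :: "'a \<Rightarrow> 'c::euclidean_space"
  assumes f: "integrable M f" and K: "K \<subseteq> \<Omega>" "compact K"
  shows "integrable (lebesgue_on K) f"
proof -
  have Ks: "K \<in> sets lebesgue" using K by (simp add: compact_sets_lebesgue)
  have "integrable lebesgue (\<lambda>x. indicator \<Omega> x *\<^sub>R f x)" using f by (simp add: integrable_restrict_space)
  from integrable_mult_indicator[OF Ks this]
  have "integrable lebesgue (\<lambda>x. indicator K x *\<^sub>R indicator \<Omega> x *\<^sub>R f x)" .
  also have "(\<lambda>x. indicator K x *\<^sub>R indicator \<Omega> x *\<^sub>R f x) = (\<lambda>x. indicator K x *\<^sub>R f x)"
  proof
    show "indicator K x *\<^sub>R indicator \<Omega> x *\<^sub>R f x = indicator K x *\<^sub>R f x" for x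
      by (cases "x \<in> K") (use K(1) in auto)
  qed
  finally show ?thesis using Ks by (simp add: integrable_restrict_space)
qed

text \<open>Both sides of the integration by parts are packed into one pairing with the bounded
  field \<open>c\<close>. For a smooth approximant that pairing integrates the directional
  derivative of the product with \<open>\<psi>\<close>, hence it vanishes, and so does its
  limit.\<close>

lemma W0_weak_gradient:
  assumes U: "U \<in> W0" shows "has_weak_gradient \<Omega> (\<lambda>x. fst (U x)) (\<lambda>x. snd (U x))"
proof -
  have fLp: "(\<lambda>x. fst (U x)) \<in> Lp_space M p" "(\<lambda>x. snd (U x)) \<in> Lp_space M p"
    using p by (intro Lp_bound_norm[OF _ W0_Lp[OF U]] W0_fst_measurable[OF U] W0_snd_measurable[OF U]
        AE_I2 norm_fst_le_norm norm_snd_le_norm; simp)+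
  show ?thesis unfolding has_weak_gradient_def
  proof (intro conjI allI impI ballI; (elim conjE)?)
    fix K assume "compact K" "K \<subseteq> \<Omega>"
    then show "integrable (lebesgue_on K) (\<lambda>x. fst (U x))" "integrable (lebesgue_on K) (\<lambda>x. snd (U x))"
      using fLp Lp_integrable_norm integrable_compact_subset by blast+
  next
    fix \<psi> and b :: 'a assume \<psi>: "\<psi> \<in> test_functions \<Omega>" and b: "b \<in> Basis"
    obtain \<phi> where \<phi>: "\<And>n::nat. \<phi> n \<in> test_functions \<Omega>" "(\<lambda>n. Lp_dist M p (jet (\<phi> n)) U) \<longlonglongrightarrow> 0"
      using W0_seq[OF U] by blast
    obtain B where B: "B \<ge> 0" "\<And>x. norm (jet \<psi> x) \<le> B" using test_jet_bounded[OF \<psi>] by blast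
    have \<psi>B: "\<bar>\<psi> x\<bar> \<le> B" "norm (classical_grad \<psi> x) \<le> B" for x
      using B(2)[of x] norm_fst_le[of "\<psi> x" "classical_grad \<psi> x"] norm_snd_le[of "classical_grad \<psi> x" "\<psi> x"]
      by (auto simp: jet_def)
    have nb: "norm b = 1" using b by simp
    define D where "D = (\<lambda>x. classical_grad \<psi> x \<bullet> b)"
    have DB: "\<bar>D x\<bar> \<le> B" for x
      unfolding D_def using Cauchy_Schwarz_ineq2[of "classical_grad \<psi> x" b] \<psi>B(2)[of x] nb by simp
    have cD: "continuous_on UNIV D" unfolding D_def
      by (intro continuous_on_inner smooth_continuous_grad[OF test_smooth[OF \<psi>]] continuous_on_const)
    have c\<psi>: "continuous_on UNIV \<psi>" using smooth_fun_continuous[OF test_smooth[OF \<psi>]] .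
    define c where "c = (\<lambda>x. (D x, \<psi> x *\<^sub>R b))"
    have cm: "c \<in> borel_measurable M" unfolding c_def
      by (rule cont_measurable) (intro continuous_on_Pair continuous_on_scaleR continuous_on_const cD c\<psi>)
    have cB: "norm (c x) \<le> 2 * B" for x
      using norm_Pair_le[of "D x" "\<psi> x *\<^sub>R b"] \<psi>B(1)[of x] DB[of x] nb by (simp add: c_def)
    have "(LINT x|M. jet (\<phi> n) x \<bullet> c x) = 0" for n
    proof -
      note s = test_smooth[OF \<phi>(1)[of n]] test_smooth[OF \<psi>]
      have t: "(\<lambda>x. \<phi> n x * \<psi> x) \<in> test_functions \<Omega>"
        by (rule test_functions_op[OF \<psi> smooth_fun_mult[OF s]]) simp
      have e: "jet (\<phi> n) x \<bullet> c x = classical_grad (\<lambda>x. \<phi> n x * \<psi> x) x \<bullet> b" for x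
        by (simp add: grad_mult[OF s] jet_def c_def D_def inner_add_left)
      have "(LINT x|M. classical_grad (\<lambda>x. \<phi> n x * \<psi> x) x \<bullet> b) = (LINT x|lborel. classical_grad (\<lambda>x. \<phi> n x * \<psi> x) x \<bullet> b)"
        by (rule LINT_M_eq_lborel)
           (use test_vanish(2)[OF t] borel_measurable_continuous_onI[OF continuous_on_inner[OF smooth_continuous_grad[OF test_smooth[OF t]] continuous_on_const]] in auto)
      then show ?thesis unfolding e using integral_directional_derivative_0[OF test_UNIV[OF t]] by simp
    qed
    then have 0: "(LINT x|M. U x \<bullet> c x) = 0"
      using W0_integral_inner_tendsto(1)[OF \<phi> U cm cB] by (simp add: LIMSEQ_const_iff)
    have i1: "integrable M (\<lambda>x. U x \<bullet> (D x, 0))"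
    proof (rule W0_integral_inner_tendsto(2)[OF \<phi> U, where B=B])
      show "(\<lambda>x. (D x, 0)) \<in> borel_measurable M"
        by (rule cont_measurable) (intro continuous_on_Pair continuous_on_const cD)
    qed (use DB in \<open>simp add: norm_Pair\<close>)
    have i2: "integrable M (\<lambda>x. U x \<bullet> (0, \<psi> x *\<^sub>R b))"
    proof (rule W0_integral_inner_tendsto(2)[OF \<phi> U, where B=B])
      show "(\<lambda>x. (0, \<psi> x *\<^sub>R b)) \<in> borel_measurable M"
        by (rule cont_measurable) (intro continuous_on_Pair continuous_on_scaleR continuous_on_const c\<psi>)
    qed (use \<psi>B nb in \<open>simp add: norm_Pair\<close>)
    have "U x \<bullet> c x = U x \<bullet> (D x, 0) + U x \<bullet> (0, \<psi> x *\<^sub>R b)" for x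
      by (simp add: c_def inner_prod_def)
    then have "(LINT x|M. U x \<bullet> (D x, 0)) + (LINT x|M. U x \<bullet> (0, \<psi> x *\<^sub>R b)) = 0"
      using 0 i1 i2 by simp
    then show "(LINT x|M. fst (U x) * (classical_grad \<psi> x \<bullet> b)) = - (LINT x|M. (snd (U x) \<bullet> b) * \<psi> x)"
      by (simp add: inner_prod_def D_def mult.commute[of _ "\<psi> _"] add_eq_0_iff)
  qed
qed

section \<open>Fundamental lemma of the calculus of variations and uniqueness of weak
  gradients\<close>

lemma compact_exhaustion:
  obtains K :: "nat \<Rightarrow> 'a set" where "\<And>j. compact (K j)" "\<And>j. K j \<subseteq> \<Omega>" "\<Omega> \<subseteq> (\<Union>j. K j)"
proof -
  define K where "K = (\<lambda>j. closure \<Omega> \<inter> {x. infdist x (- \<Omega>) \<ge> 1 / real (Suc j)})"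
  \<comment> \<open>The distance to the empty set is 0 by convention, so the complement has to be
    known nonempty; boundedness of \<open>\<Omega>\<close> ensures it.\<close>
  have ne: "- \<Omega> \<noteq> {}" using bounded_\<Omega> not_bounded_UNIV by (metis Compl_empty_eq double_complement)
  have cl: "closed (- \<Omega>)" using open_\<Omega> by auto
  have 1: "compact (K j)" for j
    unfolding K_def using bounded_\<Omega>
    by (intro compact_Int_closed closed_Collect_le continuous_on_const continuous_on_infdist continuous_on_id)
       (auto simp: compact_closure)
  have 2: "K j \<subseteq> \<Omega>" for j
  proof
    fix x assume "x \<in> K j"
    then have "infdist x (- \<Omega>) > 0" unfolding K_def by (auto intro: less_le_trans[of 0 "1 / real (Suc j)"])
    then show "x \<in> \<Omega>" by (metis Compl_iff infdist_zero less_irrefl)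
  qed
  have 3: "\<Omega> \<subseteq> (\<Union>j. K j)"
  proof
    fix x assume x: "x \<in> \<Omega>"
    then have "infdist x (- \<Omega>) > 0" using infdist_pos_not_in_closed[OF cl ne] by simp
    then obtain j where "1 / real (Suc j) < infdist x (- \<Omega>)"
      using nat_approx_posE by (metis of_nat_Suc)
    then show "x \<in> (\<Union>j. K j)" using x closure_subset unfolding K_def by (auto intro!: exI[of _ j])
  qed
  show ?thesis using that 1 2 3 by blast
qed

text \<open>Test functions approximate the indicator of \<open>K\<close> from outside; inner regularity then gives the
  fundamental lemma of the calculus of variations.\<close>

lemma integral_compact_0:
  fixes g :: "'a \<Rightarrow> real"
  assumes loc: "\<And>K. compact K \<Longrightarrow> K \<subseteq> \<Omega> \<Longrightarrow> integrable (lebesgue_on K) g"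
    and test: "\<And>\<psi>. \<psi> \<in> test_functions \<Omega> \<Longrightarrow> (LINT x|M. g x * \<psi> x) = 0"
    and K: "compact K" "K \<subseteq> \<Omega>"
  shows "(LINT x|lebesgue_on K. g x) = 0"
proof (cases "K = {}")
  case True
  then show ?thesis by (simp add: integral_restrict_space)
next
  case False
  obtain \<zeta> where \<zeta>: "\<zeta> \<in> test_functions \<Omega>" "\<And>x. x \<in> K \<Longrightarrow> \<zeta> x = 1"
    using smooth_cutoff[OF K(1) open_\<Omega> K(2)] by metis
  define K' where "K' = closure {x. \<zeta> x \<noteq> 0}"
  have K': "compact K'" "K' \<subseteq> \<Omega>" using \<zeta>(1) by (auto simp: K'_def test_functions_def)
  \<comment> \<open>The neighbourhoods shrink to \<open>K\<close> inside the fixed compact set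
    \<open>K'\<close>, on which \<open>g\<close> is integrable and serves as dominating
    function.\<close>
  define V where "V = (\<lambda>m. {x. \<zeta> x \<noteq> 0} \<inter> {x. infdist x K < 1 / real (Suc m)})"
  have V: "open (V m)" "K \<subseteq> V m" "V m \<subseteq> K'" for m
  proof -
    have "open {x. \<zeta> x \<noteq> 0}"
      by (rule open_Collect_neq) (intro smooth_fun_continuous[OF test_smooth[OF \<zeta>(1)]] continuous_on_const)+
    moreover have "open {x. infdist x K < 1 / real (Suc m)}"
      by (rule open_Collect_less) (intro continuous_on_infdist continuous_on_id continuous_on_const)+
    ultimately show "open (V m)" by (simp add: V_def open_Int)
    show "K \<subseteq> V m" using \<zeta>(2) by (auto simp: V_def)
    show "V m \<subseteq> K'" using closure_subset[of "{x. \<zeta> x \<noteq> 0}"] by (auto simp: V_def K'_def)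
  qed
  have "\<exists>\<xi>. \<xi> \<in> test_functions (V m) \<and> (\<forall>x. 0 \<le> \<xi> x \<and> \<xi> x \<le> 1) \<and> (\<forall>x\<in>K. \<xi> x = 1)" for m
    using smooth_cutoff[OF K(1) V(1,2)] by metis
  then obtain \<xi> where \<xi>: "\<And>m. \<xi> m \<in> test_functions (V m)" "\<And>m x. 0 \<le> \<xi> m x" "\<And>m x. \<xi> m x \<le> 1"
    "\<And>m x. x \<in> K \<Longrightarrow> \<xi> m x = 1" by metis
  have \<xi>\<Omega>: "\<xi> m \<in> test_functions \<Omega>" for m
  proof -
    have "V m \<subseteq> \<Omega>" using V(3) K'(2) by blast
    then show ?thesis using \<xi>(1)[of m] unfolding test_functions_def by blast
  qed
  have sets: "K \<in> sets lebesgue" "K' \<in> sets lebesgue" using K K' by (simp_all add: compact_sets_lebesgue)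
  have gi: "integrable lebesgue (\<lambda>x. indicator K' x *\<^sub>R g x)"
    using loc[OF K'] sets by (simp add: integrable_restrict_space)
  have \<xi>m: "\<xi> m \<in> borel_measurable lebesgue" for m
    using borel_measurable_continuous_onI[OF smooth_fun_continuous[OF test_smooth[OF \<xi>(1)]]]
    by (simp add: measurable_completion)
  have z: "(LINT x|lebesgue. indicator K' x *\<^sub>R g x * \<xi> m x) = 0" for m
  proof -
    have "(LINT x|M. g x * \<xi> m x) = (LINT x|lebesgue. indicator \<Omega> x *\<^sub>R (g x * \<xi> m x))"
      by (rule integral_restrict_space) simp
    also have "(\<lambda>x. indicator \<Omega> x *\<^sub>R (g x * \<xi> m x)) = (\<lambda>x. indicator K' x *\<^sub>R g x * \<xi> m x)"
    proof
      fix x show "indicator \<Omega> x *\<^sub>R (g x * \<xi> m x) = indicator K' x *\<^sub>R g x * \<xi> m x"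
        using test_vanish(1)[OF \<xi>(1), of x m] V(3)[of m] K'(2) by (auto simp: indicator_def)
    qed
    finally show ?thesis using test[OF \<xi>\<Omega>] by simp
  qed
  have "(\<lambda>m. LINT x|lebesgue. indicator K' x *\<^sub>R g x * \<xi> m x) \<longlonglongrightarrow> (LINT x|lebesgue. indicator K x *\<^sub>R g x)"
  proof (rule integral_dominated_convergence[where w="\<lambda>x. norm (indicator K' x *\<^sub>R g x)"])
    show "(\<lambda>x. indicator K x *\<^sub>R g x) \<in> borel_measurable lebesgue"
      using loc[OF K] sets by (simp add: integrable_restrict_space)
    show "(\<lambda>x. indicator K' x *\<^sub>R g x * \<xi> m x) \<in> borel_measurable lebesgue" for m
      using gi \<xi>m by (intro borel_measurable_times) auto
    show "integrable lebesgue (\<lambda>x. norm (indicator K' x *\<^sub>R g x))" using gi by (rule integrable_norm)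
    show "AE x in lebesgue. norm (indicator K' x *\<^sub>R g x * \<xi> m x) \<le> norm (indicator K' x *\<^sub>R g x)" for m
    proof (rule AE_I2)
      fix x have "\<bar>\<xi> m x\<bar> \<le> 1" using \<xi>(2,3)[where m=m and x=x] by simp
      then have "\<bar>indicator K' x *\<^sub>R g x\<bar> * \<bar>\<xi> m x\<bar> \<le> \<bar>indicator K' x *\<^sub>R g x\<bar>"
        by (intro mult_left_le) auto
      then show "norm (indicator K' x *\<^sub>R g x * \<xi> m x) \<le> norm (indicator K' x *\<^sub>R g x)"
        by (simp only: real_norm_def abs_mult)
    qed
    have "(\<lambda>m. indicator K' x *\<^sub>R g x * \<xi> m x) \<longlonglongrightarrow> indicator K x *\<^sub>R g x" for x
    proof (cases "x \<in> K")
      case True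
      then have "x \<in> K'" using V by blast
      then show ?thesis using True \<xi>(4) by simp
    next
      case xK: False
      have "infdist x K > 0" using infdist_pos_not_in_closed[OF compact_imp_closed[OF K(1)] False xK] .
      then obtain N where N: "1 / real (Suc N) < infdist x K" using nat_approx_posE by (metis of_nat_Suc)
      have "\<xi> m x = 0" if "m \<ge> N" for m
      proof -
        have "1 / real (Suc m) \<le> 1 / real (Suc N)" using that by (simp add: frac_le)
        then have "x \<notin> V m" using N by (auto simp: V_def)
        then show ?thesis using test_vanish(1)[OF \<xi>(1)] by blast
      qed
      then have "eventually (\<lambda>m. indicator K' x *\<^sub>R g x * \<xi> m x = indicator K x *\<^sub>R g x) sequentially"
        using xK by (auto simp: eventually_sequentially)
      then show ?thesis by (rule tendsto_eventually)
    qed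
    then show "AE x in lebesgue. (\<lambda>m. indicator K' x *\<^sub>R g x * \<xi> m x) \<longlonglongrightarrow> indicator K x *\<^sub>R g x" by simp
  qed
  then have "(LINT x|lebesgue. indicator K x *\<^sub>R g x) = 0" using z by (simp add: LIMSEQ_const_iff)
  then show ?thesis using sets by (simp add: integral_restrict_space)
qed

text \<open>A closed subset of \<open>{g > 0}\<close> within a compact set has integral 0 although
  \<open>g\<close> is positive on it, hence it is null. Inner regularity then makes
  \<open>{g > 0}\<close> null on each compact set, and an exhaustion finishes.\<close>

lemma AE_nonpos_of_compact_integrals:
  fixes g :: "'a \<Rightarrow> real"
  assumes loc: "\<And>K. compact K \<Longrightarrow> K \<subseteq> \<Omega> \<Longrightarrow> integrable (lebesgue_on K) g"
    and int: "\<And>K. compact K \<Longrightarrow> K \<subseteq> \<Omega> \<Longrightarrow> (LINT x|lebesgue_on K. g x) = 0"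
  shows "AE x in M. g x \<le> 0"
proof -
  have main: "AE x in lebesgue. x \<in> K \<longrightarrow> g x \<le> 0" if K: "compact K" "K \<subseteq> \<Omega>" for K
  proof -
    define P where "P = {x \<in> K. g x > 0}"
    have Ks: "K \<in> sets lebesgue" using K by (simp add: compact_sets_lebesgue)
    have "g \<in> borel_measurable (lebesgue_on K)" using loc[OF K] by auto
    then have "{x \<in> space (lebesgue_on K). g x > 0} \<in> sets (lebesgue_on K)" by measurable
    then have Ps: "P \<in> sets lebesgue" using Ks by (auto simp: P_def sets_restrict_space_iff)
    have null: "T \<in> null_sets lebesgue" if T: "closed T" "T \<subseteq> P" for T
    proof -
      have Tc: "compact T" using T K(1) compact_Int_closed[OF K(1) T(1)] 
        by (metis (no_types, lifting) P_def inf.absorb_iff2 mem_Collect_eq subset_iff)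
      have T\<Omega>: "T \<subseteq> \<Omega>" using T K by (auto simp: P_def)
      have Ts: "T \<in> sets lebesgue" using Tc by (simp add: compact_sets_lebesgue)
      have "AE x in lebesgue_on T. 0 \<le> g x" using T by (intro AE_I2) (auto simp: P_def subset_iff less_imp_le)
      then have "AE x in lebesgue_on T. g x = 0"
        using int[OF Tc T\<Omega>] integral_nonneg_eq_0_iff_AE[OF loc[OF Tc T\<Omega>]] by simp
      then have "AE x in lebesgue. x \<in> T \<longrightarrow> g x = 0" using Ts by (simp add: AE_restrict_space_iff)
      then have "AE x in lebesgue. x \<notin> T"
        by eventually_elim (use T in \<open>force simp: P_def\<close>)
      then show ?thesis using AE_iff_null_sets[OF Ts] by simp
    qed
    have Pe: "emeasure lebesgue P \<le> ennreal e" if "e > 0" for e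
    proof -
      obtain T where T: "closed T" "T \<subseteq> P" "P - T \<in> lmeasurable" "emeasure lebesgue (P - T) < ennreal e"
        using sets_lebesgue_inner_closed[OF Ps \<open>e > 0\<close>] by metis
      have "emeasure lebesgue P \<le> emeasure lebesgue T + emeasure lebesgue (P - T)"
        using T null[OF T(1,2)] Ps by (metis Diff_partition emeasure_subadditive fmeasurableD null_setsD2)
      also have "emeasure lebesgue T = 0" using null[OF T(1,2)] by (rule null_setsD1)
      also have "0 + emeasure lebesgue (P - T) \<le> ennreal e" using T(4) by (metis add_0 less_imp_le)
      finally show ?thesis .
    qed
    have "emeasure lebesgue P \<le> 0"
    proof (rule ennreal_le_epsilon)
      fix e :: real assume "0 < e"
      then show "emeasure lebesgue P \<le> 0 + ennreal e" using Pe[of e] by simp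
    qed
    then have "P \<in> null_sets lebesgue" using Ps by auto
    then have "AE x in lebesgue. x \<notin> P" using AE_iff_null_sets[OF Ps] by simp
    then show ?thesis by eventually_elim (auto simp: P_def)
  qed
  obtain K :: "nat \<Rightarrow> 'a set" where K: "\<And>j. compact (K j)" "\<And>j. K j \<subseteq> \<Omega>" "\<Omega> \<subseteq> (\<Union>j. K j)"
    using compact_exhaustion by metis
  have "AE x in lebesgue. \<forall>j. x \<in> K j \<longrightarrow> g x \<le> 0"
    unfolding AE_all_countable using main[OF K(1,2)] by blast
  then have "AE x in lebesgue. x \<in> \<Omega> \<longrightarrow> g x \<le> 0" by eventually_elim (use K(3) in blast)
  then show ?thesis by (simp add: AE_restrict_space_iff)
qed

lemma AE_0_of_test:
  fixes g :: "'a \<Rightarrow> real"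
  assumes loc: "\<And>K. compact K \<Longrightarrow> K \<subseteq> \<Omega> \<Longrightarrow> integrable (lebesgue_on K) g"
    and test: "\<And>\<psi>. \<psi> \<in> test_functions \<Omega> \<Longrightarrow> (LINT x|M. g x * \<psi> x) = 0"
  shows "AE x in M. g x = 0"
proof -
  note i = integral_compact_0[OF loc test]
  have "AE x in M. g x \<le> 0" by (rule AE_nonpos_of_compact_integrals[OF loc i])
  moreover have "AE x in M. - g x \<le> 0" 
    by (rule AE_nonpos_of_compact_integrals) (use loc i in auto)
  ultimately show ?thesis by eventually_elim simp
qed

text \<open>\<open>positive_solution\<close> quantifies over its own weak gradient, separately from
  the approximable one that witnesses membership in \<open>W1p_0\<close>. Uniqueness identifies the
  two.\<close>

lemma weak_gradient_unique:
  assumes 1: "has_weak_gradient \<Omega> u G" and 2: "has_weak_gradient \<Omega> u H"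
  shows "AE x in M. G x = H x"
proof -
  have li: "integrable (lebesgue_on K) G" "integrable (lebesgue_on K) H" if "compact K" "K \<subseteq> \<Omega>" for K
    using 1 2 that unfolding has_weak_gradient_def by blast+
  have "AE x in M. (G x - H x) \<bullet> b = 0" if b: "b \<in> Basis" for b
  proof (rule AE_0_of_test)
    show "integrable (lebesgue_on K) (\<lambda>x. (G x - H x) \<bullet> b)" if "compact K" "K \<subseteq> \<Omega>" for K
      using li[OF that] by (intro integrable_inner_left Bochner_Integration.integrable_diff) auto
    fix \<psi> assume \<psi>: "\<psi> \<in> test_functions \<Omega>"
    define K where "K = closure {x. \<psi> x \<noteq> 0}"
    have K: "compact K" "K \<subseteq> \<Omega>" using \<psi> by (auto simp: K_def test_functions_def)
    obtain B where B: "B \<ge> 0" "\<And>x. norm (jet \<psi> x) \<le> B" using test_jet_bounded[OF \<psi>] by blast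
    have \<psi>B: "\<bar>\<psi> x\<bar> \<le> B" for x
      using B(2)[of x] norm_fst_le[of "\<psi> x" "classical_grad \<psi> x"] by (auto simp: jet_def)
    have i: "integrable M (\<lambda>x. (F x \<bullet> b) * \<psi> x)" if F: "integrable (lebesgue_on K) F" for F :: "'a \<Rightarrow> 'a"
    proof -
      have Ks: "K \<in> sets lebesgue" using K by (simp add: compact_sets_lebesgue)
      have Fi: "integrable lebesgue (\<lambda>x. indicator K x *\<^sub>R (F x \<bullet> b))"
        using integrable_inner_left[OF F, of b] b Ks by (simp add: integrable_restrict_space)
      have "integrable lebesgue (\<lambda>x. indicator K x *\<^sub>R (F x \<bullet> b) * \<psi> x)"
      proof (rule Bochner_Integration.integrable_bound)
        show "integrable lebesgue (\<lambda>x. B * (indicator K x *\<^sub>R (F x \<bullet> b)))" using Fi by (rule integrable_mult_right)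
        show "(\<lambda>x. indicator K x *\<^sub>R (F x \<bullet> b) * \<psi> x) \<in> borel_measurable lebesgue"
          using Fi borel_measurable_continuous_onI[OF smooth_fun_continuous[OF test_smooth[OF \<psi>]]]
          by (intro borel_measurable_times) (auto simp: measurable_completion)
        show "AE x in lebesgue. norm (indicator K x *\<^sub>R (F x \<bullet> b) * \<psi> x) \<le> norm (B * (indicator K x *\<^sub>R (F x \<bullet> b)))"
        proof (rule AE_I2)
          fix x
          have "\<bar>\<psi> x\<bar> * \<bar>indicator K x *\<^sub>R (F x \<bullet> b)\<bar> \<le> B * \<bar>indicator K x *\<^sub>R (F x \<bullet> b)\<bar>"
            by (rule mult_right_mono[OF \<psi>B]) simp
          then show "norm (indicator K x *\<^sub>R (F x \<bullet> b) * \<psi> x) \<le> norm (B * (indicator K x *\<^sub>R (F x \<bullet> b)))"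
            using B(1) by (simp add: abs_mult mult.commute)
        qed
      qed
      also have "(\<lambda>x. indicator K x *\<^sub>R (F x \<bullet> b) * \<psi> x) = (\<lambda>x. indicator \<Omega> x *\<^sub>R ((F x \<bullet> b) * \<psi> x))"
      proof
        fix x show "indicator K x *\<^sub>R (F x \<bullet> b) * \<psi> x = indicator \<Omega> x *\<^sub>R ((F x \<bullet> b) * \<psi> x)"
          using K(2) test_zero[OF \<psi>, of x] by (auto simp: indicator_def K_def)
      qed
      finally show ?thesis by (simp add: integrable_restrict_space)
    qed
    have "(LINT x|M. (G x \<bullet> b) * \<psi> x) = (LINT x|M. (H x \<bullet> b) * \<psi> x)"
    proof -
      have "(LINT x|M. u x * (classical_grad \<psi> x \<bullet> b)) = - (LINT x|M. (G x \<bullet> b) * \<psi> x)"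
        using 1 \<psi> b unfolding has_weak_gradient_def by blast
      moreover have "(LINT x|M. u x * (classical_grad \<psi> x \<bullet> b)) = - (LINT x|M. (H x \<bullet> b) * \<psi> x)"
        using 2 \<psi> b unfolding has_weak_gradient_def by blast
      ultimately show ?thesis by simp
    qed
    then show "(LINT x|M. ((G x - H x) \<bullet> b) * \<psi> x) = 0"
      using i[OF li(1)[OF K]] i[OF li(2)[OF K]] by (simp add: inner_diff_left left_diff_distrib)
  qed
  then have "AE x in M. \<forall>b\<in>Basis. (G x - H x) \<bullet> b = 0" by (simp add: AE_ball_countable countable_finite)
  then show ?thesis by eventually_elim (simp add: euclidean_eq_iff[of "G _"] inner_diff_left)
qed

end

subsection \<open>A defining function with integrable negative powers\<close>

lemma nn_integral_lborel_translate:
  fixes f :: "'a::euclidean_space \<Rightarrow> ennreal"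
  assumes "f \<in> borel_measurable borel"
  shows "(\<integral>\<^sup>+x. f (x + c) \<partial>lborel) = (\<integral>\<^sup>+x. f x \<partial>lborel)"
proof -
  have "(\<integral>\<^sup>+x. f x \<partial>distr lborel borel ((+) c)) = (\<integral>\<^sup>+x. f (c + x) \<partial>lborel)"
    by (rule nn_integral_distr) (use assms in auto)
  then show ?thesis by (simp add: lborel_distr_plus add.commute)
qed

text \<open>A translation by \<open>\<tau>\<close> along \<open>e\<close> raises the height over the graph by \<open>\<tau>\<close>. Averaging
  over \<open>0 \<le> \<tau> \<le> 1\<close> reduces the integral to a one-dimensional one, without rotating coordinates.\<close>

lemma nn_integral_height_finite:
  fixes \<delta> :: "'a::euclidean_space \<Rightarrow> real" and e :: 'a
  assumes \<beta>: "0 < \<beta>" "\<beta> < 1" and e: "norm e = 1" and \<delta>: "continuous_on UNIV \<delta>"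
    and shift: "\<And>y \<tau>. \<delta> (y + \<tau> *\<^sub>R e) = \<delta> y + \<tau>"
  shows "(\<integral>\<^sup>+y. indicator (ball x R) y * (ennreal (\<delta> y powr (- \<beta>)) * indicator {0..1} (\<delta> y)) \<partial>lborel) < \<infinity>"
proof -
  define h where "h = (\<lambda>s::real. ennreal (s powr (- \<beta>)) * indicator {0..1} s)"
  define J where "J = (\<integral>\<^sup>+y. indicator (ball x R) y * h (\<delta> y) \<partial>lborel)"
  have bs: "(indicator (ball x r) :: 'a \<Rightarrow> ennreal) \<in> borel_measurable borel" for r
    by (intro borel_measurable_indicator) simp
  have hm [measurable]: "h \<in> borel_measurable borel" unfolding h_def by measurable
  have \<delta>m [measurable]: "\<delta> \<in> borel_measurable borel" using \<delta> by (rule borel_measurable_continuous_onI)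
  have hint: "(\<integral>\<^sup>+s. h s \<partial>lborel) = ennreal (1 / (1 - \<beta>))"
    using nn_integral_has_integral_lebesgue'[OF _ has_integral_powr_from_0[of "- \<beta>" 1]] \<beta>
    by (simp add: h_def)
  \<comment> \<open>The translation has length at most 1, so the ball grows by 1. The left-hand side
    does not depend on \<open>\<tau>\<close>, which makes averaging over \<open>\<tau>\<close> free
    of cost.\<close>
  have step: "J \<le> (\<integral>\<^sup>+y. indicator (ball x (R + 1)) y * h (\<delta> y + \<tau>) \<partial>lborel)" if \<tau>: "\<tau> \<in> {0..1}" for \<tau>
  proof -
    have "J = (\<integral>\<^sup>+y. indicator (ball x R) (y + \<tau> *\<^sub>R e) * h (\<delta> (y + \<tau> *\<^sub>R e)) \<partial>lborel)"
      unfolding J_def by (rule nn_integral_lborel_translate[symmetric])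
        (intro borel_measurable_times_ennreal borel_measurable_indicator measurable_compose[OF \<delta>m hm], simp)
    also have "\<dots> \<le> (\<integral>\<^sup>+y. indicator (ball x (R + 1)) y * h (\<delta> y + \<tau>) \<partial>lborel)"
    proof (rule nn_integral_mono)
      fix y
      have "y \<in> ball x (R + 1)" if "y + \<tau> *\<^sub>R e \<in> ball x R"
      proof -
        have "dist x y \<le> dist x (y + \<tau> *\<^sub>R e) + dist (y + \<tau> *\<^sub>R e) y" by (rule dist_triangle)
        also have "dist (y + \<tau> *\<^sub>R e) y = \<tau>" using \<tau> e by (simp add: dist_norm)
        finally show ?thesis using that \<tau> by simp
      qed
      then show "indicator (ball x R) (y + \<tau> *\<^sub>R e) * h (\<delta> (y + \<tau> *\<^sub>R e)) \<le> indicator (ball x (R + 1)) y * h (\<delta> y + \<tau>)"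
        unfolding shift by (intro mult_right_mono) (auto split: split_indicator)
    qed
    finally show ?thesis .
  qed
  have "J = (\<integral>\<^sup>+\<tau>. J * indicator {0..1::real} \<tau> \<partial>lborel)"
    by (subst nn_integral_cmult_indicator) auto
  also have "\<dots> \<le> (\<integral>\<^sup>+\<tau>. (\<integral>\<^sup>+y. indicator (ball x (R + 1)) y * h (\<delta> y + \<tau>) \<partial>lborel) \<partial>lborel)"
    by (rule nn_integral_mono) (use step in \<open>auto split: split_indicator\<close>)
  also have "\<dots> = (\<integral>\<^sup>+y. (\<integral>\<^sup>+\<tau>. indicator (ball x (R + 1)) y * h (\<delta> y + \<tau>) \<partial>lborel) \<partial>lborel)"
  proof (rule lborel_pair.Fubini')
    have \<delta>l: "\<delta> \<in> borel_measurable lborel" and il: "(indicator (ball x (R + 1)) :: 'a \<Rightarrow> ennreal) \<in> borel_measurable lborel"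
      using \<delta>m by (simp, intro borel_measurable_indicator, simp)
    have a: "(\<lambda>z :: 'a \<times> real. \<delta> (fst z) + snd z) \<in> borel_measurable (lborel \<Otimes>\<^sub>M lborel)"
      by (intro borel_measurable_add measurable_compose[OF measurable_fst \<delta>l]) simp
    show "(\<lambda>(y, \<tau>). indicator (ball x (R + 1)) y * h (\<delta> y + \<tau>)) \<in> borel_measurable (lborel \<Otimes>\<^sub>M lborel)"
      unfolding case_prod_beta
      by (intro borel_measurable_times_ennreal measurable_compose[OF measurable_fst il] measurable_compose[OF a hm])
  qed
  also have "\<dots> = (\<integral>\<^sup>+y. indicator (ball x (R + 1)) y * ennreal (1 / (1 - \<beta>)) \<partial>lborel)"
  proof (rule nn_integral_cong)
    fix y
    have "(\<integral>\<^sup>+\<tau>. h (\<tau> + \<delta> y) \<partial>lborel) = ennreal (1 / (1 - \<beta>))"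
      using nn_integral_lborel_translate[OF hm, of "\<delta> y"] hint by simp
    then show "(\<integral>\<^sup>+\<tau>. indicator (ball x (R + 1)) y * h (\<delta> y + \<tau>) \<partial>lborel) = indicator (ball x (R + 1)) y * ennreal (1 / (1 - \<beta>))"
      by (subst nn_integral_cmult) (auto simp: add.commute)
  qed
  also have "\<dots> = emeasure lborel (ball x (R + 1)) * ennreal (1 / (1 - \<beta>))"
    by (subst nn_integral_multc) (auto simp: bs)
  also have "\<dots> < \<infinity>"
    using emeasure_bounded_finite[of "ball x (R + 1)"] by (simp add: ennreal_mult_less_top)
  finally show ?thesis by (simp add: J_def h_def)
qed

context sobolev
begin

text \<open>The heights \<open>\<delta>\<close> over the local graphs are glued with nonnegative
  cut-offs, not normalised to sum 1. Every summand is nonnegative inside \<open>\<Omega>\<close> and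
  nonpositive outside, so the sign survives the sum. Near each boundary point some cut-off equals 1,
  hence \<open>W\<close> dominates that height and its negative power is bounded by that of the
  height.\<close>

lemma defining_function:
  assumes sb: "smooth_boundary \<Omega>" and \<beta>: "0 < \<beta>" "\<beta> < 1"
  obtains W where "smooth_fun W" "\<And>x. x \<in> \<Omega> \<Longrightarrow> W x > 0" "\<And>x. x \<notin> \<Omega> \<Longrightarrow> W x \<le> 0"
    "integrable M (\<lambda>x. W x powr (- \<beta>))"
proof -
  define P where "P = (\<lambda>x q. fst q > 0 \<and> norm (fst (snd q)) = 1 \<and> smooth_fun (snd (snd q)) \<and>
      \<Omega> \<inter> ball x (fst q) =
        {y \<in> ball x (fst q). y \<bullet> fst (snd q) > snd (snd q) (y - (y \<bullet> fst (snd q)) *\<^sub>R fst (snd q))})"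
  have "\<exists>q. P x q" if x: "x \<in> frontier \<Omega>" for x
  proof -
    obtain r e \<gamma> where "r > 0" "norm e = 1" "smooth_fun \<gamma>"
        "\<Omega> \<inter> ball x r = {y \<in> ball x r. y \<bullet> e > \<gamma> (y - (y \<bullet> e) *\<^sub>R e)}"
      using sb[unfolded smooth_boundary_def, rule_format, OF x] by blast
    then have "P x (r, e, \<gamma>)" by (simp add: P_def)
    then show ?thesis by blast
  qed
  then obtain q where q: "\<And>x. x \<in> frontier \<Omega> \<Longrightarrow> P x (q x)" by metis
  define r e \<gamma> where "r = (\<lambda>x. fst (q x))" and "e = (\<lambda>x. fst (snd (q x)))" and "\<gamma> = (\<lambda>x. snd (snd (q x)))"
  have re: "r x > 0 \<and> norm (e x) = 1 \<and> smooth_fun (\<gamma> x) \<and>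
        \<Omega> \<inter> ball x (r x) = {y \<in> ball x (r x). y \<bullet> e x > \<gamma> x (y - (y \<bullet> e x) *\<^sub>R e x)}"
    if "x \<in> frontier \<Omega>" for x
    using q[OF that] by (simp add: P_def r_def e_def \<gamma>_def)
  define \<delta> where "\<delta> = (\<lambda>x y. y \<bullet> e x - \<gamma> x (y - (y \<bullet> e x) *\<^sub>R e x))"
  have \<delta>s: "smooth_fun (\<delta> x)" if "x \<in> frontier \<Omega>" for x
  proof -
    have L: "bounded_linear (\<lambda>y. y - (y \<bullet> e x) *\<^sub>R e x)"
      by (rule bounded_linear_sub[OF bounded_linear_ident
            bounded_linear_compose[OF bounded_linear_scaleR_left bounded_linear_inner_left]])
    have "smooth_fun (\<gamma> x)" using re[OF that] by blast
    from smooth_fun_diff[OF smooth_fun_bounded_linear[OF bounded_linear_inner_left] smooth_fun_compose_linear[OF L this]]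
    show ?thesis unfolding \<delta>_def .
  qed
  have \<delta>\<Omega>: "y \<in> \<Omega> \<longleftrightarrow> \<delta> x y > 0" if "x \<in> frontier \<Omega>" "y \<in> ball x (r x)" for x y
  proof -
    have "y \<in> \<Omega> \<inter> ball x (r x) \<longleftrightarrow> y \<in> {y \<in> ball x (r x). y \<bullet> e x > \<gamma> x (y - (y \<bullet> e x) *\<^sub>R e x)}"
      using re[OF that(1)] by simp
    then show ?thesis using that(2) by (simp add: \<delta>_def)
  qed
  have \<delta>shift: "\<delta> x (y + \<tau> *\<^sub>R e x) = \<delta> x y + \<tau>" if "x \<in> frontier \<Omega>" for x y \<tau>
  proof -
    have "e x \<bullet> e x = 1" using re[OF that] by (simp add: norm_eq_1)
    then show ?thesis by (simp add: \<delta>_def inner_add_left algebra_simps)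
  qed
  have "\<exists>\<zeta>. \<zeta> \<in> test_functions (ball x (r x)) \<and> (\<forall>y. 0 \<le> \<zeta> y) \<and> (\<forall>y\<in>cball x (r x / 2). \<zeta> y = 1)"
    if "x \<in> frontier \<Omega>" for x
  proof -
    have sub: "cball x (r x / 2) \<subseteq> ball x (r x)" using re[OF that] by (simp add: cball_subset_ball_iff)
    obtain z where "z \<in> test_functions (ball x (r x))" "\<And>y. 0 \<le> z y" "\<And>y. z y \<le> 1" "\<And>y. y \<in> cball x (r x / 2) \<Longrightarrow> z y = 1"
      by (rule smooth_cutoff[OF compact_cball open_ball sub], rule that, assumption+)
    then show ?thesis by blast
  qed
  then obtain \<zeta> where \<zeta>: "\<And>x. x \<in> frontier \<Omega> \<Longrightarrow> \<zeta> x \<in> test_functions (ball x (r x)) \<and> (\<forall>y. 0 \<le> \<zeta> x y) \<and> (\<forall>y\<in>cball x (r x / 2). \<zeta> x y = 1)"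
    by metis
  have cf: "compact (frontier \<Omega>)" using bounded_\<Omega> by (rule compact_frontier_bounded)
  obtain C where C: "C \<subseteq> frontier \<Omega>" "finite C" "frontier \<Omega> \<subseteq> (\<Union>x\<in>C. ball x (r x / 2))"
  proof (rule compactE_image[OF cf, of "frontier \<Omega>" "\<lambda>x. ball x (r x / 2)"])
    show "frontier \<Omega> \<subseteq> (\<Union>x\<in>frontier \<Omega>. ball x (r x / 2))" using re by force
  qed auto
  \<comment> \<open>The half-balls cover the boundary, so what remains of the closure is a compact
    subset of \<open>\<Omega>\<close>; the cut-off \<open>\<zeta>0\<close> lifts \<open>W\<close> to
    at least 1 there.\<close>
  define K0 where "K0 = closure \<Omega> - (\<Union>x\<in>C. ball x (r x / 2))"
  have K0: "compact K0" unfolding K0_def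
    by (rule compact_diff) (use bounded_\<Omega> in \<open>auto simp: compact_closure\<close>)
  have K0\<Omega>: "K0 \<subseteq> \<Omega>" using C(3) closure_Un_frontier[of \<Omega>] unfolding K0_def by blast
  obtain \<zeta>0 where \<zeta>0: "\<zeta>0 \<in> test_functions \<Omega>" "\<And>x. 0 \<le> \<zeta>0 x" "\<And>x. x \<in> K0 \<Longrightarrow> \<zeta>0 x = 1"
    using smooth_cutoff[OF K0 open_\<Omega> K0\<Omega>] by metis
  define W where "W = (\<lambda>y. (\<Sum>x\<in>C. \<zeta> x y * \<delta> x y) + \<zeta>0 y)"
  have Ws: "smooth_fun W" unfolding W_def
    by (intro smooth_fun_add smooth_fun_sum smooth_fun_mult test_smooth[OF \<zeta>0(1)] \<delta>s) (use \<zeta> C test_smooth in blast)+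
  have term_pos: "0 \<le> \<zeta> x y * \<delta> x y" if "x \<in> C" "y \<in> \<Omega>" for x y
  proof (cases "y \<in> ball x (r x)")
    case True
    then show ?thesis using \<delta>\<Omega>[of x y] \<zeta> C that by (auto simp: subset_iff less_imp_le)
  next
    case False
    then show ?thesis using \<zeta>[of x] C that test_vanish(1)[of "\<zeta> x" "ball x (r x)" y] by auto
  qed
  have W_ge: "W y \<ge> \<delta> x y" if "x \<in> C" "y \<in> \<Omega>" "y \<in> ball x (r x / 2)" for x y
  proof -
    have "\<zeta> x y * \<delta> x y \<le> (\<Sum>x\<in>C. \<zeta> x y * \<delta> x y)"
      by (rule member_le_sum) (use C that term_pos in auto)
    moreover have "\<zeta> x y = 1" using \<zeta> C that by auto
    ultimately show ?thesis using \<zeta>0(2)[of y] by (simp add: W_def)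
  qed
  have W_ge1: "W y \<ge> 1" if "y \<in> K0" for y
  proof -
    have "0 \<le> (\<Sum>x\<in>C. \<zeta> x y * \<delta> x y)" by (rule sum_nonneg) (use term_pos K0\<Omega> that in auto)
    then show ?thesis using \<zeta>0(3)[OF that] by (simp add: W_def)
  qed
  have \<Omega>_cases: "y \<in> K0 \<or> (\<exists>x\<in>C. y \<in> ball x (r x / 2))" if "y \<in> \<Omega>" for y
    using that closure_subset unfolding K0_def by blast
  have half: "y \<in> ball x (r x)" if "y \<in> ball x (r x / 2)" "x \<in> C" for x y
  proof -
    have "r x > 0" using re[of x] C(1) that(2) by auto
    then show ?thesis using that(1) by auto
  qed
  have Wpos: "W y > 0" if "y \<in> \<Omega>" for y
    using \<Omega>_cases[OF that]
  proof
    assume "y \<in> K0" then show ?thesis using W_ge1[of y] by linarith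
  next
    assume "\<exists>x\<in>C. y \<in> ball x (r x / 2)"
    then obtain x where x: "x \<in> C" "y \<in> ball x (r x / 2)" by blast
    then have "\<delta> x y > 0" using \<delta>\<Omega>[of x y] half that C(1) by blast
    then show ?thesis using W_ge[OF x(1) that x(2)] by linarith
  qed
  have Wneg: "W y \<le> 0" if "y \<notin> \<Omega>" for y
  proof -
    have "\<zeta> x y * \<delta> x y \<le> 0" if x: "x \<in> C" for x
    proof (cases "y \<in> ball x (r x)")
      case True
      then have "\<not> \<delta> x y > 0" using \<delta>\<Omega>[of x y] \<open>y \<notin> \<Omega>\<close> x C by blast
      moreover have "\<zeta> x y \<ge> 0" using \<zeta> x C by blast
      ultimately show ?thesis by (simp add: mult_nonneg_nonpos)
    next
      case False
      then show ?thesis using \<zeta>[of x] C x test_vanish(1)[of "\<zeta> x" "ball x (r x)" y] by auto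
    qed
    then have "(\<Sum>x\<in>C. \<zeta> x y * \<delta> x y) \<le> 0" by (rule sum_nonpos)
    then show ?thesis using test_vanish(1)[OF \<zeta>0(1) that] by (simp add: W_def)
  qed
  define F where "F = (\<lambda>x y. indicator (ball x (r x / 2)) y * (ennreal (\<delta> x y powr (- \<beta>)) * indicator {0..1} (\<delta> x y)))"
  have Fm [measurable]: "F x \<in> borel_measurable borel" if "x \<in> C" for x
  proof -
    have h: "(\<lambda>s::real. ennreal (s powr (- \<beta>)) * indicator {0..1} s) \<in> borel_measurable borel" by measurable
    have m: "\<delta> x \<in> borel_measurable borel"
      using smooth_fun_continuous[OF \<delta>s] C(1) that by (intro borel_measurable_continuous_onI) auto
    show ?thesis unfolding F_def
      by (rule borel_measurable_times_ennreal[OF _ measurable_compose[OF m h]]) (intro borel_measurable_indicator, simp)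
  qed
  have Ffin: "(\<integral>\<^sup>+y. F x y \<partial>lborel) < \<infinity>" if "x \<in> C" for x
    unfolding F_def
    by (rule nn_integral_height_finite[where e="e x"]) (use \<beta> re smooth_fun_continuous[OF \<delta>s] \<delta>shift C(1) that in blast)+
  \<comment> \<open>Where \<open>W y < 1\<close>, the point lies in a half-ball with
    \<open>0 < \<delta> x y \<le> W y < 1\<close>, so its height falls into the range to which
    \<open>F\<close> is cut off. Elsewhere the power is at most 1.\<close>
  have bound: "ennreal (W y powr (- \<beta>)) \<le> (\<Sum>x\<in>C. F x y) + 1" if y: "y \<in> \<Omega>" for y
  proof (cases "W y \<ge> 1")
    case True
    have "W y powr (- \<beta>) \<le> W y powr 0" using True \<beta> by (intro powr_mono) auto
    then have "ennreal (W y powr (- \<beta>)) \<le> ennreal 1" using True by (intro ennreal_leI) simp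
    then show ?thesis by (simp add: add_increasing)
  next
    case False
    then obtain x where x: "x \<in> C" "y \<in> ball x (r x / 2)" using \<Omega>_cases[OF y] W_ge1 by blast
    have d: "0 < \<delta> x y" "\<delta> x y \<le> W y" using W_ge[OF x(1) y x(2)] \<delta>\<Omega>[of x y] half x y C(1) by blast+
    have "W y powr (- \<beta>) \<le> \<delta> x y powr (- \<beta>)" using d \<beta> by (intro powr_mono2') auto
    then have "ennreal (W y powr (- \<beta>)) \<le> F x y" using d False x by (simp add: F_def ennreal_leI)
    also have "\<dots> \<le> (\<Sum>x\<in>C. F x y)" by (rule member_le_sum) (use C x in auto)
    finally show ?thesis by (simp add: add_increasing2)
  qed
  have int: "integrable M (\<lambda>x. W x powr (- \<beta>))"
  proof (rule integrableI_nonneg)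
    show "(\<lambda>x. W x powr (- \<beta>)) \<in> borel_measurable M"
      using cont_measurable[OF smooth_fun_continuous[OF Ws]] by measurable
    have "(\<integral>\<^sup>+x. ennreal (W x powr (- \<beta>)) \<partial>M) = (\<integral>\<^sup>+x. ennreal (W x powr (- \<beta>)) * indicator \<Omega> x \<partial>lebesgue)"
      by (rule nn_integral_restrict_space) simp
    also have "\<dots> = (\<integral>\<^sup>+x. ennreal (W x powr (- \<beta>)) * indicator \<Omega> x \<partial>lborel)" by (rule nn_integral_completion)
    also have "\<dots> \<le> (\<integral>\<^sup>+y. (\<Sum>x\<in>C. F x y) + indicator \<Omega> y \<partial>lborel)"
    proof (rule nn_integral_mono)
      fix y show "ennreal (W y powr (- \<beta>)) * indicator \<Omega> y \<le> (\<Sum>x\<in>C. F x y) + indicator \<Omega> y"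
        using bound[of y] by (cases "y \<in> \<Omega>") auto
    qed
    also have "\<dots> = (\<integral>\<^sup>+y. (\<Sum>x\<in>C. F x y) \<partial>lborel) + emeasure lborel \<Omega>"
      using open_\<Omega> by (subst nn_integral_add) auto
    also have "(\<integral>\<^sup>+y. (\<Sum>x\<in>C. F x y) \<partial>lborel) = (\<Sum>x\<in>C. \<integral>\<^sup>+y. F x y \<partial>lborel)"
      by (rule nn_integral_sum) auto
    also have "(\<Sum>x\<in>C. \<integral>\<^sup>+y. F x y \<partial>lborel) + emeasure lborel \<Omega> < \<infinity>"
      using Ffin emeasure_bounded_finite[OF bounded_\<Omega>] C(2) by (auto simp: ennreal_sum_less_top less_top)
    finally show "(\<integral>\<^sup>+x. ennreal (W x powr (- \<beta>)) \<partial>M) < \<infinity>" .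
  qed simp
  show ?thesis using that Ws Wpos Wneg int by blast
qed

text \<open>The truncations \<open>soft_pos k \<circ> W\<close> are test functions converging to \<open>W\<close>.\<close>

lemma jet_defining_function_W0:
  assumes W: "smooth_fun W" "\<And>x. x \<in> \<Omega> \<Longrightarrow> W x > 0" "\<And>x. x \<notin> \<Omega> \<Longrightarrow> W x \<le> 0"
  shows "jet W \<in> W0"
proof -
  obtain C where C: "C \<ge> 0" "\<And>k t. \<bar>deriv (soft_pos k) t\<bar> \<le> C" using deriv_soft_pos_bounded by blast
  let ?S = "\<lambda>n. soft_pos (real (Suc n))"
  have test: "(\<lambda>x. ?S n (W x)) \<in> test_functions \<Omega>" for n
  \<comment> \<open>Intersecting with the closure gives compactness, and the bound from below on
    \<open>W\<close> keeps the set inside \<open>\<Omega>\<close>, because \<open>W \<le> 0\<close>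
    outside.\<close>
  proof (rule test_functionsI[where K="closure \<Omega> \<inter> {x. W x \<ge> 1 / real (Suc n)}"])
    show "smooth_fun (\<lambda>x. ?S n (W x))" by (rule smooth_fun_compose_real[OF smooth_soft_pos W(1)])
    show "compact (closure \<Omega> \<inter> {x. W x \<ge> 1 / real (Suc n)})"
      using bounded_\<Omega>
      by (intro compact_Int_closed closed_Collect_le continuous_on_const smooth_fun_continuous[OF W(1)])
         (simp add: compact_closure)
    show "closure \<Omega> \<inter> {x. W x \<ge> 1 / real (Suc n)} \<subseteq> \<Omega>"
    proof
      fix x assume "x \<in> closure \<Omega> \<inter> {x. W x \<ge> 1 / real (Suc n)}"
      then have "W x > 0" by (auto intro: less_le_trans[of 0 "1 / real (Suc n)"])
      then show "x \<in> \<Omega>" using W(3)[of x] by force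
    qed
    fix x assume x: "x \<notin> closure \<Omega> \<inter> {x. W x \<ge> 1 / real (Suc n)}"
    show "?S n (W x) = 0"
    proof (cases "W x \<le> 0")
      case True then show ?thesis by (simp add: soft_pos_0)
    next
      case False
      then have "x \<in> \<Omega>" using W(3) by blast
      then have "\<not> W x \<ge> 1 / real (Suc n)" using x closure_subset by blast
      then have "real (Suc n) * W x \<le> 1" by (simp add: field_simps)
      then show ?thesis by (simp add: soft_pos_def smooth_step_0)
    qed
  qed
  have js: "jet (\<lambda>x. ?S n (W x)) x = (?S n (W x), deriv (?S n) (W x) *\<^sub>R classical_grad W x)" for n x
    by (simp add: jet_def grad_compose_real[OF smooth_soft_pos W(1)])
  have "compact (jet W ` closure \<Omega>)"
    using bounded_\<Omega> continuous_on_subset[OF continuous_jet[OF W(1)]]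
    by (intro compact_continuous_image) (auto simp: compact_closure)
  then obtain B where B: "\<And>x. x \<in> closure \<Omega> \<Longrightarrow> norm (jet W x) \<le> B"
    using compact_imp_bounded bounded_iff by (metis imageI)
  show ?thesis
  proof (rule W0_dominated[where V="\<lambda>n. jet (\<lambda>x. ?S n (W x))" and g="\<lambda>x. (1 + C) * B"])
    show "jet (\<lambda>x. ?S n (W x)) \<in> W0" for n by (rule jet_W0[OF test])
    show "(\<lambda>x. (1 + C) * B) \<in> Lp_space M p" by (rule Lp_bounded[where B="norm ((1 + C) * B)"]) auto
    show "AE x in M. norm (jet (\<lambda>x. ?S n (W x)) x) \<le> (1 + C) * B" for n
    proof (rule AE_I2)
      fix x assume "x \<in> space M"
      then have x: "x \<in> \<Omega>" by simp
      have jB: "norm (jet W x) \<le> B" using B x closure_subset by blast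
      have "norm (jet (\<lambda>x. ?S n (W x)) x) \<le> \<bar>?S n (W x)\<bar> + \<bar>deriv (?S n) (W x)\<bar> * norm (classical_grad W x)"
        unfolding js using norm_Pair_le[of "?S n (W x)" "deriv (?S n) (W x) *\<^sub>R classical_grad W x"] by simp
      also have "\<dots> \<le> \<bar>W x\<bar> + C * norm (classical_grad W x)"
        using soft_pos_nonneg[of "real (Suc n)" "W x"] soft_pos_le[of "real (Suc n)" "W x"] C
        by (intro add_mono mult_right_mono) auto
      also have "\<dots> \<le> B + C * B"
        using norm_fst_le_norm[of "jet W x"] norm_snd_le_norm[of "jet W x"] jB C(1)
        by (intro add_mono mult_left_mono) (auto simp: jet_def)
      finally show "norm (jet (\<lambda>x. ?S n (W x)) x) \<le> (1 + C) * B" by (simp add: algebra_simps)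
    qed
    show "jet W \<in> borel_measurable M" by (rule cont_measurable[OF continuous_jet[OF W(1)]])
    show "AE x in M. (\<lambda>n. jet (\<lambda>x. ?S n (W x)) x) \<longlonglongrightarrow> jet W x"
    proof (rule AE_I2)
      fix x assume "x \<in> space M"
      then have "W x > 0" using W(2) by simp
      then have "(\<lambda>n. ?S n (W x)) \<longlonglongrightarrow> W x" "(\<lambda>n. deriv (?S n) (W x)) \<longlonglongrightarrow> 1"
        using soft_pos_tendsto[of "W x"] by (auto simp: max_def)
      then have "(\<lambda>n. (?S n (W x), deriv (?S n) (W x) *\<^sub>R classical_grad W x)) \<longlonglongrightarrow> (W x, 1 *\<^sub>R classical_grad W x)"
        by (intro tendsto_Pair tendsto_scaleR tendsto_const)
      then show "(\<lambda>n. jet (\<lambda>x. ?S n (W x)) x) \<longlonglongrightarrow> jet W x" unfolding js by (simp add: jet_def)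
    qed
  qed
qed

end

subsection \<open>Minimisation of the singular energy\<close>

lemma powr_neg_tangent:
  fixes s t \<beta> :: real assumes st: "s > 0" "t > 0" and \<beta>: "\<beta> > 0"
  shows "t powr (- \<beta>) \<ge> s powr (- \<beta>) - \<beta> * s powr (- \<beta> - 1) * (t - s)"
proof -
  have D: "((\<lambda>x. x powr (- \<beta>)) has_real_derivative - \<beta> * x powr (- \<beta> - 1)) (at x)" if "x > 0" for x
    using has_real_derivative_powr that by blast
  consider "t = s" | "t > s" | "t < s" by linarith
  then show ?thesis
  proof cases
    case 1 then show ?thesis by simp
  next
    case 2
    obtain c where c: "s < c" "c < t" "t powr (- \<beta>) - s powr (- \<beta>) = (t - s) * (- \<beta> * c powr (- \<beta> - 1))"
      using MVT2[of s t "\<lambda>x. x powr (- \<beta>)" "\<lambda>x. - \<beta> * x powr (- \<beta> - 1)"] D 2 st by auto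
    have "c powr (- \<beta> - 1) \<le> s powr (- \<beta> - 1)" using c st \<beta> by (intro powr_mono2') auto
    then have "(t - s) * (\<beta> * c powr (- \<beta> - 1)) \<le> (t - s) * (\<beta> * s powr (- \<beta> - 1))"
      using 2 \<beta> by (intro mult_left_mono) auto
    then show ?thesis using c(3) by (simp add: algebra_simps)
  next
    case 3
    obtain c where c: "t < c" "c < s" "s powr (- \<beta>) - t powr (- \<beta>) = (s - t) * (- \<beta> * c powr (- \<beta> - 1))"
      using MVT2[of t s "\<lambda>x. x powr (- \<beta>)" "\<lambda>x. - \<beta> * x powr (- \<beta> - 1)"] D 3 st by auto
    have "s powr (- \<beta> - 1) \<le> c powr (- \<beta> - 1)" using c st \<beta> by (intro powr_mono2') auto
    then have "(s - t) * (\<beta> * s powr (- \<beta> - 1)) \<le> (s - t) * (\<beta> * c powr (- \<beta> - 1))"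
      using 3 \<beta> by (intro mult_left_mono) auto
    then show ?thesis using c(3) by (simp add: algebra_simps)
  qed
qed

text \<open>The tangent inequalities at the midpoint are averaged; their linear terms
  cancel.\<close>

lemma powr_neg_midpoint:
  fixes s t \<beta> :: real assumes st: "s > 0" "t > 0" and \<beta>: "\<beta> > 0"
  shows "((s + t) / 2) powr (- \<beta>) \<le> (s powr (- \<beta>) + t powr (- \<beta>)) / 2"
proof -
  define m q where "m = (s + t) / 2" and "q = \<beta> * m powr (- \<beta> - 1)"
  have m: "m > 0" using st by (simp add: m_def)
  have "q * (s - m) + q * (t - m) = q * ((s - m) + (t - m))" by (simp only: distrib_left)
  also have "(s - m) + (t - m) = 0" by (simp add: m_def)
  finally have "q * (s - m) + q * (t - m) = 0" by simp
  moreover have "a \<le> (b + c) / 2" if "X + Y = 0" "a - X \<le> b" "a - Y \<le> c" for a b c X Y :: real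
  proof -
    have "a * 2 \<le> b + c" using add_mono[OF that(2,3)] that(1) by (simp add: algebra_simps)
    then show ?thesis by simp
  qed
  ultimately show ?thesis
    using powr_neg_tangent[OF m st(1) \<beta>] powr_neg_tangent[OF m st(2) \<beta>]
    unfolding q_def[symmetric] m_def[symmetric] by blast
qed

locale singular_problem = sobolev +
  fixes \<alpha> :: real and f :: "'a \<Rightarrow> real"
  assumes \<alpha>1: "1 < \<alpha>" and \<alpha>2: "\<alpha> < 2"
    and f_meas [measurable]: "f \<in> borel_measurable M"
    and f_bound: "\<exists>B. AE x in M. \<bar>f x\<bar> \<le> B"
    and f_nonneg: "AE x in M. f x \<ge> 0"
    and f_nonzero: "\<not> (AE x in M. f x = 0)"
    and boundary: "smooth_boundary \<Omega>"
begin

definition dens :: "'a \<Rightarrow> real \<times> 'a \<Rightarrow> real" where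
  "dens x z = penergy p z / p + f x * fst z powr (1 - \<alpha>) / (\<alpha> - 1)"

text \<open>Since \<open>0 powr a = 0\<close>, the conditions on positivity encode that the singular term is \<open>\<infinity>\<close> where
  \<open>u = 0 < f\<close>.\<close>

definition adm :: "('a \<Rightarrow> real \<times> 'a) set" where
  "adm = {U \<in> W0. (AE x in M. fst (U x) \<ge> 0) \<and> (AE x in M. f x > 0 \<longrightarrow> fst (U x) > 0) \<and>
     integrable M (\<lambda>x. f x * fst (U x) powr (1 - \<alpha>))}"

definition energy :: "('a \<Rightarrow> real \<times> 'a) \<Rightarrow> real" where
  "energy U = (LINT x|M. dens x (U x))"

lemma penergy_integrable:
  fixes U :: "'a \<Rightarrow> real \<times> 'a"
  assumes "U \<in> Lp_space M p" shows "integrable M (\<lambda>x. penergy p (U x))"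
proof (rule Bochner_Integration.integrable_bound)
  show "integrable M (\<lambda>x. 2 * norm (U x) powr p)" using Lp_integrable[OF assms] by simp
  show "(\<lambda>x. penergy p (U x)) \<in> borel_measurable M"
    by (rule borel_measurable_continuous_on[OF continuous_on_penergy[OF p] Lp_measurable[OF assms]])
  have "penergy p z \<le> 2 * norm z powr p" for z :: "real \<times> 'a" by (rule penergy_le) (use p in simp)
  then show "AE x in M. norm (penergy p (U x)) \<le> norm (2 * norm (U x) powr p)" by simp
qed

lemma adm_W0: "U \<in> adm \<Longrightarrow> U \<in> W0" by (simp add: adm_def)

lemma dens_integrable: "U \<in> adm \<Longrightarrow> integrable M (\<lambda>x. dens x (U x))"
  unfolding dens_def using penergy_integrable[OF W0_Lp[OF adm_W0]] by (simp add: adm_def)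

lemma dens_nonneg: "f x \<ge> 0 \<Longrightarrow> dens x z \<ge> 0"
  using \<alpha>1 p by (simp add: dens_def)

lemma energy_nonneg: "0 \<le> energy U"
  unfolding energy_def
proof (rule integral_nonneg_AE)
  show "AE x in M. 0 \<le> dens x (U x)" using f_nonneg by eventually_elim (rule dens_nonneg)
qed

text \<open>The exponent \<open>\<alpha> - 1\<close> lies strictly between 0 and 1, so the defining
  function has an integrable power of exponent \<open>1 - \<alpha>\<close>; boundedness of
  \<open>f\<close> then makes its jet a competitor of finite energy.\<close>

lemma adm_nonempty: "adm \<noteq> {}"
proof -
  obtain W where W: "smooth_fun W" "\<And>x. x \<in> \<Omega> \<Longrightarrow> W x > 0" "\<And>x. x \<notin> \<Omega> \<Longrightarrow> W x \<le> 0"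
    "integrable M (\<lambda>x. W x powr (- (\<alpha> - 1)))"
    using defining_function[OF boundary, of "\<alpha> - 1"] \<alpha>1 \<alpha>2 by auto
  obtain B where B: "AE x in M. \<bar>f x\<bar> \<le> B" using f_bound by blast
  have "integrable M (\<lambda>x. f x * W x powr (1 - \<alpha>))"
  proof (rule Bochner_Integration.integrable_bound)
    show "integrable M (\<lambda>x. B * W x powr (1 - \<alpha>))" using W(4) by simp
    show "(\<lambda>x. f x * W x powr (1 - \<alpha>)) \<in> borel_measurable M" using W(4) f_meas by simp
    show "AE x in M. norm (f x * W x powr (1 - \<alpha>)) \<le> norm (B * W x powr (1 - \<alpha>))"
      using B by eventually_elim (auto simp: abs_mult intro!: mult_right_mono)
  qed
  moreover have "AE x in M. W x > 0" using W(2) by (intro AE_I2) simp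
  ultimately have "jet W \<in> adm" using jet_defining_function_W0[OF W(1,2,3)]
    by (auto simp: adm_def jet_def elim: eventually_mono)
  then show ?thesis by blast
qed

text \<open>The singular term is convex as well, so at midpoints it only adds to the convexity
  defect: the defect of \<open>dens\<close> controls that of the \<open>p\<close>-energy, with the
  factor \<open>p\<close> undoing the normalisation \<open>1/p\<close>.\<close>

lemma adm_midpoint:
  assumes U: "U \<in> adm" and V: "V \<in> adm"
  shows "(\<lambda>x. (1/2) *\<^sub>R (U x + V x)) \<in> adm"
    and "AE x in M. (penergy p (U x) + penergy p (V x)) / 2 - penergy p ((1/2) *\<^sub>R (U x + V x))
      \<le> p * ((dens x (U x) + dens x (V x)) / 2 - dens x ((1/2) *\<^sub>R (U x + V x)))"
proof -
  let ?m = "\<lambda>x. (1/2) *\<^sub>R (U x + V x)"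
  have W: "?m \<in> W0" by (intro W0_scaleR W0_add adm_W0 U V)
  have ae: "AE x in M. fst (U x) \<ge> 0 \<and> fst (V x) \<ge> 0 \<and> f x \<ge> 0 \<and> (f x > 0 \<longrightarrow> fst (U x) > 0 \<and> fst (V x) > 0)"
  proof -
    have "AE x in M. fst (U x) \<ge> 0" "AE x in M. f x > 0 \<longrightarrow> fst (U x) > 0"
      "AE x in M. fst (V x) \<ge> 0" "AE x in M. f x > 0 \<longrightarrow> fst (V x) > 0" using U V by (auto simp: adm_def)
    then show ?thesis using f_nonneg by eventually_elim auto
  qed
  have le: "AE x in M. f x * fst (?m x) powr (1 - \<alpha>) \<le> (f x * fst (U x) powr (1 - \<alpha>) + f x * fst (V x) powr (1 - \<alpha>)) / 2"
    using ae
  proof eventually_elim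
    fix x assume *: "fst (U x) \<ge> 0 \<and> fst (V x) \<ge> 0 \<and> f x \<ge> 0 \<and> (f x > 0 \<longrightarrow> fst (U x) > 0 \<and> fst (V x) > 0)"
    show "f x * fst (?m x) powr (1 - \<alpha>) \<le> (f x * fst (U x) powr (1 - \<alpha>) + f x * fst (V x) powr (1 - \<alpha>)) / 2"
    proof (cases "f x > 0")
      case True
      have "((fst (U x) + fst (V x)) / 2) powr (- (\<alpha> - 1)) \<le> (fst (U x) powr (- (\<alpha> - 1)) + fst (V x) powr (- (\<alpha> - 1))) / 2"
        by (rule powr_neg_midpoint) (use * True \<alpha>1 in auto)
      then have "f x * ((fst (U x) + fst (V x)) / 2) powr (1 - \<alpha>) \<le> f x * ((fst (U x) powr (1 - \<alpha>) + fst (V x) powr (1 - \<alpha>)) / 2)"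
        using True by (intro mult_left_mono) auto
      moreover have "fst (?m x) = (fst (U x) + fst (V x)) / 2" by (simp add: add_divide_distrib)
      ultimately show ?thesis by (simp only: distrib_left times_divide_eq_right)
    next
      case False
      then have "f x = 0" using * by simp
      then show ?thesis by simp
    qed
  qed
  have int: "integrable M (\<lambda>x. f x * fst (?m x) powr (1 - \<alpha>))"
  proof (rule Bochner_Integration.integrable_bound)
    show "integrable M (\<lambda>x. (f x * fst (U x) powr (1 - \<alpha>) + f x * fst (V x) powr (1 - \<alpha>)) / 2)"
      using U V by (simp add: adm_def)
    show "(\<lambda>x. f x * fst (?m x) powr (1 - \<alpha>)) \<in> borel_measurable M"
      using W0_fst_measurable[OF W] f_meas by measurable
    show "AE x in M. norm (f x * fst (?m x) powr (1 - \<alpha>)) \<le> norm ((f x * fst (U x) powr (1 - \<alpha>) + f x * fst (V x) powr (1 - \<alpha>)) / 2)"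
      using le ae by eventually_elim (auto simp: abs_mult)
  qed
  have "AE x in M. 0 \<le> fst (?m x)" using ae by eventually_elim simp
  moreover have "AE x in M. 0 < f x \<longrightarrow> 0 < fst (?m x)" using ae by eventually_elim auto
  ultimately show "?m \<in> adm" unfolding adm_def using W int by blast
  show "AE x in M. (penergy p (U x) + penergy p (V x)) / 2 - penergy p (?m x)
      \<le> p * ((dens x (U x) + dens x (V x)) / 2 - dens x (?m x))"
    using le
  proof eventually_elim
    fix x assume *: "f x * fst (?m x) powr (1 - \<alpha>) \<le> (f x * fst (U x) powr (1 - \<alpha>) + f x * fst (V x) powr (1 - \<alpha>)) / 2"
    define a b c where "a = f x * fst (?m x) powr (1 - \<alpha>)" and "b = f x * fst (U x) powr (1 - \<alpha>)" and "c = f x * fst (V x) powr (1 - \<alpha>)"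
    have "p * ((dens x (U x) + dens x (V x)) / 2 - dens x (?m x)) =
      (penergy p (U x) + penergy p (V x)) / 2 - penergy p (?m x) + p * (((b + c) / 2 - a) / (\<alpha> - 1))"
    proof -
      have alg: "p * ((K / p + b / q + (L / p + c / q)) / 2 - (N / p + a / q)) = (K + L) / 2 - N + p * (((b + c) / 2 - a) / q)"
        if "q \<noteq> 0" for K L N q :: real
        using p that by (simp add: field_simps)
      show ?thesis unfolding dens_def a_def[symmetric] b_def[symmetric] c_def[symmetric]
        by (rule alg) (use \<alpha>1 in simp)
    qed
    moreover have "0 \<le> p * (((b + c) / 2 - a) / (\<alpha> - 1))" using * p \<alpha>1 by (simp add: a_def b_def c_def)
    ultimately show "(penergy p (U x) + penergy p (V x)) / 2 - penergy p (?m x)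
      \<le> p * ((dens x (U x) + dens x (V x)) / 2 - dens x (?m x))" by linarith
  qed
qed

lemma LINT_penergy_le_energy:
  assumes "U \<in> adm" shows "(LINT x|M. penergy p (U x)) \<le> p * energy U"
proof -
  have "(LINT x|M. penergy p (U x)) \<le> (LINT x|M. p * dens x (U x))"
  proof (rule integral_mono_AE)
    show "AE x in M. penergy p (U x) \<le> p * dens x (U x)"
      using f_nonneg
    proof eventually_elim
      fix x assume "0 \<le> f x"
      then have "0 \<le> p * (f x * fst (U x) powr (1 - \<alpha>) / (\<alpha> - 1))" using p \<alpha>1 by simp
      then show "penergy p (U x) \<le> p * dens x (U x)" using p by (simp add: dens_def distrib_left)
    qed
  qed (use penergy_integrable[OF W0_Lp[OF adm_W0[OF assms]]] dens_integrable[OF assms] in auto)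
  then show ?thesis by (simp add: energy_def)
qed

text \<open>Uniform convexity integrated over \<open>\<Omega>\<close>. The midpoint is admissible,
  so its energy is at least \<open>m\<close>, and the distance is controlled by the excess of the
  two energies over \<open>m\<close> up to a small multiple of the energies.\<close>

lemma adm_dist_le:
  assumes C: "C \<ge> 0" "\<And>z w :: real \<times> 'a. norm (z - w) powr p \<le>
     \<epsilon> * (penergy p z + penergy p w) + C * ((penergy p z + penergy p w) / 2 - penergy p ((1/2) *\<^sub>R (z + w)))"
    and U: "U \<in> adm" and V: "V \<in> adm" and m: "\<And>V. V \<in> adm \<Longrightarrow> m \<le> energy V" and \<epsilon>: "\<epsilon> \<ge> 0"
  shows "Lp_dist M p U V \<le> \<epsilon> * (p * (energy U + energy V)) + C * (p * ((energy U + energy V) / 2 - m))"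
proof -
  let ?m = "\<lambda>x. (1/2) *\<^sub>R (U x + V x)"
  note mid = adm_midpoint[OF U V]
  note pi = penergy_integrable[OF W0_Lp[OF adm_W0]]
  have p0: "0 \<le> p" using p by simp
  have "Lp_dist M p U V \<le> (LINT x|M. \<epsilon> * (penergy p (U x) + penergy p (V x)) + C * (p * ((dens x (U x) + dens x (V x)) / 2 - dens x (?m x))))"
    unfolding Lp_dist_def
  proof (rule integral_mono_AE)
    show "integrable M (\<lambda>x. norm (U x - V x) powr p)"
      by (rule Lp_integrable[OF Lp_diff[OF W0_Lp[OF adm_W0[OF U]] W0_Lp[OF adm_W0[OF V]] p0]])
    show "integrable M (\<lambda>x. \<epsilon> * (penergy p (U x) + penergy p (V x)) + C * (p * ((dens x (U x) + dens x (V x)) / 2 - dens x (?m x))))"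
      using pi[OF U] pi[OF V] dens_integrable[OF U] dens_integrable[OF V] dens_integrable[OF mid(1)] by simp
    show "AE x in M. norm (U x - V x) powr p \<le> \<epsilon> * (penergy p (U x) + penergy p (V x)) + C * (p * ((dens x (U x) + dens x (V x)) / 2 - dens x (?m x)))"
      using mid(2)
    proof eventually_elim
      fix x assume "(penergy p (U x) + penergy p (V x)) / 2 - penergy p (?m x)
      \<le> p * ((dens x (U x) + dens x (V x)) / 2 - dens x (?m x))"
      from mult_left_mono[OF this C(1)] C(2)[of "U x" "V x"]
      show "norm (U x - V x) powr p \<le> \<epsilon> * (penergy p (U x) + penergy p (V x)) + C * (p * ((dens x (U x) + dens x (V x)) / 2 - dens x (?m x)))"
        by linarith
    qed
  qed
  also have "\<dots> = \<epsilon> * ((LINT x|M. penergy p (U x)) + (LINT x|M. penergy p (V x))) + C * (p * ((energy U + energy V) / 2 - energy ?m))"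
    unfolding energy_def
    using pi[OF U] pi[OF V] dens_integrable[OF U] dens_integrable[OF V] dens_integrable[OF mid(1)] by simp
  also have "\<dots> \<le> \<epsilon> * (p * (energy U + energy V)) + C * (p * ((energy U + energy V) / 2 - m))"
    using LINT_penergy_le_energy[OF U] LINT_penergy_le_energy[OF V] m[OF mid(1)] \<epsilon> C(1) p
    by (intro add_mono mult_left_mono) (auto simp: distrib_left)
  finally show ?thesis .
qed

lemma minimizing_sequence_Cauchy:
  assumes U: "\<And>n. U n \<in> adm" and m: "\<And>V. V \<in> adm \<Longrightarrow> m \<le> energy V"
    and lim: "(\<lambda>n. energy (U n)) \<longlonglongrightarrow> m" and e: "e > 0"
  shows "\<exists>N. \<forall>i\<ge>N. \<forall>k\<ge>N. Lp_dist M p (U i) (U k) < e"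
proof -
  have m0: "0 \<le> m" using lim energy_nonneg by (metis LIMSEQ_le_const)
  \<comment> \<open>Two energies below \<open>m + 1\<close> then contribute exactly
    \<open>e / 2\<close> through the first term of \<open>adm_dist_le\<close>.\<close>
  define \<epsilon> where "\<epsilon> = e / (4 * p * (m + 1))"
  have \<epsilon>: "\<epsilon> > 0" using e p m0 by (simp add: \<epsilon>_def)
  obtain C where C: "C \<ge> 0" "\<And>z w :: real \<times> 'a. norm (z - w) powr p \<le>
     \<epsilon> * (penergy p z + penergy p w) + C * ((penergy p z + penergy p w) / 2 - penergy p ((1/2) *\<^sub>R (z + w)))"
    using penergy_uniformly_convex[OF p \<epsilon>] by blast
  \<comment> \<open>The excess \<open>\<eta>\<close> is at most 1, as the choice of
    \<open>\<epsilon>\<close> presumes, and small enough that the convexity term contributes at most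
    \<open>e / 4\<close>.\<close>
  define \<eta> where "\<eta> = min 1 (e / (4 * (C * p + 1)))"
  have Cp: "C * p + 1 > 0" using C(1) p by (simp add: add_nonneg_pos)
  have \<eta>: "\<eta> > 0" "\<eta> \<le> 1" "\<eta> \<le> e / (4 * (C * p + 1))" using e Cp by (auto simp: \<eta>_def)
  have "eventually (\<lambda>n. energy (U n) < m + \<eta>) sequentially"
    using order_tendstoD(2)[OF lim] \<eta> by simp
  then obtain N where N: "\<And>n. n \<ge> N \<Longrightarrow> energy (U n) < m + \<eta>" by (auto simp: eventually_sequentially)
  have "Lp_dist M p (U i) (U k) < e" if "i \<ge> N" "k \<ge> N" for i k
  proof -
    have s: "energy (U i) + energy (U k) \<le> 2 * (m + \<eta>)" using N[OF that(1)] N[OF that(2)] by simp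
    have "Lp_dist M p (U i) (U k) \<le> \<epsilon> * (p * (energy (U i) + energy (U k))) + C * (p * ((energy (U i) + energy (U k)) / 2 - m))"
      by (rule adm_dist_le[OF C U U m]) (use \<epsilon> in auto)
    also have "\<dots> \<le> \<epsilon> * (p * (2 * (m + 1))) + C * (p * \<eta>)"
    proof (intro add_mono mult_left_mono)
      show "energy (U i) + energy (U k) \<le> 2 * (m + 1)" using s \<eta> by simp
      show "(energy (U i) + energy (U k)) / 2 - m \<le> \<eta>" using s by (simp add: field_simps)
    qed (use \<epsilon> C(1) p in auto)
    also have "\<epsilon> * (p * (2 * (m + 1))) = e / 2"
    proof -
      have "p * (m + 1) \<noteq> 0" using p m0 by simp
      then show ?thesis unfolding \<epsilon>_def by (simp add: divide_simps)
    qed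
    also have "C * (p * \<eta>) \<le> (C * p + 1) * \<eta>" using \<eta> by (simp add: algebra_simps)
    also have "\<dots> \<le> e / 4" using \<eta>(3) Cp by (simp add: field_simps)
    finally show ?thesis using e by simp
  qed
  then show ?thesis by blast
qed

lemma dens_tendsto:
  assumes "(\<lambda>n. z n) \<longlonglongrightarrow> w" "f x > 0 \<longrightarrow> fst w > 0" "f x \<ge> 0"
  shows "(\<lambda>n. dens x (z n)) \<longlonglongrightarrow> dens x w"
proof -
  have 1: "(\<lambda>n. penergy p (z n)) \<longlonglongrightarrow> penergy p w"
    using continuous_on_tendsto_compose[OF continuous_on_penergy[OF p, of UNIV] assms(1)] by simp
  have 2: "(\<lambda>n. f x * fst (z n) powr (1 - \<alpha>)) \<longlonglongrightarrow> f x * fst w powr (1 - \<alpha>)"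
  proof (cases "f x > 0")
    case True
    then show ?thesis using assms by (intro tendsto_mult tendsto_powr tendsto_fst tendsto_const) auto
  next
    case False
    then have "f x = 0" using assms by simp
    then show ?thesis by simp
  qed
  show ?thesis unfolding dens_def by (intro tendsto_add tendsto_divide 1 2 tendsto_const) (use p \<alpha>1 in auto)
qed

lemma dens_at_top:
  assumes z: "(\<lambda>n. z n) \<longlonglongrightarrow> w" and f: "f x > 0" and w: "fst w = 0" and pos: "\<And>n. fst (z n) > 0"
  shows "filterlim (\<lambda>n. dens x (z n)) at_top sequentially"
proof -
  have "(\<lambda>n. fst (z n)) \<longlonglongrightarrow> 0" using tendsto_fst[OF z] w by simp
  then have l: "filterlim (\<lambda>n. fst (z n)) (at_right 0) sequentially"
    using pos by (auto simp: filterlim_at intro!: always_eventually) (metis less_irrefl)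
  have "filterlim (\<lambda>t::real. t powr (1 - \<alpha>)) at_top (at_right 0)"
  proof -
    have "LIM t at_right (0::real). inverse (t powr (\<alpha> - 1)) :> at_top"
    proof (rule filterlim_compose[OF filterlim_inverse_at_top_right])
      have "((\<lambda>t::real. t powr (\<alpha> - 1)) \<longlongrightarrow> 0 powr (\<alpha> - 1)) (at_right 0)"
        using \<alpha>1 by (intro tendsto_powr2 tendsto_ident_at tendsto_const) (auto simp: eventually_at_filter)
      then show "filterlim (\<lambda>t::real. t powr (\<alpha> - 1)) (at_right 0) (at_right 0)"
        using \<alpha>1 by (auto simp: filterlim_at eventually_at_filter)
    qed
    then show ?thesis by (simp add: powr_minus[symmetric])
  qed
  from filterlim_compose[OF this l] have 1: "filterlim (\<lambda>n. fst (z n) powr (1 - \<alpha>)) at_top sequentially" .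
  have 2: "filterlim (\<lambda>n. (f x / (\<alpha> - 1)) * fst (z n) powr (1 - \<alpha>)) at_top sequentially"
    by (rule filterlim_tendsto_pos_mult_at_top[OF tendsto_const _ 1]) (use f \<alpha>1 in auto)
  show ?thesis
    by (rule filterlim_at_top_mono[OF 2]) (use p in \<open>auto intro!: always_eventually simp: dens_def\<close>)
qed

lemma minimizer_exists:
  obtains U where "U \<in> adm" "\<And>V. V \<in> adm \<Longrightarrow> energy U \<le> energy V"
proof -
  define m where "m = Inf (energy ` adm)"
  have bdd: "bdd_below (energy ` adm)" using energy_nonneg by (auto intro!: bdd_belowI[of _ 0])
  have m: "m \<le> energy V" if "V \<in> adm" for V unfolding m_def using bdd that by (intro cInf_lower) auto
  have "\<exists>V\<in>adm. energy V < m + inverse (real (Suc n))" for n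
  proof -
    have "Inf (energy ` adm) < m + inverse (real (Suc n))" by (simp add: m_def)
    then show ?thesis using cInf_lessD[of "energy ` adm" "m + inverse (real (Suc n))"] adm_nonempty by blast
  qed
  then obtain U where U: "\<And>n. U n \<in> adm" "\<And>n. energy (U n) < m + inverse (real (Suc n))" by metis
  have lim: "(\<lambda>n. energy (U n)) \<longlonglongrightarrow> m"
  proof (rule real_tendsto_sandwich[OF _ _ tendsto_const])
    show "(\<lambda>n. m + inverse (real (Suc n))) \<longlonglongrightarrow> m"
      using tendsto_add[OF tendsto_const LIMSEQ_inverse_real_of_nat, of m] by simp
    show "eventually (\<lambda>n. energy (U n) \<le> m + inverse (real (Suc n))) sequentially"
      using U(2) by (intro always_eventually allI less_imp_le)
    show "eventually (\<lambda>n. m \<le> energy (U n)) sequentially" using m U(1) by (intro always_eventually) simp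
  qed
  have p1: "1 \<le> p" and p0: "0 < p" using p by auto
  have ULp: "U n \<in> Lp_space M p" for n by (rule W0_Lp[OF adm_W0[OF U(1)]])
  obtain V where V: "V \<in> Lp_space M p" "(\<lambda>n. Lp_dist M p (U n) V) \<longlonglongrightarrow> 0"
  proof (rule Lp_complete[OF p1 ULp])
    show "\<exists>N. \<forall>i\<ge>N. \<forall>k\<ge>N. Lp_dist M p (U i) (U k) < e" if e: "e > 0" for e
      by (rule minimizing_sequence_Cauchy[OF U(1) m lim e])
  qed (rule that, assumption+)
  have VW: "V \<in> W0" by (rule W0_limI[where V=U, OF V(1) adm_W0[OF U(1)] V(2)])
  obtain r :: "nat \<Rightarrow> nat" where r: "strict_mono r" "AE x in M. (\<lambda>n. U (r n) x) \<longlonglongrightarrow> V x"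
    by (rule Lp_subseq_AE[OF p0 ULp V(1) V(2)]) (rule that, assumption+)
  have aeU: "AE x in M. \<forall>n. fst (U (r n) x) \<ge> 0 \<and> (f x > 0 \<longrightarrow> fst (U (r n) x) > 0)"
    unfolding AE_all_countable using U(1) by (auto simp: adm_def)
  have di: "integrable M (\<lambda>x. dens x (U (r n) x))" for n by (rule dens_integrable[OF U(1)])
  have dn: "AE x in M. 0 \<le> dens x (U (r n) x)" for n using f_nonneg by eventually_elim (rule dens_nonneg)
  have le: "(LINT x|M. dens x (U (r n) x)) \<le> m + 1" for n
  proof -
    have "inverse (real (Suc (r n))) \<le> 1" by (simp add: inverse_le_1_iff)
    then show ?thesis using U(2)[of "r n"] by (simp add: energy_def)
  qed
  have nonneg: "AE x in M. fst (V x) \<ge> 0"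
    using r(2) aeU by eventually_elim (metis LIMSEQ_le_const tendsto_fst)
  \<comment> \<open>This must precede the passage to the limit in the energy: with
    \<open>0 powr a = 0\<close>, the density of a limit with value 0 is finite although the
    densities diverge, so they would not converge to it.\<close>
  have pos: "AE x in M. f x > 0 \<longrightarrow> fst (V x) > 0"
    using r(2) aeU nonneg Fatou_AE_not_at_top[OF di dn le]
  proof eventually_elim
    fix x assume *: "(\<lambda>n. U (r n) x) \<longlonglongrightarrow> V x" "\<forall>n. fst (U (r n) x) \<ge> 0 \<and> (f x > 0 \<longrightarrow> fst (U (r n) x) > 0)"
      "fst (V x) \<ge> 0" "\<not> filterlim (\<lambda>n. dens x (U (r n) x)) at_top sequentially"
    show "f x > 0 \<longrightarrow> fst (V x) > 0"
    proof (intro impI, rule ccontr)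
      assume f: "f x > 0" and "\<not> fst (V x) > 0"
      then have "fst (V x) = 0" using *(3) by simp
      from dens_at_top[OF *(1) f this] *(2) f have "filterlim (\<lambda>n. dens x (U (r n) x)) at_top sequentially" by blast
      then show False using *(4) by blast
    qed
  qed
  have dm: "(\<lambda>x. dens x (V x)) \<in> borel_measurable M"
  proof -
    have [measurable]: "(\<lambda>x. penergy p (V x)) \<in> borel_measurable M" "(\<lambda>x. fst (V x)) \<in> borel_measurable M"
      using penergy_integrable[OF V(1)] W0_fst_measurable[OF VW] by auto
    show ?thesis unfolding dens_def by measurable
  qed
  have liml: "AE x in M. (\<lambda>n. dens x (U (r n) x)) \<longlonglongrightarrow> dens x (V x)"
    using r(2) pos f_nonneg by eventually_elim (rule dens_tendsto)
  have limr: "(\<lambda>n. energy (U (r n))) \<longlonglongrightarrow> m" using LIMSEQ_subseq_LIMSEQ[OF lim r(1)] by (simp add: comp_def)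
  have lee: "(LINT x|M. dens x (U (r n) x)) \<le> energy (U (r n))" for n by (simp add: energy_def)
  note F = Fatou_real[OF di dn liml dm lee limr]
  have "integrable M (\<lambda>x. f x * fst (V x) powr (1 - \<alpha>))"
  proof (rule Bochner_Integration.integrable_bound)
    show "integrable M (\<lambda>x. (\<alpha> - 1) * dens x (V x))" using F(1) by simp
    show "(\<lambda>x. f x * fst (V x) powr (1 - \<alpha>)) \<in> borel_measurable M"
      using W0_fst_measurable[OF VW] f_meas by measurable
    show "AE x in M. norm (f x * fst (V x) powr (1 - \<alpha>)) \<le> norm ((\<alpha> - 1) * dens x (V x))"
      using f_nonneg
    proof eventually_elim
      fix x assume f: "0 \<le> f x"
      have "(\<alpha> - 1) * dens x (V x) = (\<alpha> - 1) * (penergy p (V x) / p) + f x * fst (V x) powr (1 - \<alpha>)"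
        unfolding dens_def distrib_left using \<alpha>1 by simp
      moreover have "0 \<le> (\<alpha> - 1) * (penergy p (V x) / p)" using \<alpha>1 p by simp
      ultimately show "norm (f x * fst (V x) powr (1 - \<alpha>)) \<le> norm ((\<alpha> - 1) * dens x (V x))" using f by simp
    qed
  qed
  then have "V \<in> adm" using VW nonneg pos by (simp add: adm_def)
  moreover have "energy V \<le> m" using F(2) by (simp add: energy_def)
  ultimately show ?thesis using that m order_trans by blast
qed

end

subsection \<open>The Euler--Lagrange equation\<close>

context singular_problem
begin

text \<open>Both integrals on the left of the weak equation at once, with the test function entering
  through its jet.\<close>

definition A_form :: "('a \<Rightarrow> real \<times> 'a) \<Rightarrow> ('a \<Rightarrow> real \<times> 'a) \<Rightarrow> real" where
  "A_form U \<Psi> = (LINT x|M. pflux2 p (U x) \<bullet> \<Psi> x)"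

lemma pflux2_measurable: 
  fixes U :: "'a \<Rightarrow> real \<times> 'a" shows "U \<in> borel_measurable M \<Longrightarrow> (\<lambda>x. pflux2 p (U x)) \<in> borel_measurable M"
  by (rule borel_measurable_continuous_on[OF continuous_on_pflux2[OF p]])

lemma pflux2_inner_bound:
  fixes z w :: "real \<times> 'a"
  shows "\<bar>pflux2 p z \<bullet> w\<bar> \<le> 2 * (norm z + norm w) powr p"
  using pflux2_inner_le[of p z w] powr_mult_le_add_powr[of "norm z" "norm w" p] p by simp

lemma Lp_add_norm_powr:
  fixes U \<Psi> :: "'a \<Rightarrow> real \<times> 'a"
  assumes "U \<in> Lp_space M p" "\<Psi> \<in> Lp_space M p"
  shows "integrable M (\<lambda>x. 2 * (norm (U x) + norm (\<Psi> x)) powr p)"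
  using Lp_integrable[OF Lp_add[OF Lp_norm[OF assms(1)] Lp_norm[OF assms(2)]]] p by simp

lemma A_form_integrable:
  fixes U \<Psi> :: "'a \<Rightarrow> real \<times> 'a"
  assumes U: "U \<in> Lp_space M p" and \<Psi>: "\<Psi> \<in> Lp_space M p"
  shows "integrable M (\<lambda>x. pflux2 p (U x) \<bullet> \<Psi> x)"
proof (rule Bochner_Integration.integrable_bound[OF Lp_add_norm_powr[OF U \<Psi>]])
  show "(\<lambda>x. pflux2 p (U x) \<bullet> \<Psi> x) \<in> borel_measurable M"
    by (rule borel_measurable_inner[OF pflux2_measurable[OF Lp_measurable[OF U]] Lp_measurable[OF \<Psi>]])
  show "AE x in M. norm (pflux2 p (U x) \<bullet> \<Psi> x) \<le> norm (2 * (norm (U x) + norm (\<Psi> x)) powr p)"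
    using pflux2_inner_bound by (intro AE_I2) simp
qed

text \<open>Raising the function only lowers the singular term, so nonnegative directions preserve
  finite energy.\<close>

lemma adm_perturb:
  assumes U: "U \<in> adm" and \<Psi>: "\<Psi> \<in> W0" "AE x in M. fst (\<Psi> x) \<ge> 0" and t: "t \<ge> 0"
  shows "(\<lambda>x. U x + t *\<^sub>R \<Psi> x) \<in> adm"
proof -
  let ?V = "\<lambda>x. U x + t *\<^sub>R \<Psi> x"
  have W: "?V \<in> W0" by (intro W0_add W0_scaleR adm_W0 U \<Psi>)
  have ae: "AE x in M. fst (U x) \<ge> 0" "AE x in M. f x > 0 \<longrightarrow> fst (U x) > 0"
    "integrable M (\<lambda>x. f x * fst (U x) powr (1 - \<alpha>))" using U by (auto simp: adm_def)
  have 1: "AE x in M. fst (?V x) \<ge> 0" using ae(1) \<Psi>(2) by eventually_elim (use t in simp)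
  have 2: "AE x in M. f x > 0 \<longrightarrow> fst (?V x) > 0"
    using ae(2) \<Psi>(2) by eventually_elim (use t in \<open>auto intro: add_pos_nonneg\<close>)
  have "integrable M (\<lambda>x. f x * fst (?V x) powr (1 - \<alpha>))"
  proof (rule Bochner_Integration.integrable_bound[OF ae(3)])
    show "(\<lambda>x. f x * fst (?V x) powr (1 - \<alpha>)) \<in> borel_measurable M"
      using W0_fst_measurable[OF W] f_meas by measurable
    show "AE x in M. norm (f x * fst (?V x) powr (1 - \<alpha>)) \<le> norm (f x * fst (U x) powr (1 - \<alpha>))"
      using ae(2) \<Psi>(2) f_nonneg
    proof eventually_elim
      fix x assume *: "f x > 0 \<longrightarrow> fst (U x) > 0" "fst (\<Psi> x) \<ge> 0" "0 \<le> f x"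
      show "norm (f x * fst (?V x) powr (1 - \<alpha>)) \<le> norm (f x * fst (U x) powr (1 - \<alpha>))"
      proof (cases "f x > 0")
        case True
        have "fst (?V x) powr (1 - \<alpha>) \<le> fst (U x) powr (1 - \<alpha>)"
          by (rule powr_mono2') (use * True t \<alpha>1 in auto)
        then show ?thesis using True by (simp add: abs_mult)
      next
        case False
        then have "f x = 0" using * by simp
        then show ?thesis by simp
      qed
    qed
  qed
  then show ?thesis using W 1 2 by (simp add: adm_def)
qed

text \<open>Both convex parts are compared with their tangents at the perturbed point, not at
  \<open>z\<close>. The derivative of the singular term is then taken where the function has been
  raised, and it appears on the small side of the inequality, as Fatou requires.\<close>

lemma dens_difference:
  assumes fx: "f x \<ge> 0" "f x > 0 \<longrightarrow> fst z > 0" and w: "fst w \<ge> 0" and t: "t > 0"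
  shows "f x * fst (z + t *\<^sub>R w) powr (- \<alpha>) * fst w
     \<le> pflux2 p (z + t *\<^sub>R w) \<bullet> w - (dens x (z + t *\<^sub>R w) - dens x z) / t"
proof -
  define v where "v = z + t *\<^sub>R w"
  have zv: "z - v = - (t *\<^sub>R w)" by (simp add: v_def)
  have 1: "(penergy p v - penergy p z) / p \<le> t * (pflux2 p v \<bullet> w)"
    using penergy_gradient[OF p, of v z] p unfolding zv by (simp add: field_simps)
  have 2: "f x * (fst v powr (1 - \<alpha>) - fst z powr (1 - \<alpha>)) / (\<alpha> - 1) \<le> - (t * (f x * fst v powr (- \<alpha>) * fst w))"
  proof (cases "f x > 0")
    case True
    have z0: "fst z > 0" using fx True by simp
    have v0: "fst v > 0" using z0 w t by (simp add: v_def add_pos_nonneg)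
    have a: "- (\<alpha> - 1) = 1 - \<alpha>" "- (\<alpha> - 1) - 1 = - \<alpha>" by auto
    have "fst v powr (1 - \<alpha>) - (\<alpha> - 1) * fst v powr (- \<alpha>) * (fst z - fst v) \<le> fst z powr (1 - \<alpha>)"
      using powr_neg_tangent[OF v0 z0, of "\<alpha> - 1"] \<alpha>1 unfolding a by simp
    moreover have "fst z - fst v = - (t * fst w)" by (simp add: v_def)
    ultimately have "fst v powr (1 - \<alpha>) - fst z powr (1 - \<alpha>) \<le> (\<alpha> - 1) * (- (t * (fst v powr (- \<alpha>) * fst w)))"
      by (simp add: algebra_simps)
    then have "(fst v powr (1 - \<alpha>) - fst z powr (1 - \<alpha>)) / (\<alpha> - 1) \<le> - (t * (fst v powr (- \<alpha>) * fst w))"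
      using \<alpha>1 by (simp add: pos_divide_le_eq mult.commute)
    then have "f x * ((fst v powr (1 - \<alpha>) - fst z powr (1 - \<alpha>)) / (\<alpha> - 1)) \<le> f x * (- (t * (fst v powr (- \<alpha>) * fst w)))"
      using fx(1) by (rule mult_left_mono)
    then show ?thesis by (simp add: algebra_simps)
  next
    case False
    then have "f x = 0" using fx by simp
    then show ?thesis by simp
  qed
  have "dens x v - dens x z = (penergy p v - penergy p z) / p + f x * (fst v powr (1 - \<alpha>) - fst z powr (1 - \<alpha>)) / (\<alpha> - 1)"
    by (simp add: dens_def diff_divide_distrib right_diff_distrib)
  also have "\<dots> \<le> t * (pflux2 p v \<bullet> w) - t * (f x * fst v powr (- \<alpha>) * fst w)" using 1 2 by linarith
  finally have "(dens x v - dens x z) / t \<le> (t * (pflux2 p v \<bullet> w - f x * fst v powr (- \<alpha>) * fst w)) / t"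
    using t by (intro divide_right_mono) (auto simp: right_diff_distrib)
  then have "(dens x v - dens x z) / t \<le> pflux2 p v \<bullet> w - f x * fst v powr (- \<alpha>) * fst w" using t by simp
  then show ?thesis by (simp add: v_def)
qed

definition minimizer :: "('a \<Rightarrow> real \<times> 'a) \<Rightarrow> bool" where
  "minimizer U \<longleftrightarrow> U \<in> adm \<and> (\<forall>V\<in>adm. energy U \<le> energy V)"

text \<open>By minimality the energy difference in \<open>dens_difference\<close> integrates to
  something nonnegative, which bounds the integrals of the nonnegative functions \<open>g n\<close>
  by \<open>A_form (V n) \<Psi>\<close>. The bounds converge by dominated convergence, the
  \<open>g n\<close> pointwise since \<open>u > 0\<close> where \<open>f > 0\<close>; Fatou gives
  all three claims.\<close>

lemma minimizer_supersolution:
  assumes U: "minimizer U" and \<Psi>: "\<Psi> \<in> W0" "AE x in M. fst (\<Psi> x) \<ge> 0"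
  shows "integrable M (\<lambda>x. f x * fst (U x) powr (- \<alpha>) * fst (\<Psi> x))"
    and "(LINT x|M. f x * fst (U x) powr (- \<alpha>) * fst (\<Psi> x)) \<le> A_form U \<Psi>"
    and "0 \<le> A_form U \<Psi>"
proof -
  have Ua: "U \<in> adm" using U by (simp add: minimizer_def)
  have UW: "U \<in> W0" using adm_W0[OF Ua] .
  define t where "t = (\<lambda>n. inverse (real (Suc n)))"
  have t: "t n > 0" "t n \<le> 1" for n by (auto simp: t_def inverse_le_1_iff)
  have tl: "t \<longlonglongrightarrow> 0" unfolding t_def by (rule LIMSEQ_inverse_real_of_nat)
  define V where "V = (\<lambda>n x. U x + t n *\<^sub>R \<Psi> x)"
  have Va: "V n \<in> adm" for n unfolding V_def by (rule adm_perturb[OF Ua \<Psi>]) (use t[of n] in simp)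
  note VW = adm_W0[OF Va]
  note VLp = W0_Lp[OF VW]
  have aeU: "AE x in M. fst (U x) \<ge> 0" "AE x in M. f x > 0 \<longrightarrow> fst (U x) > 0" using Ua by (auto simp: adm_def)
  define g where "g = (\<lambda>n x. f x * fst (V n x) powr (- \<alpha>) * fst (\<Psi> x))"
  have gm: "g n \<in> borel_measurable M" for n
    unfolding g_def using f_meas W0_fst_measurable[OF VW] W0_fst_measurable[OF \<Psi>(1)] by measurable
  have g0: "AE x in M. 0 \<le> g n x" for n using f_nonneg \<Psi>(2) by eventually_elim (simp add: g_def)
  have gle: "AE x in M. g n x \<le> pflux2 p (V n x) \<bullet> \<Psi> x - (dens x (V n x) - dens x (U x)) / t n" for n
    using f_nonneg aeU(2) \<Psi>(2) by eventually_elim (use dens_difference t in \<open>simp add: g_def V_def\<close>)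
  have ri: "integrable M (\<lambda>x. pflux2 p (V n x) \<bullet> \<Psi> x - (dens x (V n x) - dens x (U x)) / t n)" for n
    using A_form_integrable[OF VLp W0_Lp[OF \<Psi>(1)]] dens_integrable[OF Va] dens_integrable[OF Ua] by simp
  have gi: "integrable M (g n)" for n
    by (rule Bochner_Integration.integrable_bound[OF ri[of n] gm]) (use g0[of n] gle[of n] in \<open>eventually_elim, simp\<close>)
  have gI: "(LINT x|M. g n x) \<le> A_form (V n) \<Psi>" for n
  proof -
    have "(LINT x|M. g n x) \<le> (LINT x|M. pflux2 p (V n x) \<bullet> \<Psi> x - (dens x (V n x) - dens x (U x)) / t n)"
      by (rule integral_mono_AE[OF gi ri gle])
    also have "\<dots> = A_form (V n) \<Psi> - (energy (V n) - energy U) / t n"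
      unfolding A_form_def energy_def
      using A_form_integrable[OF VLp W0_Lp[OF \<Psi>(1)]] dens_integrable[OF Va] dens_integrable[OF Ua] by simp
    also have "\<dots> \<le> A_form (V n) \<Psi>"
    proof -
      have "0 \<le> energy (V n) - energy U" using U Va by (simp add: minimizer_def)
      then have "0 \<le> (energy (V n) - energy U) / t n" using t[of n] by (simp add: less_imp_le)
      then show ?thesis by simp
    qed
    finally show ?thesis .
  qed
  have Vl: "(\<lambda>n. V n x) \<longlonglongrightarrow> U x" for x
  proof -
    have "(\<lambda>n. U x + t n *\<^sub>R \<Psi> x) \<longlonglongrightarrow> U x + 0 *\<^sub>R \<Psi> x" by (intro tendsto_intros tl)
    then show ?thesis by (simp add: V_def)
  qed
  have Al: "(\<lambda>n. A_form (V n) \<Psi>) \<longlonglongrightarrow> A_form U \<Psi>"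
    unfolding A_form_def
  proof (rule integral_dominated_convergence)
    have "integrable M (\<lambda>x. 2 * (norm ((\<lambda>x. norm (U x) + norm (\<Psi> x)) x) + norm (\<Psi> x)) powr p)"
    proof -
      have p0: "0 \<le> p" using p by simp
      have "(\<lambda>x. norm (U x) + norm (\<Psi> x) + norm (\<Psi> x)) \<in> Lp_space M p"
        using Lp_add[OF Lp_add[OF Lp_norm[OF W0_Lp[OF UW]] Lp_norm[OF W0_Lp[OF \<Psi>(1)]] p0] Lp_norm[OF W0_Lp[OF \<Psi>(1)]] p0] .
      from Lp_integrable[OF this] show ?thesis by simp
    qed
    then show "integrable M (\<lambda>x. 2 * (norm (U x) + norm (\<Psi> x) + norm (\<Psi> x)) powr p)" by simp
    show "AE x in M. (\<lambda>n. pflux2 p (V n x) \<bullet> \<Psi> x) \<longlonglongrightarrow> pflux2 p (U x) \<bullet> \<Psi> x"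
    proof (rule AE_I2)
      fix x
      have "(\<lambda>n. pflux2 p (V n x)) \<longlonglongrightarrow> pflux2 p (U x)"
        using continuous_on_tendsto_compose[OF continuous_on_pflux2[OF p] Vl] by simp
      then show "(\<lambda>n. pflux2 p (V n x) \<bullet> \<Psi> x) \<longlonglongrightarrow> pflux2 p (U x) \<bullet> \<Psi> x" by (intro tendsto_inner tendsto_const)
    qed
    show "AE x in M. norm (pflux2 p (V n x) \<bullet> \<Psi> x) \<le> 2 * (norm (U x) + norm (\<Psi> x) + norm (\<Psi> x)) powr p" for n
    proof (rule AE_I2)
      fix x
      have "norm (V n x) \<le> norm (U x) + t n * norm (\<Psi> x)"
        unfolding V_def using norm_triangle_ineq[of "U x" "t n *\<^sub>R \<Psi> x"] t[of n] by simp
      also have "\<dots> \<le> norm (U x) + norm (\<Psi> x)" using t[of n] by (simp add: mult_left_le_one_le)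
      finally have "(norm (V n x) + norm (\<Psi> x)) powr p \<le> (norm (U x) + norm (\<Psi> x) + norm (\<Psi> x)) powr p"
        using p by (intro powr_mono2) auto
      then show "norm (pflux2 p (V n x) \<bullet> \<Psi> x) \<le> 2 * (norm (U x) + norm (\<Psi> x) + norm (\<Psi> x)) powr p"
        using pflux2_inner_bound[of "V n x" "\<Psi> x"] by simp
    qed
    show "(\<lambda>x. pflux2 p (U x) \<bullet> \<Psi> x) \<in> borel_measurable M"
      using A_form_integrable[OF W0_Lp[OF UW] W0_Lp[OF \<Psi>(1)]] by simp
    show "(\<lambda>x. pflux2 p (V n x) \<bullet> \<Psi> x) \<in> borel_measurable M" for n
      using A_form_integrable[OF VLp W0_Lp[OF \<Psi>(1)]] by simp
  qed
  have glim: "AE x in M. (\<lambda>n. g n x) \<longlonglongrightarrow> f x * fst (U x) powr (- \<alpha>) * fst (\<Psi> x)"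
    using aeU(2) f_nonneg
  proof eventually_elim
    fix x assume *: "f x > 0 \<longrightarrow> fst (U x) > 0" "0 \<le> f x"
    show "(\<lambda>n. g n x) \<longlonglongrightarrow> f x * fst (U x) powr (- \<alpha>) * fst (\<Psi> x)"
    proof (cases "f x > 0")
      case True
      then have "(\<lambda>n. fst (V n x) powr (- \<alpha>)) \<longlonglongrightarrow> fst (U x) powr (- \<alpha>)"
        using * by (intro tendsto_powr tendsto_fst Vl tendsto_const) auto
      then show ?thesis unfolding g_def by (intro tendsto_mult tendsto_const)
    next
      case False
      then have "f x = 0" using * by simp
      then show ?thesis by (simp add: g_def)
    qed
  qed
  have hm: "(\<lambda>x. f x * fst (U x) powr (- \<alpha>) * fst (\<Psi> x)) \<in> borel_measurable M"
    using f_meas W0_fst_measurable[OF UW] W0_fst_measurable[OF \<Psi>(1)] by measurable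
  show "integrable M (\<lambda>x. f x * fst (U x) powr (- \<alpha>) * fst (\<Psi> x))"
    "(LINT x|M. f x * fst (U x) powr (- \<alpha>) * fst (\<Psi> x)) \<le> A_form U \<Psi>" "0 \<le> A_form U \<Psi>"
    using Fatou_real[OF gi g0 glim hm gI Al] by auto
qed

text \<open>The equation tested with \<open>u\<close> itself. Both parts are homogeneous, so the
  energy along \<open>s u\<close> is the explicit function \<open>h\<close>; it has an interior
  minimum at \<open>s = 1\<close>, where its derivative is the difference of the two
  integrals.\<close>

lemma minimizer_virial:
  assumes U: "minimizer U"
  shows "(LINT x|M. penergy p (U x)) = (LINT x|M. f x * fst (U x) powr (1 - \<alpha>))"
proof -
  have Ua: "U \<in> adm" using U by (simp add: minimizer_def)
  define A B where "A = (LINT x|M. penergy p (U x))" and "B = (LINT x|M. f x * fst (U x) powr (1 - \<alpha>))"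
  define h where "h = (\<lambda>s. s powr p * (A / p) + s powr (1 - \<alpha>) * (B / (\<alpha> - 1)))"
  note iA = penergy_integrable[OF W0_Lp[OF adm_W0[OF Ua]]]
  have iB: "integrable M (\<lambda>x. f x * fst (U x) powr (1 - \<alpha>))" using Ua by (simp add: adm_def)
  have aeU: "AE x in M. fst (U x) \<ge> 0" "AE x in M. f x > 0 \<longrightarrow> fst (U x) > 0" using Ua by (auto simp: adm_def)
  have sc: "(\<lambda>x. s *\<^sub>R U x) \<in> adm \<and> energy (\<lambda>x. s *\<^sub>R U x) = h s" if s: "s > 0" for s
  proof -
    have fe: "AE x in M. f x * fst (s *\<^sub>R U x) powr (1 - \<alpha>) = s powr (1 - \<alpha>) * (f x * fst (U x) powr (1 - \<alpha>))"
      using aeU(1) by eventually_elim (use s in \<open>simp add: powr_mult\<close>)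
    have m: "(\<lambda>x. f x * fst (s *\<^sub>R U x) powr (1 - \<alpha>)) \<in> borel_measurable M"
      using W0_fst_measurable[OF W0_scaleR[OF adm_W0[OF Ua], of s]] f_meas by measurable
    have i: "integrable M (\<lambda>x. f x * fst (s *\<^sub>R U x) powr (1 - \<alpha>))"
      using integrable_cong_AE[OF m _ fe] iB by simp
    have "AE x in M. fst (s *\<^sub>R U x) \<ge> 0" using aeU(1) by eventually_elim (use s in simp)
    moreover have "AE x in M. f x > 0 \<longrightarrow> fst (s *\<^sub>R U x) > 0" using aeU(2) by eventually_elim (use s in simp)
    ultimately have adm: "(\<lambda>x. s *\<^sub>R U x) \<in> adm" using i W0_scaleR[OF adm_W0[OF Ua], of s] by (simp add: adm_def)
    have "energy (\<lambda>x. s *\<^sub>R U x) = (LINT x|M. penergy p (s *\<^sub>R U x) / p + f x * fst (s *\<^sub>R U x) powr (1 - \<alpha>) / (\<alpha> - 1))"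
      by (simp add: energy_def dens_def)
    also have "\<dots> = (LINT x|M. penergy p (s *\<^sub>R U x)) / p + (LINT x|M. f x * fst (s *\<^sub>R U x) powr (1 - \<alpha>)) / (\<alpha> - 1)"
      using i penergy_integrable[OF W0_Lp[OF adm_W0[OF adm]]] by simp
    also have "(LINT x|M. penergy p (s *\<^sub>R U x)) = s powr p * A"
      unfolding A_def using s by (simp add: penergy_scaleR)
    also have "(LINT x|M. f x * fst (s *\<^sub>R U x) powr (1 - \<alpha>)) = s powr (1 - \<alpha>) * B"
      using integral_cong_AE[OF m _ fe] iB by (simp add: B_def)
    finally show ?thesis using adm by (simp add: h_def)
  qed
  have min: "h 1 \<le> h s" if "s > 0" for s
  proof -
    have "energy (\<lambda>x. 1 *\<^sub>R U x) \<le> energy (\<lambda>x. s *\<^sub>R U x)" using U conjunct1[OF sc[OF that]] by (simp add: minimizer_def)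
    then show ?thesis using sc[OF that] sc[of 1] by simp
  qed
  have "(h has_real_derivative p * 1 powr (p - 1) * (A / p) + (1 - \<alpha>) * 1 powr (1 - \<alpha> - 1) * (B / (\<alpha> - 1))) (at 1)"
    unfolding h_def by (intro DERIV_add DERIV_cmult_right has_real_derivative_powr) auto
  moreover have "p * 1 powr (p - 1) * (A / p) + (1 - \<alpha>) * 1 powr (1 - \<alpha> - 1) * (B / (\<alpha> - 1)) = A - B"
  proof -
    have "(1 - \<alpha>) * (B / (\<alpha> - 1)) = - B" using \<alpha>1 by (simp add: field_simps)
    then show ?thesis using p by simp
  qed
  ultimately have D: "(h has_real_derivative A - B) (at 1)" by simp
  have "A - B = 0"
    by (rule DERIV_local_min[OF D, of 1]) (use min in auto)
  then show ?thesis by (simp add: A_def B_def)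
qed

text \<open>A test function may change sign, so it is dominated by a multiple of a cut-off that is 1
  on its support, to which the supersolution inequality applies.\<close>

lemma minimizer_test_integrable:
  assumes U: "minimizer U" and \<phi>: "\<phi> \<in> test_functions \<Omega>"
  shows "integrable M (\<lambda>x. f x * fst (U x) powr (- \<alpha>) * \<phi> x)"
proof -
  have UW: "U \<in> W0" using U adm_W0 by (simp add: minimizer_def)
  define K where "K = closure {x. \<phi> x \<noteq> 0}"
  have K: "compact K" "K \<subseteq> \<Omega>" using \<phi> by (auto simp: K_def test_functions_def)
  obtain \<zeta> where \<zeta>: "\<zeta> \<in> test_functions \<Omega>" "\<And>x. 0 \<le> \<zeta> x" "\<And>x. \<zeta> x \<le> 1" "\<And>x. x \<in> K \<Longrightarrow> \<zeta> x = 1"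
    by (rule smooth_cutoff[OF K(1) open_\<Omega> K(2)], rule that, assumption+)
  obtain B where B: "B \<ge> 0" "\<And>x. norm (jet \<phi> x) \<le> B" using test_jet_bounded[OF \<phi>] by blast
  have \<phi>B: "\<bar>\<phi> x\<bar> \<le> B * \<zeta> x" for x
  proof (cases "x \<in> K")
    case True
    then show ?thesis using B(2)[of x] norm_fst_le_norm[of "jet \<phi> x"] \<zeta>(4)[OF True] by (simp add: jet_def)
  next
    case False
    then have "\<phi> x = 0" unfolding K_def by (rule test_zero[OF \<phi>])
    then show ?thesis using B(1) \<zeta>(2)[of x] by simp
  qed
  have i: "integrable M (\<lambda>x. f x * fst (U x) powr (- \<alpha>) * \<zeta> x)"
    using minimizer_supersolution(1)[OF U jet_W0[OF \<zeta>(1)]] \<zeta>(2) by (simp add: jet_def)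
  have \<phi>m: "\<phi> \<in> borel_measurable M" by (rule cont_measurable[OF smooth_fun_continuous[OF test_smooth[OF \<phi>]]])
  show ?thesis
  proof (rule Bochner_Integration.integrable_bound)
    show "integrable M (\<lambda>x. B * (f x * fst (U x) powr (- \<alpha>) * \<zeta> x))" using i by simp
    show "(\<lambda>x. f x * fst (U x) powr (- \<alpha>) * \<phi> x) \<in> borel_measurable M"
      using f_meas W0_fst_measurable[OF UW] \<phi>m by measurable
    show "AE x in M. norm (f x * fst (U x) powr (- \<alpha>) * \<phi> x) \<le> norm (B * (f x * fst (U x) powr (- \<alpha>) * \<zeta> x))"
      using f_nonneg
    proof eventually_elim
      fix x assume fx: "0 \<le> f x"
      have "(f x * fst (U x) powr (- \<alpha>)) * \<bar>\<phi> x\<bar> \<le> (f x * fst (U x) powr (- \<alpha>)) * (B * \<zeta> x)"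
        using fx by (intro mult_left_mono \<phi>B) simp
      then show "norm (f x * fst (U x) powr (- \<alpha>) * \<phi> x) \<le> norm (B * (f x * fst (U x) powr (- \<alpha>) * \<zeta> x))"
        using fx B(1) \<zeta>(2)[of x] by (simp add: abs_mult mult.left_commute)
    qed
  qed
qed

text \<open>Test the supersolution inequality with \<open>(u + t \<phi>)\<^sup>+\<close> and use the identity obtained by scaling
  \<open>u\<close>; the error lives on \<open>{u + t \<phi> \<le> 0}\<close>, which shrinks to a null set because \<open>u > 0\<close>.\<close>

lemma minimizer_equation_le:
  assumes U: "minimizer U" and pos: "AE x in M. fst (U x) > 0" and \<phi>: "\<phi> \<in> test_functions \<Omega>"
  shows "(LINT x|M. f x * fst (U x) powr (- \<alpha>) * \<phi> x) \<le> A_form U (jet \<phi>)"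
proof -
  have Ua: "U \<in> adm" using U by (simp add: minimizer_def)
  have UW: "U \<in> W0" using adm_W0[OF Ua] .
  define t where "t = (\<lambda>n. inverse (real (Suc n)))"
  have t: "t n > 0" for n by (auto simp: t_def)
  have tl: "t \<longlonglongrightarrow> 0" unfolding t_def by (rule LIMSEQ_inverse_real_of_nat)
  define \<psi> where "\<psi> = (\<lambda>n x. fst (U x) + t n * \<phi> x)"
  define \<Psi> where "\<Psi> = (\<lambda>n x. (max 0 (\<psi> n x), (if \<psi> n x > 0 then 1 else 0) *\<^sub>R snd (U x + t n *\<^sub>R jet \<phi> x)))"
  have \<Psi>W: "\<Psi> n \<in> W0" for n
    using W0_pos_part[OF W0_add[OF UW W0_scaleR[OF jet_W0[OF \<phi>], of "t n"]]]
    by (simp add: \<Psi>_def \<psi>_def jet_def)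
  define F where "F = (\<lambda>x. pflux2 p (U x) \<bullet> jet \<phi> x)"
  have iF: "integrable M F" unfolding F_def by (rule A_form_integrable[OF W0_Lp[OF UW] jet_Lp[OF \<phi>]])
  have iN: "integrable M (\<lambda>x. penergy p (U x))" by (rule penergy_integrable[OF W0_Lp[OF UW]])
  have iB: "integrable M (\<lambda>x. f x * fst (U x) powr (1 - \<alpha>))" using Ua by (simp add: adm_def)
  have if\<phi>: "integrable M (\<lambda>x. f x * fst (U x) powr (- \<alpha>) * \<phi> x)" by (rule minimizer_test_integrable[OF U \<phi>])
  \<comment> \<open>Where \<open>u + t \<phi> \<le> 0\<close> the test jet is 0. Dropping the energy
    density there has the favourable sign, so only the term \<open>t F\<close> has to be
    compensated, and \<open>\<bar>F\<bar>\<close> on this set does it.\<close>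
  define R where "R = (\<lambda>n x. (if \<psi> n x \<le> 0 then \<bar>F x\<bar> else 0))"
  have \<psi>m: "\<psi> n \<in> borel_measurable M" for n
    unfolding \<psi>_def using W0_fst_measurable[OF UW] cont_measurable[OF smooth_fun_continuous[OF test_smooth[OF \<phi>]]] by measurable
  have Fm: "F \<in> borel_measurable M" using iF by simp
  have Rm: "R n \<in> borel_measurable M" for n
    unfolding R_def using \<psi>m[of n] Fm by measurable
  have iR: "integrable M (R n)" for n
    by (rule Bochner_Integration.integrable_bound[OF iF Rm]) (auto simp: R_def)
  have Rl: "(\<lambda>n. LINT x|M. R n x) \<longlonglongrightarrow> (LINT x|M. 0)"
  proof (rule integral_dominated_convergence[where w="\<lambda>x. \<bar>F x\<bar>"])
    show "AE x in M. (\<lambda>n. R n x) \<longlonglongrightarrow> 0"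
      using pos
    proof eventually_elim
      fix x assume u: "fst (U x) > 0"
      have "(\<lambda>n. \<psi> n x) \<longlonglongrightarrow> fst (U x) + 0 * \<phi> x" unfolding \<psi>_def by (intro tendsto_intros tl)
      then have "(\<lambda>n. \<psi> n x) \<longlonglongrightarrow> fst (U x)" by simp
      from order_tendstoD(1)[OF this u] have "eventually (\<lambda>n. R n x = 0) sequentially"
        by eventually_elim (simp add: R_def)
      then show "(\<lambda>n. R n x) \<longlonglongrightarrow> 0" by (rule tendsto_eventually)
    qed
  qed (use iF Rm in \<open>auto simp: R_def\<close>)
  have key: "(LINT x|M. f x * fst (U x) powr (- \<alpha>) * \<phi> x) \<le> A_form U (jet \<phi>) + (LINT x|M. R n x)" for n
  proof -
    have \<Psi>0: "AE x in M. fst (\<Psi> n x) \<ge> 0" by (simp add: \<Psi>_def)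
    note ss = minimizer_supersolution[OF U \<Psi>W \<Psi>0]
    have "(LINT x|M. f x * fst (U x) powr (1 - \<alpha>) + t n * (f x * fst (U x) powr (- \<alpha>) * \<phi> x))
        \<le> (LINT x|M. f x * fst (U x) powr (- \<alpha>) * fst (\<Psi> n x))"
    proof (rule integral_mono_AE)
      show "AE x in M. f x * fst (U x) powr (1 - \<alpha>) + t n * (f x * fst (U x) powr (- \<alpha>) * \<phi> x) \<le> f x * fst (U x) powr (- \<alpha>) * fst (\<Psi> n x)"
        using pos f_nonneg
      proof eventually_elim
        fix x assume u: "fst (U x) > 0" and fx: "0 \<le> f x"
        have "fst (U x) powr (1 - \<alpha>) = fst (U x) powr (- \<alpha>) * fst (U x)"
          using u powr_add[of "fst (U x)" "- \<alpha>" 1] by (simp add: add.commute)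
        then have "f x * fst (U x) powr (1 - \<alpha>) + t n * (f x * fst (U x) powr (- \<alpha>) * \<phi> x) = (f x * fst (U x) powr (- \<alpha>)) * \<psi> n x"
          by (simp add: \<psi>_def algebra_simps)
        also have "\<dots> \<le> (f x * fst (U x) powr (- \<alpha>)) * fst (\<Psi> n x)"
          using fx by (intro mult_left_mono) (auto simp: \<Psi>_def)
        finally show "f x * fst (U x) powr (1 - \<alpha>) + t n * (f x * fst (U x) powr (- \<alpha>) * \<phi> x) \<le> f x * fst (U x) powr (- \<alpha>) * fst (\<Psi> n x)" .
      qed
    qed (use iB if\<phi> ss(1) in auto)
    also have "\<dots> \<le> A_form U (\<Psi> n)" by (rule ss(2))
    also have "\<dots> \<le> (LINT x|M. penergy p (U x) + t n * F x + t n * R n x)"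
      unfolding A_form_def
    proof (rule integral_mono)
      show "integrable M (\<lambda>x. pflux2 p (U x) \<bullet> \<Psi> n x)" by (rule A_form_integrable[OF W0_Lp[OF UW] W0_Lp[OF \<Psi>W]])
      show "integrable M (\<lambda>x. penergy p (U x) + t n * F x + t n * R n x)" using iN iF iR by simp
      fix x
      show "pflux2 p (U x) \<bullet> \<Psi> n x \<le> penergy p (U x) + t n * F x + t n * R n x"
      proof (cases "\<psi> n x > 0")
        case True
        then have "\<Psi> n x = U x + t n *\<^sub>R jet \<phi> x" by (simp add: \<Psi>_def \<psi>_def jet_def prod_eq_iff)
        then have "pflux2 p (U x) \<bullet> \<Psi> n x = penergy p (U x) + t n * F x"
          by (simp add: inner_add_right pflux2_inner_self F_def)
        then show ?thesis using True by (simp add: R_def)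
      next
        case False
        then have "\<Psi> n x = 0" by (simp add: \<Psi>_def prod_eq_iff)
        moreover have "0 \<le> t n * F x + t n * \<bar>F x\<bar>" using t[of n] by (simp add: distrib_left[symmetric])
        then have "0 \<le> penergy p (U x) + (t n * F x + t n * \<bar>F x\<bar>)" by (rule add_nonneg_nonneg[OF penergy_nonneg])
        ultimately show ?thesis using False by (simp add: R_def add.assoc)
      qed
    qed
    also have "\<dots> = (LINT x|M. penergy p (U x)) + t n * A_form U (jet \<phi>) + t n * (LINT x|M. R n x)"
      using iN iF iR unfolding A_form_def F_def[symmetric] by simp
    \<comment> \<open>The scaling identity makes the terms of order 0 in \<open>t\<close> agree on
      both sides, so they cancel and the rest can be divided by \<open>t\<close>.\<close>
    also have "(LINT x|M. f x * fst (U x) powr (1 - \<alpha>) + t n * (f x * fst (U x) powr (- \<alpha>) * \<phi> x))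
       = (LINT x|M. penergy p (U x)) + t n * (LINT x|M. f x * fst (U x) powr (- \<alpha>) * \<phi> x)"
      using iB if\<phi> minimizer_virial[OF U] by simp
    finally have "t n * (LINT x|M. f x * fst (U x) powr (- \<alpha>) * \<phi> x) \<le> t n * (A_form U (jet \<phi>) + (LINT x|M. R n x))"
      by (simp add: distrib_left)
    then show ?thesis using t[of n] by simp
  qed
  have "(\<lambda>n. A_form U (jet \<phi>) + (LINT x|M. R n x)) \<longlonglongrightarrow> A_form U (jet \<phi>) + 0"
    using tendsto_add[OF tendsto_const Rl] by simp
  then have "(LINT x|M. f x * fst (U x) powr (- \<alpha>) * \<phi> x) \<le> A_form U (jet \<phi>) + 0"
    by (rule LIMSEQ_le_const) (use key in auto)
  then show ?thesis by simp
qed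

lemma minimizer_equation:
  assumes U: "minimizer U" and pos: "AE x in M. fst (U x) > 0" and \<phi>: "\<phi> \<in> test_functions \<Omega>"
  shows "A_form U (jet \<phi>) = (LINT x|M. f x * fst (U x) powr (- \<alpha>) * \<phi> x)"
proof -
  have m: "(\<lambda>x. -1 * \<phi> x) \<in> test_functions \<Omega>" by (rule test_cmult[OF \<phi>])
  have "jet (\<lambda>x. -1 * \<phi> x) x = - jet \<phi> x" for x
    using jet_cmult[OF test_smooth[OF \<phi>], of "-1" x] by simp
  then have "A_form U (jet (\<lambda>x. -1 * \<phi> x)) = - A_form U (jet \<phi>)"
    using A_form_integrable[OF W0_Lp[OF adm_W0] jet_Lp[OF \<phi>]] U by (simp add: A_form_def)
  then show ?thesis
    using minimizer_equation_le[OF U pos m] minimizer_equation_le[OF U pos \<phi>] by simp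
qed

end

subsection \<open>A Poincare inequality for two sets\<close>

lemma segment_bound:
  fixes g :: "'a::euclidean_space \<Rightarrow> real"
  assumes g: "smooth_fun g"
  shows "ennreal \<bar>g (x + h) - g x\<bar> \<le> (\<integral>\<^sup>+t. ennreal (norm h * norm (classical_grad g (x + t *\<^sub>R h))) * indicator {0..1} t \<partial>lborel)"
proof -
  have d: "((\<lambda>t. g (x + t *\<^sub>R h)) has_vector_derivative classical_grad g (x + t *\<^sub>R h) \<bullet> h) (at t within {0..1})" for t
  proof -
    have d1: "((\<lambda>t::real. x + t *\<^sub>R h) has_derivative (\<lambda>t. t *\<^sub>R h)) (at t within {0..1})"
      by (auto intro!: derivative_eq_intros)
    have d2: "(g has_derivative (\<bullet>) (classical_grad g (x + t *\<^sub>R h))) (at (x + t *\<^sub>R h))" by (rule smooth_grad[OF g])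
    from has_derivative_compose[OF d1 d2] show ?thesis
      by (simp add: has_vector_derivative_def)
  qed
  have i1: "((\<lambda>t. classical_grad g (x + t *\<^sub>R h) \<bullet> h) has_integral (g (x + 1 *\<^sub>R h) - g (x + 0 *\<^sub>R h))) {0..1}"
    by (rule fundamental_theorem_of_calculus) (use d in auto)
  let ?k = "\<lambda>t. norm h * norm (classical_grad g (x + t *\<^sub>R h))"
  have "continuous_on {0..1} ?k"
    by (intro continuous_intros continuous_on_compose2[OF smooth_continuous_grad[OF g]]) auto
  then have i2: "(?k has_integral integral {0..1} ?k) {0..1}"
    using integrable_continuous_interval integrable_integral by blast
  have "norm (g (x + 1 *\<^sub>R h) - g (x + 0 *\<^sub>R h)) \<le> integral {0..1} ?k"
    unfolding integral_unique[OF i1, symmetric]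
  proof (rule integral_norm_bound_integral)
    show "(\<lambda>t. classical_grad g (x + t *\<^sub>R h) \<bullet> h) integrable_on {0..1}" "?k integrable_on {0..1}"
      using i1 i2 by blast+
    show "norm (classical_grad g (x + t *\<^sub>R h) \<bullet> h) \<le> ?k t" for t
      using Cauchy_Schwarz_ineq2[of "classical_grad g (x + t *\<^sub>R h)" h] by (simp add: mult.commute)
  qed
  then show ?thesis
    using nn_integral_has_integral_lebesgue'[OF _ i2] by (simp add: ennreal_leI)
qed

text \<open>Writing \<open>y = x + h\<close> and integrating along the segment, only translation invariance is needed.\<close>

lemma double_integral_oscillation:
  fixes g :: "'a::euclidean_space \<Rightarrow> real"
  assumes g: "smooth_fun g" and r: "r > 0"
  shows "(\<integral>\<^sup>+x. indicator (ball x0 r) x * (\<integral>\<^sup>+y. indicator (ball x0 r) y * ennreal \<bar>g x - g y\<bar> \<partial>lborel) \<partial>lborel)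
     \<le> ennreal (2 * r) * emeasure lborel (ball (0::'a) (2 * r)) * (\<integral>\<^sup>+x. indicator (ball x0 (3 * r)) x * ennreal (norm (classical_grad g x)) \<partial>lborel)"
proof -
  let ?B = "indicator (ball x0 r) :: 'a \<Rightarrow> ennreal"
  let ?H = "indicator (ball 0 (2 * r)) :: 'a \<Rightarrow> ennreal"
  let ?T = "indicator (ball x0 (3 * r)) :: 'a \<Rightarrow> ennreal"
  define k where "k = (\<lambda>x. ennreal (norm (classical_grad g x)))"
  define I where "I = (\<integral>\<^sup>+x. ?T x * k x \<partial>lborel)"
  have bs: "(indicator (ball x s) :: 'a \<Rightarrow> ennreal) \<in> borel_measurable borel" for x s
    by (intro borel_measurable_indicator) simp
  have km: "k \<in> borel_measurable borel" unfolding k_def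
    using borel_measurable_continuous_onI[OF smooth_continuous_grad[OF g]] by measurable
  have gm: "g \<in> borel_measurable borel" using smooth_fun_continuous[OF g] by (rule borel_measurable_continuous_onI)
  \<comment> \<open>Two points of a ball of radius \<open>r\<close> differ by less than
    \<open>2 * r\<close>, and a point of the ball moved by at most that stays in the tripled ball;
    this is the origin of both radii in the statement.\<close>
  have tr: "(\<integral>\<^sup>+x. ?B x * k (x + t *\<^sub>R h) \<partial>lborel) \<le> I" if t: "t \<in> {0..1}" and h: "norm h < 2 * r" for t h
  proof -
    have "(\<integral>\<^sup>+x. ?B x * k (x + t *\<^sub>R h) \<partial>lborel) \<le> (\<integral>\<^sup>+x. ?T (x + t *\<^sub>R h) * k (x + t *\<^sub>R h) \<partial>lborel)"
    proof (rule nn_integral_mono)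
      fix x
      have "x + t *\<^sub>R h \<in> ball x0 (3 * r)" if "x \<in> ball x0 r"
      proof -
        have "dist x0 (x + t *\<^sub>R h) \<le> dist x0 x + dist x (x + t *\<^sub>R h)" by (rule dist_triangle)
        also have "dist x (x + t *\<^sub>R h) \<le> norm h" using t by (simp add: dist_norm mult_left_le_one_le)
        finally show ?thesis using that h by simp
      qed
      then show "?B x * k (x + t *\<^sub>R h) \<le> ?T (x + t *\<^sub>R h) * k (x + t *\<^sub>R h)"
        by (intro mult_right_mono) (auto split: split_indicator)
    qed
    also have "\<dots> = I" unfolding I_def
      by (rule nn_integral_lborel_translate[where f="\<lambda>x. ?T x * k x"]) (intro borel_measurable_times_ennreal bs km)
    finally show ?thesis .
  qed
  have hx: "(\<integral>\<^sup>+x. ?B x * ennreal \<bar>g (x + h) - g x\<bar> \<partial>lborel) \<le> ennreal (2 * r) * I" if h: "norm h < 2 * r" for h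
  proof -
    have "(\<integral>\<^sup>+x. ?B x * ennreal \<bar>g (x + h) - g x\<bar> \<partial>lborel)
      \<le> (\<integral>\<^sup>+x. (\<integral>\<^sup>+t. ?B x * (ennreal (2 * r) * (k (x + t *\<^sub>R h) * indicator {0..1} t)) \<partial>lborel) \<partial>lborel)"
    proof (rule nn_integral_mono)
      fix x
      have m: "(\<lambda>t. k (x + t *\<^sub>R h) * indicator {0..1::real} t) \<in> borel_measurable lborel"
        by (intro borel_measurable_times_ennreal measurable_compose[OF _ km]) auto
      have "ennreal \<bar>g (x + h) - g x\<bar> \<le> (\<integral>\<^sup>+t. ennreal (norm h * norm (classical_grad g (x + t *\<^sub>R h))) * indicator {0..1} t \<partial>lborel)"
        by (rule segment_bound[OF g])
      also have "\<dots> \<le> (\<integral>\<^sup>+t. ennreal (2 * r) * (k (x + t *\<^sub>R h) * indicator {0..1} t) \<partial>lborel)"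
      proof (rule nn_integral_mono)
        fix t :: real
        have "ennreal (norm h * norm (classical_grad g (x + t *\<^sub>R h))) \<le> ennreal (2 * r * norm (classical_grad g (x + t *\<^sub>R h)))"
          using h by (intro ennreal_leI mult_right_mono) auto
        also have "\<dots> = ennreal (2 * r) * k (x + t *\<^sub>R h)" unfolding k_def using r by (intro ennreal_mult) auto
        finally show "ennreal (norm h * norm (classical_grad g (x + t *\<^sub>R h))) * indicator {0..1} t
            \<le> ennreal (2 * r) * (k (x + t *\<^sub>R h) * indicator {0..1} t)"
          unfolding mult.assoc[symmetric] by (rule mult_right_mono) simp
      qed
      finally have "?B x * ennreal \<bar>g (x + h) - g x\<bar> \<le> ?B x * (\<integral>\<^sup>+t. ennreal (2 * r) * (k (x + t *\<^sub>R h) * indicator {0..1} t) \<partial>lborel)"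
        by (rule mult_left_mono) simp
      also have "\<dots> = (\<integral>\<^sup>+t. ?B x * (ennreal (2 * r) * (k (x + t *\<^sub>R h) * indicator {0..1} t)) \<partial>lborel)"
        by (rule nn_integral_cmult[symmetric]) (intro borel_measurable_times_ennreal m borel_measurable_const)
      finally show "?B x * ennreal \<bar>g (x + h) - g x\<bar> \<le> (\<integral>\<^sup>+t. ?B x * (ennreal (2 * r) * (k (x + t *\<^sub>R h) * indicator {0..1} t)) \<partial>lborel)" .
    qed
    also have "\<dots> = (\<integral>\<^sup>+t. (\<integral>\<^sup>+x. ?B x * (ennreal (2 * r) * (k (x + t *\<^sub>R h) * indicator {0..1} t)) \<partial>lborel) \<partial>lborel)"
    proof (rule lborel_pair.Fubini')
      have a: "(\<lambda>z :: real \<times> 'a. snd z + fst z *\<^sub>R h) \<in> borel_measurable (lborel \<Otimes>\<^sub>M lborel)"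
        by (intro borel_measurable_add borel_measurable_scaleR borel_measurable_const) simp_all
      have bl: "?B \<in> borel_measurable lborel" and il: "(indicator {0..1} :: real \<Rightarrow> ennreal) \<in> borel_measurable lborel"
        using bs by auto
      show "(\<lambda>(t, x). ?B x * (ennreal (2 * r) * (k (x + t *\<^sub>R h) * indicator {0..1} t))) \<in> borel_measurable (lborel \<Otimes>\<^sub>M lborel)"
        unfolding case_prod_beta
        by (intro borel_measurable_times_ennreal borel_measurable_const measurable_compose[OF measurable_snd bl]
            measurable_compose[OF measurable_fst il] measurable_compose[OF a km])
    qed
    also have "\<dots> \<le> (\<integral>\<^sup>+t. ennreal (2 * r) * I * indicator {0..1::real} t \<partial>lborel)"
    proof (rule nn_integral_mono)
      fix t :: real
      have "(\<integral>\<^sup>+x. ?B x * (ennreal (2 * r) * (k (x + t *\<^sub>R h) * indicator {0..1} t)) \<partial>lborel)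
         = (\<integral>\<^sup>+x. (ennreal (2 * r) * indicator {0..1} t) * (?B x * k (x + t *\<^sub>R h)) \<partial>lborel)"
        by (intro nn_integral_cong) (simp add: mult_ac)
      also have "\<dots> = (ennreal (2 * r) * indicator {0..1} t) * (\<integral>\<^sup>+x. ?B x * k (x + t *\<^sub>R h) \<partial>lborel)"
        by (rule nn_integral_cmult) (use bs in \<open>intro borel_measurable_times_ennreal measurable_compose[OF _ km]; simp\<close>)
      also have "\<dots> \<le> ennreal (2 * r) * I * indicator {0..1} t"
        using tr[of t h] h by (cases "t \<in> {0..1}") (auto intro: mult_left_mono)
      finally show "(\<integral>\<^sup>+x. ?B x * (ennreal (2 * r) * (k (x + t *\<^sub>R h) * indicator {0..1} t)) \<partial>lborel) \<le> ennreal (2 * r) * I * indicator {0..1} t" .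
    qed
    also have "\<dots> = ennreal (2 * r) * I" by (subst nn_integral_cmult_indicator) auto
    finally show ?thesis .
  qed
  have "(\<integral>\<^sup>+x. ?B x * (\<integral>\<^sup>+y. ?B y * ennreal \<bar>g x - g y\<bar> \<partial>lborel) \<partial>lborel)
      \<le> (\<integral>\<^sup>+x. (\<integral>\<^sup>+h. ?H h * (?B x * ennreal \<bar>g (x + h) - g x\<bar>) \<partial>lborel) \<partial>lborel)"
  proof (rule nn_integral_mono)
    fix x
    have dm: "(\<lambda>y. ennreal \<bar>g x - g y\<bar>) \<in> borel_measurable borel" using gm by measurable
    have "(\<integral>\<^sup>+y. ?B y * ennreal \<bar>g x - g y\<bar> \<partial>lborel) = (\<integral>\<^sup>+h. ?B (h + x) * ennreal \<bar>g x - g (h + x)\<bar> \<partial>lborel)"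
      by (rule nn_integral_lborel_translate[symmetric, where f="\<lambda>y. ?B y * ennreal \<bar>g x - g y\<bar>"])
         (intro borel_measurable_times_ennreal bs dm)
    then have "?B x * (\<integral>\<^sup>+y. ?B y * ennreal \<bar>g x - g y\<bar> \<partial>lborel) = ?B x * (\<integral>\<^sup>+h. ?B (h + x) * ennreal \<bar>g x - g (h + x)\<bar> \<partial>lborel)" by simp
    also have "\<dots> = (\<integral>\<^sup>+h. ?B x * (?B (h + x) * ennreal \<bar>g x - g (h + x)\<bar>) \<partial>lborel)"
      by (rule nn_integral_cmult[symmetric])
         (intro borel_measurable_times_ennreal measurable_compose[OF _ bs] measurable_compose[OF _ dm], auto)
    also have "\<dots> \<le> (\<integral>\<^sup>+h. ?H h * (?B x * ennreal \<bar>g (x + h) - g x\<bar>) \<partial>lborel)"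
    proof (rule nn_integral_mono)
      fix h
      have "h \<in> ball 0 (2 * r)" if "x \<in> ball x0 r" "h + x \<in> ball x0 r"
      proof -
        have "norm h = dist (h + x) x" by (simp add: dist_norm)
        also have "\<dots> \<le> dist (h + x) x0 + dist x0 x" by (rule dist_triangle)
        also have "\<dots> = dist x0 (h + x) + dist x0 x" by (simp only: dist_commute)
        also have "\<dots> < r + r" using that unfolding mem_ball by (rule add_strict_mono[rotated])
        finally show ?thesis by simp
      qed
      then show "?B x * (?B (h + x) * ennreal \<bar>g x - g (h + x)\<bar>) \<le> ?H h * (?B x * ennreal \<bar>g (x + h) - g x\<bar>)"
        by (auto split: split_indicator simp: abs_minus_commute add.commute)
    qed
    finally show "?B x * (\<integral>\<^sup>+y. ?B y * ennreal \<bar>g x - g y\<bar> \<partial>lborel) \<le> (\<integral>\<^sup>+h. ?H h * (?B x * ennreal \<bar>g (x + h) - g x\<bar>) \<partial>lborel)" .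
  qed
  also have "\<dots> = (\<integral>\<^sup>+h. (\<integral>\<^sup>+x. ?H h * (?B x * ennreal \<bar>g (x + h) - g x\<bar>) \<partial>lborel) \<partial>lborel)"
  proof (rule lborel_pair.Fubini')
    have a: "(\<lambda>z :: 'a \<times> 'a. snd z + fst z) \<in> borel_measurable (lborel \<Otimes>\<^sub>M lborel)"
      by (intro borel_measurable_add) simp_all
    have bl: "?B \<in> borel_measurable lborel" "?H \<in> borel_measurable lborel" and gl: "g \<in> borel_measurable lborel"
      using bs gm by auto
    have "(\<lambda>z :: 'a \<times> 'a. ennreal \<bar>g (snd z + fst z) - g (snd z)\<bar>) \<in> borel_measurable (lborel \<Otimes>\<^sub>M lborel)"
      using measurable_compose[OF a gm] measurable_compose[OF measurable_snd gl] by measurable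
    then show "(\<lambda>(h, x). ?H h * (?B x * ennreal \<bar>g (x + h) - g x\<bar>)) \<in> borel_measurable (lborel \<Otimes>\<^sub>M lborel)"
      unfolding case_prod_beta
      by (intro borel_measurable_times_ennreal measurable_compose[OF measurable_snd bl(1)] measurable_compose[OF measurable_fst bl(2)])
  qed
  also have "\<dots> \<le> (\<integral>\<^sup>+h. ennreal (2 * r) * I * ?H h \<partial>lborel)"
  proof (rule nn_integral_mono)
    fix h :: 'a
    have "(\<lambda>x. ?B x * ennreal \<bar>g (x + h) - g x\<bar>) \<in> borel_measurable lborel"
      using bs gm measurable_compose[OF _ gm, of "\<lambda>x. x + h" lborel] by (intro borel_measurable_times_ennreal) auto
    then have "(\<integral>\<^sup>+x. ?H h * (?B x * ennreal \<bar>g (x + h) - g x\<bar>) \<partial>lborel) = ?H h * (\<integral>\<^sup>+x. ?B x * ennreal \<bar>g (x + h) - g x\<bar> \<partial>lborel)"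
      by (rule nn_integral_cmult)
    also have "\<dots> \<le> ennreal (2 * r) * I * ?H h"
      using hx[of h] by (cases "h \<in> ball 0 (2 * r)") auto
    finally show "(\<integral>\<^sup>+x. ?H h * (?B x * ennreal \<bar>g (x + h) - g x\<bar>) \<partial>lborel) \<le> ennreal (2 * r) * I * ?H h" .
  qed
  also have "\<dots> = ennreal (2 * r) * I * emeasure lborel (ball (0::'a) (2 * r))"
    by (subst nn_integral_cmult_indicator) auto
  finally show ?thesis by (simp add: I_def k_def mult_ac)
qed

context sobolev
begin

lemma nn_integral_M_le_lborel: "(\<integral>\<^sup>+x. g x \<partial>M) \<le> (\<integral>\<^sup>+x. g x \<partial>lborel)"
proof -
  have "(\<integral>\<^sup>+x. g x \<partial>M) = (\<integral>\<^sup>+x. g x * indicator \<Omega> x \<partial>lebesgue)" by (rule nn_integral_restrict_space) simp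
  also have "\<dots> \<le> (\<integral>\<^sup>+x. g x \<partial>lebesgue)" by (rule nn_integral_mono) (simp split: split_indicator)
  finally show ?thesis by (simp add: nn_integral_completion)
qed

lemma nn_integral_lborel_eq_M:
  assumes "\<And>x. x \<notin> \<Omega> \<Longrightarrow> g x = 0"
  shows "(\<integral>\<^sup>+x. g x \<partial>lborel) = (\<integral>\<^sup>+x. g x \<partial>M)"
proof -
  have "(\<integral>\<^sup>+x. g x \<partial>M) = (\<integral>\<^sup>+x. g x * indicator \<Omega> x \<partial>lebesgue)" by (rule nn_integral_restrict_space) simp
  also have "(\<lambda>x. g x * indicator \<Omega> x) = g"
  proof
    show "g x * indicator \<Omega> x = g x" for x by (cases "x \<in> \<Omega>") (use assms in auto)
  qed
  finally show ?thesis by (simp add: nn_integral_completion)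
qed

text \<open>For points of \<open>Z\<close> and \<open>P\<close> the values differ by at least
  \<open>L\<close>, so the product of measures times \<open>L\<close> is below the double integral
  of the oscillation, hence below the gradient over the tripled ball. Smooth approximants obey the
  upper bound but have no prescribed values on \<open>Z\<close> and \<open>P\<close>; Fatou in each
  variable yields the lower bound in the limit.\<close>

lemma W0_two_sets:
  assumes V: "V \<in> W0" and r: "r > 0" "ball x0 (3 * r) \<subseteq> \<Omega>"
    and Z: "Z \<in> sets M" "Z \<subseteq> ball x0 r" "\<And>x. x \<in> Z \<Longrightarrow> fst (V x) = 0"
    and P: "P \<in> sets M" "P \<subseteq> ball x0 r" "\<And>x. x \<in> P \<Longrightarrow> fst (V x) \<ge> L" and L: "L \<ge> 0"
  shows "L * measure M Z * measure M P
    \<le> 2 * r * measure lborel (ball (0::'a) (2 * r)) * (LINT x|M. indicator (ball x0 (3 * r)) x * norm (snd (V x)))"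
proof -
  obtain \<phi> where \<phi>: "\<And>n::nat. \<phi> n \<in> test_functions \<Omega>" "(\<lambda>n. Lp_dist M p (jet (\<phi> n)) V) \<longlonglongrightarrow> 0"
    "AE x in M. (\<lambda>n. jet (\<phi> n) x) \<longlonglongrightarrow> V x" using W0_seq[OF V] by blast
  have ae: "AE x in M. (\<lambda>n. \<phi> n x) \<longlonglongrightarrow> fst (V x)"
    using \<phi>(3)
  proof eventually_elim
    fix x assume "(\<lambda>n. jet (\<phi> n) x) \<longlonglongrightarrow> V x"
    from tendsto_fst[OF this] show "(\<lambda>n. \<phi> n x) \<longlonglongrightarrow> fst (V x)" by (simp add: jet_def)
  qed
  define c where "c = 2 * r * measure lborel (ball (0::'a) (2 * r))"
  have c0: "c \<ge> 0" using r by (simp add: c_def)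
  have ce: "ennreal (2 * r) * emeasure lborel (ball (0::'a) (2 * r)) = ennreal c"
  proof -
    have "emeasure lborel (ball (0::'a) (2 * r)) = ennreal (measure lborel (ball (0::'a) (2 * r)))"
      using emeasure_bounded_finite[of "ball (0::'a) (2 * r)"] by (intro emeasure_eq_ennreal_measure) simp
    then show ?thesis using r by (simp add: c_def ennreal_mult)
  qed
  let ?T = "indicator (ball x0 (3 * r)) :: 'a \<Rightarrow> real"
  define G where "G = (\<lambda>n. LINT x|M. ?T x * norm (classical_grad (\<phi> n) x))"
  have \<phi>m: "\<phi> n \<in> borel_measurable M" for n by (rule cont_measurable[OF smooth_fun_continuous[OF test_smooth[OF \<phi>(1)]]])
  have Tm: "?T \<in> borel_measurable M"
    by (rule borel_measurable_indicator) (use r in \<open>auto simp: sets_restrict_space_iff\<close>)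
  have p0: "0 \<le> p" and p1: "1 \<le> p" using p by auto
  have Gi: "integrable M (\<lambda>x. ?T x * norm (snd (U x)))" if U: "U \<in> W0" for U
  proof (rule Bochner_Integration.integrable_bound[OF Lp_integrable_norm[OF Lp_norm[OF W0_Lp[OF U]]]])
    show "(\<lambda>x. ?T x * norm (snd (U x))) \<in> borel_measurable M"
      using Tm W0_snd_measurable[OF U] by measurable
    show "AE x in M. norm (?T x * norm (snd (U x))) \<le> norm (norm (U x))"
      by (intro AE_I2) (simp add: norm_snd_le_norm abs_mult split: split_indicator)
  qed
  have Glim: "G \<longlonglongrightarrow> (LINT x|M. ?T x * norm (snd (V x)))"
  proof -
    define k where "k = (\<lambda>n x. ?T x * norm (classical_grad (\<phi> n) x) - ?T x * norm (snd (V x)))"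
    define w where "w = (\<lambda>n x. jet (\<phi> n) x - V x)"
    have w: "w n \<in> Lp_space M p" for n unfolding w_def by (rule Lp_diff[OF jet_Lp[OF \<phi>(1)] W0_Lp[OF V] p0])
    have wl: "(\<lambda>n. LINT x|M. norm (w n x) powr p) \<longlonglongrightarrow> 0" using \<phi>(2) by (simp add: Lp_dist_def w_def)
    have g: "(\<lambda>x. 1::real) \<in> Lp_space M p" by (rule Lp_bounded[where B=1]) auto
    have i: "integrable M (\<lambda>x. ?T x * norm (classical_grad (\<phi> n) x))" for n
      using Gi[OF jet_W0[OF \<phi>(1)]] by (simp add: jet_def)
    have km: "k n \<in> borel_measurable M" for n unfolding k_def using i Gi[OF V] by simp
    have kle: "\<bar>k n x\<bar> \<le> 1 * (norm (1::real) powr (p - 1) * norm (w n x))" for n x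
    proof -
      have "\<bar>k n x\<bar> \<le> \<bar>norm (classical_grad (\<phi> n) x) - norm (snd (V x))\<bar>"
        by (simp add: k_def split: split_indicator)
      also have "\<dots> \<le> norm (classical_grad (\<phi> n) x - snd (V x))" by (rule norm_triangle_ineq3)
      also have "\<dots> \<le> norm (w n x)" using norm_snd_le_norm[of "w n x"] by (simp add: w_def jet_def)
      finally show ?thesis by simp
    qed
    have "(\<lambda>n. LINT x|M. k n x) \<longlonglongrightarrow> 0"
      by (rule integral_mult_tendsto_0(3)[OF p1 w wl g km AE_I2[OF kle]]) simp
    moreover have "(LINT x|M. k n x) = G n - (LINT x|M. ?T x * norm (snd (V x)))" for n
      unfolding k_def G_def using i Gi[OF V] by simp
    ultimately show ?thesis using LIM_zero_cancel by simp
  qed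
  define D where "D = (\<lambda>n x. (\<integral>\<^sup>+y. indicator P y * ennreal \<bar>\<phi> n x - \<phi> n y\<bar> \<partial>M))"
  have Dm: "D n \<in> borel_measurable M" for n
  proof -
    have 1: "(\<lambda>z. \<phi> n (fst z)) \<in> borel_measurable (M \<Otimes>\<^sub>M M)" "(\<lambda>z. \<phi> n (snd z)) \<in> borel_measurable (M \<Otimes>\<^sub>M M)"
      by (rule measurable_compose[OF measurable_fst \<phi>m], rule measurable_compose[OF measurable_snd \<phi>m])
    have 2: "(\<lambda>z. indicator P (snd z) :: ennreal) \<in> borel_measurable (M \<Otimes>\<^sub>M M)"
      by (rule measurable_compose[OF measurable_snd borel_measurable_indicator[OF P(1)]])
    have "(\<lambda>z. indicator P (snd z) * ennreal \<bar>\<phi> n (fst z) - \<phi> n (snd z)\<bar>) \<in> borel_measurable (M \<Otimes>\<^sub>M M)"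
      using 1 2 by measurable
    then show ?thesis unfolding D_def
      by (intro fin.borel_measurable_nn_integral) (simp add: case_prod_beta)
  qed
  have up: "(\<integral>\<^sup>+x. indicator Z x * D n x \<partial>M) \<le> ennreal (c * G n)" for n
  proof -
    have s: "smooth_fun (\<phi> n)" by (rule test_smooth[OF \<phi>(1)])
    let ?B = "indicator (ball x0 r) :: 'a \<Rightarrow> ennreal"
    have "(\<integral>\<^sup>+x. indicator Z x * D n x \<partial>M) \<le> (\<integral>\<^sup>+x. ?B x * (\<integral>\<^sup>+y. ?B y * ennreal \<bar>\<phi> n x - \<phi> n y\<bar> \<partial>lborel) \<partial>M)"
    proof (rule nn_integral_mono)
      fix x
      have "D n x \<le> (\<integral>\<^sup>+y. ?B y * ennreal \<bar>\<phi> n x - \<phi> n y\<bar> \<partial>M)" unfolding D_def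
        using P(2) by (intro nn_integral_mono mult_right_mono) (auto split: split_indicator)
      also have "\<dots> \<le> (\<integral>\<^sup>+y. ?B y * ennreal \<bar>\<phi> n x - \<phi> n y\<bar> \<partial>lborel)" by (rule nn_integral_M_le_lborel)
      finally show "indicator Z x * D n x \<le> ?B x * (\<integral>\<^sup>+y. ?B y * ennreal \<bar>\<phi> n x - \<phi> n y\<bar> \<partial>lborel)"
        using Z(2) by (intro mult_mono) (auto split: split_indicator)
    qed
    also have "\<dots> \<le> (\<integral>\<^sup>+x. ?B x * (\<integral>\<^sup>+y. ?B y * ennreal \<bar>\<phi> n x - \<phi> n y\<bar> \<partial>lborel) \<partial>lborel)"
      by (rule nn_integral_M_le_lborel)
    also have "\<dots> \<le> ennreal c * (\<integral>\<^sup>+x. indicator (ball x0 (3 * r)) x * ennreal (norm (classical_grad (\<phi> n) x)) \<partial>lborel)"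
      using double_integral_oscillation[OF s r(1), of x0] by (simp add: ce)
    also have "(\<integral>\<^sup>+x. indicator (ball x0 (3 * r)) x * ennreal (norm (classical_grad (\<phi> n) x)) \<partial>lborel)
      = (\<integral>\<^sup>+x. indicator (ball x0 (3 * r)) x * ennreal (norm (classical_grad (\<phi> n) x)) \<partial>M)"
      by (rule nn_integral_lborel_eq_M) (use test_vanish(2)[OF \<phi>(1)] in simp)
    also have "\<dots> = (\<integral>\<^sup>+x. ennreal (?T x * norm (classical_grad (\<phi> n) x)) \<partial>M)"
      by (intro nn_integral_cong) (simp split: split_indicator)
    also have "\<dots> = ennreal (G n)" unfolding G_def
      by (rule nn_integral_eq_integral) (use Gi[OF jet_W0[OF \<phi>(1)[of n]]] in \<open>auto simp: jet_def\<close>)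
    also have "ennreal c * ennreal (G n) = ennreal (c * G n)"
      using c0 by (simp add: ennreal_mult' )
    finally show ?thesis .
  qed
  have low: "AE x in M. indicator Z x * (ennreal L * emeasure M P) \<le> liminf (\<lambda>n. indicator Z x * D n x)"
    using ae
  proof eventually_elim
    fix x assume x: "(\<lambda>n. \<phi> n x) \<longlonglongrightarrow> fst (V x)"
    show "indicator Z x * (ennreal L * emeasure M P) \<le> liminf (\<lambda>n. indicator Z x * D n x)"
    proof (cases "x \<in> Z")
      case True
      have "ennreal L * emeasure M P = (\<integral>\<^sup>+y. ennreal L * indicator P y \<partial>M)" using P(1) by (simp add: nn_integral_cmult_indicator)
      also have "\<dots> \<le> (\<integral>\<^sup>+y. liminf (\<lambda>n. indicator P y * ennreal \<bar>\<phi> n x - \<phi> n y\<bar>) \<partial>M)"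
      proof (rule nn_integral_mono_AE, use ae in eventually_elim)
        fix y assume y: "(\<lambda>n. \<phi> n y) \<longlonglongrightarrow> fst (V y)"
        show "ennreal L * indicator P y \<le> liminf (\<lambda>n. indicator P y * ennreal \<bar>\<phi> n x - \<phi> n y\<bar>)"
        proof (cases "y \<in> P")
          case yP: True
          have "(\<lambda>n. \<bar>\<phi> n x - \<phi> n y\<bar>) \<longlonglongrightarrow> \<bar>fst (V x) - fst (V y)\<bar>" by (intro tendsto_rabs tendsto_diff x y)
          from tendsto_ennrealI[OF this] have "liminf (\<lambda>n. ennreal \<bar>\<phi> n x - \<phi> n y\<bar>) = ennreal \<bar>fst (V x) - fst (V y)\<bar>"
            by (simp add: lim_imp_Liminf)
          moreover have "L \<le> \<bar>fst (V x) - fst (V y)\<bar>" using Z(3)[OF True] P(3)[OF yP] by simp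
          ultimately show ?thesis using yP by (simp add: ennreal_leI)
        qed simp
      qed
      also have "\<dots> \<le> liminf (\<lambda>n. \<integral>\<^sup>+y. indicator P y * ennreal \<bar>\<phi> n x - \<phi> n y\<bar> \<partial>M)"
      proof (rule nn_integral_liminf)
        show "(\<lambda>y. indicator P y * ennreal \<bar>\<phi> n x - \<phi> n y\<bar>) \<in> borel_measurable M" for n
          using \<phi>m[of n] P(1) by measurable
      qed
      finally show ?thesis using True by (simp add: D_def)
    qed simp
  qed
  have "ennreal L * emeasure M P * emeasure M Z = (\<integral>\<^sup>+x. ennreal L * emeasure M P * indicator Z x \<partial>M)"
    using Z(1) by (simp add: nn_integral_cmult_indicator)
  also have "\<dots> \<le> (\<integral>\<^sup>+x. liminf (\<lambda>n. indicator Z x * D n x) \<partial>M)"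
    by (rule nn_integral_mono_AE) (use low in \<open>simp add: mult.commute mult.left_commute\<close>)
  also have "\<dots> \<le> liminf (\<lambda>n. \<integral>\<^sup>+x. indicator Z x * D n x \<partial>M)"
    by (rule nn_integral_liminf) (use Dm Z(1) in measurable)
  also have "\<dots> \<le> liminf (\<lambda>n. ennreal (c * G n))"
    by (rule Liminf_mono) (use up in simp)
  also have "\<dots> = ennreal (c * (LINT x|M. ?T x * norm (snd (V x))))"
    by (rule lim_imp_Liminf) (auto intro!: tendsto_ennrealI tendsto_mult Glim)
  finally have fin: "ennreal L * emeasure M P * emeasure M Z \<le> ennreal (c * (LINT x|M. ?T x * norm (snd (V x))))" .
  have "ennreal L * emeasure M P * emeasure M Z = ennreal (L * measure M P * measure M Z)"
    using L by (simp add: fin.emeasure_eq_measure ennreal_mult)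
  then have "L * measure M P * measure M Z \<le> c * (LINT x|M. ?T x * norm (snd (V x)))"
    using fin c0 by (simp add: ennreal_le_iff)
  then show ?thesis by (simp add: c_def mult_ac)
qed

end

subsection \<open>The strong maximum principle\<close>

text \<open>\<open>lift1\<close> is \<open>1 + t\<close> on \<open>[0, \<infinity>)\<close>, extended to a smooth function bounded below by \<open>1/2\<close>.\<close>

definition lift1 :: "real \<Rightarrow> real" where
  "lift1 t = 1 + t * smooth_step (3 + 4 * t)"

lemma smooth_lift1: "smooth_fun lift1"
  unfolding lift1_def[abs_def]
  by (rule smooth_fun_add[OF smooth_fun_const smooth_fun_mult[OF smooth_fun_ident_real
        smooth_fun_compose_real[OF smooth_fun_step smooth_fun_add[OF smooth_fun_const smooth_fun_mult[OF smooth_fun_const smooth_fun_ident_real]]]]])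

lemma lift1_ge: "lift1 t \<ge> 1/2"
proof -
  consider "t \<le> - 1/2" | "- 1/2 < t" "t < 0" | "t \<ge> 0" by linarith
  then show ?thesis
  proof cases
    case 1 then show ?thesis by (simp add: lift1_def smooth_step_0)
  next
    case 2
    have "(- t) * smooth_step (3 + 4 * t) \<le> - t" using 2 smooth_step_le1 by (intro mult_left_le) auto
    then show ?thesis using 2 unfolding lift1_def by linarith
  next
    case 3 then show ?thesis using smooth_step_ge0[of "3 + 4 * t"] by (simp add: lift1_def add_increasing2)
  qed
qed

lemma lift1_eq: "t \<ge> - 1/4 \<Longrightarrow> lift1 t = 1 + t"
  by (simp add: lift1_def smooth_step_1)

lemma deriv_lift1: "t \<ge> 0 \<Longrightarrow> deriv lift1 t = 1"
proof -
  assume t: "t \<ge> 0"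
  have "((\<lambda>t. 1 + t) has_real_derivative 1) (at t)" by (auto intro!: derivative_eq_intros)
  then have "(lift1 has_real_derivative 1) (at t)"
    by (rule has_field_derivative_transform_within_open[where S="{- 1/4<..}"]) (use t lift1_eq in auto)
  then show ?thesis by (rule DERIV_imp_deriv)
qed

lemma deriv_lift1_bounded:
  obtains C where "C \<ge> 0" "\<And>t. \<bar>deriv lift1 t\<bar> \<le> C"
proof -
  have "compact (deriv lift1 ` {-1..0::real})"
    by (rule compact_continuous_image) (use continuous_on_subset[OF smooth_real_deriv(3)[OF smooth_lift1]] in auto)
  then obtain B where B: "\<And>y. y \<in> deriv lift1 ` {-1..0::real} \<Longrightarrow> norm y \<le> B"
    using compact_imp_bounded bounded_iff by metis
  have "\<bar>deriv lift1 t\<bar> \<le> max B 1" for t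
  proof -
    consider "t < - 1" | "t \<in> {-1..0}" | "t \<ge> 0" by fastforce
    then show ?thesis
    proof cases
      case 1
      have "((\<lambda>t. 1) has_real_derivative 0) (at t)" by simp
      then have "(lift1 has_real_derivative 0) (at t)"
        by (rule has_field_derivative_transform_within_open[where S="{..< - 1/2}"])
           (use 1 in \<open>auto simp: lift1_def smooth_step_0\<close>)
      then show ?thesis by (simp add: DERIV_imp_deriv)
    next
      case 2 then show ?thesis using B[of "deriv lift1 t"] by auto
    next
      case 3 then show ?thesis by (simp add: deriv_lift1)
    qed
  qed
  then show ?thesis using that[of "max B 1"] by auto
qed

text \<open>With \<open>\<kappa>\<close> the value of \<open>z * q\<close> at which \<open>a\<close>
  equals \<open>(p - 1) / 2\<close> times \<open>z * q\<close>: above it the left side is absorbed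
  into the first summand, below it the left side is at most
  \<open>a * \<kappa> powr (p - 1)\<close>. The latter uses
  \<open>z ^ (m - 1) \<le> z powr (p - 1)\<close>, from \<open>z \<le> 1\<close> and
  \<open>m \<ge> p\<close>.\<close>

lemma log_estimate_young:
  fixes q z a p :: real and m :: nat
  assumes q: "0 \<le> q" and z: "0 \<le> z" "z \<le> 1" and a: "0 \<le> a" and p: "1 < p" and m: "p \<le> real m"
  shows "q powr (p - 1) * (a * z ^ (m - 1)) \<le> (p - 1) / 2 * (z ^ m * q powr p) + a * (2 * a / (p - 1)) powr (p - 1)"
proof -
  define \<kappa> where "\<kappa> = 2 * a / (p - 1)"
  have m2: "m \<ge> 2" using p m by (cases m) auto
  have zm: "z ^ m = z ^ (m - 1) * z" using m2 by (metis One_nat_def Suc_pred less_le_trans pos2 power_Suc2)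
  show ?thesis
  proof (cases "z * q \<ge> \<kappa>")
    case True
    have "a \<le> (p - 1) / 2 * (z * q)" using True p by (simp add: \<kappa>_def field_simps)
    then have "(z ^ (m - 1) * q powr (p - 1)) * a \<le> (z ^ (m - 1) * q powr (p - 1)) * ((p - 1) / 2 * (z * q))"
      using z by (intro mult_left_mono) auto
    also have "\<dots> = (p - 1) / 2 * (z ^ m * q powr p)"
    proof -
      have "q powr (p - 1) * q = q powr p" using q p by (cases "q = 0") (auto simp: powr_diff)
      then show ?thesis unfolding zm by (metis (no_types, opaque_lifting) mult.assoc mult.commute)
    qed
    finally show ?thesis using a by (simp add: mult_ac add_increasing2)
  next
    case False
    have "z ^ (m - 1) \<le> z powr (p - 1)"
    proof (cases "z = 0")
      case True then show ?thesis using m2 by (simp add: power_0_left)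
    next
      case False
      have "z ^ (m - 1) = z powr (real (m - 1))" using False z by (simp add: powr_realpow)
      also have "\<dots> \<le> z powr (p - 1)" using z False m m2 by (intro powr_mono') (auto simp: of_nat_diff)
      finally show ?thesis .
    qed
    then have "q powr (p - 1) * (a * z ^ (m - 1)) \<le> q powr (p - 1) * (a * z powr (p - 1))"
      using a by (intro mult_left_mono) auto
    also have "\<dots> = a * (z * q) powr (p - 1)" using z q by (simp add: powr_mult)
    also have "\<dots> \<le> a * \<kappa> powr (p - 1)" using False z q p a by (intro mult_left_mono powr_mono2) auto
    finally show ?thesis using z p unfolding \<kappa>_def by (simp add: add_increasing)
  qed
qed

context singular_problem
begin

text \<open>The right-hand side is replaced by 0. The class is then closed under multiplication by
  positive constants, on which the blow-up argument rests.\<close>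

definition supersolution :: "('a \<Rightarrow> real \<times> 'a) \<Rightarrow> bool" where
  "supersolution W \<longleftrightarrow> W \<in> W0 \<and> (AE x in M. fst (W x) \<ge> 0) \<and>
     (\<forall>\<Psi>\<in>W0. (AE x in M. fst (\<Psi> x) \<ge> 0) \<longrightarrow> 0 \<le> A_form W \<Psi>)"

lemma supersolution_scaleR:
  assumes "supersolution W" "\<delta> > 0" shows "supersolution (\<lambda>x. \<delta> *\<^sub>R W x)"
proof -
  have "AE x in M. fst (\<delta> *\<^sub>R W x) \<ge> 0"
    using assms(1) unfolding supersolution_def by (auto elim!: eventually_mono simp: assms(2) less_imp_le)
  moreover have "A_form (\<lambda>x. \<delta> *\<^sub>R W x) \<Psi> = \<delta> powr (p - 1) * A_form W \<Psi>" for \<Psi>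
    by (simp add: A_form_def pflux2_scaleR[OF assms(2)])
  ultimately show ?thesis using assms W0_scaleR by (simp add: supersolution_def)
qed

lemma minimizer_is_supersolution:
  assumes "minimizer U" shows "supersolution U"
  using assms minimizer_supersolution(3)[OF assms] by (auto simp: supersolution_def minimizer_def adm_def)

text \<open>Testing with \<open>\<zeta>\<^sup>m (1 + w)\<^sup>1\<^sup>-\<^sup>p\<close> bounds the gradient of \<open>log (1 + w)\<close> independently of the
  supersolution \<open>w\<close>.\<close>

lemma log_estimate:
  assumes W: "supersolution W" and \<zeta>: "\<zeta> \<in> test_functions \<Omega>" "\<And>x. 0 \<le> \<zeta> x" "\<And>x. \<zeta> x \<le> 1"
    and m: "p \<le> real m" and B: "\<And>x. norm (classical_grad \<zeta> x) \<le> B"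
  defines "q \<equiv> \<lambda>x. norm (snd (W x)) / (1 + fst (W x))" and "a \<equiv> real m * B"
  shows "integrable M (\<lambda>x. \<zeta> x ^ m * q x powr p)"
    and "(p - 1) / 2 * (LINT x|M. \<zeta> x ^ m * q x powr p) \<le> (1 + a * (2 * a / (p - 1)) powr (p - 1)) * measure M \<Omega>"
proof -
  have WW: "W \<in> W0" and W0: "AE x in M. fst (W x) \<ge> 0" using W by (auto simp: supersolution_def)
  have B0: "B \<ge> 0" using B[of undefined] norm_ge_zero order_trans by blast
  have a0: "a \<ge> 0" using B0 by (simp add: a_def)
  have m2: "m \<ge> 2" using p m by (cases m) auto
  have \<zeta>s: "smooth_fun \<zeta>" using test_smooth[OF \<zeta>(1)] .
  \<comment> \<open>An integer exponent keeps the power of the cut-off smooth, and an exponent at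
    least \<open>p\<close> lets its gradient be absorbed.\<close>
  define Z where "Z = (\<lambda>x. \<zeta> x ^ m)"
  have pw: "smooth_fun (\<lambda>t::real. t ^ m)" by (rule smooth_fun_power[OF smooth_fun_ident_real])
  have Zt: "Z \<in> test_functions \<Omega>" unfolding Z_def
    by (rule test_functions_op[OF \<zeta>(1) smooth_fun_power[OF \<zeta>s]]) (use m2 in \<open>simp add: power_0_left\<close>)
  have gZ: "norm (classical_grad Z x) \<le> a * \<zeta> x ^ (m - 1)" for x
  proof -
    have "deriv (\<lambda>t::real. t ^ m) (\<zeta> x) = real m * \<zeta> x ^ (m - 1)"
      by (rule DERIV_imp_deriv) (auto intro!: derivative_eq_intros)
    then have "classical_grad Z x = (real m * \<zeta> x ^ (m - 1)) *\<^sub>R classical_grad \<zeta> x"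
      unfolding Z_def using grad_compose_real[OF pw \<zeta>s] by simp
    then have "norm (classical_grad Z x) = real m * \<zeta> x ^ (m - 1) * norm (classical_grad \<zeta> x)"
      using \<zeta>(2)[of x] by simp
    also have "\<dots> \<le> real m * \<zeta> x ^ (m - 1) * B" using \<zeta>(2)[of x] by (intro mult_left_mono B) simp
    finally show ?thesis by (simp add: a_def mult_ac)
  qed
  have Z01: "0 \<le> Z x" "Z x \<le> 1" for x using \<zeta>(2,3) by (auto simp: Z_def power_le_one)
  have lpos: "lift1 t > 0" for t using lift1_ge[of t] by linarith
  \<comment> \<open>With the exponent \<open>1 - p\<close> the flux times \<open>T\<close> becomes
    \<open>q powr (p - 1)\<close>, so that for \<open>w \<ge> 0\<close> the first-order terms see
    only \<open>q\<close>, the length of the gradient of \<open>ln (1 + w)\<close>.\<close>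
  define T where "T = (\<lambda>t. lift1 t powr (1 - p))"
  have Ts: "smooth_fun T" unfolding T_def by (rule smooth_fun_powr[OF lpos smooth_lift1])
  have dT: "deriv T t = (1 - p) * lift1 t powr (- p) * deriv lift1 t" for t
  proof (rule DERIV_imp_deriv)
    have "((\<lambda>y. y powr (1 - p)) has_real_derivative (1 - p) * lift1 t powr (1 - p - 1)) (at (lift1 t))"
      by (rule has_real_derivative_powr[OF lpos])
    from DERIV_chain2[OF this smooth_real_deriv(1)[OF smooth_lift1]]
    show "(T has_real_derivative (1 - p) * lift1 t powr (- p) * deriv lift1 t) (at t)" by (simp add: T_def)
  qed
  obtain C where C: "C \<ge> 0" "\<And>t. \<bar>deriv lift1 t\<bar> \<le> C" using deriv_lift1_bounded by blast
  have Tb: "\<bar>T t\<bar> \<le> (1/2) powr (1 - p)" for t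
    unfolding T_def using lift1_ge[of t] p powr_mono2'[of "1 - p" "1/2" "lift1 t"] by simp
  have dTb: "\<bar>deriv T t\<bar> \<le> (p - 1) * (1/2) powr (- p) * C" for t
  proof -
    have "lift1 t powr (- p) \<le> (1/2) powr (- p)" using lift1_ge[of t] p powr_mono2'[of "- p" "1/2" "lift1 t"] by simp
    then show ?thesis unfolding dT abs_mult using p C by (intro mult_mono) auto
  qed
  define \<Psi> where "\<Psi> = (\<lambda>x. (Z x * T (fst (W x)), T (fst (W x)) *\<^sub>R classical_grad Z x + (Z x * deriv T (fst (W x))) *\<^sub>R snd (W x)))"
  have \<Psi>W: "\<Psi> \<in> W0" unfolding \<Psi>_def by (rule W0_mult_test[OF WW Zt Ts Tb dTb])
  have "AE x in M. fst (\<Psi> x) \<ge> 0" using Z01 by (simp add: \<Psi>_def T_def)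
  then have A0: "0 \<le> A_form W \<Psi>" using W \<Psi>W by (simp add: supersolution_def)
  define K where "K = 1 + a * (2 * a / (p - 1)) powr (p - 1)"
  have pt: "AE x in M. pflux2 p (W x) \<bullet> \<Psi> x \<le> K - (p - 1) / 2 * (\<zeta> x ^ m * q x powr p)"
    using W0
  proof eventually_elim
    fix x assume w: "fst (W x) \<ge> 0"
    define u H where "u = fst (W x)" and "H = snd (W x)"
    have u: "u \<ge> 0" using w by (simp add: u_def)
    have q: "q x = norm H / (1 + u)" "q x \<ge> 0" using u by (simp_all add: q_def u_def H_def)
    have l: "lift1 u = 1 + u" using u by (simp add: lift1_eq)
    have T: "T u = (1 + u) powr (1 - p)" "deriv T u = - (p - 1) * (1 + u) powr (- p)"
      using u by (simp add: T_def l, simp add: dT l deriv_lift1)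
    have qp: "q x powr s = norm H powr s * (1 + u) powr (- s)" for s
      unfolding q(1) using u by (simp add: powr_divide powr_minus_divide)
    \<comment> \<open>Three terms: the zero-order one is at most 1, the one with the gradient of the
      cut-off is treated by Young's inequality, and the last is \<open>- (p - 1)\<close> times the
      quantity to be bounded. Half of the last absorbs the second.\<close>
    have "pflux2 p (W x) \<bullet> \<Psi> x = pflux p u * (Z x * T u) + T u * (pflux p H \<bullet> classical_grad Z x) + Z x * deriv T u * norm H powr p"
      unfolding \<Psi>_def u_def[symmetric] H_def[symmetric] pflux2_def inner_prod_def
      by (simp add: u_def[symmetric] H_def[symmetric] inner_add_right pflux_inner_self)
    moreover have "pflux p u * (Z x * T u) \<le> 1"
    proof -
      have "pflux p u \<le> u powr (p - 1)" using norm_pflux[of p u] u by (simp add: abs_le_iff)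
      also have "\<dots> \<le> (1 + u) powr (p - 1)" using u p by (intro powr_mono2) auto
      finally have "pflux p u * T u \<le> (1 + u) powr (p - 1) * (1 + u) powr (1 - p)" unfolding T by (rule mult_right_mono) simp
      also have "\<dots> = 1" using u by (simp add: powr_add[symmetric])
      finally have "Z x * (pflux p u * T u) \<le> Z x * 1" using Z01 by (intro mult_left_mono)
      then show ?thesis using Z01(2)[of x] by (simp add: mult_ac)
    qed
    moreover have "T u * (pflux p H \<bullet> classical_grad Z x) \<le> q x powr (p - 1) * (a * \<zeta> x ^ (m - 1))"
    proof -
      have "pflux p H \<bullet> classical_grad Z x \<le> norm H powr (p - 1) * norm (classical_grad Z x)"
        using norm_cauchy_schwarz[of "pflux p H" "classical_grad Z x"] by (simp add: norm_pflux)
      also have "\<dots> \<le> norm H powr (p - 1) * (a * \<zeta> x ^ (m - 1))" by (intro mult_left_mono gZ) simp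
      finally have "T u * (pflux p H \<bullet> classical_grad Z x) \<le> T u * (norm H powr (p - 1) * (a * \<zeta> x ^ (m - 1)))"
        by (intro mult_left_mono) (auto simp: T_def)
      then show ?thesis using qp[of "p - 1"] by (simp add: T mult_ac)
    qed
    moreover have "Z x * deriv T u * norm H powr p = - (p - 1) * (\<zeta> x ^ m * q x powr p)"
      using qp[of p] by (simp add: T Z_def mult_ac)
    moreover have "q x powr (p - 1) * (a * \<zeta> x ^ (m - 1)) \<le> (p - 1) / 2 * (\<zeta> x ^ m * q x powr p) + a * (2 * a / (p - 1)) powr (p - 1)"
      by (rule log_estimate_young[OF q(2) \<zeta>(2,3) a0 p m])
    ultimately have "pflux2 p (W x) \<bullet> \<Psi> x \<le> 1 + ((p - 1) / 2 * (\<zeta> x ^ m * q x powr p) + a * (2 * a / (p - 1)) powr (p - 1))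
        + - (p - 1) * (\<zeta> x ^ m * q x powr p)" by linarith
    also have "\<dots> = K - (p - 1) / 2 * (\<zeta> x ^ m * q x powr p)" by (simp add: K_def field_simps)
    finally show "pflux2 p (W x) \<bullet> \<Psi> x \<le> K - (p - 1) / 2 * (\<zeta> x ^ m * q x powr p)" .
  qed
  show i: "integrable M (\<lambda>x. \<zeta> x ^ m * q x powr p)"
  proof (rule Bochner_Integration.integrable_bound[OF Lp_integrable[OF W0_Lp[OF WW]]])
    show "(\<lambda>x. \<zeta> x ^ m * q x powr p) \<in> borel_measurable M"
      unfolding q_def using cont_measurable[OF smooth_fun_continuous[OF \<zeta>s]] W0_fst_measurable[OF WW] W0_snd_measurable[OF WW]
      by measurable
    show "AE x in M. norm (\<zeta> x ^ m * q x powr p) \<le> norm (norm (W x) powr p)"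
      using W0
    proof eventually_elim
      fix x assume w: "fst (W x) \<ge> 0"
      have "q x \<le> norm (snd (W x))" using w by (simp add: q_def divide_le_eq mult_left_le distrib_left)
      also have "\<dots> \<le> norm (W x)" by (rule norm_snd_le_norm)
      finally have "q x powr p \<le> norm (W x) powr p" using w p by (intro powr_mono2) (auto simp: q_def)
      moreover have "\<zeta> x ^ m * q x powr p \<le> 1 * q x powr p" using Z01(2)[of x] by (intro mult_right_mono) (auto simp: Z_def)
      ultimately show "norm (\<zeta> x ^ m * q x powr p) \<le> norm (norm (W x) powr p)" using \<zeta>(2)[of x] by simp
    qed
  qed
  have "0 \<le> (LINT x|M. K - (p - 1) / 2 * (\<zeta> x ^ m * q x powr p))"
    using A0 unfolding A_form_def
    by (rule order_trans) (rule integral_mono_AE[OF A_form_integrable[OF W0_Lp[OF WW] W0_Lp[OF \<Psi>W]] _ pt], use i in simp)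
  also have "\<dots> = K * measure M \<Omega> - (p - 1) / 2 * (LINT x|M. \<zeta> x ^ m * q x powr p)"
    using i by simp
  finally show "(p - 1) / 2 * (LINT x|M. \<zeta> x ^ m * q x powr p) \<le> (1 + a * (2 * a / (p - 1)) powr (p - 1)) * measure M \<Omega>"
    by (simp add: K_def)
qed

text \<open>Otherwise \<open>{u = 0}\<close> and some \<open>{u \<ge> s}\<close> both have positive
  measure in the ball. For every \<open>k > 0\<close>, \<open>ln (1 + k u)\<close> vanishes on the
  first set and is at least \<open>ln (1 + k s)\<close> on the second, while its gradient is bounded
  independently of \<open>k\<close>. The inequality for two sets then fails for large
  \<open>k\<close>.\<close>

lemma supersolution_dichotomy:
  assumes U: "supersolution U" and r: "r > 0" "cball x0 (3 * r) \<subseteq> \<Omega>"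
  shows "(AE x in M. x \<in> ball x0 r \<longrightarrow> fst (U x) = 0) \<or> (AE x in M. x \<in> ball x0 r \<longrightarrow> fst (U x) > 0)"
proof (rule ccontr)
  assume neg: "\<not> ?thesis"
  have UW: "U \<in> W0" and U0: "AE x in M. fst (U x) \<ge> 0" using U by (auto simp: supersolution_def)
  have bm: "ball x0 r \<in> sets lebesgue" by simp
  have b3: "ball x0 (3 * r) \<subseteq> \<Omega>" using r(2) ball_subset_cball by blast
  have b1: "ball x0 r \<subseteq> \<Omega>" using b3 r(1) subset_ball[of r "3 * r" x0] by auto
  have bM: "ball x0 r \<in> sets M" using b1 bm by (simp add: sets_restrict_space_iff)
  define Z where "Z = {x \<in> space M. fst (U x) = 0} \<inter> ball x0 r"
  define P where "P = (\<lambda>n::nat. {x \<in> space M. fst (U x) \<ge> 1 / real (Suc n)} \<inter> ball x0 r)"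
  note fm = W0_fst_measurable[OF UW]
  have Zs: "Z \<in> sets M" unfolding Z_def using fm bM by measurable
  have Ps: "P n \<in> sets M" for n unfolding P_def using fm bM by measurable
  have Zpos: "measure M Z > 0"
  proof (rule ccontr)
    assume "\<not> measure M Z > 0"
    then have "measure M Z = 0" using measure_nonneg[of M Z] by linarith
    then have "AE x in M. x \<notin> Z" using AE_iff_null_sets[OF Zs] fin.emeasure_eq_measure[of Z] Zs by (auto simp: null_sets_def)
    then have "AE x in M. x \<in> ball x0 r \<longrightarrow> fst (U x) > 0"
      using U0 AE_space by eventually_elim (auto simp: Z_def)
    then show False using neg by blast
  qed
  obtain n where Ppos: "measure M (P n) > 0"
  proof (rule ccontr)
    assume "\<not> thesis"
    then have "\<not> measure M (P n) > 0" for n using that by blast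
    then have "measure M (P n) = 0" for n using measure_nonneg[of M "P n"] by (metis antisym_conv2)
    then have "AE x in M. x \<notin> P n" for n using AE_iff_null_sets[OF Ps] fin.emeasure_eq_measure[of "P n"] Ps by (auto simp: null_sets_def)
    then have "AE x in M. \<forall>n. x \<notin> P n" unfolding AE_all_countable by blast
    then have "AE x in M. x \<in> ball x0 r \<longrightarrow> fst (U x) = 0"
      using U0 AE_space
    proof eventually_elim
      fix x assume *: "\<forall>n. x \<notin> P n" "fst (U x) \<ge> 0" "x \<in> space M"
      show "x \<in> ball x0 r \<longrightarrow> fst (U x) = 0"
      proof (intro impI, rule ccontr)
        assume x: "x \<in> ball x0 r" "fst (U x) \<noteq> 0"
        then have "fst (U x) > 0" using *(2) by simp
        then obtain n where "1 / real (Suc n) < fst (U x)" using nat_approx_posE by (metis of_nat_Suc)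
        then have "x \<in> P n" using *(3) x by (simp add: P_def less_imp_le)
        then show False using * by blast
      qed
    qed
    then show False using neg by blast
  qed
  define s where "s = 1 / real (Suc n)"
  have s: "s > 0" by (simp add: s_def)
  obtain \<zeta> where \<zeta>: "\<zeta> \<in> test_functions \<Omega>" "\<And>x. 0 \<le> \<zeta> x" "\<And>x. \<zeta> x \<le> 1" "\<And>x. x \<in> cball x0 (3 * r) \<Longrightarrow> \<zeta> x = 1"
    by (rule smooth_cutoff[OF compact_cball open_\<Omega> r(2)], rule that, assumption+)
  obtain B where B: "B \<ge> 0" "\<And>x. norm (jet \<zeta> x) \<le> B" using test_jet_bounded[OF \<zeta>(1)] by blast
  have gB: "norm (classical_grad \<zeta> x) \<le> B" for x using B(2)[of x] norm_snd_le_norm[of "jet \<zeta> x"] by (simp add: jet_def)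
  obtain m :: nat where m: "p \<le> real m" using real_arch_simple by blast
  define a where "a = real m * B"
  define K where "K = (1 + a * (2 * a / (p - 1)) powr (p - 1)) * measure M \<Omega>"
  define c where "c = 2 * r * measure lborel (ball (0::'a) (2 * r))"
  have c0: "c \<ge> 0" using r by (simp add: c_def)
  define E where "E = c * (measure M \<Omega> + 2 / (p - 1) * K)"
  have lpos: "lift1 t > 0" for t using lift1_ge[of t] by linarith
  define L where "L = (\<lambda>t. ln (lift1 t))"
  have Ls: "smooth_fun L" unfolding L_def by (rule smooth_fun_ln[OF lpos smooth_lift1])
  have dL: "deriv L t = deriv lift1 t / lift1 t" for t
  proof (rule DERIV_imp_deriv)
    from DERIV_chain2[OF DERIV_ln[OF lpos] smooth_real_deriv(1)[OF smooth_lift1, of t]]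
    show "(L has_real_derivative deriv lift1 t / lift1 t) (at t)" by (simp add: L_def divide_inverse mult.commute)
  qed
  obtain C where C: "C \<ge> 0" "\<And>t. \<bar>deriv lift1 t\<bar> \<le> C" using deriv_lift1_bounded by blast
  have dLb: "\<bar>deriv L t\<bar> \<le> 2 * C" for t
  proof -
    have "\<bar>deriv L t\<bar> = \<bar>deriv lift1 t\<bar> / lift1 t" unfolding dL using lpos[of t] by simp
    also have "\<dots> \<le> C / (1/2)" by (intro frac_le C lift1_ge) (use C in auto)
    finally show ?thesis by simp
  qed
  \<comment> \<open>\<open>E\<close> does not involve \<open>k\<close>: the logarithmic estimate
    holds with the same constant for all positive multiples of \<open>U\<close>.\<close>
  have main: "ln (1 + k * s) * measure M Z * measure M (P n) \<le> E" if k: "k > 0" for k :: real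
  proof -
    define W where "W = (\<lambda>x. k *\<^sub>R U x)"
    have W: "supersolution W" unfolding W_def by (rule supersolution_scaleR[OF U k])
    have WW: "W \<in> W0" and W0: "AE x in M. fst (W x) \<ge> 0" using W by (auto simp: supersolution_def)
    define q where "q = (\<lambda>x. norm (snd (W x)) / (1 + fst (W x)))"
    have le: "integrable M (\<lambda>x. \<zeta> x ^ m * q x powr p)" "(p - 1) / 2 * (LINT x|M. \<zeta> x ^ m * q x powr p) \<le> K"
      unfolding q_def a_def K_def by (rule log_estimate[OF W \<zeta>(1-3) m gB])+
    define V where "V = (\<lambda>x. (L (fst (W x)), deriv L (fst (W x)) *\<^sub>R snd (W x)))"
    have L0: "L 0 = 0" by (simp add: L_def lift1_def)
    have VW: "V \<in> W0" unfolding V_def by (rule W0_compose[OF WW Ls L0 dLb])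
    have "ln (1 + k * s) * measure M Z * measure M (P n) \<le> c * (LINT x|M. indicator (ball x0 (3 * r)) x * norm (snd (V x)))"
      unfolding c_def
    proof (rule W0_two_sets[OF VW r(1) b3 Zs _ _ Ps])
      show "Z \<subseteq> ball x0 r" "P n \<subseteq> ball x0 r" by (auto simp: Z_def P_def)
      show "fst (V x) = 0" if "x \<in> Z" for x using that L0 by (simp add: V_def W_def Z_def)
      show "ln (1 + k * s) \<le> fst (V x)" if "x \<in> P n" for x
      proof -
        have "fst (U x) \<ge> s" using that by (simp add: P_def s_def)
        then have ks: "k * s \<le> k * fst (U x)" using k by simp
        have "0 < k * s" using k s by simp
        then have "ln (1 + k * s) \<le> ln (1 + k * fst (U x))" using ks by simp
        also have "\<dots> = fst (V x)" using ks \<open>0 < k * s\<close> by (simp add: V_def W_def L_def lift1_eq)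
        finally show ?thesis .
      qed
      show "0 \<le> ln (1 + k * s)" using k s by simp
    qed
    \<comment> \<open>The gradient of \<open>V\<close> has length \<open>q\<close>, and
      \<open>q \<le> 1 + q powr p\<close> together with \<open>\<zeta> = 1\<close> on the tripled
      ball brings in the quantity bounded by the logarithmic estimate.\<close>
    also have "\<dots> \<le> c * (LINT x|M. 1 + \<zeta> x ^ m * q x powr p)"
    proof (rule mult_left_mono[OF integral_mono_AE' c0])
      show "integrable M (\<lambda>x. 1 + \<zeta> x ^ m * q x powr p)" using le(1) by simp
      show "AE x in M. indicator (ball x0 (3 * r)) x * norm (snd (V x)) \<le> 1 + \<zeta> x ^ m * q x powr p"
        using W0
      proof eventually_elim
        fix x assume w: "fst (W x) \<ge> 0"
        have nV: "norm (snd (V x)) = q x" using w by (simp add: V_def q_def dL deriv_lift1 lift1_eq)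
        have q0: "q x \<ge> 0" using w by (simp add: q_def)
        show "indicator (ball x0 (3 * r)) x * norm (snd (V x)) \<le> 1 + \<zeta> x ^ m * q x powr p"
        proof (cases "x \<in> ball x0 (3 * r)")
          case True
          then have "\<zeta> x = 1" using \<zeta>(4) ball_subset_cball by blast
          then show ?thesis using True nV young_eps[of 1 "q x" p 1] q0 p by simp
        next
          case False
          then show ?thesis using \<zeta>(2)[of x] by (simp add: add_nonneg_nonneg)
        qed
      qed
      show "AE x in M. 0 \<le> 1 + \<zeta> x ^ m * q x powr p" using \<zeta>(2) by (simp add: add_nonneg_nonneg)
    qed
    also have "(LINT x|M. 1 + \<zeta> x ^ m * q x powr p) = measure M \<Omega> + (LINT x|M. \<zeta> x ^ m * q x powr p)"
      using le(1) by simp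
    also have "c * (measure M \<Omega> + (LINT x|M. \<zeta> x ^ m * q x powr p)) \<le> E"
      unfolding E_def using le(2) p by (intro mult_left_mono[OF _ c0]) (simp add: field_simps)
    finally show ?thesis .
  qed
  define \<mu> where "\<mu> = measure M Z * measure M (P n)"
  have \<mu>: "\<mu> > 0" using Zpos Ppos by (simp add: \<mu>_def)
  \<comment> \<open>Chosen so that the logarithm exceeds \<open>E / \<mu> + 1\<close>, which makes
    the left side of \<open>main\<close> at least \<open>E + \<mu>\<close>.\<close>
  define k where "k = exp (E / \<mu> + 1) / s"
  have k: "k > 0" using s by (simp add: k_def)
  have ks: "k * s = exp (E / \<mu> + 1)" using s by (simp add: k_def)
  have "E / \<mu> + 1 = ln (exp (E / \<mu> + 1))" by simp
  also have "\<dots> \<le> ln (1 + k * s)" unfolding ks by (subst ln_le_cancel_iff) (auto simp: add_pos_pos)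
  finally have "(E / \<mu> + 1) * \<mu> \<le> ln (1 + k * s) * \<mu>" using \<mu> by (intro mult_right_mono) auto
  also have "\<dots> \<le> E" using main[OF k] by (simp add: \<mu>_def mult.assoc)
  finally show False using \<mu> by (simp add: distrib_right)
qed

text \<open>By Lindelof countably many of the open sets suffice, and countably many exceptional null
  sets can be united.\<close>

lemma AE_of_local:
  assumes "\<And>S. S \<in> F \<Longrightarrow> open S \<and> (AE x in M. x \<in> S \<longrightarrow> Q x)" "\<Omega> \<subseteq> \<Union>F"
  shows "AE x in M. Q x"
proof -
  obtain F' where F': "F' \<subseteq> F" "countable F'" "\<Union>F' = \<Union>F"
    using Lindelof[of F] assms(1) by blast
  have "AE x in M. \<forall>S\<in>F'. x \<in> S \<longrightarrow> Q x"
    using F' assms(1) by (subst AE_ball_countable) auto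
  then show ?thesis using AE_space
    by eventually_elim (use F'(3) assms(2) in auto)
qed

text \<open>By the dichotomy \<open>\<Omega>\<close> is covered by two open sets, on which
  \<open>u\<close> is locally zero or locally positive almost everywhere. They are disjoint since
  nonempty open sets are not negligible, so connectedness leaves only one of them.\<close>

lemma supersolution_positive:
  assumes U: "supersolution U" and conn: "connected \<Omega>" and nz: "\<not> (AE x in M. fst (U x) = 0)"
  shows "AE x in M. fst (U x) > 0"
proof -
  define F0 F1 where "F0 = {S. open S \<and> S \<subseteq> \<Omega> \<and> (AE x in M. x \<in> S \<longrightarrow> fst (U x) = 0)}"
    and "F1 = {S. open S \<and> S \<subseteq> \<Omega> \<and> (AE x in M. x \<in> S \<longrightarrow> fst (U x) > 0)}"
  have cover: "\<Omega> \<subseteq> \<Union>F0 \<union> \<Union>F1"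
  proof
    fix x assume "x \<in> \<Omega>"
    then obtain e where e: "e > 0" "cball x e \<subseteq> \<Omega>" using open_\<Omega> open_contains_cball by blast
    have r: "e / 3 > 0" "cball x (3 * (e / 3)) \<subseteq> \<Omega>" using e by auto
    have b: "ball x (e / 3) \<subseteq> \<Omega>" "x \<in> ball x (e / 3)" "open (ball x (e / 3))"
      using e subset_ball[of "e / 3" e x] ball_subset_cball[of x e] by auto
    from supersolution_dichotomy[OF U r] show "x \<in> \<Union>F0 \<union> \<Union>F1"
    proof
      assume "AE y in M. y \<in> ball x (e / 3) \<longrightarrow> fst (U y) = 0"
      then have "ball x (e / 3) \<in> F0" using b by (simp add: F0_def)
      then show ?thesis using b(2) by blast
    next
      assume "AE y in M. y \<in> ball x (e / 3) \<longrightarrow> fst (U y) > 0"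
      then have "ball x (e / 3) \<in> F1" using b by (simp add: F1_def)
      then show ?thesis using b(2) by blast
    qed
  qed
  have op: "open (\<Union>F0)" "open (\<Union>F1)" by (auto simp: F0_def F1_def)
  have disj: "\<Union>F0 \<inter> \<Union>F1 \<inter> \<Omega> = {}"
  proof (rule ccontr)
    assume "\<Union>F0 \<inter> \<Union>F1 \<inter> \<Omega> \<noteq> {}"
    then obtain x S0 S1 where S: "S0 \<in> F0" "S1 \<in> F1" "x \<in> S0" "x \<in> S1" by blast
    define S where "S = S0 \<inter> S1"
    have S': "open S" "S \<noteq> {}" "S \<subseteq> \<Omega>" using S by (auto simp: S_def F0_def F1_def)
    have a0: "AE x in M. x \<in> S0 \<longrightarrow> fst (U x) = 0" and a1: "AE x in M. x \<in> S1 \<longrightarrow> fst (U x) > 0"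
      using S by (auto simp: F0_def F1_def)
    have "AE x in M. x \<notin> S" using a0 a1 by eventually_elim (auto simp: S_def)
    then have "AE x in lebesgue. x \<in> \<Omega> \<longrightarrow> x \<notin> S" by (simp add: AE_restrict_space_iff)
    then have "AE x in lebesgue. x \<notin> S" by eventually_elim (use S'(3) in auto)
    then have "negligible S" using AE_iff_null_sets[of S lebesgue] S'(1) by (simp add: negligible_iff_null_sets borel_open)
    then show False using open_not_negligible S' by blast
  qed
  have "\<Union>F0 \<inter> \<Omega> = {} \<or> \<Union>F1 \<inter> \<Omega> = {}"
    by (rule connectedD[OF conn op disj cover])
  then show ?thesis
  proof
    assume "\<Union>F0 \<inter> \<Omega> = {}"
    then have "\<Omega> \<subseteq> \<Union>F1" using cover by blast
    then show ?thesis by (rule AE_of_local[rotated]) (auto simp: F1_def)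
  next
    assume "\<Union>F1 \<inter> \<Omega> = {}"
    then have "\<Omega> \<subseteq> \<Union>F0" using cover by blast
    then have "AE x in M. fst (U x) = 0" by (rule AE_of_local[rotated]) (auto simp: F0_def)
    then show ?thesis using nz by blast
  qed
qed

text \<open>The trivial alternative is excluded by \<open>f\<close>: admissibility forces
  \<open>u > 0\<close> on \<open>{f > 0}\<close>, which is not null.\<close>

lemma minimizer_positive:
  assumes U: "minimizer U" and conn: "connected \<Omega>"
  shows "AE x in M. fst (U x) > 0"
proof (rule supersolution_positive[OF minimizer_is_supersolution[OF U] conn], rule notI)
  assume "AE x in M. fst (U x) = 0"
  moreover have "AE x in M. f x > 0 \<longrightarrow> fst (U x) > 0" using U by (simp add: minimizer_def adm_def)
  ultimately have "AE x in M. f x = 0" using f_nonneg by eventually_elim auto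
  then show False using f_nonzero by blast
qed

end

subsection \<open>Uniqueness\<close>

text \<open>This is \<open>sqrt (t^2 + \<epsilon>^2) - \<epsilon>\<close>, written with
  \<open>powr\<close> for the smoothness rule. It vanishes at 0, lies below
  \<open>\<bar>t\<bar>\<close> and has slope at most 1, so composing with it does not enlarge the
  norm of a jet.\<close>

definition soft_abs :: "real \<Rightarrow> real \<Rightarrow> real" where
  "soft_abs \<epsilon> t = (t * t + \<epsilon>\<^sup>2) powr (1/2) - \<epsilon>"

lemma soft_abs_sqrt: "soft_abs \<epsilon> t = sqrt (t\<^sup>2 + \<epsilon>\<^sup>2) - \<epsilon>"
  by (simp add: soft_abs_def powr_half_sqrt power2_eq_square)

lemma smooth_soft_abs: "\<epsilon> > 0 \<Longrightarrow> smooth_fun (soft_abs \<epsilon>)"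
  unfolding soft_abs_def[abs_def]
  by (rule smooth_fun_diff[OF smooth_fun_powr[OF _ smooth_fun_add[OF
        smooth_fun_mult[OF smooth_fun_ident_real smooth_fun_ident_real] smooth_fun_const]] smooth_fun_const])
     (simp add: add_nonneg_pos)

lemma soft_abs_0: "\<epsilon> > 0 \<Longrightarrow> soft_abs \<epsilon> 0 = 0"
  and soft_abs_nonneg: "\<epsilon> > 0 \<Longrightarrow> 0 \<le> soft_abs \<epsilon> t"
  and soft_abs_le: "\<epsilon> > 0 \<Longrightarrow> soft_abs \<epsilon> t \<le> \<bar>t\<bar>"
proof -
  show "soft_abs \<epsilon> 0 = 0" if "\<epsilon> > 0" using that by (simp add: soft_abs_sqrt)
  show "0 \<le> soft_abs \<epsilon> t" if "\<epsilon> > 0" using that by (simp add: soft_abs_sqrt real_le_rsqrt)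
  show "soft_abs \<epsilon> t \<le> \<bar>t\<bar>" if "\<epsilon> > 0"
    using sqrt_sum_squares_le_sum_abs[of t \<epsilon>] that by (simp add: soft_abs_sqrt)
qed

lemma deriv_soft_abs_le: assumes \<epsilon>: "\<epsilon> > 0" shows "\<bar>deriv (soft_abs \<epsilon>) t\<bar> \<le> 1"
proof -
  have pos: "t\<^sup>2 + \<epsilon>\<^sup>2 > 0" using \<epsilon> by (simp add: add_nonneg_pos)
  have "((\<lambda>t. sqrt (t\<^sup>2 + \<epsilon>\<^sup>2) - \<epsilon>) has_real_derivative t / sqrt (t\<^sup>2 + \<epsilon>\<^sup>2)) (at t)"
    using pos by (auto intro!: derivative_eq_intros simp: field_simps)
  moreover have "soft_abs \<epsilon> = (\<lambda>t. sqrt (t\<^sup>2 + \<epsilon>\<^sup>2) - \<epsilon>)" by (rule ext) (rule soft_abs_sqrt)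
  ultimately have "deriv (soft_abs \<epsilon>) t = t / sqrt (t\<^sup>2 + \<epsilon>\<^sup>2)" by (simp add: DERIV_imp_deriv)
  moreover have "\<bar>t\<bar> \<le> sqrt (t\<^sup>2 + \<epsilon>\<^sup>2)" by (rule real_le_rsqrt) simp
  ultimately show ?thesis using pos by (simp add: abs_divide divide_le_eq)
qed

lemma soft_abs_tendsto: "(\<lambda>n. soft_abs (inverse (real (Suc n))) t) \<longlonglongrightarrow> \<bar>t\<bar>"
proof -
  have "(\<lambda>n. sqrt (t\<^sup>2 + (inverse (real (Suc n)))\<^sup>2) - inverse (real (Suc n))) \<longlonglongrightarrow> sqrt (t\<^sup>2 + 0\<^sup>2) - 0"
    by (intro tendsto_intros LIMSEQ_inverse_real_of_nat)
  then show ?thesis by (simp add: soft_abs_sqrt)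
qed

section \<open>Identification of \<open>W1p_0\<close> with the space of jets\<close>

context sobolev
begin

text \<open>The two closures use equivalent norms: sums of \<open>p\<close>-th powers of the
  components on one side, the norm of the pair on the other, comparable up to
  \<open>2 powr p\<close>. From right to left the weak gradient comes from
  \<open>W0_weak_gradient\<close>.\<close>

lemma W1p_0_iff: "u \<in> W1p_0 \<Omega> p \<longleftrightarrow> (\<exists>G. (\<lambda>x. (u x, G x)) \<in> W0)"
proof
  have p0: "0 \<le> p" using p by simp
  assume "u \<in> W1p_0 \<Omega> p"
  then obtain G where u: "u \<in> Lp_space M p" and G: "G \<in> Lp_space M p"
    and ap: "\<And>\<epsilon>. \<epsilon> > 0 \<Longrightarrow> \<exists>\<phi>\<in>test_functions \<Omega>.
        (LINT x|M. \<bar>u x - \<phi> x\<bar> powr p) + (LINT x|M. norm (G x - classical_grad \<phi> x) powr p) < \<epsilon>"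
    unfolding W1p_0_def Lp_on_eq by blast
  define U where "U = (\<lambda>x. (u x, G x))"
  have split: "norm z powr p \<le> 2 powr p * (\<bar>fst z\<bar> powr p + norm (snd z) powr p)" for z :: "real \<times> 'a"
    using norm_powr_le_penergy[OF p0, of z] by (simp add: penergy_def)
  have ULp: "U \<in> Lp_space M p"
  proof (rule Lp_bound)
    show "U \<in> borel_measurable M" unfolding U_def by (intro borel_measurable_Pair Lp_measurable[OF u] Lp_measurable[OF G])
    show "integrable M (\<lambda>x. 2 powr p * (norm (u x) powr p + norm (G x) powr p))"
      using Lp_integrable[OF u] Lp_integrable[OF G] by simp
    show "AE x in M. norm (U x) powr p \<le> 2 powr p * (norm (u x) powr p + norm (G x) powr p)"
    proof (rule AE_I2)
      show "norm (U x) powr p \<le> 2 powr p * (norm (u x) powr p + norm (G x) powr p)" for x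
        using split[of "U x"] by (simp add: U_def)
    qed
  qed
  have "\<exists>\<phi>\<in>test_functions \<Omega>. Lp_dist M p (jet \<phi>) U < \<epsilon>" if e: "\<epsilon> > 0" for \<epsilon>
  proof -
    have "\<epsilon> / 2 powr p > 0" using e by simp
    from ap[OF this] obtain \<phi> where \<phi>: "\<phi> \<in> test_functions \<Omega>"
      "(LINT x|M. \<bar>u x - \<phi> x\<bar> powr p) + (LINT x|M. norm (G x - classical_grad \<phi> x) powr p) < \<epsilon> / 2 powr p" by blast
    note d = Lp_integrable[OF Lp_diff[OF jet_Lp[OF \<phi>(1)] ULp p0]]
    have cm: "(\<lambda>x. u x - \<phi> x) \<in> borel_measurable M" "(\<lambda>x. G x - classical_grad \<phi> x) \<in> borel_measurable M"
      using Lp_measurable[OF u] Lp_measurable[OF G] cont_measurable[OF smooth_fun_continuous[OF test_smooth[OF \<phi>(1)]]]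
        cont_measurable[OF smooth_continuous_grad[OF test_smooth[OF \<phi>(1)]]] by measurable
    have i1: "integrable M (\<lambda>x. \<bar>u x - \<phi> x\<bar> powr p)"
    proof (rule Bochner_Integration.integrable_bound[OF d])
      show "AE x in M. norm (\<bar>u x - \<phi> x\<bar> powr p) \<le> norm (norm (jet \<phi> x - U x) powr p)"
        using p by (intro AE_I2) (auto intro!: powr_mono2 order_trans[OF _ norm_fst_le_norm] simp: jet_def U_def)
    qed (use cm in measurable)
    have i2: "integrable M (\<lambda>x. norm (G x - classical_grad \<phi> x) powr p)"
    proof (rule Bochner_Integration.integrable_bound[OF d])
      show "AE x in M. norm (norm (G x - classical_grad \<phi> x) powr p) \<le> norm (norm (jet \<phi> x - U x) powr p)"
        using p by (intro AE_I2) (auto intro!: powr_mono2 order_trans[OF _ norm_snd_le_norm] simp: jet_def U_def norm_minus_commute)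
    qed (use cm in measurable)
    have "Lp_dist M p (jet \<phi>) U \<le> (LINT x|M. 2 powr p * (\<bar>u x - \<phi> x\<bar> powr p + norm (G x - classical_grad \<phi> x) powr p))"
      unfolding Lp_dist_def
    proof (rule integral_mono[OF d])
      show "norm (jet \<phi> x - U x) powr p \<le> 2 powr p * (\<bar>u x - \<phi> x\<bar> powr p + norm (G x - classical_grad \<phi> x) powr p)" for x
        using split[of "jet \<phi> x - U x"] by (simp add: jet_def U_def abs_minus_commute norm_minus_commute)
    qed (use i1 i2 in simp)
    also have "\<dots> = 2 powr p * ((LINT x|M. \<bar>u x - \<phi> x\<bar> powr p) + (LINT x|M. norm (G x - classical_grad \<phi> x) powr p))"
      using i1 i2 by simp
    also have "\<dots> < 2 powr p * (\<epsilon> / 2 powr p)" using \<phi>(2) by (intro mult_strict_left_mono) auto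
    finally show ?thesis using \<phi>(1) by auto
  qed
  then have "U \<in> W0" using ULp by (simp add: W0_def)
  then show "\<exists>G. (\<lambda>x. (u x, G x)) \<in> W0" unfolding U_def by blast
next
  have p0: "0 \<le> p" using p by simp
  assume "\<exists>G. (\<lambda>x. (u x, G x)) \<in> W0"
  then obtain G where U: "(\<lambda>x. (u x, G x)) \<in> W0" by blast
  define U where "U = (\<lambda>x. (u x, G x))"
  have UW: "U \<in> W0" using U by (simp add: U_def)
  have u: "u \<in> Lp_space M p"
    by (rule Lp_bound_norm[OF _ W0_Lp[OF UW] p0])
       (use W0_fst_measurable[OF UW] norm_fst_le_norm[of "U _"] in \<open>auto simp: U_def intro!: AE_I2 order_trans[OF _ norm_fst_le_norm]\<close>)
  have G: "G \<in> Lp_space M p"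
    by (rule Lp_bound_norm[OF _ W0_Lp[OF UW] p0])
       (use W0_snd_measurable[OF UW] in \<open>auto simp: U_def intro!: AE_I2 order_trans[OF _ norm_snd_le_norm]\<close>)
  have wg: "has_weak_gradient \<Omega> u G" using W0_weak_gradient[OF UW] by (simp add: U_def)
  have "\<exists>\<phi>\<in>test_functions \<Omega>. (LINT x|M. \<bar>u x - \<phi> x\<bar> powr p) + (LINT x|M. norm (G x - classical_grad \<phi> x) powr p) < \<epsilon>"
    if e: "\<epsilon> > 0" for \<epsilon>
  proof -
    have "\<epsilon> / 2 > 0" using e by simp
    then obtain \<phi> where \<phi>: "\<phi> \<in> test_functions \<Omega>" "Lp_dist M p (jet \<phi>) U < \<epsilon> / 2"
      using UW unfolding W0_def by blast
    note d = Lp_integrable[OF Lp_diff[OF jet_Lp[OF \<phi>(1)] W0_Lp[OF UW] p0]]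
    have "(LINT x|M. \<bar>u x - \<phi> x\<bar> powr p) \<le> Lp_dist M p (jet \<phi>) U" unfolding Lp_dist_def
      by (rule integral_mono_AE'[OF d])
         (use p in \<open>auto intro!: AE_I2 powr_mono2 order_trans[OF _ norm_fst_le_norm] simp: jet_def U_def\<close>)
    moreover have "(LINT x|M. norm (G x - classical_grad \<phi> x) powr p) \<le> Lp_dist M p (jet \<phi>) U" unfolding Lp_dist_def
      by (rule integral_mono_AE'[OF d])
         (use p in \<open>auto intro!: AE_I2 powr_mono2 order_trans[OF _ norm_snd_le_norm] simp: jet_def U_def norm_minus_commute\<close>)
    ultimately show ?thesis using \<phi> by (intro bexI[of _ \<phi>]) auto
  qed
  then show "u \<in> W1p_0 \<Omega> p" unfolding W1p_0_def Lp_on_eq using u G wg by blast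
qed

end

section \<open>Weak solutions, extension of the test class, uniqueness\<close>

context singular_problem
begin

text \<open>The gradient is part of the data here, as second component of \<open>V\<close>, so two
  solutions can be subtracted and compared inside \<open>W0\<close>.\<close>

definition weak_solution :: "('a \<Rightarrow> real \<times> 'a) \<Rightarrow> bool" where
  "weak_solution V \<longleftrightarrow> V \<in> W0 \<and> (AE x in M. fst (V x) > 0) \<and>
     (\<forall>\<phi>\<in>test_functions \<Omega>. integrable M (\<lambda>x. f x * fst (V x) powr (- \<alpha>) * \<phi> x) \<and>
        A_form V (jet \<phi>) = (LINT x|M. f x * fst (V x) powr (- \<alpha>) * \<phi> x))"

lemma minimizer_weak_solution:
  assumes "minimizer U" "connected \<Omega>" shows "weak_solution U"
proof -
  have "U \<in> W0" using assms(1) adm_W0 by (simp add: minimizer_def)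
  then show ?thesis
    unfolding weak_solution_def
    using minimizer_positive[OF assms] minimizer_equation[OF assms(1)] minimizer_test_integrable[OF assms(1)] by blast
qed

lemma dual_integrable:
  assumes V: "V \<in> W0" and w: "w \<in> Lp_space M p"
  shows "integrable M (\<lambda>x. 2 * (norm (V x) powr (p - 1) * norm (w x)))"
proof (rule Bochner_Integration.integrable_bound)
  show "integrable M (\<lambda>x. 2 * (norm (norm (V x) + norm (w x)) powr p))"
    using Lp_integrable[OF Lp_add[OF Lp_norm[OF W0_Lp[OF V]] Lp_norm[OF w]]] p by simp
  show "(\<lambda>x. 2 * (norm (V x) powr (p - 1) * norm (w x))) \<in> borel_measurable M"
    using Lp_measurable[OF Lp_norm[OF W0_Lp[OF V]]] Lp_measurable[OF Lp_norm[OF w]] by measurable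
  show "AE x in M. norm (2 * (norm (V x) powr (p - 1) * norm (w x))) \<le> norm (2 * (norm (norm (V x) + norm (w x)) powr p))"
    using powr_mult_le_add_powr[of "norm (V _)" "norm (w _)" p] p by (intro AE_I2) simp
qed

text \<open>The singular term is controlled by the \<open>W\<^sub>0\<close>-norm: test with smooth approximations of \<open>|\<phi>|\<close>.\<close>

lemma weak_solution_abs_le:
  assumes V: "weak_solution V" and \<phi>: "\<phi> \<in> test_functions \<Omega>"
  shows "(LINT x|M. f x * fst (V x) powr (- \<alpha>) * \<bar>\<phi> x\<bar>) \<le> (LINT x|M. 2 * (norm (V x) powr (p - 1) * norm (jet \<phi> x)))"
proof -
  have VW: "V \<in> W0" using V by (simp add: weak_solution_def)
  define e where "e = (\<lambda>n. inverse (real (Suc n)))"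
  have e: "e n > 0" for n by (simp add: e_def)
  define \<psi> where "\<psi> = (\<lambda>n x. soft_abs (e n) (\<phi> x))"
  have \<psi>t: "\<psi> n \<in> test_functions \<Omega>" for n unfolding \<psi>_def
    by (rule test_functions_op[OF \<phi> smooth_fun_compose_real[OF smooth_soft_abs[OF e] test_smooth[OF \<phi>]]])
       (simp add: soft_abs_0[OF e])
  have jle: "norm (jet (\<psi> n) x) \<le> norm (jet \<phi> x)" for n x
  proof -
    have "\<bar>\<psi> n x\<bar> \<le> \<bar>\<phi> x\<bar>" using soft_abs_nonneg[OF e] soft_abs_le[OF e] by (simp add: \<psi>_def)
    then have "(\<psi> n x)\<^sup>2 \<le> (\<phi> x)\<^sup>2" by (simp add: abs_le_square_iff)
    moreover have "norm (classical_grad (\<psi> n) x) \<le> norm (classical_grad \<phi> x)"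
      unfolding \<psi>_def grad_compose_real[OF smooth_soft_abs[OF e] test_smooth[OF \<phi>]]
      using deriv_soft_abs_le[OF e] by (simp add: mult_left_le_one_le)
    ultimately have "(\<psi> n x)\<^sup>2 + (norm (classical_grad (\<psi> n) x))\<^sup>2 \<le> (\<phi> x)\<^sup>2 + (norm (classical_grad \<phi> x))\<^sup>2"
      by (intro add_mono power_mono[of "norm _"]) auto
    then show ?thesis by (simp add: jet_def norm_Pair)
  qed
  define \<mu> where "\<mu> = (\<lambda>x. f x * fst (V x) powr (- \<alpha>))"
  have i: "integrable M (\<lambda>x. \<mu> x * \<psi> n x)" and eq: "A_form V (jet (\<psi> n)) = (LINT x|M. \<mu> x * \<psi> n x)" for n
    using V \<psi>t[of n] unfolding weak_solution_def \<mu>_def by blast+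
  have i\<phi>: "integrable M (\<lambda>x. \<mu> x * \<phi> x)" using V \<phi> unfolding weak_solution_def \<mu>_def by blast
  have \<mu>0: "AE x in M. 0 \<le> \<mu> x" using f_nonneg by eventually_elim (simp add: \<mu>_def)
  have le: "(LINT x|M. \<mu> x * \<psi> n x) \<le> (LINT x|M. 2 * (norm (V x) powr (p - 1) * norm (jet \<phi> x)))" for n
    unfolding eq[symmetric] A_form_def
  proof (rule integral_mono[OF A_form_integrable[OF W0_Lp[OF VW] jet_Lp[OF \<psi>t]] dual_integrable[OF VW jet_Lp[OF \<phi>]]])
    fix x
    have "pflux2 p (V x) \<bullet> jet (\<psi> n) x \<le> 2 * (norm (V x) powr (p - 1) * norm (jet (\<psi> n) x))"
      using pflux2_inner_le[of p "V x" "jet (\<psi> n) x"] p by simp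
    also have "\<dots> \<le> 2 * (norm (V x) powr (p - 1) * norm (jet \<phi> x))" by (intro mult_left_mono jle) auto
    finally show "pflux2 p (V x) \<bullet> jet (\<psi> n) x \<le> 2 * (norm (V x) powr (p - 1) * norm (jet \<phi> x))" .
  qed
  have nn: "AE x in M. 0 \<le> \<mu> x * \<psi> n x" for n
    using \<mu>0 by eventually_elim (simp add: \<psi>_def soft_abs_nonneg[OF e])
  have l: "AE x in M. (\<lambda>n. \<mu> x * \<psi> n x) \<longlonglongrightarrow> \<mu> x * \<bar>\<phi> x\<bar>"
    unfolding \<psi>_def e_def by (intro AE_I2 tendsto_mult tendsto_const soft_abs_tendsto)
  have m: "(\<lambda>x. \<mu> x * \<bar>\<phi> x\<bar>) \<in> borel_measurable M"
    unfolding \<mu>_def using f_meas W0_fst_measurable[OF VW] cont_measurable[OF smooth_fun_continuous[OF test_smooth[OF \<phi>]]]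
    by measurable
  show ?thesis using Fatou_real(2)[OF i nn l m le tendsto_const] by (simp add: \<mu>_def)
qed

text \<open>The weight \<open>\<mu> = f u powr (- \<alpha>)\<close> is known only through its
  integrals against test functions. The bound for absolute values shows that test functions whose
  jets converge are Cauchy for the measure with density \<open>\<mu>\<close>; then both sides of the
  equation pass to the limit.\<close>

lemma weak_solution_extend:
  assumes V: "weak_solution V" and \<Psi>: "\<Psi> \<in> W0"
  shows "integrable M (\<lambda>x. f x * fst (V x) powr (- \<alpha>) * fst (\<Psi> x))"
    and "A_form V \<Psi> = (LINT x|M. f x * fst (V x) powr (- \<alpha>) * fst (\<Psi> x))"
proof -
  have VW: "V \<in> W0" using V by (simp add: weak_solution_def)
  have p0: "0 \<le> p" and p1: "1 \<le> p" using p by auto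
  obtain \<phi> where \<phi>: "\<And>n::nat. \<phi> n \<in> test_functions \<Omega>" "(\<lambda>n. Lp_dist M p (jet (\<phi> n)) \<Psi>) \<longlonglongrightarrow> 0"
    "AE x in M. (\<lambda>n. jet (\<phi> n) x) \<longlonglongrightarrow> \<Psi> x" using W0_seq[OF \<Psi>] by blast
  define \<mu> where "\<mu> = (\<lambda>x. f x * fst (V x) powr (- \<alpha>))"
  have \<mu>0: "AE x in M. 0 \<le> \<mu> x" using f_nonneg by eventually_elim (simp add: \<mu>_def)
  have \<mu>m: "\<mu> \<in> borel_measurable M" unfolding \<mu>_def using f_meas W0_fst_measurable[OF VW] by measurable
  define w where "w = (\<lambda>n x. jet (\<phi> n) x - \<Psi> x)"
  have w: "w n \<in> Lp_space M p" for n unfolding w_def by (rule Lp_diff[OF jet_Lp[OF \<phi>(1)] W0_Lp[OF \<Psi>] p0])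
  have wl: "(\<lambda>n. LINT x|M. norm (w n x) powr p) \<longlonglongrightarrow> 0" using \<phi>(2) by (simp add: Lp_dist_def w_def)
  define a where "a = (\<lambda>n. LINT x|M. 2 * (norm (V x) powr (p - 1) * norm (w n x)))"
  have al: "a \<longlonglongrightarrow> 0" unfolding a_def
    by (rule integral_mult_tendsto_0(3)[OF p1 w wl W0_Lp[OF VW], where C=2])
       (use dual_integrable[OF VW w] in auto)
  have Al: "(\<lambda>n. A_form V (jet (\<phi> n))) \<longlonglongrightarrow> A_form V \<Psi>"
  proof -
    have "(\<lambda>n. LINT x|M. pflux2 p (V x) \<bullet> w n x) \<longlonglongrightarrow> 0"
      by (rule integral_mult_tendsto_0(3)[OF p1 w wl W0_Lp[OF VW], where C=2])
         (use A_form_integrable[OF W0_Lp[OF VW] w] AE_I2[OF pflux2_inner_le[OF p1]] in auto)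
    moreover have "(LINT x|M. pflux2 p (V x) \<bullet> w n x) = A_form V (jet (\<phi> n)) - A_form V \<Psi>" for n
      unfolding A_form_def w_def inner_diff_right
      using A_form_integrable[OF W0_Lp[OF VW] jet_Lp[OF \<phi>(1)]] A_form_integrable[OF W0_Lp[OF VW] W0_Lp[OF \<Psi>]] by simp
    ultimately show ?thesis using LIM_zero_cancel by simp
  qed
  have i: "integrable M (\<lambda>x. \<mu> x * \<phi> n x)" and eq: "A_form V (jet (\<phi> n)) = (LINT x|M. \<mu> x * \<phi> n x)" for n
    using V \<phi>(1)[of n] unfolding weak_solution_def \<mu>_def by blast+
  have dt: "(\<lambda>x. \<phi> n x + -1 * \<phi> k x) \<in> test_functions \<Omega>" for n k by (rule test_add[OF \<phi>(1) test_cmult[OF \<phi>(1)]])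
  have jd: "jet (\<lambda>x. \<phi> n x + -1 * \<phi> k x) x = w n x - w k x" for n k x
    using jet_add[OF test_smooth[OF \<phi>(1)[of n]] test_smooth[OF test_cmult[OF \<phi>(1)[of k], of "-1"]], of x]
      jet_cmult[OF test_smooth[OF \<phi>(1)[of k]], of "-1" x] by (simp add: w_def)
  have id: "integrable M (\<lambda>x. \<mu> x * \<bar>\<phi> n x - \<phi> k x\<bar>)" for n k
  proof -
    have "integrable M (\<lambda>x. \<mu> x * \<phi> n x - \<mu> x * \<phi> k x)" using i by simp
    then show ?thesis
      by (rule Bochner_Integration.integrable_bound)
         (use \<mu>m cont_measurable[OF smooth_fun_continuous[OF test_smooth[OF \<phi>(1)]]] in \<open>auto simp: right_diff_distrib[symmetric] abs_mult\<close>)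
  qed
  have le: "(LINT x|M. \<mu> x * \<bar>\<phi> n x - \<phi> k x\<bar>) \<le> a n + a k" for n k
  proof -
    have "(LINT x|M. \<mu> x * \<bar>\<phi> n x - \<phi> k x\<bar>) \<le> (LINT x|M. 2 * (norm (V x) powr (p - 1) * norm (w n x - w k x)))"
      using weak_solution_abs_le[OF V dt[of n k]] unfolding jd by (simp add: \<mu>_def)
    also have "\<dots> \<le> (LINT x|M. 2 * (norm (V x) powr (p - 1) * norm (w n x)) + 2 * (norm (V x) powr (p - 1) * norm (w k x)))"
    proof (rule integral_mono)
      show "integrable M (\<lambda>x. 2 * (norm (V x) powr (p - 1) * norm (w n x - w k x)))"
        by (rule dual_integrable[OF VW Lp_diff[OF w w p0]])
      show "2 * (norm (V x) powr (p - 1) * norm (w n x - w k x)) \<le> 2 * (norm (V x) powr (p - 1) * norm (w n x)) + 2 * (norm (V x) powr (p - 1) * norm (w k x))" for x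
        using mult_left_mono[OF norm_triangle_ineq4[of "w n x" "w k x"], of "norm (V x) powr (p - 1)"] by (simp add: distrib_left)
    qed (use dual_integrable[OF VW w] in simp)
    also have "\<dots> = a n + a k" unfolding a_def using dual_integrable[OF VW w] by simp
    finally show ?thesis .
  qed
  have \<phi>l: "AE x in M. (\<lambda>n. \<phi> n x) \<longlonglongrightarrow> fst (\<Psi> x)"
    using \<phi>(3)
  proof eventually_elim
    fix x assume "(\<lambda>n. jet (\<phi> n) x) \<longlonglongrightarrow> \<Psi> x"
    from tendsto_fst[OF this] show "(\<lambda>n. \<phi> n x) \<longlonglongrightarrow> fst (\<Psi> x)" by (simp add: jet_def)
  qed
  \<comment> \<open>Fatou in \<open>k\<close> with \<open>n\<close> fixed turns the Cauchy estimate
    into convergence towards the value of \<open>\<Psi>\<close>, and supplies integrability of the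
    limit.\<close>
  have F: "integrable M (\<lambda>x. \<mu> x * \<bar>\<phi> n x - fst (\<Psi> x)\<bar>)" "(LINT x|M. \<mu> x * \<bar>\<phi> n x - fst (\<Psi> x)\<bar>) \<le> a n" for n
  proof -
    have nn: "AE x in M. 0 \<le> \<mu> x * \<bar>\<phi> n x - \<phi> k x\<bar>" for k using \<mu>0 by eventually_elim simp
    have l: "AE x in M. (\<lambda>k. \<mu> x * \<bar>\<phi> n x - \<phi> k x\<bar>) \<longlonglongrightarrow> \<mu> x * \<bar>\<phi> n x - fst (\<Psi> x)\<bar>"
      using \<phi>l by eventually_elim (intro tendsto_intros)
    have m: "(\<lambda>x. \<mu> x * \<bar>\<phi> n x - fst (\<Psi> x)\<bar>) \<in> borel_measurable M"
      using \<mu>m cont_measurable[OF smooth_fun_continuous[OF test_smooth[OF \<phi>(1)[of n]]]] W0_fst_measurable[OF \<Psi>] by measurable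
    have c: "(\<lambda>k. a n + a k) \<longlonglongrightarrow> a n" using tendsto_add[OF tendsto_const al, of "a n"] by simp
    show "integrable M (\<lambda>x. \<mu> x * \<bar>\<phi> n x - fst (\<Psi> x)\<bar>)" "(LINT x|M. \<mu> x * \<bar>\<phi> n x - fst (\<Psi> x)\<bar>) \<le> a n"
      using Fatou_real[OF id nn l m le c] by auto
  qed
  have iD: "integrable M (\<lambda>x. \<mu> x * (\<phi> n x - fst (\<Psi> x)))" for n
    by (rule Bochner_Integration.integrable_bound[OF F(1)[of n]])
       (use \<mu>m cont_measurable[OF smooth_fun_continuous[OF test_smooth[OF \<phi>(1)[of n]]]] W0_fst_measurable[OF \<Psi>] in \<open>auto simp: abs_mult\<close>)
  have e: "(\<lambda>x. \<mu> x * fst (\<Psi> x)) = (\<lambda>x. \<mu> x * \<phi> n x - \<mu> x * (\<phi> n x - fst (\<Psi> x)))" for n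
    by (auto simp: algebra_simps)
  have i\<Psi>: "integrable M (\<lambda>x. \<mu> x * fst (\<Psi> x))"
    unfolding e[of 0] using i[of 0] iD[of 0] by (rule Bochner_Integration.integrable_diff)
  then show "integrable M (\<lambda>x. f x * fst (V x) powr (- \<alpha>) * fst (\<Psi> x))" by (simp add: \<mu>_def)
  have d0: "(\<lambda>n. LINT x|M. \<mu> x * (\<phi> n x - fst (\<Psi> x))) \<longlonglongrightarrow> 0"
  proof (rule Lim_null_comparison[OF always_eventually al], rule allI)
    fix n
    have "\<bar>LINT x|M. \<mu> x * (\<phi> n x - fst (\<Psi> x))\<bar> \<le> (LINT x|M. \<bar>\<mu> x * (\<phi> n x - fst (\<Psi> x))\<bar>)" by (rule integral_abs_bound)
    also have "\<dots> = (LINT x|M. \<mu> x * \<bar>\<phi> n x - fst (\<Psi> x)\<bar>)"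
    proof (rule integral_cong_AE)
      show "AE x in M. \<bar>\<mu> x * (\<phi> n x - fst (\<Psi> x))\<bar> = \<mu> x * \<bar>\<phi> n x - fst (\<Psi> x)\<bar>"
        using \<mu>0 by eventually_elim (simp add: abs_mult)
    qed (use F(1)[of n] iD[of n] in auto)
    also have "\<dots> \<le> a n" by (rule F(2))
    finally show "norm (LINT x|M. \<mu> x * (\<phi> n x - fst (\<Psi> x))) \<le> a n" by simp
  qed
  have "(LINT x|M. \<mu> x * (\<phi> n x - fst (\<Psi> x))) = A_form V (jet (\<phi> n)) - (LINT x|M. \<mu> x * fst (\<Psi> x))" for n
    unfolding eq right_diff_distrib using i[of n] i\<Psi> by simp
  then have "(\<lambda>n. A_form V (jet (\<phi> n)) - (LINT x|M. \<mu> x * fst (\<Psi> x))) \<longlonglongrightarrow> 0" using d0 by simp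
  then have "(\<lambda>n. A_form V (jet (\<phi> n))) \<longlonglongrightarrow> (LINT x|M. \<mu> x * fst (\<Psi> x))" by (rule LIM_zero_cancel)
  then show "A_form V \<Psi> = (LINT x|M. f x * fst (V x) powr (- \<alpha>) * fst (\<Psi> x))"
    using LIMSEQ_unique[OF Al] by (simp add: \<mu>_def)
qed

lemma weak_solution_unique:
  assumes U: "weak_solution U" and V: "weak_solution V"
  shows "AE x in M. U x = V x"
proof -
  have UW: "U \<in> W0" "AE x in M. fst (U x) > 0" and VW: "V \<in> W0" "AE x in M. fst (V x) > 0"
    using U V by (auto simp: weak_solution_def)
  define D where "D = (\<lambda>x. U x - V x)"
  have D: "D \<in> W0" unfolding D_def by (rule W0_diff[OF UW(1) VW(1)])
  note eU = weak_solution_extend[OF U D] and eV = weak_solution_extend[OF V D]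
  note iU = A_form_integrable[OF W0_Lp[OF UW(1)] W0_Lp[OF D]] and iV = A_form_integrable[OF W0_Lp[OF VW(1)] W0_Lp[OF D]]
  have i: "integrable M (\<lambda>x. (pflux2 p (U x) - pflux2 p (V x)) \<bullet> D x)"
    unfolding inner_diff_left using iU iV by simp
  have mono: "(pflux2 p (U x) - pflux2 p (V x)) \<bullet> D x \<ge> 0" for x
    using pflux2_monotone_strict[OF p, of "U x" "V x"] unfolding D_def by (cases "U x = V x") (auto simp: less_imp_le)
  have "(LINT x|M. (pflux2 p (U x) - pflux2 p (V x)) \<bullet> D x) = A_form U D - A_form V D"
    unfolding inner_diff_left A_form_def using iU iV by simp
  also have "\<dots> = (LINT x|M. f x * fst (U x) powr (- \<alpha>) * fst (D x) - f x * fst (V x) powr (- \<alpha>) * fst (D x))"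
    using eU eV by simp
  also have "\<dots> \<le> (LINT x|M. 0)"
  proof (rule integral_mono_AE)
    show "AE x in M. f x * fst (U x) powr (- \<alpha>) * fst (D x) - f x * fst (V x) powr (- \<alpha>) * fst (D x) \<le> 0"
      using f_nonneg UW(2) VW(2)
    proof eventually_elim
      fix x assume *: "0 \<le> f x" "fst (U x) > 0" "fst (V x) > 0"
      have "(fst (U x) powr (- \<alpha>) - fst (V x) powr (- \<alpha>)) * (fst (U x) - fst (V x)) \<le> 0"
      proof (cases "fst (U x) \<le> fst (V x)")
        case True
        then have "fst (V x) powr (- \<alpha>) \<le> fst (U x) powr (- \<alpha>)" using * \<alpha>1 by (intro powr_mono2') auto
        then show ?thesis using True by (intro mult_nonneg_nonpos) auto
      next
        case False
        then have "fst (U x) powr (- \<alpha>) \<le> fst (V x) powr (- \<alpha>)" using * \<alpha>1 by (intro powr_mono2') auto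
        then show ?thesis using False by (intro mult_nonpos_nonneg) auto
      qed
      then have "f x * ((fst (U x) powr (- \<alpha>) - fst (V x) powr (- \<alpha>)) * (fst (U x) - fst (V x))) \<le> 0"
        using *(1) by (rule mult_nonneg_nonpos[rotated])
      then show "f x * fst (U x) powr (- \<alpha>) * fst (D x) - f x * fst (V x) powr (- \<alpha>) * fst (D x) \<le> 0"
        by (simp add: D_def algebra_simps)
    qed
  qed (use eU(1) eV(1) in auto)
  finally have le0: "(LINT x|M. (pflux2 p (U x) - pflux2 p (V x)) \<bullet> D x) \<le> (LINT x|M. 0)" .
  have "(LINT x|M. (pflux2 p (U x) - pflux2 p (V x)) \<bullet> D x) = 0"
  proof -
    have "0 \<le> (LINT x|M. (pflux2 p (U x) - pflux2 p (V x)) \<bullet> D x)"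
      by (rule integral_nonneg_AE) (use mono in simp)
    then show ?thesis using le0 by simp
  qed
  then have "AE x in M. (pflux2 p (U x) - pflux2 p (V x)) \<bullet> D x = 0"
    using integral_nonneg_eq_0_iff_AE[OF i] mono by simp
  then show ?thesis
  proof eventually_elim
    fix x assume "(pflux2 p (U x) - pflux2 p (V x)) \<bullet> D x = 0"
    then show "U x = V x" using pflux2_monotone_strict[OF p, of "U x" "V x"] unfolding D_def by (metis less_irrefl)
  qed
qed

section \<open>Passage between \<open>weak_solution\<close> and
  \<open>positive_solution\<close>\<close>

lemma singular_term_eq:
  fixes u c y t :: real shows "c * t / u powr \<alpha> = c * u powr (- \<alpha>) * t"
  by (simp add: powr_minus divide_inverse)

text \<open>Pairing the flux with a jet that has one component removed isolates the gradient
  integral or the zero-order integral; \<open>positive_solution\<close> demands that each of them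
  exist separately.\<close>

lemma test_component_Lp:
  assumes "\<phi> \<in> test_functions \<Omega>"
  shows "(\<lambda>x. (\<phi> x, 0 :: 'a)) \<in> Lp_space M p" "(\<lambda>x. (0 :: real, classical_grad \<phi> x)) \<in> Lp_space M p"
proof -
  note s = test_smooth[OF assms]
  have m: "(\<lambda>x. (\<phi> x, 0 :: 'a)) \<in> borel_measurable M" "(\<lambda>x. (0 :: real, classical_grad \<phi> x)) \<in> borel_measurable M"
    by (rule cont_measurable, intro continuous_on_Pair continuous_on_const smooth_fun_continuous[OF s],
        rule cont_measurable, intro continuous_on_Pair continuous_on_const smooth_continuous_grad[OF s])
  have p0: "0 \<le> p" using p by simp
  show "(\<lambda>x. (\<phi> x, 0 :: 'a)) \<in> Lp_space M p"
    by (rule Lp_bound_norm[OF m(1) jet_Lp[OF assms] p0]) (simp add: jet_def norm_Pair)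
  show "(\<lambda>x. (0 :: real, classical_grad \<phi> x)) \<in> Lp_space M p"
    by (rule Lp_bound_norm[OF m(2) jet_Lp[OF assms] p0]) (simp add: jet_def norm_Pair)
qed

lemma A_form_jet:
  assumes V: "V \<in> W0" and \<phi>: "\<phi> \<in> test_functions \<Omega>"
  shows "integrable M (\<lambda>x. pflux p (snd (V x)) \<bullet> classical_grad \<phi> x)"
    and "integrable M (\<lambda>x. pflux p (fst (V x)) * \<phi> x)"
    and "A_form V (jet \<phi>) = (LINT x|M. pflux p (snd (V x)) \<bullet> classical_grad \<phi> x) + (LINT x|M. pflux p (fst (V x)) * \<phi> x)"
proof -
  show 1: "integrable M (\<lambda>x. pflux p (snd (V x)) \<bullet> classical_grad \<phi> x)"
    using A_form_integrable[OF W0_Lp[OF V] test_component_Lp(2)[OF \<phi>]] by (simp add: pflux2_def inner_prod_def)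
  show 2: "integrable M (\<lambda>x. pflux p (fst (V x)) * \<phi> x)"
    using A_form_integrable[OF W0_Lp[OF V] test_component_Lp(1)[OF \<phi>]] by (simp add: pflux2_def inner_prod_def)
  show "A_form V (jet \<phi>) = (LINT x|M. pflux p (snd (V x)) \<bullet> classical_grad \<phi> x) + (LINT x|M. pflux p (fst (V x)) * \<phi> x)"
    unfolding A_form_def using 1 2 by (simp add: pflux2_def inner_prod_def jet_def add.commute)
qed

lemma weak_solution_positive_solution:
  assumes V: "weak_solution V" shows "positive_solution \<Omega> p \<alpha> f (\<lambda>x. fst (V x))"
proof -
  have VW: "V \<in> W0" and pos: "AE x in M. fst (V x) > 0" using V by (auto simp: weak_solution_def)
  have W: "(\<lambda>x. fst (V x)) \<in> W1p_0 \<Omega> p"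
    unfolding W1p_0_iff using VW by (intro exI[of _ "\<lambda>x. snd (V x)"]) simp
  show ?thesis unfolding positive_solution_def
  proof (intro conjI exI[of _ "\<lambda>x. snd (V x)"] ballI W pos W0_weak_gradient[OF VW])
    fix \<phi> assume \<phi>: "\<phi> \<in> test_functions \<Omega>"
    note A = A_form_jet[OF VW \<phi>]
    have i: "integrable M (\<lambda>x. f x * fst (V x) powr (- \<alpha>) * \<phi> x)"
      and eq: "A_form V (jet \<phi>) = (LINT x|M. f x * fst (V x) powr (- \<alpha>) * \<phi> x)"
      using V \<phi> by (auto simp: weak_solution_def)
    have pf: "pflux p u = \<bar>u\<bar> powr (p - 2) * u" for u :: real by (simp add: pflux_def)
    show "integrable M (\<lambda>x. (norm (snd (V x)) powr (p - 2) *\<^sub>R snd (V x)) \<bullet> classical_grad \<phi> x)"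
      using A(1) unfolding pflux_def .
    show "integrable M (\<lambda>x. \<bar>fst (V x)\<bar> powr (p - 2) * fst (V x) * \<phi> x)" using A(2) unfolding pf .
    show "integrable M (\<lambda>x. f x * \<phi> x / fst (V x) powr \<alpha>)" unfolding singular_term_eq by (rule i)
    show "(LINT x|M. (norm (snd (V x)) powr (p - 2) *\<^sub>R snd (V x)) \<bullet> classical_grad \<phi> x)
        + (LINT x|M. \<bar>fst (V x)\<bar> powr (p - 2) * fst (V x) * \<phi> x) = (LINT x|M. f x * \<phi> x / fst (V x) powr \<alpha>)"
      using A(3) eq unfolding singular_term_eq pf by (simp add: pflux_def)
  qed
qed

lemma positive_solution_weak_solution:
  assumes v: "positive_solution \<Omega> p \<alpha> f v"
  obtains V where "weak_solution V" "\<And>x. fst (V x) = v x"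
proof -
  obtain H where VW: "(\<lambda>x. (v x, H x)) \<in> W0" using v unfolding positive_solution_def W1p_0_iff by blast
  define V where "V = (\<lambda>x. (v x, H x))"
  have V: "V \<in> W0" using VW by (simp add: V_def)
  have pos: "AE x in M. fst (V x) > 0" using v by (simp add: positive_solution_def V_def)
  obtain G where G: "has_weak_gradient \<Omega> v G"
    and eqn: "\<And>\<phi>. \<phi> \<in> test_functions \<Omega> \<Longrightarrow>
      integrable M (\<lambda>x. (norm (G x) powr (p - 2) *\<^sub>R G x) \<bullet> classical_grad \<phi> x) \<and>
      integrable M (\<lambda>x. f x * \<phi> x / v x powr \<alpha>) \<and>
      (LINT x|M. (norm (G x) powr (p - 2) *\<^sub>R G x) \<bullet> classical_grad \<phi> x) + (LINT x|M. \<bar>v x\<bar> powr (p - 2) * v x * \<phi> x)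
        = (LINT x|M. f x * \<phi> x / v x powr \<alpha>)"
    using v unfolding positive_solution_def by blast
  \<comment> \<open>\<open>H\<close> is the gradient approximable by test functions,
    \<open>G\<close> the one occurring in the equation.\<close>
  have HG: "AE x in M. H x = G x"
    using weak_gradient_unique[OF W0_weak_gradient[OF V], of G] G by (simp add: V_def)
  have "integrable M (\<lambda>x. f x * fst (V x) powr (- \<alpha>) * \<phi> x) \<and>
        A_form V (jet \<phi>) = (LINT x|M. f x * fst (V x) powr (- \<alpha>) * \<phi> x)" if \<phi>: "\<phi> \<in> test_functions \<Omega>" for \<phi>
  proof -
    note A = A_form_jet[OF V \<phi>] and E = eqn[OF \<phi>]
    have "(LINT x|M. pflux p (snd (V x)) \<bullet> classical_grad \<phi> x) = (LINT x|M. pflux p (G x) \<bullet> classical_grad \<phi> x)"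
    proof (rule integral_cong_AE)
      show "(\<lambda>x. pflux p (snd (V x)) \<bullet> classical_grad \<phi> x) \<in> borel_measurable M" using A(1) by simp
      show "(\<lambda>x. pflux p (G x) \<bullet> classical_grad \<phi> x) \<in> borel_measurable M" using E unfolding pflux_def by blast
      show "AE x in M. pflux p (snd (V x)) \<bullet> classical_grad \<phi> x = pflux p (G x) \<bullet> classical_grad \<phi> x"
        using HG by eventually_elim (simp add: V_def)
    qed
    then show ?thesis using A(3) E by (simp add: V_def pflux_def singular_term_eq)
  qed
  then have "weak_solution V" using V pos by (simp add: weak_solution_def)
  then show ?thesis using that by (simp add: V_def)
qed

end

theorem theorem4p2:
  fixes \<Omega> :: "(real ^ 'n) set" and p \<alpha> :: real and f :: "real ^ 'n \<Rightarrow> real"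
  assumes "open \<Omega>" and "connected \<Omega>" and "\<Omega> \<noteq> {}" and "bounded \<Omega>" and "smooth_boundary \<Omega>"
    and "p > 1" and "1 < \<alpha>" and "\<alpha> < 2"
    and "f \<in> Linfty_on \<Omega>"
    and "AE x in lebesgue_on \<Omega>. f x \<ge> 0"
    and "\<not> (AE x in lebesgue_on \<Omega>. f x = 0)"
  shows "\<exists>u. positive_solution \<Omega> p \<alpha> f u \<and>
           (\<forall>v. positive_solution \<Omega> p \<alpha> f v \<longrightarrow> (AE x in lebesgue_on \<Omega>. v x = u x))"
proof -
  interpret singular_problem \<Omega> p \<alpha> f
    by unfold_locales (use assms in \<open>auto simp: Linfty_on_def\<close>)
  obtain U where "U \<in> adm" "\<And>V. V \<in> adm \<Longrightarrow> energy U \<le> energy V" using minimizer_exists by blast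
  then have "minimizer U" by (simp add: minimizer_def)
  then have U: "weak_solution U" using assms(2) by (rule minimizer_weak_solution)
  have "AE x in lebesgue_on \<Omega>. v x = fst (U x)" if v: "positive_solution \<Omega> p \<alpha> f v" for v
  proof -
    obtain V where V: "weak_solution V" "\<And>x. fst (V x) = v x" using positive_solution_weak_solution[OF v] by blast
    show ?thesis using weak_solution_unique[OF V(1) U]
      by eventually_elim (simp flip: V(2))
  qed
  then show ?thesis using weak_solution_positive_solution[OF U] by blast
qed

end
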